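(* Let $m\in\mathbb Z$, $n\in\mathbb N_0$, $\tau,\tau^\ast>0$, $\psi,\psi^\ast\in\mathbb R$. Then $$A_{m,n}(\tau,\tau^\ast,\psi,\psi^\ast,k)\to B_{m,n}(\tau,\tau^\ast,\psi,\psi^\ast)\qquad\text{as } k\to0^+,$$ where $$A_{m,n}=\frac12\,\rho_k(\tau,\psi)^{1/2}\rho_k(\tau^\ast,\psi^\ast)^{1/2}\big(C_{m,n}+S_{m,n}\big),\qquad \rho_k(\tau,\psi)=\frac{\mathrm{dn}(\psi,k)-\mathrm{cn}(\psi,k)\,\mathrm{dn}(\tau,k')}{k'\,\mathrm{sn}(\tau,k')},$$ $$C_{m,n}=\mathrm{Ec}^n_{|m|-\frac12}(2K-\psi,k)\,\mathrm{Ec}^n_{|m|-\frac12}(2K-\psi^\ast,k)\,\mathrm{Ec}^n_{|m|-\frac12}(i(K'-\tau),k)\,\mathrm{Fc}^n_{|m|-\frac12}(i(K'-\tau^\ast),k),$$ $S_{m,n}$ is the same expression with $\mathrm{Ec},\mathrm{Fc}$ replaced by $\mathrm{Es},\mathrm{Fs}$ if $n\ge1$, and $S_{m,0}=0$; and $$B_{m,n}=\frac1\pi(\cosh\tau-\cos\psi)^{1/2}(\cosh\tau^\ast-\cos\psi^\ast)^{1/2}\,\epsilon_n\cos(n(\psi-\psi^\ast))\,(-1)^m\frac{\Gamma(n-m+\frac12)}{\Gamma(n+m+\frac12)}\,Q_{n-\frac12}^m(\cosh\tau)\,P_{n-\frac12}^m(\cosh\tau^\ast),$$ with $\epsilon_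n=2-\delta_{n,0}$.
   Context: For $k\in(0,1)$: $k'=\sqrt{1-k^2}$; $K=K(k)$ and $K'=K(k')$ are the complete elliptic integrals of the first kind of moduli $k$ and $k'$; $\mathrm{sn},\mathrm{cn},\mathrm{dn}$ are the Jacobian elliptic functions. $\mathbb N_0=\{0,1,2,\dots\}$. Since $K'\to\infty$ as $k\to0$, $\tau,\tau^\ast<2K'$ for small $k$ and $A_{m,n}$ is then defined. Lamé functions of the first kind. For $\nu\ge-\frac12$ consider the Lamé equation $E''(s)+(h-\nu(\nu+1)k^2\mathrm{sn}^2(s,k))E(s)=0$. For $n\in\mathbb N_0$ define eigenvalues $h$ and eigenfunctions on $[0,K]$ having exactly $n$ zeros in $(0,K)$: $b_\nu^{2n+2},\mathrm{Es}_\nu^{2n+2}$ for $E(0)=E(K)=0$; $b_\nu^{2n+1},\mathrm{Es}_\nu^{2n+1}$ for $E'(0)=E(K)=0$; $a_\nu^{2n+1},\mathrm{Ec}_\nu^{2n+1}$ for $E(0)=E'(K)=0$; $a_\nu^{2n},\mathrm{Ec}_\nu^{2n}$ for $E'(0)=E'(K)=0$. The eigenfunctions are real and normalized by $\int_0^K E(s)^2ds=1$ (the choice of sign is immaterial here). They extend as solutions of the Lamé equation with period $4K$ to $\mathbb R$, and analytically to the strip $|\operatorname{Im}s|<K'$. Lamé functions of the second kind. $\mathrm{Fc}_\nu^n(s,k)$, $|\operatorname{Im}s|<K'$, is the solution of the Lamé equation with $h=a_\nu^n$ belonging to the exponent $\nu+1$ at the regular singular point $s=iK'$, i.e. of the form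 $\sum_{p\ge0}d_p(s-iK')^{2p+\nu+1}$, $d_0\neq0$, near $iK'$; $\mathrm{Fs}_\nu^{n+1}$ is the analogous solution for $h=b_\nu^{n+1}$. They are normalized by $F(it)\frac{d}{dt}E(it)-E(it)\frac{d}{dt}F(it)=1$, where $(E,F)=(\mathrm{Ec}_\nu^n,\mathrm{Fc}_\nu^n)$ or $(\mathrm{Es}_\nu^{n+1},\mathrm{Fs}_\nu^{n+1})$. $P_\alpha^\beta,Q_\alpha^\beta$ on $\mathbb C\setminus(-\infty,1]$ are the associated Legendre functions of the first and second kind (as in DLMF 14.3.6, 14.3.7): $P_\alpha^\beta(z)=\frac{1}{\Gamma(1-\beta)}\left(\frac{z+1}{z-1}\right)^{\beta/2}{}_2F_1\!\left(-\alpha,\alpha+1;1-\beta;\frac{1-z}2\right)$ (understood by the usual limit when $\beta$ is a positive integer) and $Q_\alpha^\beta(z)=\frac{e^{i\beta\pi}\sqrt\pi\,\Gamma(\alpha+\beta+1)(z^2-1)^{\beta/2}}{2^{\alpha+1}\Gamma(\alpha+\frac32)z^{\alpha+\beta+1}}\,{}_2F_1\!\left(\frac{\alpha+\beta+1}2,\frac{\alpha+\beta+2}2;\alpha+\frac32;\frac1{z^2}\right)$. (The $A_{m,n}$ and $B_{m,n}$ are the coefficients in the expansions $\frac1{\|\mathbf r-\mathbf r^\ast\|}=\sum_{m\in\mathbb Z}e^{im(\phi-\phi^\ast)}\sum_{n\ge0}A_{m,n}$ in flat-ring harmonics and $\sum_{m\in\mathbb Z}e^{im(\phi-\phi^\ast)}\sum_{n\ge0}B_{m,n}$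 in toroidal harmonics.) *)

theory Defs
  imports "HOL-Complex_Analysis.Complex_Analysis"
begin

section \<open>Elliptic integrals and Jacobian elliptic functions\<close>

text \<open>In this theory \<open>k\<close> is a modulus in \<open>(0,1)\<close>, not a parameter \<open>k\<^sup>2\<close>.\<close>

definition compl_modulus :: "real \<Rightarrow> real" where
  "compl_modulus k = sqrt (1 - k\<^sup>2)"

definition elliptic_F :: "real \<Rightarrow> real \<Rightarrow> real" where
  "elliptic_F k \<phi> = (LBINT \<theta>=0..\<phi>. 1 / sqrt (1 - k\<^sup>2 * (sin \<theta>)\<^sup>2))"

definition elliptic_K :: "real \<Rightarrow> real" where
  "elliptic_K k = elliptic_F k (pi / 2)"

definition elliptic_K' :: "real \<Rightarrow> real" where
  "elliptic_K' k = elliptic_K (compl_modulus k)"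

definition jacobi_am :: "real \<Rightarrow> real \<Rightarrow> real" where
  "jacobi_am u k = (THE \<phi>. elliptic_F k \<phi> = u)"

definition jacobi_sn :: "real \<Rightarrow> real \<Rightarrow> real" where
  "jacobi_sn u k = sin (jacobi_am u k)"

definition jacobi_cn :: "real \<Rightarrow> real \<Rightarrow> real" where
  "jacobi_cn u k = cos (jacobi_am u k)"

definition jacobi_dn :: "real \<Rightarrow> real \<Rightarrow> real" where
  "jacobi_dn u k = sqrt (1 - k\<^sup>2 * (jacobi_sn u k)\<^sup>2)"

definition strip :: "real \<Rightarrow> complex set" where
  "strip k = {s. \<bar>Im s\<bar> < elliptic_K' k}"

text \<open>The poles of \<open>sn\<close> nearest to the real axis lie on the boundary of the strip, so the
  analytic continuation of the real function to the strip exists; it is unique there.\<close>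

definition jacobi_sn_strip :: "complex \<Rightarrow> real \<Rightarrow> complex" where
  "jacobi_sn_strip s k =
     (SOME f. f holomorphic_on strip k \<and>
              (\<forall>x::real. f (of_real x) = of_real (jacobi_sn x k))) s"

section \<open>Lame functions of the first kind\<close>

text \<open>\<open>E\<close> solves the Lame equation on \<open>[0,K]\<close>, and \<open>E'\<close> is its derivative.\<close>

definition lame_solution ::
  "real \<Rightarrow> real \<Rightarrow> real \<Rightarrow> (real \<Rightarrow> real) \<Rightarrow> (real \<Rightarrow> real) \<Rightarrow> bool" where
  "lame_solution \<nu> k h E E' \<longleftrightarrow>
     (\<forall>s\<in>{0..elliptic_K k}.
        (E has_real_derivative E' s) (at s within {0..elliptic_K k}) \<and>
        (\<exists>E''. (E' has_real_derivative E'') (at s within {0..elliptic_K k}) \<and>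
               E'' + (h - \<nu> * (\<nu> + 1) * k\<^sup>2 * (jacobi_sn s k)\<^sup>2) * E s = 0))"

definition lame_normalized :: "real \<Rightarrow> (real \<Rightarrow> real) \<Rightarrow> bool" where
  "lame_normalized k E \<longleftrightarrow> ((\<lambda>s. (E s)\<^sup>2) has_integral 1) {0..elliptic_K k}"

definition exact_zeros :: "real \<Rightarrow> nat \<Rightarrow> (real \<Rightarrow> real) \<Rightarrow> bool" where
  "exact_zeros k N E \<longleftrightarrow>
     finite {s\<in>{0<..<elliptic_K k}. E s = 0} \<and> card {s\<in>{0<..<elliptic_K k}. E s = 0} = N"

text \<open>The index \<open>j\<close> below is the upper index of \<open>Ec\<close> and \<open>Es\<close>, so the number of zeros in
  \<open>(0,K)\<close> is \<open>n\<close> for \<open>Ec\<close> with \<open>j = 2n\<close> or \<open>j = 2n+1\<close>, and for \<open>Es\<close> with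
  \<open>j = 2n+1\<close> or \<open>j = 2n+2\<close>; for \<open>Es\<close> only \<open>j \<ge> 1\<close> is meaningful.\<close>

definition lame_c_eigen :: "real \<Rightarrow> nat \<Rightarrow> real \<Rightarrow> real \<Rightarrow> (real \<Rightarrow> real) \<Rightarrow> bool" where
  "lame_c_eigen \<nu> j k h E \<longleftrightarrow>
     (\<exists>E'. lame_solution \<nu> k h E E' \<and>
           (if even j then E' 0 = 0 else E 0 = 0) \<and> E' (elliptic_K k) = 0) \<and>
     exact_zeros k (j div 2) E \<and> lame_normalized k E"

definition lame_s_eigen :: "real \<Rightarrow> nat \<Rightarrow> real \<Rightarrow> real \<Rightarrow> (real \<Rightarrow> real) \<Rightarrow> bool" where
  "lame_s_eigen \<nu> j k h E \<longleftrightarrow>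
     (\<exists>E'. lame_solution \<nu> k h E E' \<and>
           (if even j then E 0 = 0 else E' 0 = 0) \<and> E (elliptic_K k) = 0) \<and>
     exact_zeros k ((j - 1) div 2) E \<and> lame_normalized k E"

definition lame_a :: "real \<Rightarrow> nat \<Rightarrow> real \<Rightarrow> real" where
  "lame_a \<nu> j k = (SOME h. \<exists>E. lame_c_eigen \<nu> j k h E)"

definition lame_b :: "real \<Rightarrow> nat \<Rightarrow> real \<Rightarrow> real" where
  "lame_b \<nu> j k = (SOME h. \<exists>E. lame_s_eigen \<nu> j k h E)"

text \<open>The eigenvalue is unique and the eigenfunction is unique up to sign, hence so is its
  analytic continuation from \<open>[0,K]\<close> to the strip.\<close>

definition lame_Ec :: "real \<Rightarrow> nat \<Rightarrow> real \<Rightarrow> complex \<Rightarrow> complex" where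
  "lame_Ec \<nu> j k =
     (SOME f. f holomorphic_on strip k \<and>
        (\<exists>E. lame_c_eigen \<nu> j k (lame_a \<nu> j k) E \<and>
             (\<forall>s\<in>{0..elliptic_K k}. f (of_real s) = of_real (E s))))"

definition lame_Es :: "real \<Rightarrow> nat \<Rightarrow> real \<Rightarrow> complex \<Rightarrow> complex" where
  "lame_Es \<nu> j k =
     (SOME f. f holomorphic_on strip k \<and>
        (\<exists>E. lame_s_eigen \<nu> j k (lame_b \<nu> j k) E \<and>
             (\<forall>s\<in>{0..elliptic_K k}. f (of_real s) = of_real (E s))))"

section \<open>Lame functions of the second kind\<close>

text \<open>\<open>s - iK'\<close> has negative imaginary part for \<open>s\<close> in the strip, so the principal
  power is holomorphic there; another branch would only rescale all \<open>d p\<close> by a common factor.\<close>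

definition frobenius_at_iK' :: "real \<Rightarrow> real \<Rightarrow> (complex \<Rightarrow> complex) \<Rightarrow> bool" where
  "frobenius_at_iK' \<nu> k F \<longleftrightarrow>
     (\<exists>d r. d 0 \<noteq> 0 \<and> r > 0 \<and>
        (\<forall>s \<in> strip k \<inter> ball (\<i> * of_real (elliptic_K' k)) r.
           (\<lambda>p. d p * (s - \<i> * of_real (elliptic_K' k)) powr of_real (2 * real p + \<nu> + 1))
             sums F s))"

definition lame_second_kind ::
  "real \<Rightarrow> real \<Rightarrow> real \<Rightarrow> (complex \<Rightarrow> complex) \<Rightarrow> (complex \<Rightarrow> complex) \<Rightarrow> bool" where
  "lame_second_kind \<nu> k h E F \<longleftrightarrow>
     F holomorphic_on strip k \<and>
     (\<forall>s \<in> strip k. deriv (deriv F) s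
        + (of_real h - of_real (\<nu> * (\<nu> + 1) * k\<^sup>2) * (jacobi_sn_strip s k)\<^sup>2) * F s = 0) \<and>
     frobenius_at_iK' \<nu> k F \<and>
     (\<forall>t::real. \<bar>t\<bar> < elliptic_K' k \<longrightarrow>
        F (\<i> * of_real t) * vector_derivative (\<lambda>t. E (\<i> * of_real t)) (at t)
        - E (\<i> * of_real t) * vector_derivative (\<lambda>t. F (\<i> * of_real t)) (at t) = 1)"

definition lame_Fc :: "real \<Rightarrow> nat \<Rightarrow> real \<Rightarrow> complex \<Rightarrow> complex" where
  "lame_Fc \<nu> j k = (SOME F. lame_second_kind \<nu> k (lame_a \<nu> j k) (lame_Ec \<nu> j k) F)"

definition lame_Fs :: "real \<Rightarrow> nat \<Rightarrow> real \<Rightarrow> complex \<Rightarrow> complex" where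
  "lame_Fs \<nu> j k = (SOME F. lame_second_kind \<nu> k (lame_b \<nu> j k) (lame_Es \<nu> j k) F)"

section \<open>Associated Legendre functions\<close>

text \<open>Olver's hypergeometric function \<open>2F1(a,b;c;z) / \<Gamma>(c)\<close>, principal branch on the plane cut
  along \<open>[1,\<infinity>)\<close>. Since \<open>1/\<Gamma>(c+n) = 1 / (\<Gamma>(c) (c)\<^sub>n)\<close>, writing the coefficients with
  \<open>1/\<Gamma>(c+n)\<close> builds in the limiting value at \<open>c = 0, -1, -2, \<dots>\<close>.
  DLMF 14.3.6 and 14.3.7 are stated in terms of this function.\<close>

definition olver_F :: "complex \<Rightarrow> complex \<Rightarrow> complex \<Rightarrow> complex \<Rightarrow> complex" where
  "olver_F a b c z =
     (SOME f. f holomorphic_on - (of_real ` {1::real..}) \<and>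
        (\<forall>w\<in>ball 0 1.
           (\<lambda>n. pochhammer a n * pochhammer b n * rGamma (c + of_nat n) / fact n * w ^ n)
             sums f w)) z"

definition legendre_P :: "complex \<Rightarrow> complex \<Rightarrow> complex \<Rightarrow> complex" where
  "legendre_P \<alpha> \<beta> z =
     ((z + 1) / (z - 1)) powr (\<beta> / 2) * olver_F (- \<alpha>) (\<alpha> + 1) (1 - \<beta>) ((1 - z) / 2)"

text \<open>On the plane cut along \<open>(-\<infinity>,1]\<close> the branch of \<open>(z\<^sup>2 - 1)\<^sup>\<beta>\<^sup>/\<^sup>2\<close> that is positive for
  \<open>z > 1\<close> (\<open>\<beta>\<close> real) is the product of principal powers below.\<close>

definition legendre_Q :: "complex \<Rightarrow> complex \<Rightarrow> complex \<Rightarrow> complex" where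
  "legendre_Q \<alpha> \<beta> z =
     exp (\<i> * \<beta> * of_real pi) * of_real (sqrt pi) * Gamma (\<alpha> + \<beta> + 1)
     * ((z - 1) powr (\<beta> / 2) * (z + 1) powr (\<beta> / 2))
     / (2 powr (\<alpha> + 1) * z powr (\<alpha> + \<beta> + 1))
     * olver_F ((\<alpha> + \<beta> + 1) / 2) ((\<alpha> + \<beta> + 2) / 2) (\<alpha> + 3 / 2) (1 / z\<^sup>2)"

section \<open>The expansion coefficients\<close>

definition flat_ring_rho :: "real \<Rightarrow> real \<Rightarrow> real \<Rightarrow> real" where
  "flat_ring_rho k \<tau> \<psi> =
     (jacobi_dn \<psi> k - jacobi_cn \<psi> k * jacobi_dn \<tau> (compl_modulus k))
     / (compl_modulus k * jacobi_sn \<tau> (compl_modulus k))"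

definition lame_nu :: "int \<Rightarrow> real" where
  "lame_nu m = of_int \<bar>m\<bar> - 1 / 2"

definition coeff_C ::
  "int \<Rightarrow> nat \<Rightarrow> real \<Rightarrow> real \<Rightarrow> real \<Rightarrow> real \<Rightarrow> real \<Rightarrow> complex" where
  "coeff_C m n \<tau> \<tau>' \<psi> \<psi>' k =
     lame_Ec (lame_nu m) n k (of_real (2 * elliptic_K k - \<psi>))
     * lame_Ec (lame_nu m) n k (of_real (2 * elliptic_K k - \<psi>'))
     * lame_Ec (lame_nu m) n k (\<i> * of_real (elliptic_K' k - \<tau>))
     * lame_Fc (lame_nu m) n k (\<i> * of_real (elliptic_K' k - \<tau>'))"

definition coeff_S ::
  "int \<Rightarrow> nat \<Rightarrow> real \<Rightarrow> real \<Rightarrow> real \<Rightarrow> real \<Rightarrow> real \<Rightarrow> complex" where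
  "coeff_S m n \<tau> \<tau>' \<psi> \<psi>' k =
     (if n = 0 then 0 else
       lame_Es (lame_nu m) n k (of_real (2 * elliptic_K k - \<psi>))
       * lame_Es (lame_nu m) n k (of_real (2 * elliptic_K k - \<psi>'))
       * lame_Es (lame_nu m) n k (\<i> * of_real (elliptic_K' k - \<tau>))
       * lame_Fs (lame_nu m) n k (\<i> * of_real (elliptic_K' k - \<tau>')))"

definition coeff_A ::
  "int \<Rightarrow> nat \<Rightarrow> real \<Rightarrow> real \<Rightarrow> real \<Rightarrow> real \<Rightarrow> real \<Rightarrow> complex" where
  "coeff_A m n \<tau> \<tau>' \<psi> \<psi>' k =
     1 / 2 * of_real (sqrt (flat_ring_rho k \<tau> \<psi>)) * of_real (sqrt (flat_ring_rho k \<tau>' \<psi>'))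
     * (coeff_C m n \<tau> \<tau>' \<psi> \<psi>' k + coeff_S m n \<tau> \<tau>' \<psi> \<psi>' k)"

definition neumann_factor :: "nat \<Rightarrow> real" where
  "neumann_factor n = (if n = 0 then 1 else 2)"

definition coeff_B ::
  "int \<Rightarrow> nat \<Rightarrow> real \<Rightarrow> real \<Rightarrow> real \<Rightarrow> real \<Rightarrow> complex" where
  "coeff_B m n \<tau> \<tau>' \<psi> \<psi>' =
     of_real (1 / pi * sqrt (cosh \<tau> - cos \<psi>) * sqrt (cosh \<tau>' - cos \<psi>')
       * neumann_factor n * cos (real n * (\<psi> - \<psi>'))
       * (-1) powi m
       * (Gamma (real n - of_int m + 1 / 2) / Gamma (real n + of_int m + 1 / 2)))
     * legendre_Q (of_nat n - 1 / 2) (of_int m) (of_real (cosh \<tau>))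
     * legendre_P (of_nat n - 1 / 2) (of_int m) (of_real (cosh \<tau>'))"

end

theory Submission
	imports Defs "HOL-Real_Asymp.Real_Asymp"
begin

text \<open>Put \<open>s = i(K' - \<tau>)\<close>. On this segment the Lame equation becomes \<open>y'' = (h + \<nu>(\<nu>+1) cs(\<tau>,k')^2) y\<close> on
\<open>(0, K']\<close>. As \<open>k\<close> tends to 0 the function \<open>cs(\<tau>,k')\<close> tends to \<open>1/sinh \<tau>\<close>, the eigenvalue \<open>h\<close> tends to the square of \<open>n\<close>, and
\<open>K'\<close> tends to infinity. The limiting equation is the one satisfied by \<open>sqrt (sinh \<tau>)\<close> times a Legendre function of
\<open>cosh \<tau>\<close> with parameters \<open>n - 1/2\<close> and \<open>m\<close>. The function of the second kind is the regular branch at \<open>\<tau> = 0\<close>, hence tends, up to a factor,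
to the function \<open>P\<close> (\<open>frobenius_solution_limit\<close>). The function of the first kind is prescribed at the far end \<open>\<tau> = K'\<close>,
hence tends, up to a factor, to the function \<open>Q\<close>, which is recessive at infinity (\<open>lame_std_limit\<close>). Both limits are obtained from
the derivative of a Wronskian, whose smallness comes from estimates of \<open>cs\<close> on the whole growing interval.

The unknown factors are harmless: the Wronskian of the two Lame functions is normalised, so their product converges to a product of
Legendre functions over the Wronskian of the latter (\<open>lame_product_limit\<close>, \<open>tor_wronskian\<close>).
On the real axis the equation tends to \<open>y'' = - n^2 y\<close> and \<open>K\<close> to \<open>\<pi>/2\<close>, so the eigenfunctions tend to normalised sines and cosines,
and the sum over the two families is an addition theorem (\<open>trig_product_sum\<close>).

The objects have to be shown to exist first. Eigenvalues near the square of \<open>n\<close> come from a sign change, the number of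
zeros from a polar angle and uniqueness from Sturm comparison (\<open>lame_eigen_exists\<close>, \<open>lame_eigen_unique\<close>). The function sn
is continued to the strip by its addition theorem, and the function of the second kind is a Frobenius series at the pole
(\<open>lame_frobenius_exists\<close>), which \<open>lame_second_kind_exists\<close> normalises.\<close>

section \<open>Second-order linear equations on a real interval\<close>

definition schroedinger_on ::
	"real set => (real => real) => (real => 'a::real_normed_vector) => (real => 'a) => bool" where
	"schroedinger_on S V y y' \<longleftrightarrow>
		 (\<forall>t\<in>S. (y has_vector_derivative y' t) (at t within S) &
						(y' has_vector_derivative V t *\<^sub>R y t) (at t within S))"

lemma schroedinger_onD:
	assumes "schroedinger_on S V y y'" "t \<in> S"
	shows "(y has_vector_derivative y' t) (at t within S)"
		"(y' has_vector_derivative V t *\<^sub>R y t) (at t within S)" using assms by (auto simp: schroedinger_on_def)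

lemma schroedinger_on_subset:
	"schroedinger_on S V y y' ==> T \<subseteq> S ==> schroedinger_on T V y y'"
	unfolding schroedinger_on_def by (meson has_vector_derivative_within_subset subsetD)


lemma schroedinger_on_linear:
	assumes "schroedinger_on S V y y'" "bounded_linear f"
	shows "schroedinger_on S V (%t. f (y t)) (%t. f (y' t))" unfolding schroedinger_on_def
proof (intro ballI conjI)
	interpret f: bounded_linear f by fact
	fix t assume t: "t \<in> S"
	show "((%t. f (y t)) has_vector_derivative f (y' t)) (at t within S)" by (rule f.has_vector_derivative[OF schroedinger_onD(1)[OF assms(1) t]])
	show "((%t. f (y' t)) has_vector_derivative V t *\<^sub>R f (y t)) (at t within S)"
		using f.has_vector_derivative[OF schroedinger_onD(2)[OF assms(1) t]] by (simp add: f.scaleR)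
qed

lemma schroedinger_on_reflect:
	assumes "schroedinger_on S V y y'"
	shows "schroedinger_on (uminus ` S) (%t. V (- t)) (%t. y (- t)) (%t. - y' (- t))" unfolding schroedinger_on_def
proof (intro ballI conjI)
	fix t assume "t \<in> uminus ` S"
	hence t: "- t \<in> S" by auto
	have im: "uminus ` uminus ` S=S" by (auto simp: image_image)
	have d: "(uminus has_vector_derivative -1) (at t within uminus ` S)" for t :: real
		by (auto intro!: derivative_eq_intros simp: has_vector_derivative_def)
	have "((y \<circ> uminus) has_vector_derivative (-1) *\<^sub>R y' (- t)) (at t within uminus ` S)"
		by (rule vector_diff_chain_within[OF d]) (simp add: im schroedinger_onD(1)[OF assms t])
	thus "((%t. y (- t)) has_vector_derivative-y' (- t)) (at t within uminus ` S)" by (simp add: o_def)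
	have "((y' \<circ> uminus) has_vector_derivative (-1) *\<^sub>R (V (- t) *\<^sub>R y (- t))) (at t within uminus ` S)"
		by (rule vector_diff_chain_within[OF d]) (simp add: im schroedinger_onD(2)[OF assms t])
	from has_vector_derivative_minus[OF this]
	show "((%t. - y' (- t)) has_vector_derivative V (- t) *\<^sub>R y (- t)) (at t within uminus ` S)" by (simp add: o_def)
qed

lemma schroedinger_on_continuous:
	assumes "schroedinger_on S V y y'"
	shows "continuous_on S y" "continuous_on S y'" using schroedinger_onD[OF assms]
	by (meson continuous_on_eq_continuous_within has_vector_derivative_continuous)+

lemma has_real_derivative_inner_self:
	fixes f :: "real => 'a::real_inner"
	assumes "(f has_vector_derivative f') (at t within S)"
	shows "((%t. f t \<bullet> f t) has_real_derivative 2*(f t \<bullet> f')) (at t within S)"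
	using has_derivative_inner[OF assms[unfolded has_vector_derivative_def] assms[unfolded has_vector_derivative_def]]
	by (simp add: has_field_derivative_def inner_commute algebra_simps)
		 (erule has_derivative_eq_rhs,auto simp: fun_eq_iff inner_commute)

lemma schroedinger_energy_forward:
	fixes y z :: "real => 'a::real_inner"
	assumes y: "schroedinger_on {a..b} V y y'" and z: "schroedinger_on {a..b} U z z'"
		and M: "!!t. t \<in> {a..b} ==> \<bar>V t\<bar> <= M"
		and G: "!!t. t \<in> {a..b} ==> \<bar>V t-U t\<bar> * norm (z t) <= G"
		and t: "t \<in> {a..b}"
	shows "(norm (y t-z t))^2+(norm (y' t-z' t))^2
		<= ((norm (y a-z a))^2+(norm (y' a-z' a))^2 + G^2*(b-a)) * exp ((2 + M)*(b-a))"
proof -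
	define d d' where "d=(%t. y t-z t)" and "d'=(%t. y' t-z' t)"
	define N where "N=(%t. d t \<bullet> d t + d' t \<bullet> d' t)"
	define L where "L=2 + M"
	have "a <= b" "0 <= M" using t M[OF t] by auto
	hence "L >= 0" by (simp add: L_def)
	define H where "H=(%t. N t * exp (- L*(t-a))-G\<^sup>2 * t)"
	define N' where "N'=(%s. 2*(d s \<bullet> d' s)+2*(d' s \<bullet> (V s *\<^sub>R y s-U s *\<^sub>R z s)))"
	have N': "(N has_real_derivative N' s) (at s within {a..b})" if s: "s \<in> {a..b}" for s unfolding N_def N'_def d_def d'_def
		by (intro DERIV_add has_real_derivative_inner_self has_vector_derivative_diff
				schroedinger_onD[OF y s] schroedinger_onD[OF z s])
	have N'_le: "N' s <= L * N s + G^2" if s: "s \<in> {a..b}" for s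
	proof -
		have "d s \<bullet> d' s <= norm (d s) * norm (d' s)" by (rule norm_cauchy_schwarz)
		moreover have "V s *\<^sub>R y s-U s *\<^sub>R z s=V s *\<^sub>R d s+(V s-U s) *\<^sub>R z s" by (simp add: d_def algebra_simps)
		moreover have "d' s \<bullet> (V s *\<^sub>R d s) <= M*(norm (d s) * norm (d' s))"
		proof -
			have "d' s \<bullet> (V s *\<^sub>R d s) <= norm (d' s)*(\<bar>V s\<bar> * norm (d s))"
				using norm_cauchy_schwarz[of "d' s" "V s *\<^sub>R d s"] by simp
			also have "... <= norm (d' s)*(M * norm (d s))" by (intro mult_left_mono mult_right_mono M s) auto
			finally show ?thesis by (simp add: mult_ac)
		qed
		moreover have "d' s \<bullet> ((V s-U s) *\<^sub>R z s) <= norm (d' s) * G"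
		proof -
			have "d' s \<bullet> ((V s-U s) *\<^sub>R z s) <= norm (d' s) * norm ((V s-U s) *\<^sub>R z s)" by (rule norm_cauchy_schwarz)
			also have "... <= norm (d' s) * G" using G[OF s] by (intro mult_left_mono) auto
			finally show ?thesis .
		qed
		ultimately have "N' s <= 2*(norm (d s) * norm (d' s))+2*(M*(norm (d s) * norm (d' s)))+2*(norm (d' s) * G)"
			unfolding N'_def by (simp add: inner_add_right)
		also have "... <= ((norm (d s))^2+(norm (d' s))^2) + M*((norm (d s))^2+(norm (d' s))^2)+((norm (d' s))^2 + G^2)"
		proof (intro add_mono)
			show "2*(norm (d s) * norm (d' s)) <= (norm (d s))^2+(norm (d' s))^2" using sum_squares_bound[of "norm (d s)" "norm (d' s)"] by simp
			thus "2*(M*(norm (d s) * norm (d' s))) <= M*((norm (d s))^2+(norm (d' s))^2)" using mult_left_mono[OF _ \<open>0 <= M\<close>] by fastforce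
			show "2*(norm (d' s) * G) <= (norm (d' s))^2 + G^2" using sum_squares_bound[of "norm (d' s)" G] by simp
		qed
		also have "... <= L * N s + G^2" unfolding N_def L_def by (simp add: power2_norm_eq_inner algebra_simps)
		finally show ?thesis .
	qed
	have H': "(H has_real_derivative (N' s-L * N s) * exp (- L*(s-a))-G\<^sup>2) (at s within {a..b})"
		if "s \<in> {a..b}" for s unfolding H_def by (rule derivative_eq_intros N'[OF that] refl | simp add: algebra_simps)+
	have "H t <= H a"
	proof (rule DERIV_nonpos_imp_decreasing_open[of a t H])
		show "a <= t" using t by simp
		fix s assume s: "a < s" "s < t"
		hence "s \<in> {a..b}" using t by simp
		have "at s within {a..b} = at s" using s t by (intro at_within_interior) auto
		moreover have "(N' s-L * N s) * exp (- L*(s-a)) <= G^2*1"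
		proof (cases "N' s-L * N s >= 0")
			case True
			thus ?thesis using N'_le[OF \<open>s \<in> {a..b}\<close>] s \<open>L >= 0\<close> by (intro mult_mono) (auto simp: mult_nonneg_nonneg)
		next
			case False
			hence "(N' s-L * N s) * exp (- L*(s-a)) <= 0" by (intro mult_nonpos_nonneg) auto
			thus ?thesis by (smt (verit) zero_le_power2 mult_cancel_left2)
		qed
		ultimately show "\<exists>w. (H has_real_derivative w) (at s) & w <= 0" using H'[OF \<open>s \<in> {a..b}\<close>] by fastforce
	next
		show "continuous_on {a..t} H"
		proof (rule continuous_on_subset[of "{a..b}"])
			show "continuous_on {a..b} H" using H' by (meson DERIV_continuous continuous_on_eq_continuous_within)
		qed (use t in auto)
	qed
	hence "N t * exp (- L*(t-a)) <= N a + G^2*(t-a)" by (simp add: H_def algebra_simps)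
	hence "N t * exp (- L*(t-a)) * exp (L*(t-a)) <= (N a + G^2*(t-a)) * exp (L*(t-a))" by (intro mult_right_mono) auto
	hence "N t <= (N a + G^2*(t-a)) * exp (L*(t-a))" by (simp add: mult.assoc flip: exp_add)
	also have "... <= (N a + G^2*(b-a)) * exp (L*(b-a))"
		using t \<open>L >= 0\<close> by (intro mult_mono add_mono mult_left_mono) (auto simp: N_def intro: mult_left_mono)
	finally show ?thesis by (simp add: N_def L_def d_def d'_def power2_norm_eq_inner)
qed

text \<open>Gronwall's argument for the energy of the difference; the defect \<open>(V - U) z\<close> acts as a forcing term. Uniqueness and continuous dependence on the potential both follow.\<close>

lemma schroedinger_energy:
	fixes y z :: "real => 'a::real_inner"
	assumes y: "schroedinger_on {a..b} V y y'" and z: "schroedinger_on {a..b} U z z'"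
		and M: "!!t. t \<in> {a..b} ==> \<bar>V t\<bar> <= M"
		and G: "!!t. t \<in> {a..b} ==> \<bar>V t-U t\<bar> * norm (z t) <= G"
		and t: "t0 \<in> {a..b}" "t \<in> {a..b}"
	shows "(norm (y t-z t))^2+(norm (y' t-z' t))^2
		<= ((norm (y t0-z t0))^2+(norm (y' t0-z' t0))^2 + G^2*(b-a)) * exp ((2 + M)*(b-a))"
proof -
	have M0: "0 <= M" using M[OF t(1)] by simp
	have mono: "(X + G^2 * c) * exp ((2 + M) * c) <= (X + G^2*(b-a)) * exp ((2 + M)*(b-a))"
		if "0 <= c" "c <= b-a" "0 <= X" for c X using that M0 by (intro mult_mono add_mono mult_left_mono) auto
	show ?thesis
	proof (cases "t0 <= t")
		case True
		have "(norm (y t-z t))^2+(norm (y' t-z' t))^2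
			<= ((norm (y t0-z t0))^2+(norm (y' t0-z' t0))^2 + G^2*(b-t0)) * exp ((2 + M)*(b-t0))"
			by (rule schroedinger_energy_forward[of t0 b V y y' U z z' M G t])
				 (use True t M G in \<open>auto intro: schroedinger_on_subset[OF y] schroedinger_on_subset[OF z]\<close>)
		also have "... <= ((norm (y t0-z t0))^2+(norm (y' t0-z' t0))^2 + G^2*(b-a)) * exp ((2 + M)*(b-a))" by (rule mono) (use t in auto)
		finally show ?thesis .
	next
		case False
		have im: "uminus ` {a..t0} = {-t0..-a}" by simp
		have sub: "{a..t0} \<subseteq> {a..b}" using t by auto
		have "(norm (y (-(-t))-z (-(-t))))^2+(norm (- y' (-(-t)) - - z' (-(-t))))^2
			<= ((norm (y (-(-t0))-z (-(-t0))))^2+(norm (- y' (-(-t0)) - - z' (-(-t0))))^2 + G^2*(-a - -t0)) * exp ((2 + M)*(-a - -t0))"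
			by (rule schroedinger_energy_forward[OF
						schroedinger_on_reflect[OF schroedinger_on_subset[OF y sub],unfolded im]
						schroedinger_on_reflect[OF schroedinger_on_subset[OF z sub],unfolded im]])
				 (use False t M G in auto)
		also have "... = ((norm (y t0-z t0))^2+(norm (y' t0-z' t0))^2 + G^2*(t0-a)) * exp ((2 + M)*(t0-a))" by (simp add: norm_minus_commute)
		also have "... <= ((norm (y t0-z t0))^2+(norm (y' t0-z' t0))^2 + G^2*(b-a)) * exp ((2 + M)*(b-a))" by (rule mono) (use t in auto)
		finally show ?thesis by (simp add: norm_minus_commute)
	qed
qed

lemma schroedinger_unique:
	fixes y z :: "real => 'a::real_inner"
	assumes y: "schroedinger_on {a..b} V y y'" and z: "schroedinger_on {a..b} V z z'"
		and V: "bounded (V ` {a..b})" and t0: "t0 \<in> {a..b}" "y t0=z t0" "y' t0=z' t0"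
		and t: "t \<in> {a..b}"
	shows "y t=z t" "y' t=z' t"
proof -
	obtain M where M: "!!t. t \<in> {a..b} ==> \<bar>V t\<bar> <= M" using V unfolding bounded_iff by (metis image_eqI real_norm_def)
	have "(norm (y t-z t))^2+(norm (y' t-z' t))^2 <= 0" using schroedinger_energy[OF y z M _ t0(1) t,of 0] t0 by auto
	hence "(norm (y t-z t))^2=0 & (norm (y' t-z' t))\<^sup>2=0" by (smt (verit) zero_le_power2)
	thus "y t=z t" "y' t=z' t" by auto
qed

lemma schroedinger_uniform_limit:
	fixes y :: "'k => real => 'a::real_inner"
	assumes y: "\<forall>\<^sub>F k in F. schroedinger_on {a..b} (V k) (y k) (y' k)"
		and z: "schroedinger_on {a..b} U z z'"
		and V: "uniform_limit {a..b} V U F" and U: "bounded (U ` {a..b})"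
		and t0: "t0 \<in> {a..b}" "((%k. y k t0) \<longlongrightarrow> z t0) F" "((%k. y' k t0) \<longlongrightarrow> z' t0) F"
	shows "uniform_limit {a..b} y z F" "uniform_limit {a..b} y' z' F"
proof -
	obtain M where M: "!!t. t \<in> {a..b} ==> \<bar>U t\<bar> <= M" using U unfolding bounded_iff by (metis image_eqI real_norm_def)
	have "compact (z ` {a..b})" by (intro compact_continuous_image schroedinger_on_continuous[OF z]) auto
	then obtain B where B: "!!t. t \<in> {a..b} ==> norm (z t) <= B" "B > 0"
		using compact_imp_bounded bounded_pos by (metis (no_types,lifting) image_eqI)
	have "a <= b" using t0 by simp
	define C where "C=exp ((2+(M+1))*(b-a))"
	have C: "C > 0" by (simp add: C_def)
	have main: "\<forall>\<^sub>F k in F. \<forall>t\<in>{a..b}. norm (y k t-z t) < e & norm (y' k t-z' t) < e" if e: "e > 0" for e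
	proof -
		define \<eta> where "\<eta>=e^2/(4 * C)"
		have \<eta>: "\<eta> > 0" using e C by (simp add: \<eta>_def)
		define \<delta> where "\<delta>=sqrt (\<eta>/(B^2*(b-a)+1))"
		have den: "B^2*(b-a)+1 > 0" using \<open>a <= b\<close> by (smt (verit) mult_nonneg_nonneg zero_le_power2)
		have \<delta>: "\<delta> > 0" "(\<delta> * B)^2*(b-a) <= \<eta>"
		proof -
			show "\<delta> > 0" using \<eta> den by (simp add: \<delta>_def)
			have "\<delta>^2=\<eta>/(B^2*(b-a)+1)" using \<eta> den by (simp add: \<delta>_def)
			hence "(\<delta> * B)^2*(b-a)=\<eta>*(B^2*(b-a)/(B^2*(b-a)+1))" by (simp add: power_mult_distrib)
			also have "... <= \<eta>*1" using \<eta> den by (intro mult_left_mono) auto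
			finally show "(\<delta> * B)^2*(b-a) <= \<eta>" by simp
		qed
		have ev1: "\<forall>\<^sub>F k in F. norm (y k t0-z t0) < sqrt \<eta>" "\<forall>\<^sub>F k in F. norm (y' k t0-z' t0) < sqrt \<eta>"
			using t0(2,3)[unfolded tendsto_iff,rule_format,of "sqrt \<eta>"] \<eta> by (auto simp: dist_norm)
		have ev2: "\<forall>\<^sub>F k in F. \<forall>t\<in>{a..b}. \<bar>V k t-U t\<bar> < min \<delta> 1"
			using V[unfolded uniform_limit_iff,rule_format,of "min \<delta> 1"] \<delta>(1) by (simp add: dist_real_def)
		show ?thesis using y ev1 ev2
		proof eventually_elim
			case (elim k)
			show ?case
			proof
				fix t assume t: "t \<in> {a..b}"
				have "(norm (y k t-z t))^2+(norm (y' k t-z' t))^2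
					<= ((norm (y k t0-z t0))^2+(norm (y' k t0-z' t0))^2+(\<delta> * B)^2*(b-a)) * exp ((2+(M+1))*(b-a))"
				proof (rule schroedinger_energy[OF elim(1) z _ _ t0(1) t])
					fix s assume s: "s \<in> {a..b}"
					show "\<bar>V k s\<bar> <= M+1" using elim(4) M[OF s] s by fastforce
					show "\<bar>V k s-U s\<bar> * norm (z s) <= \<delta> * B" using elim(4) B s \<delta> by (intro mult_mono) fastforce+
				qed
				also have "... < (\<eta>+\<eta>+2*\<eta>) * C" unfolding C_def
				proof (intro mult_strict_right_mono)
					have "(norm (y k t0-z t0))^2 < (sqrt \<eta>)^2" "(norm (y' k t0-z' t0))^2 < (sqrt \<eta>)^2" using elim(2,3) by (intro power_strict_mono; simp)+
					thus "(norm (y k t0-z t0))^2+(norm (y' k t0-z' t0))^2+(\<delta> * B)^2*(b-a) < \<eta>+\<eta>+2*\<eta>" using \<delta>(2) \<eta> by simp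
				qed auto
				also have "... = e^2" using C by (simp add: \<eta>_def)
				finally have "(norm (y k t-z t))^2 < e^2 & (norm (y' k t-z' t))\<^sup>2 < e^2" by (smt (verit) zero_le_power2)
				thus "norm (y k t-z t) < e & norm (y' k t-z' t) < e" using e by (meson less_imp_le power2_less_imp_less)
			qed
		qed
	qed
	show "uniform_limit {a..b} y z F" unfolding uniform_limit_iff dist_norm using main by (fastforce elim: eventually_mono)
	show "uniform_limit {a..b} y' z' F" unfolding uniform_limit_iff dist_norm using main by (fastforce elim: eventually_mono)
qed

lemma wronskian_derivative:
	fixes y z :: "real => complex"
	assumes "schroedinger_on S V y y'" "schroedinger_on S U z z'" "t \<in> S"
	shows "((%t. y t * z' t-y' t * z t) has_vector_derivative of_real (U t-V t)*(y t * z t)) (at t within S)"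
proof -
	note d=schroedinger_onD[OF assms(1,3)] schroedinger_onD[OF assms(2,3)]
	have "((%t. y t * z' t-y' t * z t) has_vector_derivative
			(y t*(U t *\<^sub>R z t) + y' t * z' t)-(y' t * z' t+(V t *\<^sub>R y t) * z t)) (at t within S)"
		by (intro has_vector_derivative_diff has_vector_derivative_mult d)
	thus ?thesis by (rule has_vector_derivative_eq_rhs) (simp add: scaleR_conv_of_real algebra_simps)
qed

section \<open>Linear equations in the complex domain\<close>

text \<open>Domains that are star-shaped about the initial point are enough: the strip is one, and so is the plane cut along a half-line.\<close>

lemma linear_ode_exists:
	fixes p q :: "complex => complex" and y0 y1 :: complex
	assumes S: "open S" "z0 \<in> S" "!!z. z \<in> S ==> closed_segment z0 z \<subseteq> S"
		and p: "p holomorphic_on S" and q: "q holomorphic_on S"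
	obtains y where "y holomorphic_on S" "y z0=y0" "deriv y z0=y1"
		"!!z. z \<in> S ==> deriv (deriv y) z=p z * deriv y z + q z * y z"
proof -
	have star: "starlike S" using S by (auto simp: starlike_def)
	have prim: "\<exists>g. g z0=0 & (\<forall>z\<in>S. (g has_field_derivative f z) (at z))" if "f holomorphic_on S" for f
	proof -
		have "\<exists>g. \<forall>z\<in>S. (g has_field_derivative f z) (at z)"
			using that S by (intro holomorphic_starlike_primitive[OF _ star S(1),where k="{}"])
				(auto simp: holomorphic_on_imp_continuous_on holomorphic_on_open field_differentiable_def)
		then obtain g where g: "\<forall>z\<in>S. (g has_field_derivative f z) (at z)" by blast
		hence "\<forall>z\<in>S. ((%z. g z-g z0) has_field_derivative f z) (at z)" by (auto intro!: derivative_eq_intros)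
		thus ?thesis by (intro exI[of _ "%z. g z-g z0"]) auto
	qed
	define I where "I=(%f. SOME g. g z0=0 & (\<forall>z\<in>S. (g has_field_derivative f z) (at z)))"
	have I: "I f z0=0" "!!z. z \<in> S ==> (I f has_field_derivative f z) (at z)" if "f holomorphic_on S" for f
		using someI_ex[OF prim[OF that]] unfolding I_def by blast+
	define T where "T=rec_nat (%z::complex. y0,%z::complex. y1)
			(%_ AB. (I (snd AB),I (%z. p z * snd AB z + q z * fst AB z)))"
	define A B where "A=(%n. fst (T n))" and "B=(%n. snd (T n))"
	have A0: "A 0=(%z. y0)" and B0: "B 0=(%z. y1)"
		and AS: "!!n. A (Suc n)=I (B n)" and BS: "!!n. B (Suc n)=I (%z. p z * B n z + q z * A n z)" by (simp_all add: A_def B_def T_def)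
	have hol: "A n holomorphic_on S & B n holomorphic_on S" for n
	proof (induction n)
		case (Suc n)
		hence "(%z. p z * B n z + q z * A n z) holomorphic_on S" by (intro holomorphic_intros p q) auto
		with Suc show ?case unfolding AS BS using I(2) S(1) by (meson holomorphic_on_open)
	qed (auto simp: A0 B0)
	define A' where "A' n z=(case n of 0 => 0 | Suc m => B m z)" for n z
	define B' where "B' n z=(case n of 0 => 0 | Suc m => p z * B m z + q z * A m z)" for n z
	have dA: "(A n has_field_derivative A' n z) (at z)" if "z \<in> S" for n z using that hol by (cases n) (auto simp: A'_def A0 AS intro!: I(2))
	have dB: "(B n has_field_derivative B' n z) (at z)" if "z \<in> S" for n z
		using that hol by (cases n) (auto simp: B'_def B0 BS intro!: I(2) holomorphic_intros p q)
	have bound: "norm (A n z) <= C*(2 * M * norm (z-z0))^n/fact n &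
							 norm (B n z) <= C*(2 * M * norm (z-z0))^n/fact n"
		if M: "M >= 1" "!!z. z \<in> closed_segment z0 w ==> norm (p z) <= M & norm (q z) <= M"
			and w: "w \<in> S" and z: "z \<in> closed_segment z0 w" and C: "C=norm y0 + norm y1" for n z w M C using z
	proof (induction n arbitrary: z)
		case 0
		thus ?case using C by (simp add: A0 B0)
	next
		case (Suc n)
		have segw: "closed_segment z0 z \<subseteq> closed_segment z0 w" using Suc.prems by (simp add: subset_closed_segment)
		hence segS: "closed_segment z0 z \<subseteq> S" using S(3)[OF w] by blast
		define D where "D=norm (z-z0)"
		define \<gamma> where "\<gamma>=(%t::real. z0 + of_real t*(z-z0))"
		have \<gamma>: "\<gamma> t \<in> closed_segment z0 z" "norm (\<gamma> t-z0)=t * D" if "t \<in> {0..1}" for t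
		proof -
			show "\<gamma> t \<in> closed_segment z0 z" unfolding \<gamma>_def closed_segment_def using that
				by (intro CollectI exI[of _ t]) (auto simp: scaleR_conv_of_real algebra_simps)
			show "norm (\<gamma> t-z0)=t * D" using that by (simp add: \<gamma>_def D_def norm_mult)
		qed
		define K where "K=C*(2 * M * D)^n/fact n"
		have "C >= 0" using C by simp
		have est: "norm (g z) <= C*(2 * M * D)^Suc n/fact (Suc n)"
			if g0: "g z0=0" and g': "!!z. z \<in> S ==> (g has_field_derivative g' z) (at z)"
				and b: "!!t. t \<in> {0..1} ==> norm (g' (\<gamma> t)) <= 2 * M*(C*(2 * M*(t * D))^n/fact n)" for g g'
		proof -
			define \<phi> where "\<phi>=(%t::real. C*(2 * M * D * t)^Suc n/fact (Suc n))"
			have \<gamma>d: "(\<gamma> has_vector_derivative (z-z0)) (at t within {0..1})" for t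
				unfolding \<gamma>_def by (auto intro!: derivative_eq_intros simp: has_vector_derivative_def scaleR_conv_of_real)
			have gd: "((%t. g (\<gamma> t)) has_vector_derivative (z-z0) * g' (\<gamma> t)) (at t within {0..1})" if "t \<in> {0..1}" for t
			proof -
				have "(g has_field_derivative g' (\<gamma> t)) (at (\<gamma> t) within \<gamma> ` {0..1})"
					using g'[of "\<gamma> t"] \<gamma>(1)[OF that] segS by (auto intro: has_field_derivative_at_within)
				from field_vector_diff_chain_within[OF \<gamma>d this] show ?thesis by (simp add: o_def)
			qed
			have "norm (g (\<gamma> 1)-g (\<gamma> 0)) <= \<phi> 1-\<phi> 0"
			proof (rule differentiable_bound_general)
				show "(0::real) < 1" by simp
				show "continuous_on {0..1} (%t. g (\<gamma> t))" using gd by (meson continuous_on_eq_continuous_within has_vector_derivative_continuous)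
				show "continuous_on {0..1} \<phi>" unfolding \<phi>_def by (intro continuous_intros) simp
				fix t :: real assume t: "0 < t" "t < 1"
				have at: "at t within {0..1} = at t" using t by (intro at_within_interior) auto
				show "((%t. g (\<gamma> t)) has_vector_derivative (z-z0) * g' (\<gamma> t)) (at t)" using gd[of t] t at by simp
				have "(\<phi> has_real_derivative C*(real (Suc n)*(2 * M * D * t)^n*(2 * M * D))/fact (Suc n)) (at t)"
					unfolding \<phi>_def by (auto intro!: derivative_eq_intros simp del: fact_Suc power_Suc)
				also have "C*(real (Suc n)*(2 * M * D * t)^n*(2 * M * D))/fact (Suc n)
					 = D*(2 * M*(C*(2 * M*(t * D))^n/fact n))" by (simp add: divide_simps power_mult_distrib)
				finally show "(\<phi> has_vector_derivative D*(2 * M*(C*(2 * M*(t * D))^n/fact n))) (at t)"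
					by (simp add: has_real_derivative_iff_has_vector_derivative)
				show "norm ((z-z0) * g' (\<gamma> t)) <= D*(2 * M*(C*(2 * M*(t * D))^n/fact n))"
					unfolding norm_mult D_def[symmetric] using b[of t] t by (intro mult_left_mono) (auto simp: D_def)
			qed
			thus ?thesis using g0 by (simp add: \<gamma>_def \<phi>_def)
		qed
		have IH: "norm (A n (\<gamma> t)) <= C*(2 * M*(t * D))^n/fact n"
			"norm (B n (\<gamma> t)) <= C*(2 * M*(t * D))^n/fact n" if "t \<in> {0..1}" for t using Suc.IH[of "\<gamma> t"] \<gamma>[OF that] segw by auto
		have pos: "0 <= C*(2 * M*(t * D))^n/fact n" if "t \<in> {0..1}" for t using that \<open>C >= 0\<close> M(1) by (auto simp: D_def)
		have Ab: "norm (A (Suc n) z) <= C*(2 * M * D)^Suc n/fact (Suc n)"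
		proof (rule est[where g' = "B n"])
			show "A (Suc n) z0=0" unfolding AS using I(1) hol by blast
			show "(A (Suc n) has_field_derivative B n z) (at z)" if "z \<in> S" for z unfolding AS using I(2) hol that by blast
			fix t :: real assume t: "t \<in> {0..1}"
			have "norm (B n (\<gamma> t)) <= 1*(C*(2 * M*(t * D))^n/fact n)" using IH(2)[OF t] by simp
			also have "... <= 2 * M*(C*(2 * M*(t * D))^n/fact n)" using pos[OF t] M(1) by (intro mult_right_mono) auto
			finally show "norm (B n (\<gamma> t)) <= 2 * M*(C*(2 * M*(t * D))^n/fact n)" .
		qed
		have Bb: "norm (B (Suc n) z) <= C*(2 * M * D)^Suc n/fact (Suc n)"
		proof (rule est[where g' = "%z. p z * B n z + q z * A n z"])
			have h: "(%z. p z * B n z + q z * A n z) holomorphic_on S" using hol by (intro holomorphic_intros p q) auto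
			show "B (Suc n) z0=0" unfolding BS using I(1) h by blast
			show "(B (Suc n) has_field_derivative p z * B n z + q z * A n z) (at z)" if "z \<in> S" for z unfolding BS using I(2)[OF h that] by simp
			fix t :: real assume t: "t \<in> {0..1}"
			have pq: "norm (p (\<gamma> t)) <= M" "norm (q (\<gamma> t)) <= M" using M(2) \<gamma>[OF t] segw by auto
			have "norm (p (\<gamma> t) * B n (\<gamma> t) + q (\<gamma> t) * A n (\<gamma> t))
				 <= norm (p (\<gamma> t)) * norm (B n (\<gamma> t)) + norm (q (\<gamma> t)) * norm (A n (\<gamma> t))"
				using norm_triangle_ineq by (metis norm_mult)
			also have "... <= M*(C*(2 * M*(t * D))^n/fact n) + M*(C*(2 * M*(t * D))^n/fact n)" using IH[OF t] pq M(1) by (intro add_mono mult_mono) auto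
			finally show "norm (p (\<gamma> t) * B n (\<gamma> t) + q (\<gamma> t) * A n (\<gamma> t)) <= 2 * M*(C*(2 * M*(t * D))^n/fact n)"
				by (simp add: mult_ac)
		qed
		show ?case using Ab Bb by (simp add: D_def)
	qed
	have local: "\<exists>d h. 0 < d & summable h & (\<forall>n. \<forall>y\<in>ball x d \<inter> S. norm (A n y) <= h n & norm (B n y) <= h n)"
		if x: "x \<in> S" for x
	proof -
		obtain d where d: "d > 0" "cball x d \<subseteq> S" using S(1) x open_contains_cball by blast
		define H where "H=(%(t,w). z0 + of_real t*(w-z0)) ` ({0..1::real} \<times> cball x d)"
		have "compact H" unfolding H_def by (intro compact_continuous_image compact_Times) (auto simp: case_prod_unfold intro!: continuous_intros)
		have seg: "closed_segment z0 w \<subseteq> H" if "w \<in> cball x d" for w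
		proof
			fix v assume "v \<in> closed_segment z0 w"
			then obtain t where "0 <= t" "t <= 1" "v=(1-t) *\<^sub>R z0 + t *\<^sub>R w" by (auto simp: closed_segment_def)
			thus "v \<in> H" unfolding H_def using that by (intro image_eqI[of _ _ "(t,w)"]) (auto simp: scaleR_conv_of_real algebra_simps)
		qed
		have "H \<subseteq> S"
		proof
			fix v assume "v \<in> H"
			then obtain t w where tw: "0 <= t" "t <= 1" "w \<in> cball x d" "v=z0 + of_real t*(w-z0)" by (auto simp: H_def)
			hence "v \<in> closed_segment z0 w" unfolding closed_segment_def by (intro CollectI exI[of _ t]) (auto simp: scaleR_conv_of_real algebra_simps)
			thus "v \<in> S" using S(3) d tw by blast
		qed
		have "compact (p ` H)" "compact (q ` H)" using \<open>compact H\<close> \<open>H \<subseteq> S\<close> p q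
			by (auto intro!: compact_continuous_image elim!: continuous_on_subset[OF holomorphic_on_imp_continuous_on])
		then obtain M1 M2 where "\<forall>x\<in>H. norm (p x) <= M1" "\<forall>x\<in>H. norm (q x) <= M2"
			by (metis bounded_iff compact_imp_bounded image_eqI)
		then obtain M where M: "M >= 1" "!!z. z \<in> H ==> norm (p z) <= M & norm (q z) <= M"
			by (intro that[of "max 1 (max M1 M2)"]) (auto simp: le_max_iff_disj)
		define R where "R=norm (x-z0) + d"
		define C where "C=norm y0 + norm y1"
		define h where "h n=C*(2 * M * R)^n/fact n" for n
		have "summable h"
		proof -
			have "summable (%n. C*(inverse (fact n)*(2 * M * R)^n))" by (intro summable_mult summable_exp)
			thus ?thesis by (simp add: h_def[abs_def] divide_inverse mult_ac)
		qed
		moreover have "norm (A n y) <= h n & norm (B n y) <= h n" if y: "y \<in> ball x d" for n y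
		proof -
			have yc: "y \<in> cball x d" using y by auto
			have "norm (y-z0) <= R" unfolding R_def using y by (smt (verit,best) dist_commute dist_norm dist_triangle2 mem_ball)
			hence "C*(2 * M * norm (y-z0))^n/fact n <= h n"
				unfolding h_def using M(1) by (intro divide_right_mono mult_left_mono power_mono) (auto simp: C_def)
			moreover have "norm (A n y) <= C*(2 * M * norm (y-z0))^n/fact n &
							 norm (B n y) <= C*(2 * M * norm (y-z0))^n/fact n" by (rule bound[where w=y]) (use M seg[OF yc] d yc C_def in auto)
			ultimately show ?thesis by linarith
		qed
		ultimately show ?thesis using d(1) by blast
	qed
	have "\<exists>g g'. \<forall>x\<in>S. ((%n. A n x) sums g x) & ((%n. A' n x) sums g' x) & (g has_field_derivative g' x) (at x)"
	proof (rule series_and_derivative_comparison_local[OF S(1) dA])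
		fix x assume "x \<in> S"
		from local[OF this] obtain d h where "0 < d" "summable h"
			"\<forall>n. \<forall>y\<in>ball x d \<inter> S. norm (A n y) <= h n & norm (B n y) <= h n" by blast
		thus "\<exists>d h. 0 < d & summable h & (\<forall>\<^sub>F n in sequentially. \<forall>y\<in>ball x d \<inter> S. norm (A n y) <= h n)"
			by (intro exI[of _ d] exI[of _ h]) (auto intro!: always_eventually)
	qed
	then obtain y y' where y: "!!x. x \<in> S ==> (%n. A n x) sums y x" "!!x. x \<in> S ==> (%n. A' n x) sums y' x"
		"!!x. x \<in> S ==> (y has_field_derivative y' x) (at x)" by blast
	have "\<exists>g g'. \<forall>x\<in>S. ((%n. B n x) sums g x) & ((%n. B' n x) sums g' x) & (g has_field_derivative g' x) (at x)"
	proof (rule series_and_derivative_comparison_local[OF S(1) dB])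
		fix x assume "x \<in> S"
		from local[OF this] obtain d h where "0 < d" "summable h"
			"\<forall>n. \<forall>y\<in>ball x d \<inter> S. norm (A n y) <= h n & norm (B n y) <= h n" by blast
		thus "\<exists>d h. 0 < d & summable h & (\<forall>\<^sub>F n in sequentially. \<forall>y\<in>ball x d \<inter> S. norm (B n y) <= h n)"
			by (intro exI[of _ d] exI[of _ h]) (auto intro!: always_eventually)
	qed
	then obtain v v' where v: "!!x. x \<in> S ==> (%n. B n x) sums v x" "!!x. x \<in> S ==> (%n. B' n x) sums v' x"
		"!!x. x \<in> S ==> (v has_field_derivative v' x) (at x)" by blast
	have y'v: "y' x=v x" if "x \<in> S" for x
	proof -
		have "(%n. A' (Suc n) x) sums y' x" using y(2)[OF that] by (subst sums_Suc_iff) (simp add: A'_def)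
		thus ?thesis using v(1)[OF that] by (simp add: A'_def sums_iff)
	qed
	have v'eq: "v' x=p x * v x + q x * y x" if "x \<in> S" for x
	proof -
		have "(%n. B' (Suc n) x) sums v' x" using v(2)[OF that] by (subst sums_Suc_iff) (simp add: B'_def)
		moreover have "(%n. p x * B n x + q x * A n x) sums (p x * v x + q x * y x)" by (intro sums_add sums_mult v(1) y(1) that)
		ultimately show ?thesis by (simp add: B'_def sums_iff)
	qed
	have dy: "deriv y x=v x" if "x \<in> S" for x using y(3)[OF that] y'v[OF that] by (simp add: DERIV_imp_deriv)
	show ?thesis
	proof
		show "y holomorphic_on S" using y(3) S(1) by (meson holomorphic_on_open)
		have A1: "A n z0=(if n=0 then y0 else 0)" and B1: "B n z0=(if n=0 then y1 else 0)" for n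
			using hol by (cases n; auto simp: A0 AS B0 BS intro!: I(1) holomorphic_intros p q)+
		show "y z0=y0" using y(1)[OF S(2)] sums_If_finite[of "%n. n=0" "%_. y0"] by (simp add: A1 sums_iff)
		show "deriv y z0=y1" using v(1)[OF S(2)] sums_If_finite[of "%n. n=0" "%_. y1"] by (simp add: dy S B1 sums_iff)
		fix z assume z: "z \<in> S"
		have "(deriv y has_field_derivative v' z) (at z)" by (rule has_field_derivative_transform_within_open[OF v(3)[OF z] S(1) z]) (simp add: dy)
		thus "deriv (deriv y) z=p z * deriv y z + q z * y z" using v'eq[OF z] dy[OF z] by (simp add: DERIV_imp_deriv)
	qed
qed

lemma linear_ode_unique:
	fixes p q :: "complex => complex"
	assumes S: "open S" "connected S" "z0 \<in> S"
		and p: "p holomorphic_on S" and q: "q holomorphic_on S"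
		and y: "y holomorphic_on S" "!!z. z \<in> S ==> deriv (deriv y) z=p z * deriv y z + q z * y z"
		and w: "w holomorphic_on S" "!!z. z \<in> S ==> deriv (deriv w) z=p z * deriv w z + q z * w z"
		and eq: "y z0=w z0" "deriv y z0=deriv w z0" and z: "z \<in> S"
	shows "y z=w z"
proof -
	define d where "d=(%z. y z-w z)"
	have dh: "d holomorphic_on S" unfolding d_def by (intro holomorphic_intros y w)
	have fd: "f field_differentiable at z" if "f holomorphic_on S" "z \<in> S" for f z using that S(1) holomorphic_on_imp_differentiable_at by blast
	have d1: "deriv d z=deriv y z-deriv w z" if "z \<in> S" for z unfolding d_def using that fd y w by simp
	have d2: "deriv (deriv d) z=p z * deriv d z + q z * d z" if z: "z \<in> S" for z
	proof -
		have "deriv (deriv d) z=deriv (%z. deriv y z-deriv w z) z" using d1 S(1) z by (intro complex_derivative_transform_within_open[where s=S])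
				(auto intro!: holomorphic_intros holomorphic_deriv dh y w)
		also have "... = deriv (deriv y) z-deriv (deriv w) z"
			using fd[OF holomorphic_deriv[OF y(1) S(1)] z] fd[OF holomorphic_deriv[OF w(1) S(1)] z] by simp
		also have "... = p z*(deriv y z-deriv w z) + q z*(y z-w z)" using y(2)[OF z] w(2)[OF z] by (simp add: algebra_simps)
		finally show ?thesis using d1[OF z] by (simp add: d_def)
	qed
	have d'h: "deriv d holomorphic_on S" by (rule holomorphic_deriv[OF dh S(1)])
	have zero: "(deriv ^^ n) d z0=0" for n
	proof (induction n rule: less_induct)
		case (less n)
		consider "n=0" | "n=1" | m where "n=Suc (Suc m)" by (metis One_nat_def not0_implies_Suc)
		thus ?case
		proof cases
			case 1 thus ?thesis using eq by (simp add: d_def)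
		next
			case 2 thus ?thesis using eq d1[OF S(3)] by simp
		next
			case (3 m)
			have comp: "(deriv ^^ n) d=(deriv ^^ m) (deriv (deriv d))" unfolding 3 by (simp add: funpow_swap1)
			have comp1: "(deriv ^^ i) (deriv d)=(deriv ^^ Suc i) d" for i by (simp add: funpow_swap1)
			have "(deriv ^^ n) d z0=(deriv ^^ m) (%z. p z * deriv d z + q z * d z) z0" unfolding comp
				by (rule higher_deriv_transform_within_open[OF _ _ S(1) S(3)])
					 (auto intro!: holomorphic_intros p q dh d'h holomorphic_deriv S(1) d2)
			also have "... = (deriv ^^ m) (%z. p z * deriv d z) z0+(deriv ^^ m) (%z. q z * d z) z0"
				by (rule higher_deriv_add[OF _ _ S(1) S(3)]) (intro holomorphic_intros p q dh d'h)+
			also have "(deriv ^^ m) (%z. p z * deriv d z) z0=0" unfolding higher_deriv_mult[OF p d'h S(1) S(3)] comp1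
			proof (intro sum.neutral ballI)
				fix i assume "i \<in> {0..m}"
				hence "(deriv ^^ Suc (m-i)) d z0=0" using 3 by (intro less.IH) auto
				thus "of_nat (m choose i)*(deriv ^^ i) p z0*(deriv ^^ Suc (m-i)) d z0=0" by (simp only: mult_zero_right)
			qed
			also have "(deriv ^^ m) (%z. q z * d z) z0=0" unfolding higher_deriv_mult[OF q dh S(1) S(3)] using less.IH 3 by (intro sum.neutral) auto
			finally show ?thesis by simp
		qed
	qed
	have "d z=0" by (rule holomorphic_fun_eq_0_on_connected[OF dh S(1,2) zero S(3) z])
	thus ?thesis by (simp add: d_def)
qed

section \<open>Jacobian elliptic functions of a real argument\<close>

lemma sqrt_modulus_pos:
	fixes ka x :: real
	assumes "ka^2 < 1" shows "0 < 1-ka\<^sup>2*(sin x)^2"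
proof -
	have "ka^2*(sin x)^2 <= ka^2*1" by (intro mult_left_mono) (auto simp: abs_square_le_1)
	thus ?thesis using assms by simp
qed

lemma elliptic_F_0 [simp]: "elliptic_F ka 0=0" by (simp add: elliptic_F_def flip: zero_ereal_def)

lemma elliptic_F_deriv:
	assumes ka: "ka^2 < 1"
	shows "(elliptic_F ka has_real_derivative 1/sqrt (1-ka\<^sup>2*(sin x)^2)) (at x)"
proof -
	define b where "b=\<bar>x\<bar>+1"
	have "((%u. LBINT y=ereal 0..ereal u. 1/sqrt (1-ka\<^sup>2*(sin y)^2)) has_vector_derivative
			1/sqrt (1-ka\<^sup>2*(sin x)^2)) (at x within {-b..b})" using sqrt_modulus_pos[OF ka]
		by (intro interval_integral_FTC2 continuous_intros) (auto simp: b_def less_le)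
	moreover have "at x within {-b..b} = at x" by (intro at_within_interior) (auto simp: b_def)
	ultimately show ?thesis by (simp add: has_real_derivative_iff_has_vector_derivative elliptic_F_def[abs_def] zero_ereal_def)
qed

lemma elliptic_F_expands:
	assumes ka: "ka^2 < 1" and "x <= y"
	shows "y-x <= elliptic_F ka y-elliptic_F ka x"
proof -
	have "elliptic_F ka x-x <= elliptic_F ka y-y"
	proof (rule DERIV_nonneg_imp_nondecreasing[OF assms(2)])
		fix z
		have "((%x. elliptic_F ka x-x) has_real_derivative 1/sqrt (1-ka\<^sup>2*(sin z)^2)-1) (at z)" by (intro derivative_intros elliptic_F_deriv[OF ka])
		moreover have "sqrt (1-ka\<^sup>2*(sin z)^2) <= 1" by simp
		ultimately show "\<exists>y. ((%x. elliptic_F ka x-x) has_real_derivative y) (at z) & 0 <= y"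
			using sqrt_modulus_pos[OF ka,of z] by (intro exI conjI) (auto simp: divide_simps)
	qed
	thus ?thesis by simp
qed

lemma elliptic_F_strict_mono: "ka^2 < 1 ==> x < y ==> elliptic_F ka x < elliptic_F ka y" using elliptic_F_expands[of ka x y] by simp

lemma elliptic_F_less_iff: "ka^2 < 1 ==> elliptic_F ka x < elliptic_F ka y \<longleftrightarrow> x < y"
	using elliptic_F_strict_mono[of ka x y] elliptic_F_strict_mono[of ka y x] by (cases x y rule: linorder_cases) auto

lemma elliptic_F_minus:
	assumes ka: "ka^2 < 1" shows "elliptic_F ka (- x) = - elliptic_F ka x"
proof -
	have "((%x. elliptic_F ka x + elliptic_F ka (- x)) has_real_derivative 0) (at z)" for z
		by (rule derivative_eq_intros DERIV_chain2[OF elliptic_F_deriv[OF ka]] elliptic_F_deriv[OF ka] refl | simp)+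
	from DERIV_isconst_all[OF allI[OF this],of x 0] show ?thesis by simp
qed

lemma elliptic_F_surj:
	assumes ka: "ka^2 < 1" shows "\<exists>x. elliptic_F ka x=u"
proof -
	have "elliptic_F ka (- \<bar>u\<bar>) <= u" "u <= elliptic_F ka \<bar>u\<bar>"
		using elliptic_F_expands[OF ka,of 0 "\<bar>u\<bar>"] elliptic_F_expands[OF ka,of "-\<bar>u\<bar>" 0] by auto
	moreover have "continuous_on {-\<bar>u\<bar>..\<bar>u\<bar>} (elliptic_F ka)"
		using elliptic_F_deriv[OF ka] by (meson DERIV_isCont continuous_at_imp_continuous_on)
	ultimately show ?thesis using IVT'[of "elliptic_F ka" "-\<bar>u\<bar>" u "\<bar>u\<bar>"] by auto
qed

lemma jacobi_am_F [simp]: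
	assumes ka: "ka^2 < 1" shows "jacobi_am (elliptic_F ka x) ka=x" unfolding jacobi_am_def
proof (rule the_equality)
	fix y assume "elliptic_F ka y=elliptic_F ka x"
	thus "y=x" using elliptic_F_less_iff[OF ka,of x y] elliptic_F_less_iff[OF ka,of y x] by simp
qed simp

lemma elliptic_F_am [simp]:
	assumes ka: "ka^2 < 1" shows "elliptic_F ka (jacobi_am u ka)=u"
proof -
	obtain x where x: "elliptic_F ka x=u" using elliptic_F_surj[OF ka] by blast
	show ?thesis using jacobi_am_F[OF ka,of x] unfolding x by (simp add: x)
qed

lemma jacobi_am_0 [simp]: "ka^2 < 1 ==> jacobi_am 0 ka=0" using jacobi_am_F[of ka 0] by simp

lemma jacobi_am_minus: "ka^2 < 1 ==> jacobi_am (- u) ka = - jacobi_am u ka" by (metis elliptic_F_am elliptic_F_minus jacobi_am_F)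

lemma jacobi_dn_pos: "ka^2 < 1 ==> jacobi_dn u ka > 0" using sqrt_modulus_pos[of ka "jacobi_am u ka"] by (simp add: jacobi_dn_def jacobi_sn_def)

lemma jacobi_am_deriv:
	assumes ka: "ka^2 < 1"
	shows "((%u. jacobi_am u ka) has_real_derivative jacobi_dn u ka) (at u)"
proof -
	have lip: "\<bar>jacobi_am v ka-jacobi_am w ka\<bar> <= \<bar>v-w\<bar>" for v w using elliptic_F_expands[OF ka,of "jacobi_am v ka" "jacobi_am w ka"]
			elliptic_F_expands[OF ka,of "jacobi_am w ka" "jacobi_am v ka"] ka by (cases "jacobi_am v ka <= jacobi_am w ka") auto
	have "isCont (%u. jacobi_am u ka) u" unfolding continuous_at_eps_delta using lip by (metis dist_real_def le_less_trans)
	moreover have "1/sqrt (1-ka\<^sup>2*(sin (jacobi_am u ka))^2) ~= 0" using sqrt_modulus_pos[OF ka,of "jacobi_am u ka"] by simp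
	ultimately have "((%u. jacobi_am u ka) has_real_derivative inverse (1/sqrt (1-ka\<^sup>2*(sin (jacobi_am u ka))^2))) (at u)"
		by (intro DERIV_inverse_function[where a = "u-1" and b = "u+1",OF elliptic_F_deriv[OF ka]])
			 (simp_all only: elliptic_F_am[OF ka],simp_all)
	thus ?thesis by (simp add: jacobi_dn_def jacobi_sn_def)
qed

lemma jacobi_sn_cn: "(jacobi_sn u ka)^2+(jacobi_cn u ka)^2=1" by (simp add: jacobi_sn_def jacobi_cn_def)

lemma jacobi_dn_square: "ka^2 < 1 ==> (jacobi_dn u ka)\<^sup>2=1-ka\<^sup>2*(jacobi_sn u ka)^2"
	using sqrt_modulus_pos[of ka "jacobi_am u ka"] by (simp add: jacobi_dn_def jacobi_sn_def)

lemma jacobi_sn_bound: "\<bar>jacobi_sn u ka\<bar> <= 1" by (simp add: jacobi_sn_def)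

lemma jacobi_sn_deriv:
	assumes ka: "ka^2 < 1"
	shows "((%u. jacobi_sn u ka) has_real_derivative jacobi_cn u ka * jacobi_dn u ka) (at u)" unfolding jacobi_sn_def jacobi_cn_def
	by (rule derivative_eq_intros jacobi_am_deriv[OF ka] refl | simp)+

lemma jacobi_cn_deriv:
	assumes ka: "ka^2 < 1"
	shows "((%u. jacobi_cn u ka) has_real_derivative-jacobi_sn u ka * jacobi_dn u ka) (at u)" unfolding jacobi_sn_def jacobi_cn_def
	by (rule derivative_eq_intros jacobi_am_deriv[OF ka] refl | simp)+

lemma jacobi_dn_deriv:
	assumes ka: "ka^2 < 1"
	shows "((%u. jacobi_dn u ka) has_real_derivative-ka\<^sup>2 * jacobi_sn u ka * jacobi_cn u ka) (at u)"
proof -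
	have eq: "(%u. jacobi_dn u ka)=(%u. sqrt (1-ka\<^sup>2*(jacobi_sn u ka)^2))" by (simp add: jacobi_dn_def)
	have p: "0 < 1-ka\<^sup>2*(jacobi_sn u ka)^2" using sqrt_modulus_pos[OF ka,of "jacobi_am u ka"] by (simp add: jacobi_sn_def)
	have "((%u. 1-ka\<^sup>2*(jacobi_sn u ka)^2) has_real_derivative
		 - (ka^2*(2 * jacobi_sn u ka*(jacobi_cn u ka * jacobi_dn u ka)))) (at u)" by (rule derivative_eq_intros jacobi_sn_deriv[OF ka] refl | simp)+
	from DERIV_chain2[OF DERIV_real_sqrt[OF p] this]
	have "((%u. jacobi_dn u ka) has_real_derivative
		 inverse (jacobi_dn u ka)/2 * - (ka^2*(2 * jacobi_sn u ka*(jacobi_cn u ka * jacobi_dn u ka)))) (at u)"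
		unfolding eq[symmetric] by (simp add: jacobi_dn_def)
	thus ?thesis by (rule DERIV_cong) (use jacobi_dn_pos[OF ka,of u] in \<open>simp add: field_simps\<close>)
qed

lemma elliptic_K_pos: "ka^2 < 1 ==> pi/2 <= elliptic_K ka" using elliptic_F_expands[of ka 0 "pi/2"] by (simp add: elliptic_K_def)

lemma elliptic_K_gt_0: "ka^2 < 1 ==> 0 < elliptic_K ka" using elliptic_K_pos[of ka] pi_gt_zero by linarith

lemma jacobi_am_less_iff: "ka^2 < 1 ==> jacobi_am u ka < jacobi_am v ka \<longleftrightarrow> u < v" by (metis elliptic_F_am elliptic_F_less_iff)

lemma jacobi_am_K: "ka^2 < 1 ==> jacobi_am (elliptic_K ka) ka=pi/2" by (simp add: elliptic_K_def)

lemma jacobi_am_bounds: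
	assumes "ka^2 < 1" "\<bar>u\<bar> < elliptic_K ka"
	shows "- (pi/2) < jacobi_am u ka" "jacobi_am u ka < pi/2"
	using jacobi_am_less_iff[OF assms(1),of u "elliptic_K ka"] jacobi_am_less_iff[OF assms(1),of "- elliptic_K ka" u]
		assms jacobi_am_K[OF assms(1)] jacobi_am_minus[OF assms(1)] by auto

lemma jacobi_cn_pos: "ka^2 < 1 ==> \<bar>u\<bar> < elliptic_K ka ==> jacobi_cn u ka > 0"
	using jacobi_am_bounds[of ka u] by (simp add: jacobi_cn_def cos_gt_zero_pi)

section \<open>The small-modulus limit of the Jacobian functions\<close>

lemma compl_modulus_square: "0 < k ==> k < 1 ==> (compl_modulus k)\<^sup>2=1-k\<^sup>2" by (simp add: compl_modulus_def abs_square_le_1 power_le_one)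

lemma compl_modulus_square_less: "0 < k ==> k < 1 ==> (compl_modulus k)\<^sup>2 < 1" by (simp add: compl_modulus_square)

text \<open>If the amplitude of \<open>\<tau>\<close> for the modulus \<open>k'\<close> is the Gudermannian of \<open>G\<close>, then \<open>cs(\<tau>,k')\<close> is exactly \<open>1/sinh G\<close>. The small-modulus limit then only says that \<open>\<tau>\<close> is close to \<open>G\<close>.\<close>

definition gd_inverse :: "real => real => real" where
	"gd_inverse k G=elliptic_F (compl_modulus k) (arctan (sinh G))"

lemma sin_arctan_sinh: "sin (arctan (sinh G))=tanh (G::real)" "cos (arctan (sinh G))=1/cosh G"
proof -
	have "1+(sinh G)^2=(cosh G)^2" by (simp add: cosh_square_eq)
	hence "sqrt (1+(sinh G)^2) = cosh G" by (simp add: real_sqrt_unique)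
	thus "sin (arctan (sinh G))=tanh (G::real)" "cos (arctan (sinh G))=1/cosh G" by (simp_all add: sin_arctan cos_arctan tanh_def)
qed

context
	fixes k :: real
	assumes k: "0 < k" "k < 1"
begin

lemma gd_inverse_deriv: "(gd_inverse k has_real_derivative 1/sqrt (1 + k^2*(sinh G)^2)) (at G)"
proof -
	note c = compl_modulus_square_less[OF k]
	have ch: "cosh G > 0" by simp
	have "((%G. elliptic_F (compl_modulus k) (arctan (sinh G))) has_real_derivative
		 (1/sqrt (1-(compl_modulus k)\<^sup>2*(sin (arctan (sinh G)))^2))*(inverse (1+(sinh G)^2) * cosh G)) (at G)"
		by (rule DERIV_chain2[OF elliptic_F_deriv[OF c]]) (auto intro!: derivative_eq_intros)
	moreover have "(1/sqrt (1-(compl_modulus k)\<^sup>2*(sin (arctan (sinh G)))^2))*(inverse (1+(sinh G)^2) * cosh G)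
		 = 1/sqrt (1 + k^2*(sinh G)^2)"
	proof -
		have "1-(compl_modulus k)\<^sup>2*(sin (arctan (sinh G)))^2=(1 + k^2*(sinh G)^2)/(cosh G)^2" unfolding sin_arctan_sinh compl_modulus_square[OF k]
			by (simp add: tanh_def field_simps) (simp add: cosh_square_eq algebra_simps)
		moreover have "1+(sinh G)^2=(cosh G)^2" by (simp add: cosh_square_eq)
		ultimately show ?thesis using ch by (simp add: real_sqrt_divide) (simp add: power2_eq_square inverse_eq_divide)
	qed
	ultimately show ?thesis by (simp add: gd_inverse_def[abs_def])
qed

lemma gd_inverse_0 [simp]: "gd_inverse k 0=0" by (simp add: gd_inverse_def)

lemma gd_inverse_less_iff: "gd_inverse k G < gd_inverse k H \<longleftrightarrow> G < H"
	by (simp add: gd_inverse_def elliptic_F_less_iff[OF compl_modulus_square_less[OF k]] arctan_less_iff)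

lemma gd_inverse_less_K: "gd_inverse k G < elliptic_K' k" unfolding gd_inverse_def elliptic_K'_def elliptic_K_def
	by (simp add: elliptic_F_less_iff[OF compl_modulus_square_less[OF k]] arctan_ubound del: less_divide_eq_numeral1)

lemma gd_inverse_surj:
	assumes "0 < \<tau>" "\<tau> < elliptic_K' k"
	obtains G where "G > 0" "\<tau>=gd_inverse k G"
proof -
	define c where "c = compl_modulus k"
	have c: "c^2 < 1" unfolding c_def by (rule compl_modulus_square_less[OF k])
	define \<phi> where "\<phi>=jacobi_am \<tau> c"
	have "0 < \<phi>" "\<phi> < pi/2" using jacobi_am_bounds[OF c,of \<tau>] jacobi_am_less_iff[OF c,of 0 \<tau>] assms c
		by (auto simp: \<phi>_def elliptic_K'_def c_def)
	hence "arctan (sinh (arsinh (tan \<phi>)))=\<phi>" by (simp add: arctan_tan)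
	hence "gd_inverse k (arsinh (tan \<phi>))=\<tau>" using c by (simp add: gd_inverse_def \<phi>_def c_def)
	moreover from this have "arsinh (tan \<phi>) > 0" using assms gd_inverse_less_iff[of 0 "arsinh (tan \<phi>)"] gd_inverse_0 by linarith
	ultimately show ?thesis using that by metis
qed

lemma jacobi_gd_inverse:
	"jacobi_sn (gd_inverse k G) (compl_modulus k)=tanh G"
	"jacobi_cn (gd_inverse k G) (compl_modulus k)=1/cosh G"
	by (simp_all add: jacobi_sn_def jacobi_cn_def gd_inverse_def compl_modulus_square_less[OF k] sin_arctan_sinh)

lemma gd_inverse_le:
	assumes "0 <= G" shows "gd_inverse k G <= G"
proof -
	have "0-gd_inverse k 0 <= G-gd_inverse k G"
	proof (rule DERIV_nonneg_imp_nondecreasing[OF assms])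
		fix z
		have "((%G. G-gd_inverse k G) has_real_derivative 1-1/sqrt (1 + k^2*(sinh z)^2)) (at z)" by (intro derivative_intros gd_inverse_deriv)
		moreover have "1/sqrt (1 + k^2*(sinh z)^2) <= 1" by (intro divide_le_eq_1[THEN iffD2]) auto
		ultimately show "\<exists>y. ((%G. G-gd_inverse k G) has_real_derivative y) (at z) & 0 <= y" by (intro exI conjI) (assumption,linarith)
	qed
	thus ?thesis by simp
qed

lemma gd_inverse_ge:
	assumes "0 <= G" "G <= T"
	shows "G-k\<^sup>2*(cosh T)^2 * G^3 <= gd_inverse k G"
proof -
	have "gd_inverse k 0-(0-k\<^sup>2*(cosh T)^2*0^3) <= gd_inverse k G-(G-k\<^sup>2*(cosh T)^2 * G^3)"
	proof (rule DERIV_nonneg_imp_nondecreasing[OF assms(1)])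
		fix z assume z: "0 <= z" "z <= G"
		have d: "((%G. gd_inverse k G-(G-k\<^sup>2*(cosh T)^2 * G^3)) has_real_derivative
			 1/sqrt (1 + k^2*(sinh z)^2)-(1-k\<^sup>2*(cosh T)^2*(3 * z^2))) (at z)" by (auto intro!: derivative_eq_intros gd_inverse_deriv)
		have "sinh z <= z * cosh z"
		proof -
			have "0 * cosh 0-sinh 0 <= z * cosh z-sinh z" by (rule DERIV_nonneg_imp_nondecreasing[OF z(1)])
					 (auto intro!: derivative_eq_intros exI simp: sinh_real_nonneg_iff)
			thus ?thesis by simp
		qed
		also have "... <= z * cosh T" using z assms by (intro mult_left_mono) (auto simp: cosh_real_nonneg_le_iff)
		finally have s: "(sinh z)^2 <= (z * cosh T)^2" using z by (intro power_mono) auto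
		define x where "x=k^2*(sinh z)^2"
		have x: "x >= 0" "x <= k^2*(z * cosh T)^2" using s by (auto simp: x_def intro!: mult_left_mono)
		have "1-x <= 1/sqrt (1 + x)"
		proof -
			have "sqrt (1 + x) <= 1 + x" using x by (intro real_le_lsqrt) (auto simp: power2_eq_square algebra_simps)
			hence "1/(1 + x) <= 1/sqrt (1 + x)" using x by (intro divide_left_mono) auto
			moreover have "1-x <= 1/(1 + x)" using x by (simp add: field_simps)
			ultimately show ?thesis by linarith
		qed
		moreover have "x <= k^2*(cosh T)^2*(3 * z^2)"
		proof -
			have "0 <= k^2*(z * cosh T)^2" by simp
			hence "k^2*(z * cosh T)^2 <= 3*(k^2*(z * cosh T)^2)" by linarith
			also have "... = k^2*(cosh T)^2*(3 * z^2)" by (simp add: power_mult_distrib)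
			finally show ?thesis using x(2) by linarith
		qed
		ultimately show "\<exists>y. ((%G. gd_inverse k G-(G-k\<^sup>2*(cosh T)^2 * G^3)) has_real_derivative y) (at z) & 0 <= y"
			using d unfolding x_def by (intro exI conjI) (assumption,linarith)
	qed
	thus ?thesis by simp
qed

text \<open>A crude bound in place of the logarithmic asymptotics; it already makes \<open>k K'\<close> tend to 0.\<close>

lemma elliptic_K'_le:
	assumes k2: "k^2 <= 1/2"
	shows "elliptic_K' k <= 4/sqrt k"
proof -
	have bnd: "gd_inverse k G <= 4/sqrt k" if "G >= 0" for G
	proof -
		have "0-(gd_inverse k 0) <= (4/sqrt k)*(1-exp (- G/2))-gd_inverse k G"
		proof (rule order_trans[OF _ DERIV_nonneg_imp_nondecreasing[of 0 G "%G. (4/sqrt k)*(1-exp (- G/2))-gd_inverse k G"]])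
			fix z assume z: "0 <= z" "z <= G"
			have d: "((%G. (4/sqrt k)*(1-exp (- G/2))-gd_inverse k G) has_real_derivative
					(2/sqrt k) * exp (- z/2)-1/sqrt (1 + k^2*(sinh z)^2)) (at z)"
				using k by (auto intro!: derivative_eq_intros gd_inverse_deriv simp: exp_minus field_simps)
			have "1 + k^2*(sinh z)^2=1-k\<^sup>2+(k * cosh z)^2" by (simp add: sinh_square_eq algebra_simps power_mult_distrib)
			also have "... >= 1/2*(1+(k * cosh z)^2)" using k2 zero_le_power2[of "k * cosh z"] by argo
			also have "1/2*(1+(k * cosh z)^2) >= k * cosh z" using sum_squares_bound[of 1 "k * cosh z"] by simp
			finally have "k * cosh z <= 1 + k^2*(sinh z)^2" by simp
			moreover have "exp z/4 <= cosh z" by (simp add: cosh_def)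
			ultimately have "k*(exp z/4) <= 1 + k^2*(sinh z)^2" using k by (smt (verit) mult_left_mono)
			hence "sqrt (k*(exp z/4)) <= sqrt (1 + k^2*(sinh z)^2)" by simp
			moreover have "sqrt (k*(exp z/4))=sqrt k * exp (z/2)/2"
			proof -
				have "sqrt (exp z)=exp (z/2)" by (rule real_sqrt_unique) (simp_all flip: exp_double)
				thus ?thesis by (simp add: real_sqrt_mult real_sqrt_divide)
			qed
			ultimately have "sqrt k * exp (z/2)/2 <= sqrt (1 + k^2*(sinh z)^2)" by linarith
			hence "1/sqrt (1 + k^2*(sinh z)^2) <= 1/(sqrt k * exp (z/2)/2)" using k by (intro divide_left_mono mult_pos_pos) (auto simp: add_pos_nonneg)
			also have "... = (2/sqrt k) * exp (- z/2)" by (simp add: exp_minus field_simps)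
			finally show "\<exists>y. ((%G. (4/sqrt k)*(1-exp (- G/2))-gd_inverse k G) has_real_derivative y) (at z) & 0 <= y"
				using d by (intro exI conjI) (assumption,linarith)
		qed (use that in auto)
		moreover have "(4/sqrt k)*(1-exp (- G/2)) <= (4/sqrt k)*1" using k by (intro mult_left_mono) auto
		ultimately show ?thesis by simp
	qed
	show ?thesis
	proof (rule ccontr)
		assume "\<not> ?thesis"
		then obtain \<tau> where \<tau>: "4/sqrt k < \<tau>" "\<tau> < elliptic_K' k" using dense by (meson not_le)
		hence "\<tau> > 0" using k by (smt (verit) divide_pos_pos real_sqrt_gt_zero)
		thus False using gd_inverse_surj[OF _ \<tau>(2)] bnd \<tau>(1) by (metis less_imp_le not_le)
	qed
qed

end

text \<open>Up to sign this is \<open>(k sn)\<close> squared at \<open>i(K' - \<tau>)\<close>, hence the potential on the segment from the pole \<open>iK'\<close> to the origin.\<close>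

definition jacobi_cs_square :: "real => real => real" where
	"jacobi_cs_square k \<tau>=(jacobi_cn \<tau> (compl_modulus k)/jacobi_sn \<tau> (compl_modulus k))^2"

lemma jacobi_cs_square_gd:
	assumes "0 < k" "k < 1" "G > 0"
	shows "jacobi_cs_square k (gd_inverse k G)=1/(sinh G)^2" using assms by (simp add: jacobi_cs_square_def jacobi_gd_inverse tanh_def power_divide)

lemma jacobi_cs_square_K: "0 < k ==> k < 1 ==> jacobi_cs_square k (elliptic_K' k)=0"
	by (simp add: jacobi_cs_square_def elliptic_K'_def jacobi_cn_def jacobi_am_K[OF compl_modulus_square_less])

lemma jacobi_cs_square_le:
	assumes k: "0 < k" "k < 1" and \<tau>: "0 < \<tau>" "\<tau> <= elliptic_K' k"
	shows "\<bar>jacobi_cs_square k \<tau>-1/(sinh \<tau>)^2\<bar> <= 1/(sinh \<tau>)^2"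
proof -
	have "jacobi_cs_square k \<tau> <= 1/(sinh \<tau>)^2"
	proof (cases "\<tau>=elliptic_K' k")
		case False
		then obtain G where G: "G > 0" "\<tau>=gd_inverse k G" using gd_inverse_surj[OF k] \<tau> by (metis less_le)
		have "\<tau> <= G" using gd_inverse_le[OF k,of G] G by simp
		hence "(sinh \<tau>)^2 <= (sinh G)^2" using \<tau> by (intro power_mono) (auto simp: sinh_real_le_iff)
		thus ?thesis unfolding G(2) jacobi_cs_square_gd[OF k G(1)] using \<tau> G by (intro divide_left_mono) auto
	qed (simp add: jacobi_cs_square_K k)
	moreover have "0 <= jacobi_cs_square k \<tau>" by (simp add: jacobi_cs_square_def)
	ultimately show ?thesis by linarith
qed

lemma gd_inverse_close:
	assumes T: "T > 0"
	shows "\<exists>C. C > 0 & (\<forall>\<^sub>F k in at_right 0. \<forall>\<tau>. 0 < \<tau> & \<tau> <= T \<longrightarrow> \<tau> < elliptic_K' k &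
		(\<exists>G>0. \<tau>=gd_inverse k G & \<tau> <= G & G <= T+1 & G-\<tau> <= C * k^2*\<tau>^3))"
proof (intro exI conjI)
	define S where "S=(cosh (T+1))^2"
	have S: "S > 0" by (simp add: S_def)
	show "8 * S > 0" using S by simp
	have "((%k::real. k\<^sup>2 * S*(T+1)^3) \<longlongrightarrow> 0\<^sup>2 * S*(T+1)^3) (at_right 0)" by (intro tendsto_intros)
	hence e1: "\<forall>\<^sub>F k::real in at_right 0. k\<^sup>2 * S*(T+1)^3 < 1/2" by (rule order_tendstoD) simp
	have e2: "\<forall>\<^sub>F k::real in at_right 0. 0 < k & k < 1" by (auto simp: eventually_at_right_field intro!: exI[of _ 1])
	show "\<forall>\<^sub>F k in at_right 0. \<forall>\<tau>. 0 < \<tau> & \<tau> <= T \<longrightarrow> \<tau> < elliptic_K' k &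
		(\<exists>G>0. \<tau>=gd_inverse k G & \<tau> <= G & G <= T+1 & G-\<tau> <= 8 * S * k^2*\<tau>^3)" using e1 e2
	proof eventually_elim
		case (elim k)
		hence k: "0 < k" "k < 1" by auto
		show ?case
		proof (intro allI impI conjI)
			fix \<tau> assume \<tau>: "0 < \<tau> & \<tau> <= T"
			have "T < gd_inverse k (T+1)" using gd_inverse_ge[OF k,of "T+1" "T+1"] elim(1) T by (simp add: S_def)
			thus lt: "\<tau> < elliptic_K' k" using gd_inverse_less_K[OF k,of "T+1"] \<tau> by linarith
			obtain G where G: "G > 0" "\<tau>=gd_inverse k G" using gd_inverse_surj[OF k] \<tau> lt by metis
			have GT: "G < T+1" using gd_inverse_less_iff[OF k,of G "T+1"] \<open>T < gd_inverse k (T+1)\<close> G \<tau> by simp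
			have le: "\<tau> <= G" using gd_inverse_le[OF k,of G] G by simp
			have ge: "G-k\<^sup>2 * S * G^3 <= \<tau>" using gd_inverse_ge[OF k,of G "T+1"] G GT by (simp add: S_def)
			have "k^2 * S * G^3 <= k^2 * S*(T+1)^2 * G"
			proof -
				have "G^3=G^2 * G" by (simp add: power3_eq_cube power2_eq_square)
				also have "... <= (T+1)^2 * G" using G GT by (intro mult_right_mono power_mono) auto
				finally show ?thesis using S by (simp add: mult.assoc mult_left_mono)
			qed
			also have "... <= 1/2 * G"
			proof (rule mult_right_mono)
				have "(T+1)^2 <= (T+1)^3" using T by (intro power_increasing) auto
				hence "k^2 * S*(T+1)^2 <= k^2 * S*(T+1)^3" using S by (intro mult_left_mono) auto
				thus "k^2 * S*(T+1)^2 <= 1/2" using elim(1) by linarith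
			qed (use G in auto)
			finally have "G <= 2*\<tau>" using ge by linarith
			hence "G^3 <= (2*\<tau>)^3" using G by (intro power_mono) auto
			hence "k^2 * S * G^3 <= k^2 * S*(2*\<tau>)^3" using S by (intro mult_left_mono) auto
			also have "... = 8 * S * k^2*\<tau>^3" by (simp add: power_mult_distrib)
			finally have "G-\<tau> <= 8 * S * k^2*\<tau>^3" using ge by linarith
			thus "\<exists>G>0. \<tau>=gd_inverse k G & \<tau> <= G & G <= T+1 & G-\<tau> <= 8 * S * k^2*\<tau>^3" using G le GT by (intro exI[of _ G]) auto
		qed
	qed
qed

lemma small_modulus: "\<forall>\<^sub>F k::real in at_right 0. 0 < k & k < 1" by (auto simp: eventually_at_right_field intro!: exI[of _ 1])

lemma elliptic_K'_at_top: "filterlim elliptic_K' at_top (at_right 0)" unfolding filterlim_at_top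
proof
	fix Z :: real
	obtain C where "\<forall>\<^sub>F k in at_right 0. \<forall>\<tau>. 0 < \<tau> & \<tau> <= \<bar>Z\<bar>+1 \<longrightarrow> \<tau> < elliptic_K' k &
		(\<exists>G>0. \<tau>=gd_inverse k G & \<tau> <= G & G <= \<bar>Z\<bar>+1+1 & G-\<tau> <= C * k^2*\<tau>^3)"
		using gd_inverse_close[of "\<bar>Z\<bar>+1"] by fastforce
	thus "\<forall>\<^sub>F k in at_right 0. Z <= elliptic_K' k"
	proof eventually_elim
		case (elim k)
		have "0 < \<bar>Z\<bar>+1 & \<bar>Z\<bar>+1 <= \<bar>Z\<bar>+1" by simp
		with elim have "\<bar>Z\<bar>+1 < elliptic_K' k" by blast
		thus ?case by simp
	qed
qed

lemma jacobi_cs_square_uniform: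
	assumes T: "T > 0"
	shows "\<exists>C>0. \<forall>\<^sub>F k in at_right 0. \<forall>\<tau>. 0 < \<tau> & \<tau> <= T \<longrightarrow>
		\<bar>jacobi_cs_square k \<tau>-1/(sinh \<tau>)^2\<bar> <= C * k^2"
proof -
	obtain C where C: "C > 0" "\<forall>\<^sub>F k in at_right 0. \<forall>\<tau>. 0 < \<tau> & \<tau> <= T \<longrightarrow> \<tau> < elliptic_K' k &
		(\<exists>G>0. \<tau>=gd_inverse k G & \<tau> <= G & G <= T+1 & G-\<tau> <= C * k^2*\<tau>^3)" using gd_inverse_close[OF T] by auto
	have "\<forall>\<^sub>F k in at_right 0. \<forall>\<tau>. 0 < \<tau> & \<tau> <= T \<longrightarrow>
		\<bar>jacobi_cs_square k \<tau>-1/(sinh \<tau>)^2\<bar> <= (2 * cosh (T+1) * C) * k^2" using C(2) small_modulus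
	proof eventually_elim
		case (elim k)
		hence k: "0 < k" "k < 1" by auto
		show ?case
		proof (intro allI impI)
			fix \<tau> assume \<tau>: "0 < \<tau> & \<tau> <= T"
			obtain G where G: "G > 0" "\<tau>=gd_inverse k G" "\<tau> <= G" "G <= T+1" "G-\<tau> <= C * k^2*\<tau>^3" using elim(1) \<tau> by blast
			define c where "c=2 * cosh (T+1)/\<tau>^3"
			have "1/(sinh \<tau>)^2 + c*\<tau> <= 1/(sinh G)^2 + c * G"
			proof (rule DERIV_nonneg_imp_nondecreasing[OF G(3)])
				fix z assume z: "\<tau> <= z" "z <= G"
				hence z0: "z > 0" using \<tau> by linarith
				hence sz: "sinh z > 0" by simp
				have d: "((%x. 1/(sinh x)^2 + c * x) has_real_derivative-(2 * cosh z/sinh z^3) + c) (at z)"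
					using sz by (auto intro!: derivative_eq_intros simp: field_simps power2_eq_square power3_eq_cube)
				have "z <= sinh z"
				proof -
					have "sinh 0-0 <= sinh z-z" by (rule DERIV_nonneg_imp_nondecreasing[of 0 z "%z. sinh z-z"])
							 (use z0 in \<open>auto intro!: derivative_eq_intros exI simp: cosh_real_ge_1\<close>)
					thus ?thesis by simp
				qed
				hence "\<tau>^3 <= sinh z^3" using z \<tau> by (intro power_mono) auto
				moreover have "cosh z <= cosh (T+1)" using z z0 G(4) \<tau> by (subst cosh_real_nonneg_le_iff) auto
				ultimately have "2 * cosh z/sinh z^3 <= c" unfolding c_def using \<tau> by (intro frac_le) auto
				thus "\<exists>y. ((%x. 1/(sinh x)^2 + c * x) has_real_derivative y) (at z) & 0 <= y" using d by (intro exI conjI) (assumption,linarith)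
			qed
			hence "1/(sinh \<tau>)^2-1/(sinh G)^2 <= c*(G-\<tau>)" by (simp add: algebra_simps)
			also have "... <= c*(C * k^2*\<tau>^3)" using G(5) \<tau> by (intro mult_left_mono) (auto simp: c_def)
			also have "... = (2 * cosh (T+1) * C) * k^2" using \<tau> by (simp add: c_def)
			finally have "1/(sinh \<tau>)^2-1/(sinh G)^2 <= (2 * cosh (T+1) * C) * k^2" .
			moreover have "1/(sinh G)^2 <= 1/(sinh \<tau>)^2" using \<tau> G by (intro divide_left_mono power_mono) (auto simp: sinh_real_le_iff)
			ultimately show "\<bar>jacobi_cs_square k \<tau>-1/(sinh \<tau>)^2\<bar> <= (2 * cosh (T+1) * C) * k^2"
				using jacobi_cs_square_gd[OF k G(1)] G(2) by (simp add: abs_le_iff)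
		qed
	qed
	thus ?thesis using C(1) by (intro exI[of _ "2 * cosh (T+1) * C"]) auto
qed

lemma inverse_sinh_square_le:
	assumes "0 < a" "a <= (\<tau>::real)"
	shows "1/(sinh \<tau>)^2 <= (4/(1-exp (- 2 * a))^2) * exp (- 2*\<tau>)"
proof -
	have e: "0 < 1-exp (- 2 * a)" using assms by simp
	have s: "sinh \<tau>=exp \<tau>*(1-exp (- 2*\<tau>))/2" by (simp add: sinh_def algebra_simps flip: exp_add)
	have "exp \<tau>*(1-exp (- 2 * a))/2 <= sinh \<tau>" unfolding s using assms by simp
	hence "(exp \<tau>*(1-exp (- 2 * a))/2)^2 <= (sinh \<tau>)^2" using e by (intro power_mono) auto
	hence "1/(sinh \<tau>)^2 <= 1/(exp \<tau>*(1-exp (- 2 * a))/2)^2" using e assms by (intro divide_left_mono mult_pos_pos) auto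
	also have "... = (4/(1-exp (- 2 * a))^2) * exp (- 2*\<tau>)"
	proof -
		have "exp (- 2*\<tau>)=1/(exp \<tau>)^2" using exp_double[of \<tau>] by (simp add: exp_minus inverse_eq_divide)
		thus ?thesis by (simp add: power_mult_distrib power_divide)
	qed
	finally show ?thesis .
qed

text \<open>The interval grows with \<open>K'\<close>, so that uniform smallness would not survive integration; an exponential weight does.\<close>

lemma jacobi_cs_square_weighted:
	assumes a: "0 < a" and \<eta>: "\<eta> > 0"
	shows "\<forall>\<^sub>F k in at_right 0. \<forall>\<tau>. a <= \<tau> & \<tau> <= elliptic_K' k \<longrightarrow>
		\<bar>jacobi_cs_square k \<tau>-1/(sinh \<tau>)^2\<bar> <= \<eta> * exp (- \<tau>)"
proof -
	define D where "D=4/(1-exp (- 2 * a))^2"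
	have D: "D > 0" using a by (simp add: D_def)
	define T where "T=max 1 (ln (D/\<eta>))"
	have "T > 0" by (simp add: T_def)
	obtain C where C: "C > 0" "\<forall>\<^sub>F k in at_right 0. \<forall>\<tau>. 0 < \<tau> & \<tau> <= T \<longrightarrow>
		\<bar>jacobi_cs_square k \<tau>-1/(sinh \<tau>)^2\<bar> <= C * k^2" using jacobi_cs_square_uniform[OF \<open>T > 0\<close>] by blast
	have "((%k::real. C * k^2) \<longlongrightarrow> C*0^2) (at_right 0)" by (intro tendsto_intros)
	hence "\<forall>\<^sub>F k::real in at_right 0. C * k^2 < \<eta> * exp (- T)" by (rule order_tendstoD) (use \<eta> in simp)
	thus ?thesis using C(2) small_modulus
	proof eventually_elim
		case (elim k)
		show ?case
		proof (intro allI impI)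
			fix \<tau> assume \<tau>: "a <= \<tau> & \<tau> <= elliptic_K' k"
			show "\<bar>jacobi_cs_square k \<tau>-1/(sinh \<tau>)^2\<bar> <= \<eta> * exp (- \<tau>)"
			proof (cases "\<tau> <= T")
				case True
				have "\<bar>jacobi_cs_square k \<tau>-1/(sinh \<tau>)^2\<bar> <= C * k^2" using elim(2) True \<tau> a by auto
				also have "... <= \<eta> * exp (- T)" using elim(1) by simp
				also have "... <= \<eta> * exp (- \<tau>)" using True \<eta> by simp
				finally show ?thesis .
			next
				case False
				have "\<bar>jacobi_cs_square k \<tau>-1/(sinh \<tau>)^2\<bar> <= 1/(sinh \<tau>)^2" using elim \<tau> a by (intro jacobi_cs_square_le) auto
				also have "... <= D * exp (- 2*\<tau>)" unfolding D_def using \<tau> a by (intro inverse_sinh_square_le) auto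
				also have "... = D * exp (- \<tau>) * exp (- \<tau>)" by (simp flip: exp_add)
				also have "... <= \<eta> * exp (- \<tau>)"
				proof (rule mult_right_mono)
					have "ln (D/\<eta>) <= \<tau>" using False by (simp add: T_def)
					hence "exp (ln (D/\<eta>)) <= exp \<tau>" by simp
					hence "D/\<eta> <= exp \<tau>" using D \<eta> by simp
					thus "D * exp (- \<tau>) <= \<eta>" using \<eta> by (simp add: exp_minus field_simps)
				qed auto
				finally show ?thesis .
			qed
		qed
	qed
qed

lemma elliptic_F_le:
	assumes ka: "ka^2 < 1" and x: "0 <= x"
	shows "elliptic_F ka x <= x/sqrt (1-ka\<^sup>2)"
proof -
	have "0/sqrt (1-ka\<^sup>2)-elliptic_F ka 0 <= x/sqrt (1-ka\<^sup>2)-elliptic_F ka x"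
	proof (rule DERIV_nonneg_imp_nondecreasing[OF x])
		fix z
		have "((%x. x/sqrt (1-ka\<^sup>2)-elliptic_F ka x) has_real_derivative 1/sqrt (1-ka\<^sup>2)-1/sqrt (1-ka\<^sup>2*(sin z)^2)) (at z)"
			by (intro DERIV_diff DERIV_cdivide DERIV_ident elliptic_F_deriv ka)
		moreover have "ka^2*(sin z)^2 <= ka^2*1" by (intro mult_left_mono) (auto simp: abs_square_le_1)
		hence "1/sqrt (1-ka\<^sup>2*(sin z)^2) <= 1/sqrt (1-ka\<^sup>2)" using ka sqrt_modulus_pos[OF ka,of z] by (intro divide_left_mono) auto
		ultimately show "\<exists>y. ((%x. x/sqrt (1-ka\<^sup>2)-elliptic_F ka x) has_real_derivative y) (at z) & 0 <= y"
			by (intro exI conjI) (assumption,linarith)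
	qed
	thus ?thesis by simp
qed

lemma sqrt_modulus_tendsto: "((%k::real. sqrt (1-k\<^sup>2)) \<longlongrightarrow> 1) (at_right 0)" by (rule tendsto_eq_intros refl | simp)+

lemma elliptic_K_tendsto: "(elliptic_K \<longlongrightarrow> pi/2) (at_right 0)"
proof (rule tendsto_sandwich)
	show "\<forall>\<^sub>F k in at_right 0. pi/2 <= elliptic_K k"
		using small_modulus by eventually_elim (intro elliptic_K_pos,simp add: abs_square_less_1)
	show "\<forall>\<^sub>F k in at_right 0. elliptic_K k <= (pi/2)/sqrt (1-k\<^sup>2)" using small_modulus
		by eventually_elim (unfold elliptic_K_def,rule elliptic_F_le,auto simp: abs_square_less_1)
	show "((%k. (pi/2)/sqrt (1-k\<^sup>2)) \<longlongrightarrow> pi/2) (at_right 0)"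
		using tendsto_divide[OF tendsto_const[of "pi/2"] sqrt_modulus_tendsto] by simp
qed simp

lemma jacobi_am_tendsto: "((%k. jacobi_am u k) \<longlongrightarrow> u) (at_right 0)"
proof -
	have pos: "((%k. jacobi_am u k) \<longlongrightarrow> u) (at_right 0)" if "u >= 0" for u
	proof (rule tendsto_sandwich)
		have am0: "0 <= jacobi_am u k" if "0 < k" "k < 1" for k
			using jacobi_am_less_iff[of k u 0] that \<open>u >= 0\<close> by (auto simp: abs_square_less_1 not_less[symmetric])
		show "\<forall>\<^sub>F k in at_right 0. u * sqrt (1-k\<^sup>2) <= jacobi_am u k" using small_modulus
		proof eventually_elim
			case (elim k)
			hence k: "k^2 < 1" by (simp add: abs_square_less_1)
			show ?case using elliptic_F_le[OF k am0[of k]] elim k by (simp add: field_simps)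
		qed
		show "\<forall>\<^sub>F k in at_right 0. jacobi_am u k <= u" using small_modulus
		proof eventually_elim
			case (elim k)
			hence k: "k^2 < 1" by (simp add: abs_square_less_1)
			show ?case using elliptic_F_expands[OF k am0[of k]] elim k by simp
		qed
		show "((%k. u * sqrt (1-k\<^sup>2)) \<longlongrightarrow> u) (at_right 0)" using tendsto_mult[OF tendsto_const[of u] sqrt_modulus_tendsto] by simp
	qed simp
	show ?thesis
	proof (cases "u >= 0")
		case False
		have "((%k. - jacobi_am (- u) k) \<longlongrightarrow>-(- u)) (at_right 0)" by (intro tendsto_minus pos) (use False in auto)
		moreover have "\<forall>\<^sub>F k in at_right 0. - jacobi_am (- u) k=jacobi_am u k"
			using small_modulus by eventually_elim (simp add: jacobi_am_minus abs_square_less_1)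
		ultimately show ?thesis by (simp add: filterlim_cong[OF refl refl])
	qed (rule pos)
qed

lemma flat_ring_rho_tendsto:
	assumes \<tau>: "\<tau> > 0"
	shows "((%k. flat_ring_rho k \<tau> \<psi>) \<longlongrightarrow> (cosh \<tau>-cos \<psi>)/sinh \<tau>) (at_right 0)"
proof -
	have sn: "((%k. jacobi_sn \<psi> k) \<longlongrightarrow> sin \<psi>) (at_right 0)" and cn: "((%k. jacobi_cn \<psi> k) \<longlongrightarrow> cos \<psi>) (at_right 0)"
		unfolding jacobi_sn_def jacobi_cn_def by (intro tendsto_intros jacobi_am_tendsto)+
	have dn: "((%k. jacobi_dn \<psi> k) \<longlongrightarrow> sqrt (1-0\<^sup>2*(sin \<psi>)^2)) (at_right 0)"
		unfolding jacobi_dn_def by (intro tendsto_intros sn)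
	obtain C where C: "C > 0" "\<forall>\<^sub>F k in at_right 0. \<forall>\<tau>'. 0 < \<tau>' & \<tau>' <= \<tau> \<longrightarrow> \<tau>' < elliptic_K' k &
		(\<exists>G>0. \<tau>'=gd_inverse k G & \<tau>' <= G & G <= \<tau>+1 & G-\<tau>' <= C * k^2*\<tau>'^3)" using gd_inverse_close[OF \<tau>] by auto
	define G where "G k=(SOME G. G > 0 & \<tau>=gd_inverse k G & \<tau> <= G & G-\<tau> <= C * k^2*\<tau>^3)" for k
	have G: "\<forall>\<^sub>F k in at_right 0. G k > 0 & \<tau>=gd_inverse k (G k) & \<tau> <= G k & G k-\<tau> <= C * k^2*\<tau>^3" using C(2)
	proof eventually_elim
		case (elim k)
		hence "\<exists>G. G > 0 & \<tau>=gd_inverse k G & \<tau> <= G & G-\<tau> <= C * k^2*\<tau>^3" using \<tau> by blast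
		from someI_ex[OF this] show ?case unfolding G_def .
	qed
	have Glim: "(G \<longlongrightarrow> \<tau>) (at_right 0)"
	proof (rule tendsto_sandwich)
		show "\<forall>\<^sub>F k in at_right 0. \<tau> <= G k" using G by eventually_elim auto
		show "\<forall>\<^sub>F k in at_right 0. G k <= \<tau> + C * k^2*\<tau>^3" using G by eventually_elim auto
		have "((%k. \<tau> + C * k^2*\<tau>^3) \<longlongrightarrow> \<tau> + C*0^2*\<tau>^3) (at_right 0)" by (intro tendsto_intros)
		thus "((%k. \<tau> + C * k^2*\<tau>^3) \<longlongrightarrow> \<tau>) (at_right 0)" by simp
	qed simp
	have cm: "(compl_modulus \<longlongrightarrow> 1) (at_right 0)" unfolding compl_modulus_def[abs_def] by (rule sqrt_modulus_tendsto)
	have "((%k. (jacobi_dn \<psi> k-jacobi_cn \<psi> k * sqrt (1-(compl_modulus k)\<^sup>2*(tanh (G k))^2))/(compl_modulus k * tanh (G k)))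
		 \<longlongrightarrow> (sqrt (1-0\<^sup>2*(sin \<psi>)^2)-cos \<psi> * sqrt (1-1\<^sup>2*(tanh \<tau>)^2))/(1 * tanh \<tau>)) (at_right 0)"
		using \<tau> by (intro tendsto_intros dn cn Glim cm) auto
	moreover have "(sqrt (1-0\<^sup>2*(sin \<psi>)^2)-cos \<psi> * sqrt (1-1\<^sup>2*(tanh \<tau>)^2))/(1 * tanh \<tau>)=(cosh \<tau>-cos \<psi>)/sinh \<tau>"
	proof -
		have "1-(tanh \<tau>)\<^sup>2=(1/cosh \<tau>)^2" unfolding tanh_def power_divide by (simp add: divide_simps) (simp add: cosh_square_eq)
		hence "sqrt (1-(tanh \<tau>)\<^sup>2)=1/cosh \<tau>" by (simp add: real_sqrt_divide)
		thus ?thesis using \<tau> by (simp add: tanh_def field_simps)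
	qed
	moreover have "\<forall>\<^sub>F k in at_right 0. (jacobi_dn \<psi> k-jacobi_cn \<psi> k * sqrt (1-(compl_modulus k)\<^sup>2*(tanh (G k))^2))/(compl_modulus k * tanh (G k))=flat_ring_rho k \<tau> \<psi>"
		using G small_modulus
	proof eventually_elim
		case (elim k)
		hence "jacobi_sn \<tau> (compl_modulus k)=tanh (G k)" using jacobi_gd_inverse(1)[of k "G k"] by auto
		thus ?case by (simp add: flat_ring_rho_def jacobi_dn_def)
	qed
	ultimately show ?thesis by (simp add: filterlim_cong[OF refl refl])
qed

section \<open>The function sn in the strip\<close>

lemma holomorphic_eq_on_connected_set:
	assumes "f holomorphic_on S" "g holomorphic_on S" "open S" "connected S"
		and "connected U" "U \<subseteq> S" "a \<in> U" "b \<in> U" "a ~= b" "!!z. z \<in> U ==> f z=g z" "w \<in> S"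
	shows "f w=g w"
proof -
	have "a islimpt U" using assms by (intro connected_imp_perfect) auto
	have "f w-g w=0" by (rule analytic_continuation[of "%z. f z-g z" S U a])
			 (use assms \<open>a islimpt U\<close> in \<open>auto intro!: holomorphic_intros\<close>)
	thus ?thesis by simp
qed

lemma strip_alt: "strip k = {s. - elliptic_K' k < Im s} \<inter> {s. Im s < elliptic_K' k}" by (auto simp: strip_def)

lemma open_strip: "open (strip k)" unfolding strip_alt by (intro open_Int open_halfspace_Im_gt open_halfspace_Im_lt)

lemma convex_strip: "convex (strip k)" unfolding strip_alt by (intro convex_Int convex_halfspace_Im_gt convex_halfspace_Im_lt)

lemma has_field_derivative_from_CR:
	fixes U V :: "complex => real"
	assumes "(U has_derivative (%h. a * Re h + b * Im h)) (at z)"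
		and "(V has_derivative (%h. - b * Re h + a * Im h)) (at z)"
	shows "((%z. Complex (U z) (V z)) has_field_derivative Complex a (- b)) (at z)"
proof -
	have eq: "(%z. Complex (U z) (V z))=(%z. of_real (U z)+\<i> * of_real (V z))" by (simp add: Complex_eq)
	have "((%z. of_real (U z)+\<i> * of_real (V z)) has_derivative
			(%h. of_real (a * Re h + b * Im h)+\<i> * of_real (- b * Re h + a * Im h))) (at z)"
		by (intro has_derivative_add has_derivative_mult_right has_derivative_of_real assms)
	moreover have "(%h. of_real (a * Re h + b * Im h)+\<i> * of_real (- b * Re h + a * Im h))=(*) (Complex a (- b))"
		by (auto simp: fun_eq_iff complex_eq_iff algebra_simps)
	ultimately show ?thesis unfolding eq has_field_derivative_def by simp
qed

text \<open>The formula is the addition theorem for \<open>sn(x + iy)\<close> with the imaginary argument removed by Jacobi's transformation.\<close>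

definition sn_cont :: "real => complex => complex" where
	"sn_cont k z=(let s=jacobi_sn (Re z) k; c=jacobi_cn (Re z) k; d=jacobi_dn (Re z) k;
		 s1=jacobi_sn (Im z) (compl_modulus k); c1=jacobi_cn (Im z) (compl_modulus k);
		 d1=jacobi_dn (Im z) (compl_modulus k); D = c1^2 + k^2 * s^2 * s1^2
	 in Complex (s * d1/D) (c * d * s1 * c1/D))"

context
	fixes k :: real
	assumes k: "0 < k" "k < 1"
begin

private lemma k2: "k^2 < 1" using k by (simp add: abs_square_less_1)

private lemma K2: "(compl_modulus k)^2 < 1" by (rule compl_modulus_square_less[OF k])

lemma elliptic_K'_pos: "0 < elliptic_K' k" using elliptic_K_pos[OF K2] pi_gt_zero unfolding elliptic_K'_def by linarith

private definition sn_cont_deriv :: "complex => complex" where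
	"sn_cont_deriv z=(let s=jacobi_sn (Re z) k; c=jacobi_cn (Re z) k; d=jacobi_dn (Re z) k;
		 s1=jacobi_sn (Im z) (compl_modulus k); c1=jacobi_cn (Im z) (compl_modulus k);
		 d1=jacobi_dn (Im z) (compl_modulus k); D = c1^2 + k^2 * s^2 * s1^2
	 in Complex (c * d * d1*(c1^2-k\<^sup>2 * s^2 * s1^2)/D^2)
			(- (s * s1 * c1*(2 * d^2 * d1^2-(1-k\<^sup>2) * D)/D^2)))"

lemma sn_cont_has_deriv:
	assumes z: "z \<in> strip k"
	shows "(sn_cont k has_field_derivative sn_cont_deriv z) (at z)"
proof -
	let ?K = "compl_modulus k"
	define s c d where "s=jacobi_sn (Re z) k" and "c=jacobi_cn (Re z) k" and "d=jacobi_dn (Re z) k"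
	define s1 c1 d1 where "s1=jacobi_sn (Im z) ?K" and "c1=jacobi_cn (Im z) ?K" and "d1=jacobi_dn (Im z) ?K"
	define D where "D = c1^2 + k^2 * s^2 * s1^2"
	have rel: "c^2=1-s\<^sup>2" "d^2=1-k\<^sup>2 * s^2" "c1^2=1-s1\<^sup>2" "d1^2=1-(1-k\<^sup>2) * s1^2"
		using jacobi_sn_cn[of "Re z" k] jacobi_sn_cn[of "Im z" ?K] jacobi_dn_square[OF k2,of "Re z"]
			jacobi_dn_square[OF K2,of "Im z"] compl_modulus_square[OF k] by (auto simp: s_def c_def d_def s1_def c1_def d1_def)
	have "c1 > 0" unfolding c1_def using z by (intro jacobi_cn_pos K2) (auto simp: strip_def elliptic_K'_def)
	hence Dpos: "D > 0" by (simp add: D_def add_pos_nonneg)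
	have re: "((%w. f (Re w)) has_derivative (%h. f' * Re h)) (at z)"
		if "(f has_real_derivative f') (at (Re z))" for f f'
		using has_derivative_compose[OF has_derivative_Re[OF has_derivative_ident] that[unfolded has_field_derivative_def]] by (simp add: mult.commute)
	have im: "((%w. f (Im w)) has_derivative (%h. f' * Im h)) (at z)"
		if "(f has_real_derivative f') (at (Im z))" for f f'
		using has_derivative_compose[OF has_derivative_Im[OF has_derivative_ident] that[unfolded has_field_derivative_def]] by (simp add: mult.commute)
	note ds=re[OF jacobi_sn_deriv[OF k2]] re[OF jacobi_cn_deriv[OF k2]] re[OF jacobi_dn_deriv[OF k2]]
		im[OF jacobi_sn_deriv[OF K2]] im[OF jacobi_cn_deriv[OF K2]] im[OF jacobi_dn_deriv[OF K2]]
	note ds=ds[unfolded s_def[symmetric] c_def[symmetric] d_def[symmetric] s1_def[symmetric] c1_def[symmetric] d1_def[symmetric]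
			compl_modulus_square[OF k]]
	let ?D = "%w. (jacobi_cn (Im w) ?K)\<^sup>2 + k^2*(jacobi_sn (Re w) k)^2*(jacobi_sn (Im w) ?K)^2"
	have dD: "(?D has_derivative (%h. 2 * k^2 * s * c * d * s1^2 * Re h +
			(- 2 * s1 * c1 * d1+2 * k^2 * s^2 * s1 * c1 * d1) * Im h)) (at z)" by (rule derivative_eq_intros ds refl)+
			 (auto simp: fun_eq_iff s_def c_def d_def s1_def c1_def d1_def algebra_simps power2_eq_square)
	have dN: "((%w. jacobi_sn (Re w) k * jacobi_dn (Im w) ?K) has_derivative
			(%h. c * d * d1 * Re h+(- (1-k\<^sup>2) * s * s1 * c1) * Im h)) (at z)" by (rule derivative_eq_intros ds refl)+
			 (auto simp: fun_eq_iff s_def c_def d_def s1_def c1_def d1_def algebra_simps power2_eq_square)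
	have dM: "((%w. jacobi_cn (Re w) k * jacobi_dn (Re w) k * jacobi_sn (Im w) ?K * jacobi_cn (Im w) ?K) has_derivative
			(%h. (- s * d^2-k\<^sup>2 * s * c^2) * s1 * c1 * Re h + c * d * d1*(c1^2-s1\<^sup>2) * Im h)) (at z)" by (rule derivative_eq_intros ds refl)+
			 (auto simp: fun_eq_iff s_def c_def d_def s1_def c1_def d1_def algebra_simps power2_eq_square)
	have Dz: "?D z=D" by (simp add: D_def c1_def s_def s1_def)
	let ?a = "c * d * d1*(c1^2-k\<^sup>2 * s^2 * s1^2)/D^2"
	let ?b = "s * s1 * c1*(2 * d^2 * d1^2-(1-k\<^sup>2) * D)/D^2"
	have quot: "((%w. N w / ?D w) has_derivative (%h. p * Re h + q * Im h)) (at z)"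
		if "(N has_derivative (%h. p' * Re h + q' * Im h)) (at z)"
			"p * D^2=p' * D-N z*(2 * k^2 * s * c * d * s1^2)"
			"q * D^2=q' * D-N z*(- 2 * s1 * c1 * d1+2 * k^2 * s^2 * s1 * c1 * d1)" for N p q p' q'
	proof -
		have "?D z ~= 0" using Dz Dpos by simp
		from has_derivative_divide'[OF that(1) dD this]
		show ?thesis
		proof (rule has_derivative_eq_rhs)
			show "(%h. ((p' * Re h + q' * Im h) * ?D z-N z*(2 * k^2 * s * c * d * s1^2 * Re h +
				(- 2 * s1 * c1 * d1+2 * k^2 * s^2 * s1 * c1 * d1) * Im h))/(?D z * ?D z))=(%h. p * Re h + q * Im h)"
			proof
				fix h
				have "(p' * Re h + q' * Im h) * D-N z*(2 * k^2 * s * c * d * s1^2 * Re h +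
					(- 2 * s1 * c1 * d1+2 * k^2 * s^2 * s1 * c1 * d1) * Im h)
					= (p' * D-N z*(2 * k^2 * s * c * d * s1^2)) * Re h
						+ (q' * D-N z*(- 2 * s1 * c1 * d1+2 * k^2 * s^2 * s1 * c1 * d1)) * Im h" by (simp add: algebra_simps)
				also have "... = (p * Re h + q * Im h)*(D * D)" unfolding that(2,3)[symmetric] by (simp add: algebra_simps power2_eq_square)
				finally show "((p' * Re h + q' * Im h) * ?D z-N z*(2 * k^2 * s * c * d * s1^2 * Re h +
					(- 2 * s1 * c1 * d1+2 * k^2 * s^2 * s1 * c1 * d1) * Im h))/(?D z * ?D z)=p * Re h + q * Im h" unfolding Dz using Dpos by simp
			qed
		qed
	qed
	have k2c: "k^2 * c^2=k^2-1 + d^2" unfolding rel(1) rel(2) by (simp add: algebra_simps)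
	have Dd: "D=1-d\<^sup>2 * s1^2" unfolding D_def rel(2) rel(3) by (simp add: algebra_simps)
	have U: "((%w. jacobi_sn (Re w) k * jacobi_dn (Im w) ?K / ?D w) has_derivative (%h. ?a * Re h + ?b * Im h)) (at z)"
	proof (rule quot[OF dN])
		show "?a * D^2 = c * d * d1 * D-jacobi_sn (Re z) k * jacobi_dn (Im z) ?K*(2 * k^2 * s * c * d * s1^2)"
		proof -
			have "c * d * d1*(c1^2-k\<^sup>2 * s^2 * s1^2) = c * d * d1 * D-s * d1*(2 * k^2 * s * c * d * s1^2)"
				by (simp add: D_def algebra_simps power2_eq_square)
			thus ?thesis using Dpos unfolding s_def[symmetric] d1_def[symmetric] by simp
		qed
		have "s * s1 * c1*(2 * d^2 * d1^2-(1-k\<^sup>2) * D)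
			 = - (1-k\<^sup>2) * s * s1 * c1 * D-s * d1*(- 2 * s1 * c1 * d1+2 * k^2 * s^2 * s1 * c1 * d1)"
			unfolding rel(2) by (simp add: algebra_simps power2_eq_square)
		thus "?b * D^2 = - (1-k\<^sup>2) * s * s1 * c1 * D-jacobi_sn (Re z) k * jacobi_dn (Im z) ?K*(- 2 * s1 * c1 * d1+2 * k^2 * s^2 * s1 * c1 * d1)"
			using Dpos unfolding s_def[symmetric] d1_def[symmetric] by simp
	qed
	have V: "((%w. jacobi_cn (Re w) k * jacobi_dn (Re w) k * jacobi_sn (Im w) ?K * jacobi_cn (Im w) ?K / ?D w)
		 has_derivative (%h. - ?b * Re h + ?a * Im h)) (at z)"
	proof (rule quot[OF dM])
		have "- (2 * d^2 * d1^2-(1-k\<^sup>2) * D)=(- d\<^sup>2-k\<^sup>2 * c^2) * D-2*(k^2 * c^2) * d^2 * s1^2"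
			unfolding k2c Dd rel(4) by (simp add: algebra_simps)
		hence "- (s * s1 * c1*(2 * d^2 * d1^2-(1-k\<^sup>2) * D))
			= s * s1 * c1*((- d\<^sup>2-k\<^sup>2 * c^2) * D-2*(k^2 * c^2) * d^2 * s1^2)" by (simp only: mult_minus_right[symmetric])
		also have "... = (- s * d^2-k\<^sup>2 * s * c^2) * s1 * c1 * D-c * d * s1 * c1*(2 * k^2 * s * c * d * s1^2)"
			by (simp add: algebra_simps power2_eq_square)
		finally show "- ?b * D^2=(- s * d^2-k\<^sup>2 * s * c^2) * s1 * c1 * D -
			 jacobi_cn (Re z) k * jacobi_dn (Re z) k * jacobi_sn (Im z) ?K * jacobi_cn (Im z) ?K*(2 * k^2 * s * c * d * s1^2)"
			using Dpos unfolding c_def[symmetric] d_def[symmetric] s1_def[symmetric] c1_def[symmetric] by simp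
		have "c1^2-k\<^sup>2 * s^2 * s1^2=(c1^2-s1\<^sup>2) * D+2 * s1^2 * c1^2*(1-k\<^sup>2 * s^2)" unfolding D_def rel(3) by (simp add: algebra_simps)
		hence "c * d * d1*(c1^2-k\<^sup>2 * s^2 * s1^2) = c * d * d1*((c1^2-s1\<^sup>2) * D+2 * s1^2 * c1^2*(1-k\<^sup>2 * s^2))" by (rule arg_cong)
		also have "... = c * d * d1*(c1^2-s1\<^sup>2) * D-c * d * s1 * c1*(- 2 * s1 * c1 * d1+2 * k^2 * s^2 * s1 * c1 * d1)"
			by (simp add: algebra_simps power2_eq_square)
		finally show "?a * D^2 = c * d * d1*(c1^2-s1\<^sup>2) * D -
			 jacobi_cn (Re z) k * jacobi_dn (Re z) k * jacobi_sn (Im z) ?K * jacobi_cn (Im z) ?K*(- 2 * s1 * c1 * d1+2 * k^2 * s^2 * s1 * c1 * d1)"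
			using Dpos unfolding c_def[symmetric] d_def[symmetric] s1_def[symmetric] c1_def[symmetric] by simp
	qed
	have "((%w. Complex (jacobi_sn (Re w) k * jacobi_dn (Im w) ?K / ?D w)
		 (jacobi_cn (Re w) k * jacobi_dn (Re w) k * jacobi_sn (Im w) ?K * jacobi_cn (Im w) ?K / ?D w))
		 has_field_derivative Complex ?a (- ?b)) (at z)" by (rule has_field_derivative_from_CR[OF U V])
	thus ?thesis by (simp add: sn_cont_def[abs_def] sn_cont_deriv_def Let_def s_def c_def d_def s1_def c1_def d1_def D_def)
qed

lemma sn_cont_holomorphic: "sn_cont k holomorphic_on strip k" using sn_cont_has_deriv open_strip by (meson holomorphic_on_open)

lemma sn_cont_of_real: "sn_cont k (of_real x) = of_real (jacobi_sn x k)"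
	using K2 by (simp add: sn_cont_def Let_def jacobi_sn_def[of 0] jacobi_cn_def[of 0] jacobi_dn_def[of 0] complex_eq_iff)

lemma sn_cont_imaginary:
	"sn_cont k (\<i> * of_real t)=\<i> * of_real (jacobi_sn t (compl_modulus k)/jacobi_cn t (compl_modulus k))"
	using k2 by (simp add: sn_cont_def Let_def jacobi_sn_def[of 0] jacobi_cn_def[of 0] jacobi_dn_def[of 0]
			complex_eq_iff power2_eq_square)

lemma sn_cont_minus: "sn_cont k (- z) = - sn_cont k z"
	using k2 K2 by (simp add: sn_cont_def Let_def jacobi_sn_def jacobi_cn_def jacobi_dn_def jacobi_am_minus complex_eq_iff)

lemma sn_cont_0: "sn_cont k 0=0" using sn_cont_of_real[of 0] k2 by (simp add: jacobi_sn_def)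

lemma zero_in_strip: "0 \<in> strip k" using elliptic_K'_pos by (simp add: strip_def)

lemma sn_cont_deriv_0: "deriv (sn_cont k) 0=1"
proof -
	have "sn_cont_deriv 0=1" using k2 K2 by (simp add: sn_cont_deriv_def Let_def jacobi_sn_def jacobi_cn_def jacobi_dn_def complex_eq_iff)
	thus ?thesis using sn_cont_has_deriv[OF zero_in_strip] by (simp add: DERIV_imp_deriv)
qed

lemma jacobi_sn_strip_eq:
	assumes z: "z \<in> strip k" shows "jacobi_sn_strip z k=sn_cont k z"
proof -
	let ?P = "%f. f holomorphic_on strip k & (\<forall>x::real. f (of_real x) = of_real (jacobi_sn x k))"
	have "?P (sn_cont k)" using sn_cont_holomorphic sn_cont_of_real by blast
	hence P: "?P (SOME f. ?P f)" by (rule someI[of ?P])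
	have "(SOME f. ?P f) z=sn_cont k z"
	proof (rule holomorphic_eq_on_connected_set[where U = "range of_real" and a=0 and b=1 and S = "strip k"
				and f = "SOME f. ?P f" and g = "sn_cont k"])
		show "connected (range complex_of_real)" by (intro connected_continuous_image continuous_intros) simp
		show "range complex_of_real \<subseteq> strip k" using elliptic_K'_pos by (auto simp: strip_def)
		show "0 \<in> range complex_of_real" "1 \<in> range complex_of_real" using of_real_0 of_real_1 by (metis rangeI)+
	qed (use P z sn_cont_holomorphic sn_cont_of_real open_strip convex_strip convex_connected in auto)
	thus ?thesis unfolding jacobi_sn_strip_def .
qed

lemma gd_inverse_add_conjugate:
	assumes G: "G > 0"
	shows "gd_inverse k G + gd_inverse k (arsinh (1/(k * sinh G)))=elliptic_K' k"
proof -
	define \<phi> where "\<phi>=(%G. gd_inverse k G + gd_inverse k (arsinh (1/(k * sinh G))))"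
	have d: "(\<phi> has_real_derivative 0) (at x within {0<..})" if x: "x \<in> {0<..}" for x
	proof -
		have sx: "sinh x > 0" using x by simp
		define R where "R=sqrt (1 + k^2*(sinh x)^2)"
		have R: "R > 0" "R^2=1 + k^2*(sinh x)^2" by (simp_all add: R_def add_pos_nonneg)
		have s1: "sqrt ((1/(k * sinh x))^2+1)=R/(k * sinh x)" using k sx R by (intro real_sqrt_unique) (auto simp: field_simps power2_eq_square)
		have s2: "sqrt (1 + k^2*(sinh (arsinh (1/(k * sinh x))))^2) = cosh x/sinh x"
			using k sx by (intro real_sqrt_unique) (auto simp: power_divide power_mult_distrib divide_simps cosh_square_eq)
		have "((%G. 1/(k * sinh G)) has_real_derivative-(cosh x/(k*(sinh x)^2))) (at x)"
			using k sx by (auto intro!: derivative_eq_intros simp: field_simps power2_eq_square)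
		from DERIV_chain2[OF arsinh_real_has_field_derivative this]
		have "((%G. arsinh (1/(k * sinh G))) has_real_derivative-(cosh x/(sinh x * R))) (at x)"
			unfolding s1 by (rule DERIV_cong) (use k sx R in \<open>simp add: field_simps power2_eq_square\<close>)
		from DERIV_chain2[OF gd_inverse_deriv[OF k] this]
		have "((%G. gd_inverse k (arsinh (1/(k * sinh G)))) has_real_derivative-(1/R)) (at x)"
			unfolding s2 by (rule DERIV_cong) (use sx R in \<open>simp add: field_simps\<close>)
		from DERIV_add[OF gd_inverse_deriv[OF k] this]
		show ?thesis unfolding \<phi>_def R_def by (auto intro: has_field_derivative_at_within)
	qed
	have "\<exists>c. \<forall>x\<in>{0<..}. \<phi> x = c" using has_field_derivative_zero_constant[of "{0<..}" \<phi>] d by auto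
	then obtain c where c: "!!x. x > 0 ==> \<phi> x = c" by auto
	have Fc: "isCont (elliptic_F (compl_modulus k)) x" for x using elliptic_F_deriv[OF K2] DERIV_isCont by blast
	have "((%G. gd_inverse k G) \<longlongrightarrow> elliptic_F (compl_modulus k) (pi/2)) at_top" unfolding gd_inverse_def
		by (rule isCont_tendsto_compose[OF Fc] filterlim_compose[OF tendsto_arctan_at_top] sinh_real_at_top)+
	moreover have "((%G. gd_inverse k (arsinh (1/(k * sinh G)))) \<longlongrightarrow> gd_inverse k (arsinh 0)) at_top"
	proof (rule isCont_tendsto_compose[where g = "gd_inverse k"])
		show "isCont (gd_inverse k) (arsinh 0)" using gd_inverse_deriv[OF k] DERIV_isCont by blast
		have "filterlim (%G. k * sinh G) at_top at_top"
			using k by (intro filterlim_tendsto_pos_mult_at_top[OF tendsto_const]) (auto intro: sinh_real_at_top)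
		hence "((%G. 1/(k * sinh G)) \<longlongrightarrow> 0) at_top" by (intro tendsto_divide_0[OF tendsto_const]) (rule filterlim_at_top_imp_at_infinity)
		thus "((%G. arsinh (1/(k * sinh G))) \<longlongrightarrow> arsinh 0) at_top" by (intro tendsto_intros)
	qed
	ultimately have "(\<phi> \<longlongrightarrow> elliptic_F (compl_modulus k) (pi/2) + gd_inverse k (arsinh 0)) at_top"
		unfolding \<phi>_def by (rule tendsto_add)
	moreover have "gd_inverse k (arsinh 0)=0" using gd_inverse_0[OF k] by simp
	ultimately have "(\<phi> \<longlongrightarrow> elliptic_K' k) at_top" by (simp add: elliptic_K'_def elliptic_K_def)
	moreover have "\<forall>\<^sub>F x in at_top. \<phi> x = c" using eventually_gt_at_top[of 0] by eventually_elim (rule c)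
	hence "(\<phi> \<longlongrightarrow> c) at_top" by (rule tendsto_eventually)
	ultimately have "c=elliptic_K' k" using tendsto_unique trivial_limit_at_top_linorder by blast
	thus ?thesis using c[OF G] by (simp add: \<phi>_def)
qed

lemma sn_cont_imaginary_shift:
	assumes \<tau>: "0 < \<tau>" "\<tau> < elliptic_K' k"
	shows "of_real k * sn_cont k (\<i> * of_real (elliptic_K' k-\<tau>)) * sn_cont k (- \<i> * of_real \<tau>)=1"
		"(of_real k * sn_cont k (\<i> * of_real (elliptic_K' k-\<tau>)))^2 = - of_real (jacobi_cs_square k \<tau>)"
proof -
	obtain G where G: "G > 0" "\<tau>=gd_inverse k G" using gd_inverse_surj[OF k \<tau>] .
	define H where "H=arsinh (1/(k * sinh G))"
	have H: "elliptic_K' k-\<tau>=gd_inverse k H" using gd_inverse_add_conjugate[OF G(1)] G(2) by (simp add: H_def)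
	have sc: "sn_cont k (\<i> * of_real (gd_inverse k x))=\<i> * of_real (sinh x)" for x
		unfolding sn_cont_imaginary jacobi_gd_inverse[OF k] by (simp add: tanh_def)
	have m: "sn_cont k (- \<i> * of_real \<tau>) = - (\<i> * of_real (sinh G))" using sn_cont_minus[of "\<i> * of_real \<tau>"] sc[of G] G(2) by simp
	have sG: "sinh G > 0" using G by simp
	show "of_real k * sn_cont k (\<i> * of_real (elliptic_K' k-\<tau>)) * sn_cont k (- \<i> * of_real \<tau>)=1"
		unfolding m H sc using k sG by (simp add: H_def field_simps)
	have "of_real k * sn_cont k (\<i> * of_real (elliptic_K' k-\<tau>))=\<i> * of_real (1/sinh G)" unfolding H sc using k sG by (simp add: H_def)
	thus "(of_real k * sn_cont k (\<i> * of_real (elliptic_K' k-\<tau>)))^2 = - of_real (jacobi_cs_square k \<tau>)"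
		using jacobi_cs_square_gd[OF k G(1)] G(2) by (simp add: power_mult_distrib power_divide)
qed

lemma sn_cont_imaginary_shift_square:
	assumes \<tau>: "0 < \<tau>" "\<tau> <= elliptic_K' k"
	shows "(of_real k * sn_cont k (\<i> * of_real (elliptic_K' k-\<tau>)))^2 = - of_real (jacobi_cs_square k \<tau>)"
proof (cases "\<tau>=elliptic_K' k")
	case True
	thus ?thesis by (simp add: sn_cont_0 jacobi_cs_square_K k)
qed (use sn_cont_imaginary_shift(2) \<tau> in auto)

text \<open>The shift by \<open>iK'\<close> exchanges the pole of sn with its zero. The identity is known on the imaginary axis and extends by the identity theorem.\<close>

lemma sn_cont_shift:
	assumes u: "- elliptic_K' k < Im u" "Im u < 0"
	shows "of_real k * sn_cont k (\<i> * of_real (elliptic_K' k) + u) * sn_cont k u=1"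
proof -
	let ?K = "elliptic_K' k"
	define S where "S = {u. - ?K < Im u} \<inter> {u. Im u < 0}"
	have S: "open S" "connected S" unfolding S_def by (intro open_Int open_halfspace_Im_gt open_halfspace_Im_lt)
			 (intro convex_connected convex_Int convex_halfspace_Im_gt convex_halfspace_Im_lt)
	show ?thesis
	proof (rule holomorphic_eq_on_connected_set[where S=S and U = "(%\<tau>. - \<i> * of_real \<tau>) ` {0<..<?K}"
				and a = "- \<i> * of_real (?K/2)" and b = "- \<i> * of_real (?K/3)"
				and f = "%u. of_real k * sn_cont k (\<i> * of_real ?K + u) * sn_cont k u" and g = "%_. 1"])
		show "(%u. of_real k * sn_cont k (\<i> * of_real ?K + u) * sn_cont k u) holomorphic_on S"
		proof (intro holomorphic_intros)
			have "(sn_cont k \<circ> (%u. \<i> * of_real ?K + u)) holomorphic_on S" by (rule holomorphic_on_compose_gen[OF _ sn_cont_holomorphic])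
					 (auto intro!: holomorphic_intros simp: S_def strip_def)
			thus "(%u. sn_cont k (\<i> * of_real ?K + u)) holomorphic_on S" by (simp add: o_def)
			show "sn_cont k holomorphic_on S" by (rule holomorphic_on_subset[OF sn_cont_holomorphic]) (auto simp: S_def strip_def)
		qed
		show "connected ((%\<tau>. - \<i> * of_real \<tau>) ` {0<..<?K})" by (intro connected_continuous_image continuous_intros) auto
		show "- \<i> * of_real (?K/2) \<in> (%\<tau>. - \<i> * of_real \<tau>) ` {0<..<?K}"
			"- \<i> * of_real (?K/3) \<in> (%\<tau>. - \<i> * of_real \<tau>) ` {0<..<?K}" using elliptic_K'_pos by (intro imageI; simp)+
		fix z assume "z \<in> (%\<tau>. - \<i> * of_real \<tau>) ` {0<..<?K}"
		then obtain \<tau> where \<tau>: "0 < \<tau>" "\<tau> < ?K" "z = - \<i> * of_real \<tau>" by auto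
		have "\<i> * of_real ?K + z=\<i> * of_real (?K-\<tau>)" by (simp add: \<tau>(3) algebra_simps)
		thus "of_real k * sn_cont k (\<i> * of_real ?K + z) * sn_cont k z=1" using sn_cont_imaginary_shift(1)[OF \<tau>(1,2)] \<tau>(3) by simp
	qed (use S u elliptic_K'_pos in \<open>auto simp: S_def intro!: imageI\<close>)
qed

end

section \<open>Oscillation of solutions on a quarter period\<close>

text \<open>Otherwise the Wronskian of \<open>E\<close> and \<open>F\<close> would be strictly monotone, which its signs at the end points exclude.\<close>

lemma sturm_gap:
	fixes E F :: "real => real"
	assumes E: "schroedinger_on {a..c} V E E'" and F: "schroedinger_on {a..c} U F F'"
		and ac: "a < c" and less: "!!s. s \<in> {a..c} ==> U s < V s"
		and nz: "!!s. s \<in> {a<..<c} ==> E s ~= 0"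
		and bda: "E a=0 \<or> E' a=0 & F' a=0" and bdc: "E c=0 \<or> E' c=0 & F' c=0"
	shows "\<exists>s\<in>{a<..<c}. F s=0"
proof (rule ccontr)
	assume "\<not> ?thesis"
	hence nzF: "F s ~= 0" if "s \<in> {a<..<c}" for s using that by blast
	have sgn_const: "\<exists>\<sigma>\<in>{-1,1::real}. \<forall>s\<in>{a<..<c}. \<sigma> * g s > 0"
		if g: "continuous_on {a..c} g" "!!s. s \<in> {a<..<c} ==> g s ~= 0" for g :: "real => real"
	proof -
		have "connected (g ` {a<..<c})" by (intro connected_continuous_image continuous_on_subset[OF g(1)]) auto
		moreover have "0 \<notin> g ` {a<..<c}" using g(2) by auto
		ultimately have no: "\<not> (x <= 0 & 0 <= y)" if "x \<in> g ` {a<..<c}" "y \<in> g ` {a<..<c}" for x y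
			using connectedD_interval[of "g ` {a<..<c}" x y 0] that by blast
		show ?thesis
		proof (cases "\<forall>s\<in>{a<..<c}. g s > 0")
			case True
			thus ?thesis by (intro bexI[of _ 1]) auto
		next
			case False
			then obtain s where s: "s \<in> {a<..<c}" "g s <= 0" by (auto simp: not_less)
			have "g t < 0" if "t \<in> {a<..<c}" for t using no[of "g s" "g t"] s that by (auto simp: not_le)
			thus ?thesis by (intro bexI[of _ "-1"]) auto
		qed
	qed
	obtain \<sigma> where \<sigma>: "\<sigma> \<in> {-1,1::real}" "!!s. s \<in> {a<..<c} ==> \<sigma> * E s > 0"
		using sgn_const[OF schroedinger_on_continuous(1)[OF E] nz] by blast
	obtain \<rho> where \<rho>: "\<rho> \<in> {-1,1::real}" "!!s. s \<in> {a<..<c} ==> \<rho> * F s > 0"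
		using sgn_const[OF schroedinger_on_continuous(1)[OF F] nzF] by blast
	define e e' f f' where "e=(%s. \<sigma> * E s)" and "e'=(%s. \<sigma> * E' s)" and "f=(%s. \<rho> * F s)" and "f'=(%s. \<rho> * F' s)"
	have e: "schroedinger_on {a..c} V e e'" unfolding e_def e'_def by (rule schroedinger_on_linear[OF E bounded_linear_mult_right])
	have f: "schroedinger_on {a..c} U f f'" unfolding f_def f'_def by (rule schroedinger_on_linear[OF F bounded_linear_mult_right])
	have de: "(e has_real_derivative e' s) (at s within {a..c})" "(e' has_real_derivative V s * e s) (at s within {a..c})"
		and df: "(f has_real_derivative f' s) (at s within {a..c})" "(f' has_real_derivative U s * f s) (at s within {a..c})"
		if "s \<in> {a..c}" for s
		using schroedinger_onD[OF e that] schroedinger_onD[OF f that] by (simp_all add: has_real_derivative_iff_has_vector_derivative)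
	have epos: "e s > 0" and fpos: "f s > 0" if "s \<in> {a<..<c}" for s using \<sigma>(2) \<rho>(2) that by (auto simp: e_def f_def)
	have f_nonneg: "f s >= 0" if s: "s \<in> {a..c}" for s
	proof (rule continuous_ge_on_closure[where f=f and S = "{a<..<c}"])
		show "continuous_on (closure {a<..<c}) f" using schroedinger_on_continuous(1)[OF f] ac by simp
		show "s \<in> closure {a<..<c}" using s ac by simp
	qed (use fpos less_imp_le in blast)
	define W where "W=(%s. e s * f' s-e' s * f s)"
	have dW: "(W has_real_derivative (U s-V s)*(e s * f s)) (at s within {a..c})" if "s \<in> {a..c}" for s
	proof -
		have "(W has_real_derivative (e s*(U s * f s) + e' s * f' s)-(e' s * f' s+(V s * e s) * f s)) (at s within {a..c})"
			unfolding W_def by (intro DERIV_diff DERIV_mult' de df that)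
		thus ?thesis by (rule DERIV_cong) (simp add: algebra_simps)
	qed
	have "W a > W c"
	proof (rule DERIV_neg_imp_decreasing_open[OF ac])
		fix s assume s: "a < s" "s < c"
		have "at s within {a..c} = at s" using s by (intro at_within_interior) auto
		moreover have "(U s-V s)*(e s * f s) < 0" using less[of s] epos[of s] fpos[of s] s by (intro mult_neg_pos) auto
		ultimately show "\<exists>y. (W has_real_derivative y) (at s) & y < 0" using dW[of s] s by auto
	next
		show "continuous_on {a..c} W" using dW by (meson DERIV_continuous continuous_on_eq_continuous_within)
	qed
	moreover have "W a <= 0"
	proof (cases "E a=0")
		case True
		have "e' a >= 0"
		proof (rule ccontr)
			assume "\<not> ?thesis"
			then obtain d where d: "d > 0" "!!h. 0 < h ==> a + h \<in> {a..c} ==> h < d ==> e (a + h) < e a"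
				using has_real_derivative_neg_dec_right[OF de(1)[of a]] ac by auto
			define h where "h=min d (c-a)/2"
			have "0 < h" "h < d" "a + h \<in> {a<..<c}" using d(1) ac by (auto simp: h_def min_def field_simps)
			thus False using d(2)[of h] epos[of "a + h"] True by (auto simp: e_def)
		qed
		thus ?thesis using True f_nonneg[of a] ac by (simp add: W_def e_def)
	next
		case False
		thus ?thesis using bda by (simp add: W_def e'_def f'_def)
	qed
	moreover have "W c >= 0"
	proof (cases "E c=0")
		case True
		have "e' c <= 0"
		proof (rule ccontr)
			assume "\<not> ?thesis"
			then obtain d where d: "d > 0" "!!h. 0 < h ==> c-h \<in> {a..c} ==> h < d ==> e (c-h) < e c"
				using has_real_derivative_pos_inc_left[OF de(1)[of c]] ac by auto
			define h where "h=min d (c-a)/2"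
			have "0 < h" "h < d" "c-h \<in> {a<..<c}" using d(1) ac by (auto simp: h_def min_def field_simps)
			thus False using d(2)[of h] epos[of "c-h"] True by (auto simp: e_def)
		qed
		thus ?thesis using True f_nonneg[of c] ac by (simp add: W_def e_def mult_nonpos_nonneg)
	next
		case False
		thus ?thesis using bdc by (simp add: W_def e'_def f'_def)
	qed
	ultimately show False by linarith
qed

lemma card_less_of_gaps:
	fixes Z Z' :: "real set"
	assumes "finite Z" "finite Z'" "Z \<subseteq> {a<..<b}" "a < b"
		and "!!x y. x \<in> insert a Z ==> y \<in> insert b Z ==> x < y ==> Z \<inter> {x<..<y} = {} ==> \<exists>z\<in>Z'. x < z & z < y"
	shows "card Z < card (Z' \<inter> {a<..<b})" using assms
proof (induction "card Z" arbitrary: Z b)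
	case 0
	hence "Z = {}" by simp
	with 0 obtain z where "z \<in> Z'" "a < z" "z < b" by blast
	hence "Z' \<inter> {a<..<b} ~= {}" by auto
	thus ?case using \<open>Z = {}\<close> \<open>finite Z'\<close> by (simp add: card_gt_0_iff)
next
	case (Suc n)
	hence ne: "Z ~= {}" by auto
	define m where "m=Max Z"
	have m: "m \<in> Z" "!!z. z \<in> Z ==> z <= m" using ne Suc.prems(1) by (auto simp: m_def)
	have mab: "a < m" "m < b" using m(1) Suc.prems(3) by auto
	have "card (Z - {m}) < card (Z' \<inter> {a<..<m})"
	proof (rule Suc.hyps(1))
		show "n = card (Z - {m})" using Suc.hyps(2) m(1) Suc.prems(1) by simp
		show "Z - {m} \<subseteq> {a<..<m}" using Suc.prems(3) m(2) by force
		fix x y assume xy: "x \<in> insert a (Z - {m})" "y \<in> insert m (Z - {m})" "x < y" "(Z - {m}) \<inter> {x<..<y} = {}"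
		show "\<exists>z\<in>Z'. x < z & z < y"
		proof (rule Suc.prems(5))
			have "y <= m" using xy(2) m(2) by auto
			hence "Z \<inter> {x<..<y} \<subseteq> (Z - {m}) \<inter> {x<..<y}" by auto
			thus "Z \<inter> {x<..<y} = {}" unfolding xy(4) by simp
		qed (use xy m in auto)
	qed (use Suc.prems mab in auto)
	moreover obtain z where z: "z \<in> Z'" "m < z" "z < b"
	proof -
		have "Z \<inter> {m<..<b} = {}" using m(2) by force
		hence "\<exists>z\<in>Z'. m < z & z < b" using m(1) mab(2) by (intro Suc.prems(5)) simp_all
		thus ?thesis using that by blast
	qed
	have "card (insert z (Z' \<inter> {a<..<m})) <= card (Z' \<inter> {a<..<b})" using z mab Suc.prems(2) by (intro card_mono) auto
	moreover have "card (insert z (Z' \<inter> {a<..<m}))=Suc (card (Z' \<inter> {a<..<m}))" using z Suc.prems(2) by (intro card_insert_disjoint) auto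
	ultimately show ?case using m(1) Suc.prems(1) by (simp add: card_Diff_singleton)
qed

lemma sturm_comparison:
	fixes E F :: "real => real"
	assumes E: "schroedinger_on {0..K} V E E'" and F: "schroedinger_on {0..K} U F F'"
		and K: "K > 0" and less: "!!s. s \<in> {0..K} ==> U s < V s"
		and bd0: "E 0=0 \<or> E' 0=0 & F' 0=0" and bdK: "E K=0 \<or> E' K=0 & F' K=0"
		and fin: "finite {s\<in>{0<..<K}. E s=0}" "finite {s\<in>{0<..<K}. F s=0}"
	shows "card {s\<in>{0<..<K}. E s=0} < card {s\<in>{0<..<K}. F s=0}"
proof -
	let ?Z = "{s\<in>{0<..<K}. E s=0}" and ?Z' = "{s\<in>{0<..<K}. F s=0}"
	have "card ?Z < card (?Z' \<inter> {0<..<K})"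
	proof (rule card_less_of_gaps[OF fin _ K])
		fix x y assume xy: "x \<in> insert 0 ?Z" "y \<in> insert K ?Z" "x < y" "?Z \<inter> {x<..<y} = {}"
		hence xy0: "0 <= x" "y <= K" using K by auto
		hence sub: "{x..y} \<subseteq> {0..K}" by auto
		have "\<exists>s\<in>{x<..<y}. F s=0"
		proof (rule sturm_gap[OF schroedinger_on_subset[OF E sub] schroedinger_on_subset[OF F sub] xy(3)])
			show "E s ~= 0" if "s \<in> {x<..<y}" for s
			proof
				assume "E s=0"
				hence "s \<in> ?Z \<inter> {x<..<y}" using that xy0 by simp
				thus False using xy(4) by blast
			qed
		qed (use sub less xy bd0 bdK in auto)
		then obtain s where "s \<in> {x<..<y}" "F s=0" by blast
		thus "\<exists>z\<in>?Z'. x < z & z < y" using xy0 by (intro bexI[of _ s]) auto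
	qed auto
	moreover have "?Z' \<inter> {0<..<K} = ?Z'" by auto
	ultimately show ?thesis by simp
qed

text \<open>The point \<open>(X,T)\<close> stays in the open half-plane around the direction \<open>(cos js, sin js)\<close>, which fixes a continuous polar angle within \<open>\<pi>/2\<close> of \<open>js\<close>; the hypothesis on the rotation makes the angle increase.\<close>

lemma pruefer_angle:
	fixes X T :: "real => real" and j :: nat and K :: real
	assumes K: "K > 0"
		and dX: "!!s. s \<in> {0..K} ==> (X has_real_derivative X' s) (at s within {0..K})"
		and dT: "!!s. s \<in> {0..K} ==> (T has_real_derivative T' s) (at s within {0..K})"
		and rot: "!!s::real. s \<in> {0..K} ==> X s * T' s-X' s * T s > 0"
		and close: "!!s::real. s \<in> {0..K} ==> X s * cos (j * s) + T s * sin (j * s) > 0"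
		and X0: "X 0=1" "T 0=0" and XK: "if even j then T K=0 else X K=0"
		and jK: "\<bar>j * K-j*(pi/2)\<bar> < pi/2"
	obtains \<theta> where "bij_betw \<theta> {0<..<K} {0<..<j*(pi/2)}"
		"!!s. s \<in> {0..K} ==> X s=0 \<longleftrightarrow> cos (\<theta> s)=0" "!!s. s \<in> {0..K} ==> T s=0 \<longleftrightarrow> sin (\<theta> s)=0"
proof -
	define P where "P=(%s::real. X s * cos (j * s) + T s * sin (j * s))"
	define Q where "Q=(%s::real. T s * cos (j * s)-X s * sin (j * s))"
	define \<theta> where "\<theta>=(%s::real. j * s + arctan (Q s/P s))"
	have P: "P s > 0" if "s \<in> {0..K}" for s using close that by (simp add: P_def)
	define P' where "P'=(%s::real. X' s * cos (j * s) + T' s * sin (j * s) + j * Q s)"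
	define Q' where "Q'=(%s::real. T' s * cos (j * s)-X' s * sin (j * s)-j * P s)"
	have dP: "(P has_real_derivative P' s) (at s within {0..K})" if "s \<in> {0..K}" for s unfolding P_def P'_def Q_def
		by (rule derivative_eq_intros dX[OF that] dT[OF that] refl | simp add: algebra_simps)+
	have dQ: "(Q has_real_derivative Q' s) (at s within {0..K})" if "s \<in> {0..K}" for s unfolding Q_def Q'_def P_def
		by (rule derivative_eq_intros dX[OF that] dT[OF that] refl | simp add: algebra_simps)+
	have PQ: "(P s)^2+(Q s)^2 > 0" if "s \<in> {0..K}" for s using P[OF that] by (simp add: add_pos_nonneg)
	have cs: "(cos x)^2+(sin x)^2=(1::real)" for x by simp
	have d\<theta>: "(\<theta> has_real_derivative (X s * T' s-X' s * T s)/((P s)^2+(Q s)^2)) (at s within {0..K})"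
		if s: "s \<in> {0..K}" for s
	proof -
		have d1: "((%s. Q s/P s) has_real_derivative (Q' s * P s-Q s * P' s)/(P s * P s)) (at s within {0..K})"
			using P[OF s] by (intro DERIV_divide dP dQ s) auto
		have d2: "((%s. real j * s) has_real_derivative real j) (at s within {0..K})" by (auto intro!: derivative_eq_intros)
		have "(\<theta> has_real_derivative real j + inverse (1+(Q s/P s)^2)*((Q' s * P s-Q s * P' s)/(P s * P s))) (at s within {0..K})"
			unfolding \<theta>_def by (intro DERIV_add d2 DERIV_chain2[OF DERIV_arctan d1])
		moreover have "inverse (1+(Q s/P s)^2)*((Q' s * P s-Q s * P' s)/(P s * P s))=(Q' s * P s-Q s * P' s)/((P s)^2+(Q s)^2)"
		proof -
			have "1+(Q s/P s)^2=((P s)^2+(Q s)^2)/(P s * P s)" using P[OF s] by (simp add: power_divide add_divide_distrib power2_eq_square)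
			hence "inverse (1+(Q s/P s)^2)=(P s * P s)/((P s)^2+(Q s)^2)" by (simp add: inverse_eq_divide)
			thus ?thesis using P[OF s] by simp
		qed
		moreover have "Q' s * P s-Q s * P' s=(X s * T' s-X' s * T s)*((cos (j * s))^2+(sin (j * s))^2)-j*((P s)^2+(Q s)^2)"
		proof -
			have "Q' s * P s-Q s * P' s=(T' s * cos (j * s)-X' s * sin (j * s)) * P s-Q s*(X' s * cos (j * s) + T' s * sin (j * s))-j*((P s)^2+(Q s)^2)"
				unfolding Q'_def P'_def by (simp add: algebra_simps power2_eq_square)
			also have "(T' s * cos (j * s)-X' s * sin (j * s)) * P s-Q s*(X' s * cos (j * s) + T' s * sin (j * s))
				 = (X s * T' s-X' s * T s)*((cos (j * s))^2+(sin (j * s))^2)"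
			proof -
				have "(t' * c-x' * d)*(x * c + t * d)-(t * c-x * d)*(x' * c + t' * d)=(x * t'-x' * t)*(c^2 + d^2)"
					for x t x' t' c d :: real by (simp add: algebra_simps power2_eq_square)
				thus ?thesis unfolding P_def Q_def .
			qed
			finally show ?thesis .
		qed
		moreover have "real j+(A*1-real j * N)/N=A/N" if "N > 0" for A N :: real using that by (simp add: diff_divide_distrib)
		ultimately show ?thesis by (simp only: cs PQ[OF s])
	qed
	have id2: "c*(x * c + t * d)-d*(t * c-x * d)=x*(c^2 + d^2)"
		"d*(x * c + t * d) + c*(t * c-x * d)=t*(c^2 + d^2)" for x t c d :: real by (simp_all add: algebra_simps power2_eq_square)
	define r where "r=(%s. sqrt ((P s)^2+(Q s)^2))"
	have r: "r s > 0" if "s \<in> {0..K}" for s using PQ[OF that] by (simp add: r_def)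
	have polar: "X s=r s * cos (\<theta> s)" "T s=r s * sin (\<theta> s)" if s: "s \<in> {0..K}" for s
	proof -
		have "sqrt (1+(Q s/P s)^2)=r s/P s" using P[OF s] unfolding r_def by (intro real_sqrt_unique) (auto simp: power_divide field_simps)
		hence ca: "cos (arctan (Q s/P s))=P s/r s" and sa: "sin (arctan (Q s/P s))=Q s/r s" using P[OF s] r[OF s] by (simp_all add: cos_arctan sin_arctan)
		have "r s * cos (\<theta> s) = cos (j * s) * P s-sin (j * s) * Q s" using r[OF s] by (simp add: \<theta>_def cos_add ca sa field_simps)
		also have "... = X s*((cos (j * s))^2+(sin (j * s))^2)" unfolding P_def Q_def by (rule id2)
		finally show "X s=r s * cos (\<theta> s)" by simp
		have "r s * sin (\<theta> s)=sin (j * s) * P s + cos (j * s) * Q s" using r[OF s] by (simp add: \<theta>_def sin_add ca sa field_simps)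
		also have "... = T s*((cos (j * s))^2+(sin (j * s))^2)" unfolding P_def Q_def by (rule id2)
		finally show "T s=r s * sin (\<theta> s)" by simp
	qed
	have cont: "continuous_on {0..K} \<theta>" using d\<theta> by (meson DERIV_continuous continuous_on_eq_continuous_within)
	have mono: "\<theta> s < \<theta> t" if "0 <= s" "s < t" "t <= K" for s t
	proof (rule DERIV_pos_imp_increasing_open[OF that(2)])
		fix u assume u: "s < u" "u < t"
		hence uK: "u \<in> {0..K}" "at u within {0..K} = at u" using that by (auto intro!: at_within_interior)
		thus "\<exists>y. (\<theta> has_real_derivative y) (at u) & y > 0"
			using d\<theta>[OF uK(1)] divide_pos_pos[of "X u * T' u-X' u * T u",OF _ PQ[OF uK(1)]] rot[OF uK(1)] unfolding uK(2) by auto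
	qed (rule continuous_on_subset[OF cont],use that in auto)
	have \<theta>0: "\<theta> 0=0" by (simp add: \<theta>_def Q_def X0)
	have \<theta>K: "\<theta> K=j*(pi/2)"
	proof -
		have Kin: "K \<in> {0..K}" using K by simp
		have "sin (\<theta> K-j*(pi/2))=0"
		proof (cases "even j")
			case True
			hence "sin (\<theta> K)=0" using XK polar(2)[OF Kin] r[OF Kin] by simp
			moreover have "sin (j*(pi/2))=0" using True by (auto elim!: evenE simp: sin_npi)
			ultimately show ?thesis by (simp add: sin_diff)
		next
			case False
			hence "cos (\<theta> K)=0" using XK polar(1)[OF Kin] r[OF Kin] by simp
			moreover obtain p where p: "j=2 * p+1" using False by (auto elim: oddE)
			have "cos (j*(pi/2)) = cos (real p * pi + pi/2)" unfolding p by (simp add: algebra_simps)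
			hence "cos (j*(pi/2))=0" by (simp add: cos_add)
			ultimately show ?thesis by (simp add: sin_diff)
		qed
		moreover have "\<bar>\<theta> K-j*(pi/2)\<bar> < pi" using jK arctan_bounded[of "Q K/P K"] unfolding \<theta>_def by linarith
		ultimately have "\<theta> K-j*(pi/2)=0" by (metis sin_eq_0_pi abs_less_iff minus_less_iff)
		thus ?thesis by simp
	qed
	show ?thesis
	proof (rule that)
		have "inj_on \<theta> {0<..<K}"
		proof (rule linorder_inj_onI')
			fix i j assume "i \<in> {0<..<K}" "j \<in> {0<..<K}" "i < j"
			thus "\<theta> i ~= \<theta> j" using mono[of i j] by auto
		qed
		moreover have "\<theta> ` {0<..<K} = {0<..<j*(pi/2)}"
		proof safe
			fix s assume "s \<in> {0<..<K}"
			thus "\<theta> s \<in> {0<..<j*(pi/2)}" using mono[of 0 s] mono[of s K] \<theta>0 \<theta>K by auto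
		next
			fix x assume x: "x \<in> {0<..<j*(pi/2)}"
			then obtain s where s: "0 <= s" "s <= K" "\<theta> s=x" using IVT'[of \<theta> 0 x K] \<theta>0 \<theta>K cont K by auto
			moreover have "s ~= 0" "s ~= K" using s x \<theta>0 \<theta>K by auto
			ultimately show "x \<in> \<theta> ` {0<..<K}" by (intro image_eqI[of _ _ s]) auto
		qed
		ultimately show "bij_betw \<theta> {0<..<K} {0<..<j*(pi/2)}" by (simp add: bij_betw_def)
		fix s assume s: "s \<in> {0..K}"
		show "X s=0 \<longleftrightarrow> cos (\<theta> s)=0" "T s=0 \<longleftrightarrow> sin (\<theta> s)=0" using polar[OF s] r[OF s] by auto
	qed
qed

lemma cos_zeros_count: "{x\<in>{0<..<real j*(pi/2)}. cos x=0} = (%i. (2 * real i+1)*(pi/2)) ` {..<j div 2}"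
proof (intro equalityI subsetI)
	fix x assume x: "x \<in> {x\<in>{0<..<real j*(pi/2)}. cos x=0}"
	then obtain i :: int where i: "odd i" "x = of_int i*(pi/2)" using cos_zero_iff_int by auto
	hence "0 < of_int i*(pi/2)" "of_int i*(pi/2) < real j*(pi/2)" using x by auto
	hence "0 < i" "of_int i < real j" by (auto simp: zero_less_mult_iff mult_less_cancel_right)
	hence ij: "0 < i" "i < int j" by auto
	obtain p where p: "i=2 * p+1" using i by (auto elim: oddE)
	have "nat p < j div 2" using ij p by auto
	moreover have "x=(2 * real (nat p)+1)*(pi/2)" using ij p i by simp
	ultimately show "x \<in> (%i. (2 * real i+1)*(pi/2)) ` {..<j div 2}" by blast
next
	fix x assume "x \<in> (%i. (2 * real i+1)*(pi/2)) ` {..<j div 2}"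
	then obtain i where i: "i < j div 2" "x=(2 * real i+1)*(pi/2)" by auto
	hence "2 * i+1 < j" by linarith
	hence "2 * real i+1 < real j" by linarith
	hence "x < real j*(pi/2)" unfolding i(2) by (intro mult_strict_right_mono) auto
	moreover have "cos x = cos (real i * pi + pi/2)" unfolding i(2) by (simp add: algebra_simps)
	hence "cos x=0" by (simp add: cos_add)
	moreover have "0 < x" unfolding i(2) by simp
	ultimately show "x \<in> {x\<in>{0<..<real j*(pi/2)}. cos x=0}" by simp
qed

lemma sin_zeros_count: "{x\<in>{0<..<real j*(pi/2)}. sin x=0} = (%i. (real i+1) * pi) ` {..<(j-1) div 2}"
proof (intro equalityI subsetI)
	fix x assume x: "x \<in> {x\<in>{0<..<real j*(pi/2)}. sin x=0}"
	then obtain i :: int where i: "x = of_int i * pi" using sin_zero_iff_int2 by auto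
	hence "0 < of_int i * pi" "(2 * of_int i)*(pi/2) < real j*(pi/2)" using x by auto
	hence "0 < i" "2 * of_int i < real j" by (auto simp: zero_less_mult_iff mult_less_cancel_right)
	hence ij: "0 < i" "2 * i < int j" by linarith+
	have "nat (i-1) < (j-1) div 2" using ij by linarith
	moreover have "x=(real (nat (i-1))+1) * pi" using ij i by simp
	ultimately show "x \<in> (%i. (real i+1) * pi) ` {..<(j-1) div 2}" by blast
next
	fix x assume "x \<in> (%i. (real i+1) * pi) ` {..<(j-1) div 2}"
	then obtain i where i: "i < (j-1) div 2" "x=(real i+1) * pi" by auto
	hence "2*(i+1) < j" by presburger
	hence "real (2*(i+1)) < real j" by (simp only: of_nat_less_iff)
	hence "2*(real i+1) < real j" by simp
	hence "(2*(real i+1))*(pi/2) < real j*(pi/2)" by (intro mult_strict_right_mono) auto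
	hence "x < real j*(pi/2)" unfolding i(2) by simp
	moreover have "sin x=0" unfolding i(2) by (simp add: sin_zero_iff_int2 exI[of _ "int i+1"])
	moreover have "0 < x" unfolding i(2) by simp
	ultimately show "x \<in> {x\<in>{0<..<real j*(pi/2)}. sin x=0}" by simp
qed

lemma zeros_count_via_angle:
	assumes "bij_betw \<theta> {0<..<K} {0<..<real j*(pi/2)}"
	shows "finite {s\<in>{0<..<K}. cos (\<theta> s)=0} & card {s\<in>{0<..<K}. cos (\<theta> s)=0} = j div 2"
		"finite {s\<in>{0<..<K}. sin (\<theta> s)=0} & card {s\<in>{0<..<K}. sin (\<theta> s)=0} = (j-1) div 2"
proof -
	have bij: "bij_betw \<theta> {s\<in>{0<..<K}. f (\<theta> s)=0} {x\<in>{0<..<real j*(pi/2)}. f x=0}" for f :: "real => real"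
	proof -
		have "\<theta> ` {s\<in>{0<..<K}. f (\<theta> s)=0} = {x\<in>\<theta> ` {0<..<K}. f x=0}" by blast
		thus ?thesis using assms unfolding bij_betw_def by (auto intro: inj_on_subset)
	qed
	have "inj_on (%i. (2 * real i+1)*(pi/2)) A" "inj_on (%i. (real i+1) * pi) A" for A by (auto intro!: inj_onI)
	thus "finite {s\<in>{0<..<K}. cos (\<theta> s)=0} & card {s\<in>{0<..<K}. cos (\<theta> s)=0} = j div 2"
		"finite {s\<in>{0<..<K}. sin (\<theta> s)=0} & card {s\<in>{0<..<K}. sin (\<theta> s)=0} = (j-1) div 2"
		using bij_betw_finite[OF bij[of cos]] bij_betw_same_card[OF bij[of cos]]
			bij_betw_finite[OF bij[of sin]] bij_betw_same_card[OF bij[of sin]] unfolding cos_zeros_count sin_zeros_count by (auto simp: card_image)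
qed

section \<open>The Lame equation in the strip and on the real axis\<close>

definition lame_ode :: "real => real => real => (complex => complex) => bool" where
	"lame_ode \<nu> k h y \<longleftrightarrow> y holomorphic_on strip k &
		 (\<forall>z\<in>strip k. deriv (deriv y) z=(of_real (\<nu>*(\<nu>+1) * k^2)*(sn_cont k z)^2-of_real h) * y z)"

lemma lame_coeff_holomorphic:
	"0 < k ==> k < 1 ==> (%z. of_real c*(sn_cont k z)^2-of_real h) holomorphic_on strip k" by (intro holomorphic_intros sn_cont_holomorphic)

lemma lame_ode_exists:
	assumes k: "0 < k" "k < 1" and z0: "z0 \<in> strip k"
	obtains y where "lame_ode \<nu> k h y" "y z0 = c0" "deriv y z0 = c1"
proof -
	have "closed_segment z0 z \<subseteq> strip k" if "z \<in> strip k" for z using convex_strip z0 that by (simp add: closed_segment_subset)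
	from linear_ode_exists[OF open_strip z0 this holomorphic_on_const[of 0]
			lame_coeff_holomorphic[OF k,of "\<nu>*(\<nu>+1) * k^2" h]]
	obtain y where y: "y holomorphic_on strip k" "y z0 = c0" "deriv y z0 = c1"
		"!!z. z \<in> strip k ==> deriv (deriv y) z=0 * deriv y z+(of_real (\<nu>*(\<nu>+1) * k^2)*(sn_cont k z)^2-of_real h) * y z" by metis
	show ?thesis by (rule that[OF _ y(2,3)]) (use y in \<open>simp add: lame_ode_def\<close>)
qed

lemma lame_ode_unique:
	assumes k: "0 < k" "k < 1" and S: "open S" "connected S" "S \<subseteq> strip k" "z0 \<in> S"
		and y: "y holomorphic_on S" "!!z. z \<in> S ==> deriv (deriv y) z=(of_real (\<nu>*(\<nu>+1) * k^2)*(sn_cont k z)^2-of_real h) * y z"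
		and w: "lame_ode \<nu> k h w"
		and eq: "y z0=w z0" "deriv y z0=deriv w z0" and z: "z \<in> S"
	shows "y z=w z"
proof (rule linear_ode_unique[OF S(1,2,4) holomorphic_on_const[of 0] _ y(1) _ _ _ eq z])
	show "(%z. of_real (\<nu>*(\<nu>+1) * k^2)*(sn_cont k z)^2-of_real h) holomorphic_on S"
		by (rule holomorphic_on_subset[OF lame_coeff_holomorphic[OF k] S(3)])
	show "w holomorphic_on S" using w S(3) by (auto simp: lame_ode_def intro: holomorphic_on_subset)
qed (use y w S(3) in \<open>auto simp: lame_ode_def\<close>)

lemma of_real_in_strip: "0 < k ==> k < 1 ==> of_real x \<in> strip k" using elliptic_K'_pos by (simp add: strip_def)

definition lame_potential :: "real => real => real => real => real" where
	"lame_potential \<nu> k h s=\<nu>*(\<nu>+1) * k^2*(jacobi_sn s k)^2-h"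

lemma lame_ode_derivs:
	assumes "lame_ode \<nu> k h y" "z \<in> strip k"
	shows "(y has_field_derivative deriv y z) (at z)"
		"(deriv y has_field_derivative (of_real (\<nu>*(\<nu>+1) * k^2)*(sn_cont k z)^2-of_real h) * y z) (at z)"
	using assms open_strip holomorphic_derivI holomorphic_deriv unfolding lame_ode_def by metis+

lemma lame_ode_real_line:
	assumes k: "0 < k" "k < 1" and y: "lame_ode \<nu> k h y"
	shows "schroedinger_on S (lame_potential \<nu> k h) (%x. y (of_real x)) (%x. deriv y (of_real x))" unfolding schroedinger_on_def
proof (intro ballI conjI)
	fix t
	note d=lame_ode_derivs[OF y of_real_in_strip[OF k,of t]]
	show "((%x. y (of_real x)) has_vector_derivative deriv y (of_real t)) (at t within S)" by (rule has_vector_derivative_real_field[OF d(1)])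
	show "((%x. deriv y (of_real x)) has_vector_derivative lame_potential \<nu> k h t *\<^sub>R y (of_real t)) (at t within S)"
		using has_vector_derivative_real_field[OF d(2),of S] by (simp add: sn_cont_of_real[OF k] lame_potential_def scaleR_conv_of_real)
qed

definition lame_pole_potential :: "real => real => real => real => real" where
	"lame_pole_potential \<nu> k h \<tau>=h+\<nu>*(\<nu>+1) * jacobi_cs_square k \<tau>"

lemma imaginary_in_strip: "0 < \<tau> ==> \<tau> < 2 * elliptic_K' k ==> \<i> * of_real (elliptic_K' k-\<tau>) \<in> strip k"
	by (auto simp: strip_def)

lemma lame_ode_imaginary_derivs:
	assumes y: "lame_ode \<nu> k h y" and \<tau>: "0 < \<tau>" "\<tau> < 2 * elliptic_K' k"
	shows "((%\<tau>. y (\<i> * of_real (elliptic_K' k-\<tau>))) has_vector_derivative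
			- \<i> * deriv y (\<i> * of_real (elliptic_K' k-\<tau>))) (at \<tau> within S)"
		"((%\<tau>. - \<i> * deriv y (\<i> * of_real (elliptic_K' k-\<tau>))) has_vector_derivative
			- ((of_real (\<nu>*(\<nu>+1) * k^2)*(sn_cont k (\<i> * of_real (elliptic_K' k-\<tau>)))^2-of_real h)
					* y (\<i> * of_real (elliptic_K' k-\<tau>)))) (at \<tau> within S)"
proof -
	note d=lame_ode_derivs[OF y imaginary_in_strip[OF \<tau>],THEN has_field_derivative_at_within]
	have g: "((%\<tau>. \<i> * of_real (elliptic_K' k-\<tau>)) has_vector_derivative-\<i>) (at \<tau> within S)"
		by (auto intro!: derivative_eq_intros simp: has_vector_derivative_def scaleR_conv_of_real fun_eq_iff)
	show "((%\<tau>. y (\<i> * of_real (elliptic_K' k-\<tau>))) has_vector_derivative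
			- \<i> * deriv y (\<i> * of_real (elliptic_K' k-\<tau>))) (at \<tau> within S)"
		using field_vector_diff_chain_within[OF g d(1)] by (simp add: o_def)
	have "((%\<tau>. deriv y (\<i> * of_real (elliptic_K' k-\<tau>))) has_vector_derivative
			- \<i>*((of_real (\<nu>*(\<nu>+1) * k^2)*(sn_cont k (\<i> * of_real (elliptic_K' k-\<tau>)))^2-of_real h)
					* y (\<i> * of_real (elliptic_K' k-\<tau>)))) (at \<tau> within S)" using field_vector_diff_chain_within[OF g d(2)] by (simp add: o_def)
	from has_vector_derivative_mult_right[OF this,of "- \<i>"]
	show "((%\<tau>. - \<i> * deriv y (\<i> * of_real (elliptic_K' k-\<tau>))) has_vector_derivative
			- ((of_real (\<nu>*(\<nu>+1) * k^2)*(sn_cont k (\<i> * of_real (elliptic_K' k-\<tau>)))^2-of_real h)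
					* y (\<i> * of_real (elliptic_K' k-\<tau>)))) (at \<tau> within S)" by (rule has_vector_derivative_eq_rhs) (simp add: mult.assoc[symmetric])
qed

lemma lame_ode_imaginary_line:
	assumes k: "0 < k" "k < 1" and y: "lame_ode \<nu> k h y" and S: "S \<subseteq> {0<..elliptic_K' k}"
	shows "schroedinger_on S (lame_pole_potential \<nu> k h)
		(%\<tau>. y (\<i> * of_real (elliptic_K' k-\<tau>))) (%\<tau>. - \<i> * deriv y (\<i> * of_real (elliptic_K' k-\<tau>)))"
	unfolding schroedinger_on_def
proof (intro ballI conjI)
	fix \<tau> assume "\<tau> \<in> S"
	hence \<tau>: "0 < \<tau>" "\<tau> <= elliptic_K' k" using S by auto
	hence \<tau>2: "\<tau> < 2 * elliptic_K' k" by linarith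
	note d=lame_ode_imaginary_derivs[OF y \<tau>(1) \<tau>2,of S]
	show "((%\<tau>. y (\<i> * of_real (elliptic_K' k-\<tau>))) has_vector_derivative
			- \<i> * deriv y (\<i> * of_real (elliptic_K' k-\<tau>))) (at \<tau> within S)" by (rule d(1))
	have sq: "of_real (k^2)*(sn_cont k (\<i> * of_real (elliptic_K' k-\<tau>)))^2 = - of_real (jacobi_cs_square k \<tau>)"
		using sn_cont_imaginary_shift_square[OF k \<tau>] by (simp add: power_mult_distrib)
	have "- ((of_real (\<nu>*(\<nu>+1) * k^2)*(sn_cont k (\<i> * of_real (elliptic_K' k-\<tau>)))^2-of_real h)
					* y (\<i> * of_real (elliptic_K' k-\<tau>)))
		 = lame_pole_potential \<nu> k h \<tau> *\<^sub>R y (\<i> * of_real (elliptic_K' k-\<tau>))"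
	proof -
		have "of_real (\<nu>*(\<nu>+1) * k^2)*(sn_cont k (\<i> * of_real (elliptic_K' k-\<tau>)))^2
			= of_real (\<nu>*(\<nu>+1))*(of_real (k^2)*(sn_cont k (\<i> * of_real (elliptic_K' k-\<tau>)))^2)" by (simp only: of_real_mult mult.assoc)
		also have "... = - of_real (\<nu>*(\<nu>+1) * jacobi_cs_square k \<tau>)" unfolding sq by simp
		finally have e: "of_real (\<nu>*(\<nu>+1) * k^2)*(sn_cont k (\<i> * of_real (elliptic_K' k-\<tau>)))^2
			= - of_real (\<nu>*(\<nu>+1) * jacobi_cs_square k \<tau>)" .
		have "- ((- c-d) * w)=(d + c) * w" for c d w :: complex by (simp add: algebra_simps)
		thus ?thesis unfolding e unfolding lame_pole_potential_def scaleR_conv_of_real of_real_add .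
	qed
	with d(2) show "((%\<tau>. - \<i> * deriv y (\<i> * of_real (elliptic_K' k-\<tau>))) has_vector_derivative
			lame_pole_potential \<nu> k h \<tau> *\<^sub>R y (\<i> * of_real (elliptic_K' k-\<tau>))) (at \<tau> within S)" by simp
qed

lemma lame_potential_bounded:
	"\<bar>lame_potential \<nu> k h s + h\<bar> <= \<bar>\<nu>*(\<nu>+1)\<bar> * k^2"
proof -
	have "\<bar>lame_potential \<nu> k h s + h\<bar>=\<bar>\<nu>*(\<nu>+1)\<bar> * k^2*(jacobi_sn s k)^2" by (simp add: lame_potential_def abs_mult)
	also have "... <= \<bar>\<nu>*(\<nu>+1)\<bar> * k^2*1" using jacobi_sn_bound[of s k] by (intro mult_left_mono) (auto simp: abs_square_le_1)
	finally show ?thesis by simp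
qed

lemma lame_potential_bounded_image: "bounded (lame_potential \<nu> k h ` S)" unfolding bounded_iff
proof (intro exI ballI)
	fix v assume "v \<in> lame_potential \<nu> k h ` S"
	then obtain s where "v=lame_potential \<nu> k h s" by auto
	thus "norm v <= \<bar>\<nu>*(\<nu>+1)\<bar> * k^2+\<bar>h\<bar>" using lame_potential_bounded[of \<nu> k h s] by auto
qed

text \<open>The flag distinguishes the even from the odd solution at the origin.\<close>

definition lame_std :: "real => bool => real => real => complex => complex" where
	"lame_std \<nu> b k h=(SOME y. lame_ode \<nu> k h y & y 0=(if b then 1 else 0) & deriv y 0=(if b then 0 else 1))"

lemma lame_std:
	assumes k: "0 < k" "k < 1"
	shows "lame_ode \<nu> k h (lame_std \<nu> b k h)" "lame_std \<nu> b k h 0=(if b then 1 else 0)"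
		"deriv (lame_std \<nu> b k h) 0=(if b then 0 else 1)"
proof -
	have "\<exists>y. lame_ode \<nu> k h y & y 0=(if b then 1 else 0) & deriv y 0=(if b then 0 else 1)"
		using lame_ode_exists[OF k zero_in_strip[OF k]] by metis
	from someI_ex[OF this] show "lame_ode \<nu> k h (lame_std \<nu> b k h)" "lame_std \<nu> b k h 0=(if b then 1 else 0)"
		"deriv (lame_std \<nu> b k h) 0=(if b then 0 else 1)" unfolding lame_std_def by blast+
qed

definition lame_re :: "real => bool => real => real => real => real" where
	"lame_re \<nu> b k h x=Re (lame_std \<nu> b k h (of_real x))"

definition lame_re' :: "real => bool => real => real => real => real" where
	"lame_re' \<nu> b k h x=Re (deriv (lame_std \<nu> b k h) (of_real x))"

lemma lame_re_solution:
	assumes k: "0 < k" "k < 1"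
	shows "schroedinger_on S (lame_potential \<nu> k h) (lame_re \<nu> b k h) (lame_re' \<nu> b k h)"
	unfolding lame_re_def[abs_def] lame_re'_def[abs_def]
	by (rule schroedinger_on_linear[OF lame_ode_real_line[OF k lame_std(1)[OF k]] bounded_linear_Re])

lemma lame_re_init:
	assumes k: "0 < k" "k < 1"
	shows "lame_re \<nu> b k h 0=(if b then 1 else 0)" "lame_re' \<nu> b k h 0=(if b then 0 else 1)"
	using lame_std(2,3)[OF k] by (simp_all add: lame_re_def lame_re'_def)

lemma lame_std_real:
	assumes k: "0 < k" "k < 1"
	shows "lame_std \<nu> b k h (of_real x) = of_real (lame_re \<nu> b k h x)"
proof -
	have "x \<in> {-\<bar>x\<bar>..\<bar>x\<bar>}" "0 \<in> {-\<bar>x\<bar>..\<bar>x\<bar>}" by auto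
	thus ?thesis using schroedinger_unique(1)[OF lame_ode_real_line[OF k lame_std(1)[OF k]]
			schroedinger_on_linear[OF lame_re_solution[OF k] bounded_linear_of_real] lame_potential_bounded_image,
			of 0 "-\<bar>x\<bar>" "\<bar>x\<bar>" \<nu> b h b x] lame_std(2,3)[OF k] lame_re_init[OF k] by simp
qed

definition trig_std :: "bool => real => real => real" where
	"trig_std b \<omega> s=(if b then cos (\<omega> * s) else sin (\<omega> * s)/\<omega>)"

definition trig_std' :: "bool => real => real => real" where
	"trig_std' b \<omega> s=(if b then-\<omega> * sin (\<omega> * s) else cos (\<omega> * s))"

lemma trig_std_solution:
	assumes "b \<or> \<omega> ~= 0"
	shows "schroedinger_on S (%_. - \<omega>\<^sup>2) (trig_std b \<omega>) (trig_std' b \<omega>)"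
	unfolding schroedinger_on_def has_real_derivative_iff_has_vector_derivative[symmetric]
proof (intro ballI conjI)
	fix t
	show "(trig_std b \<omega> has_real_derivative trig_std' b \<omega> t) (at t within S)" using assms unfolding trig_std_def[abs_def] trig_std'_def
		by (cases b) (auto intro!: derivative_eq_intros)
	show "(trig_std' b \<omega> has_real_derivative (- \<omega>\<^sup>2) *\<^sub>R trig_std b \<omega> t) (at t within S)"
		using assms unfolding trig_std'_def[abs_def] trig_std_def by (cases b) (auto intro!: derivative_eq_intros simp: power2_eq_square)
qed

lemma lame_re_uniform_limit:
	fixes ka \<eta> :: "'p => real"
	assumes ka: "\<forall>\<^sub>F p in F. 0 < ka p & ka p < 1" "(ka \<longlongrightarrow> 0) F" and \<eta>: "(\<eta> \<longlongrightarrow> \<omega>\<^sup>2) F"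
		and b: "b \<or> \<omega> ~= 0" and R: "R >= 0"
	shows "uniform_limit {-R..R} (%p. lame_re \<nu> b (ka p) (\<eta> p)) (trig_std b \<omega>) F"
		"uniform_limit {-R..R} (%p. lame_re' \<nu> b (ka p) (\<eta> p)) (trig_std' b \<omega>) F"
proof -
	have sol: "\<forall>\<^sub>F p in F. schroedinger_on {-R..R} (lame_potential \<nu> (ka p) (\<eta> p)) (lame_re \<nu> b (ka p) (\<eta> p)) (lame_re' \<nu> b (ka p) (\<eta> p))"
		using ka(1) by eventually_elim (auto intro: lame_re_solution)
	have pot: "uniform_limit {-R..R} (%p. lame_potential \<nu> (ka p) (\<eta> p)) (%_. - \<omega>\<^sup>2) F" unfolding uniform_limit_iff
	proof (intro allI impI)
		fix e :: real assume "e > 0"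
		have "((%p. \<bar>\<nu>*(\<nu>+1)\<bar>*(ka p)^2+\<bar>\<eta> p-\<omega>\<^sup>2\<bar>) \<longlongrightarrow> \<bar>\<nu>*(\<nu>+1)\<bar>*0^2+\<bar>\<omega>^2-\<omega>\<^sup>2\<bar>) F"
			by (intro tendsto_intros ka \<eta>)
		hence "\<forall>\<^sub>F p in F. \<bar>\<nu>*(\<nu>+1)\<bar>*(ka p)^2+\<bar>\<eta> p-\<omega>\<^sup>2\<bar> < e"
			by (rule order_tendstoD) (use \<open>e > 0\<close> in simp)
		thus "\<forall>\<^sub>F p in F. \<forall>x\<in>{-R..R}. dist (lame_potential \<nu> (ka p) (\<eta> p) x) (- \<omega>\<^sup>2) < e"
		proof eventually_elim
			case (elim p)
			show ?case
			proof
				fix x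
				have "\<bar>lame_potential \<nu> (ka p) (\<eta> p) x+\<omega>^2\<bar> <= \<bar>lame_potential \<nu> (ka p) (\<eta> p) x+\<eta> p\<bar>+\<bar>\<eta> p-\<omega>\<^sup>2\<bar>"
					by linarith
				thus "dist (lame_potential \<nu> (ka p) (\<eta> p) x) (- \<omega>\<^sup>2) < e"
					using elim lame_potential_bounded[of \<nu> "ka p" "\<eta> p" x] by (simp add: dist_real_def)
			qed
		qed
	qed
	have ini: "((%p. lame_re \<nu> b (ka p) (\<eta> p) 0) \<longlongrightarrow> trig_std b \<omega> 0) F"
		"((%p. lame_re' \<nu> b (ka p) (\<eta> p) 0) \<longlongrightarrow> trig_std' b \<omega> 0) F"
		using ka(1) by (auto intro!: tendsto_eventually elim!: eventually_mono simp: lame_re_init trig_std_def trig_std'_def)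
	have 0: "0 \<in> {-R..R}" using R by auto
	have bd: "bounded ((%_. - \<omega>\<^sup>2) ` {-R..R})" by (rule bounded_subset[of "{- \<omega>\<^sup>2}"]) auto
	show "uniform_limit {-R..R} (%p. lame_re \<nu> b (ka p) (\<eta> p)) (trig_std b \<omega>) F"
		"uniform_limit {-R..R} (%p. lame_re' \<nu> b (ka p) (\<eta> p)) (trig_std' b \<omega>) F"
		using schroedinger_uniform_limit[OF sol trig_std_solution[OF b] pot bd 0 ini] by auto
qed

lemma uniform_limit_moving_point:
	assumes u: "uniform_limit S f g F" and g: "continuous_on S g" and x: "(x \<longlongrightarrow> l) F" "\<forall>\<^sub>F p in F. x p \<in> S" "l \<in> S"
	shows "((%p. f p (x p)) \<longlongrightarrow> g l) F"
proof -
	have gl: "((%p. g (x p)) \<longlongrightarrow> g l) F" by (rule continuous_on_tendsto_compose[OF g x(1) x(3) x(2)])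
	show ?thesis
	proof (rule tendstoI)
		fix e :: real assume "e > 0"
		hence e2: "e/2 > 0" by simp
		have "\<forall>\<^sub>F p in F. \<forall>y\<in>S. dist (f p y) (g y) < e/2" using u e2 unfolding uniform_limit_iff by blast
		moreover have "\<forall>\<^sub>F p in F. dist (g (x p)) (g l) < e/2" by (rule tendstoD[OF gl e2])
		ultimately
		show "\<forall>\<^sub>F p in F. dist (f p (x p)) (g l) < e" using x(2) by eventually_elim (metis dist_triangle_half_l dist_commute)
	qed
qed

lemma lame_re_continuous_in_h:
	assumes k: "0 < k" "k < 1"
	shows "isCont (%h. lame_re \<nu> b k h x) h0" "isCont (%h. lame_re' \<nu> b k h x) h0"
proof -
	have x: "x \<in> {-\<bar>x\<bar>..\<bar>x\<bar>}" "0 \<in> {-\<bar>x\<bar>..\<bar>x\<bar>}" by auto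
	have sol: "\<forall>\<^sub>F h in at h0. schroedinger_on {-\<bar>x\<bar>..\<bar>x\<bar>} (lame_potential \<nu> k h) (lame_re \<nu> b k h) (lame_re' \<nu> b k h)"
		by (intro always_eventually allI lame_re_solution k)
	have pot: "uniform_limit {-\<bar>x\<bar>..\<bar>x\<bar>} (%h. lame_potential \<nu> k h) (lame_potential \<nu> k h0) (at h0)"
		unfolding uniform_limit_iff
	proof (intro allI impI)
		fix e :: real assume "e > 0"
		hence "\<forall>\<^sub>F h in at h0. dist h h0 < e" by (intro tendstoD[OF tendsto_ident_at])
		thus "\<forall>\<^sub>F h in at h0. \<forall>x\<in>{-\<bar>x\<bar>..\<bar>x\<bar>}. dist (lame_potential \<nu> k h x) (lame_potential \<nu> k h0 x) < e"
			by eventually_elim (auto simp: lame_potential_def dist_real_def)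
	qed
	have ini: "((%h. lame_re \<nu> b k h 0) \<longlongrightarrow> lame_re \<nu> b k h0 0) (at h0)"
		"((%h. lame_re' \<nu> b k h 0) \<longlongrightarrow> lame_re' \<nu> b k h0 0) (at h0)" by (simp_all add: lame_re_init[OF k])
	note u=schroedinger_uniform_limit[OF sol lame_re_solution[OF k] pot lame_potential_bounded_image x(2) ini]
	show "isCont (%h. lame_re \<nu> b k h x) h0" "isCont (%h. lame_re' \<nu> b k h x) h0"
		unfolding isCont_def using tendsto_uniform_limitI[OF u(1) x(1)] tendsto_uniform_limitI[OF u(2) x(1)] by auto
qed

section \<open>The eigenvalues for a small modulus\<close>

text \<open>With the flag telling whether \<open>E'(0) = 0\<close> or \<open>E(0) = 0\<close>, the four boundary value problems
	become one family; both \<open>Ec\<close> and \<open>Es\<close> are instances with index \<open>j\<close>.\<close>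

definition lame_eigen :: "real => bool => nat => real => real => (real => real) => bool" where
	"lame_eigen \<nu> b j k h E \<longleftrightarrow>
		 (\<exists>E'. schroedinger_on {0..elliptic_K k} (lame_potential \<nu> k h) E E' &
					 (if b then E' 0=0 else E 0=0) &
					 (if b=even j then E' (elliptic_K k)=0 else E (elliptic_K k)=0)) &
		 exact_zeros k ((if b then j else j-1) div 2) E & lame_normalized k E"

lemma lame_solution_iff: "lame_solution \<nu> k h E E' \<longleftrightarrow> schroedinger_on {0..elliptic_K k} (lame_potential \<nu> k h) E E'"
proof -
	have "(\<exists>E''. (E' has_real_derivative E'') (at s within {0..elliptic_K k}) &
			E''+(h-\<nu>*(\<nu>+1) * k^2*(jacobi_sn s k)^2) * E s=0) \<longleftrightarrow>
			(E' has_real_derivative lame_potential \<nu> k h s * E s) (at s within {0..elliptic_K k})" (is "?L \<longleftrightarrow> ?R") for s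
	proof
		assume ?L
		then obtain e where e: "(E' has_real_derivative e) (at s within {0..elliptic_K k})"
			"e+(h-\<nu>*(\<nu>+1) * k^2*(jacobi_sn s k)^2) * E s=0" by blast
		have "e=lame_potential \<nu> k h s * E s" using e(2) unfolding lame_potential_def by (simp add: algebra_simps)
		with e(1) show ?R by simp
	next
		assume ?R
		thus ?L by (intro exI[of _ "lame_potential \<nu> k h s * E s"]) (simp add: lame_potential_def algebra_simps)
	qed
	thus ?thesis unfolding lame_solution_def schroedinger_on_def by (simp add: has_real_derivative_iff_has_vector_derivative)
qed

lemma lame_c_eigen_iff: "lame_c_eigen \<nu> j k h E \<longleftrightarrow> lame_eigen \<nu> (even j) j k h E"
proof -
	have "(if even j then j else j-1) div 2=j div 2" by (auto elim: oddE)
	thus ?thesis unfolding lame_c_eigen_def lame_eigen_def lame_solution_iff by simp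
qed

lemma lame_s_eigen_iff: "lame_s_eigen \<nu> j k h E \<longleftrightarrow> lame_eigen \<nu> (odd j) j k h E"
proof -
	have "(if odd j then j else j-1) div 2=(j-1) div 2" by (auto elim: oddE)
	thus ?thesis unfolding lame_s_eigen_def lame_eigen_def lame_solution_iff by (cases "even j") simp_all
qed

text \<open>By Sturm comparison the larger of two eigenvalues would have more zeros.\<close>

lemma lame_eigen_unique:
	assumes k: "0 < k" "k < 1" and E: "lame_eigen \<nu> b j k h E" and F: "lame_eigen \<nu> b j k g F"
	shows "h=g"
proof -
	have "\<not> h < g" if E: "lame_eigen \<nu> b j k h E" and F: "lame_eigen \<nu> b j k g F" for h g E F
	proof
		assume "h < g"
		let ?K = "elliptic_K k"
		have K: "?K > 0" using k by (intro elliptic_K_gt_0) (simp add: abs_square_less_1)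
		obtain E' where E': "schroedinger_on {0..?K} (lame_potential \<nu> k h) E E'" "if b then E' 0=0 else E 0=0"
			"if b=even j then E' ?K=0 else E ?K=0" using E unfolding lame_eigen_def by blast
		obtain F' where F': "schroedinger_on {0..?K} (lame_potential \<nu> k g) F F'" "if b then F' 0=0 else F 0=0"
			"if b=even j then F' ?K=0 else F ?K=0" using F unfolding lame_eigen_def by blast
		have z: "exact_zeros k ((if b then j else j-1) div 2) E" "exact_zeros k ((if b then j else j-1) div 2) F"
			using E F unfolding lame_eigen_def by blast+
		have "card {s\<in>{0<..<?K}. E s=0} < card {s\<in>{0<..<?K}. F s=0}"
		proof (rule sturm_comparison[OF E'(1) F'(1) K])
			show "lame_potential \<nu> k g s < lame_potential \<nu> k h s" for s using \<open>h < g\<close> by (simp add: lame_potential_def)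
		qed (use E'(2,3) F'(2,3) z in \<open>auto simp: exact_zeros_def split: if_splits\<close>)
		thus False using z by (simp add: exact_zeros_def)
	qed
	from this[OF E F] this[OF F E] show ?thesis by simp
qed

lemma lame_eigen_of_std:
	assumes k: "0 < k" "k < 1"
		and bd: "if b=even j then lame_re' \<nu> b k h (elliptic_K k)=0 else lame_re \<nu> b k h (elliptic_K k)=0"
		and z: "exact_zeros k ((if b then j else j-1) div 2) (lame_re \<nu> b k h)"
	shows "\<exists>E. lame_eigen \<nu> b j k h E"
proof -
	let ?K = "elliptic_K k" and ?y = "lame_re \<nu> b k h" and ?y' = "lame_re' \<nu> b k h"
	have K: "?K > 0" using k by (intro elliptic_K_gt_0) (simp add: abs_square_less_1)
	note sol=lame_re_solution[OF k,where \<nu>=\<nu> and h=h and b=b]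
	have cont: "continuous_on {0..?K} (%s. (?y s)\<^sup>2)" by (intro continuous_intros schroedinger_on_continuous(1)[OF sol])
	then obtain N where N: "((%s. (?y s)\<^sup>2) has_integral N) {0..?K}" using integrable_continuous_real integrable_integral by blast
	have "N >= 0" using has_integral_nonneg[OF N] by simp
	moreover have "N ~= 0"
	proof
		assume "N=0"
		have zero: "(?y s)^2=0" if "s \<in> {0..?K}" for s
		proof (rule has_integral_0_cbox_imp_0[of 0 ?K "%s. (?y s)\<^sup>2"])
			show "continuous_on (cbox 0 ?K) (%s. (?y s)\<^sup>2)" using cont by simp
			show "((%s. (?y s)\<^sup>2) has_integral 0) (cbox 0 ?K)" using N \<open>N=0\<close> by simp
			show "box 0 ?K ~= {}" using K by simp
		qed (use that in auto)
		hence y0: "?y s=0" if "s \<in> {0..?K}" for s using that by simp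
		have "(?y has_real_derivative ?y' 0) (at 0 within {0..?K})"
			using schroedinger_onD(1)[OF sol,of 0 "{0..?K}"] K by (simp add: has_real_derivative_iff_has_vector_derivative)
		moreover have "(?y has_real_derivative 0) (at 0 within {0..?K})"
			by (rule has_field_derivative_transform_within[of "%_. 0" 0 0 "{0..?K}" 1 ?y]) (use K y0 in auto)
		ultimately have "?y' 0=0" using K unfolding has_real_derivative_iff_has_vector_derivative
			by (intro vector_derivative_unique_within_closed_interval[of 0 ?K 0 ?y]) auto
		thus False using y0[of 0] K lame_re_init[OF k,of \<nu> b h] by (cases b) auto
	qed
	ultimately have Npos: "N > 0" by simp
	define c where "c=1/sqrt N"
	have c: "c ~= 0" "c^2 * N=1" using Npos by (auto simp: c_def power_divide)
	have "lame_eigen \<nu> b j k h (%s. c * ?y s)" unfolding lame_eigen_def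
	proof (intro conjI exI)
		show "schroedinger_on {0..?K} (lame_potential \<nu> k h) (%s. c * ?y s) (%s. c * ?y' s)"
			by (rule schroedinger_on_linear[OF sol bounded_linear_mult_right])
		show "if b then c * ?y' 0=0 else c * ?y 0=0" using lame_re_init[OF k] by simp
		show "if b=even j then c * ?y' ?K=0 else c * ?y ?K=0" using bd by auto
		show "exact_zeros k ((if b then j else j-1) div 2) (%s. c * ?y s)" using z c by (simp add: exact_zeros_def)
		show "lame_normalized k (%s. c * ?y s)" using has_integral_mult_right[OF N,of "c^2"] c by (simp add: lame_normalized_def power_mult_distrib)
	qed
	thus ?thesis by blast
qed

lemma eventually_elliptic_K_near:
	assumes "e > 0" shows "\<forall>\<^sub>F k in at_right 0. \<bar>elliptic_K k-pi/2\<bar> < e"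
	using tendstoD[OF elliptic_K_tendsto assms] by (simp add: dist_real_def)

lemma boundary_tendsto:
	assumes "b \<or> \<omega> ~= 0"
	shows "((%k. lame_re \<nu> b k (\<omega>^2) (elliptic_K k)) \<longlongrightarrow> trig_std b \<omega> (pi/2)) (at_right 0)"
		"((%k. lame_re' \<nu> b k (\<omega>^2) (elliptic_K k)) \<longlongrightarrow> trig_std' b \<omega> (pi/2)) (at_right 0)"
proof -
	have p2: "pi/2 < 2" using pi_less_4 by simp
	have u: "uniform_limit {-2..2} (%k. lame_re \<nu> b k (\<omega>^2)) (trig_std b \<omega>) (at_right 0)"
		"uniform_limit {-2..2} (%k. lame_re' \<nu> b k (\<omega>^2)) (trig_std' b \<omega>) (at_right 0)"
		using lame_re_uniform_limit[of "%k. k" "at_right 0" "%_. \<omega>\<^sup>2" \<omega> b 2 \<nu>] small_modulus assms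
		by (simp_all add: tendsto_ident_at)
	have K2: "\<forall>\<^sub>F k in at_right 0. elliptic_K k \<in> {-2..2}"
	proof (rule eventually_mono)
		show "\<forall>\<^sub>F k in at_right 0. \<bar>elliptic_K k-pi/2\<bar> < 2-pi/2" by (rule eventually_elliptic_K_near) (use p2 in simp)
		fix k assume "\<bar>elliptic_K k-pi/2\<bar> < 2-pi/2"
		thus "elliptic_K k \<in> {-2..2}" unfolding atLeastAtMost_iff abs_less_iff using pi_gt_zero by linarith
	qed
	note c=schroedinger_on_continuous[OF trig_std_solution[OF assms,of "{-2..2}"]]
	show "((%k. lame_re \<nu> b k (\<omega>^2) (elliptic_K k)) \<longlongrightarrow> trig_std b \<omega> (pi/2)) (at_right 0)"
		"((%k. lame_re' \<nu> b k (\<omega>^2) (elliptic_K k)) \<longlongrightarrow> trig_std' b \<omega> (pi/2)) (at_right 0)"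
		using uniform_limit_moving_point[OF u(1) c(1) elliptic_K_tendsto K2]
			uniform_limit_moving_point[OF u(2) c(2) elliptic_K_tendsto K2] p2 pi_gt_zero by auto
qed

lemma trig_boundary_sign:
	fixes j :: nat and b :: bool and \<eta> :: real
	assumes "0 < \<eta>" "\<eta> < 1" "j >= 1"
	defines "L \<equiv> %\<omega>. if b=even j then trig_std' b \<omega> (pi/2) else trig_std b \<omega> (pi/2)"
	shows "L (j-\<eta>) * L (j+\<eta>) < 0"
proof -
	have s: "sin (\<eta>*(pi/2)) > 0" using assms by (intro sin_gt_zero) auto
	have pos: "real j-\<eta> > 0" "real j+\<eta> > 0" using assms by auto
	have sc: "(sin (real j*(pi/2)))^2+(cos (real j*(pi/2)))^2=1" by simp
	have split: "(real j-\<eta>)*(pi/2)=real j*(pi/2)-\<eta>*(pi/2)"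
		"(real j+\<eta>)*(pi/2)=real j*(pi/2)+\<eta>*(pi/2)" by (rule left_diff_distrib,rule distrib_right)
	show ?thesis
	proof (cases "even j")
		case True
		hence sj: "sin (real j*(pi/2))=0" by (auto elim!: evenE simp: sin_npi)
		hence cj: "(cos (real j*(pi/2)))^2=1" using sc by simp
		have S: "sin ((real j-\<eta>)*(pi/2)) * sin ((real j+\<eta>)*(pi/2)) = - ((cos (real j*(pi/2)))^2*(sin (\<eta>*(pi/2)))^2)"
			unfolding split sin_diff sin_add sj by (simp add: power2_eq_square)
		hence Sneg: "sin ((real j-\<eta>)*(pi/2)) * sin ((real j+\<eta>)*(pi/2)) < 0" unfolding cj using s by simp
		show ?thesis
		proof (cases b)
			case True
			have "L (j-\<eta>) * L (j+\<eta>)=((real j-\<eta>)*(real j+\<eta>))*(sin ((real j-\<eta>)*(pi/2)) * sin ((real j+\<eta>)*(pi/2)))"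
				using True \<open>even j\<close> by (simp add: L_def trig_std'_def)
			also have "... < 0" by (rule mult_pos_neg[OF mult_pos_pos[OF pos] Sneg])
			finally show ?thesis .
		next
			case False
			have "L (j-\<eta>) * L (j+\<eta>)=(sin ((real j-\<eta>)*(pi/2)) * sin ((real j+\<eta>)*(pi/2)))/((real j-\<eta>)*(real j+\<eta>))"
				using False \<open>even j\<close> by (simp add: L_def trig_std_def)
			also have "... < 0" by (rule divide_neg_pos[OF Sneg mult_pos_pos[OF pos]])
			finally show ?thesis .
		qed
	next
		case False
		then obtain p where p: "j=2 * p+1" by (auto elim: oddE)
		have "cos (real j*(pi/2)) = cos (real p * pi + pi/2)" unfolding p by (simp add: algebra_simps)
		hence cj: "cos (real j*(pi/2))=0" by (simp add: cos_add)
		hence sj: "(sin (real j*(pi/2)))^2=1" using sc by simp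
		have C: "cos ((real j-\<eta>)*(pi/2)) * cos ((real j+\<eta>)*(pi/2)) = - ((sin (real j*(pi/2)))^2*(sin (\<eta>*(pi/2)))^2)"
			unfolding split cos_diff cos_add cj by (simp add: power2_eq_square)
		have "L (j-\<eta>) * L (j+\<eta>) = cos ((real j-\<eta>)*(pi/2)) * cos ((real j+\<eta>)*(pi/2))"
			using False by (cases b) (simp_all add: L_def trig_std_def trig_std'_def)
		also have "... < 0" unfolding C sj using s by simp
		finally show ?thesis .
	qed
qed

lemma lame_std_near_trig:
	assumes b: "b \<or> j >= 1" and e: "e > 0"
	shows "\<exists>\<delta>>0. \<forall>\<^sub>F k in at_right 0. \<forall>h. \<bar>h-(real j)\<^sup>2\<bar> < \<delta> \<longrightarrow>
		(\<forall>s\<in>{-2..2}. \<bar>lame_re \<nu> b k h s-trig_std b j s\<bar> < e & \<bar>lame_re' \<nu> b k h s-trig_std' b j s\<bar> < e)"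
proof -
	let ?F = "at_right (0::real) \<times>\<^sub>F nhds ((real j)^2)"
	have 1: "\<forall>\<^sub>F p in ?F. 0 < fst p & fst p < 1"
		using eventually_compose_filterlim[OF small_modulus filterlim_fst[of "at_right 0" "nhds ((real j)^2)"]] by simp
	have 2: "((%p. fst p) \<longlongrightarrow> 0) ?F"
		using filterlim_mono[OF filterlim_fst[of "at_right (0::real)" "nhds ((real j)^2)"] _ order_refl,of "nhds 0"] by (simp add: at_within_def)
	have 3: "((%p. snd p) \<longlongrightarrow> (real j)\<^sup>2) ?F" by (rule filterlim_snd)
	have b': "b \<or> real j ~= 0" using b by auto
	note u=lame_re_uniform_limit[OF 1 2 3 b',of 2 \<nu>,simplified]
	have "\<forall>\<^sub>F p in ?F. \<forall>s\<in>{-2..2}. \<bar>lame_re \<nu> b (fst p) (snd p) s-trig_std b j s\<bar> < e & \<bar>lame_re' \<nu> b (fst p) (snd p) s-trig_std' b j s\<bar> < e"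
	proof -
		have "\<forall>\<^sub>F p in ?F. \<forall>s\<in>{-2..2}. \<bar>lame_re \<nu> b (fst p) (snd p) s-trig_std b j s\<bar> < e"
			using u(1) e unfolding uniform_limit_iff dist_real_def by blast
		moreover have "\<forall>\<^sub>F p in ?F. \<forall>s\<in>{-2..2}. \<bar>lame_re' \<nu> b (fst p) (snd p) s-trig_std' b j s\<bar> < e"
			using u(2) e unfolding uniform_limit_iff dist_real_def by blast
		ultimately show ?thesis by eventually_elim blast
	qed
	then obtain P Q where PQ: "eventually P (at_right (0::real))" "eventually Q (nhds ((real j)^2))"
		"!!k h. P k ==> Q h ==> \<forall>s\<in>{-2..2}. \<bar>lame_re \<nu> b k h s-trig_std b j s\<bar> < e & \<bar>lame_re' \<nu> b k h s-trig_std' b j s\<bar> < e"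
		unfolding eventually_prod_filter by auto
	then obtain \<delta> where "\<delta> > 0" "!!h. \<bar>h-(real j)\<^sup>2\<bar> < \<delta> ==> Q h"
		unfolding eventually_nhds_metric dist_real_def by blast
	thus ?thesis using PQ by (intro exI[of _ \<delta>]) (auto elim!: eventually_mono)
qed

text \<open>The polar angle of the solution and its derivative increases through exactly \<open>j\<close> quarter turns.\<close>

lemma lame_zero_count:
	assumes k: "0 < k" "k < 1" and j: "j >= 1"
		and K: "\<bar>elliptic_K k-pi/2\<bar> < pi/(2 * real j)" "elliptic_K k <= 2"
		and V: "!!s. lame_potential \<nu> k h s < 0"
		and close: "!!s. s \<in> {-2..2} ==> \<bar>lame_re \<nu> b k h s-trig_std b j s\<bar> < 1/(2 * real j+2) &
				\<bar>lame_re' \<nu> b k h s-trig_std' b j s\<bar> < 1/(2 * real j+2)"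
		and bd: "if b=even j then lame_re' \<nu> b k h (elliptic_K k)=0 else lame_re \<nu> b k h (elliptic_K k)=0"
	shows "exact_zeros k ((if b then j else j-1) div 2) (lame_re \<nu> b k h)"
proof -
	let ?K = "elliptic_K k"
	define Y Y' where "Y=lame_re \<nu> b k h" and "Y'=lame_re' \<nu> b k h"
	have Kpos: "?K > 0" using k by (intro elliptic_K_gt_0) (simp add: abs_square_less_1)
	have jr: "real j >= 1" using j by simp
	define e where "e=1/(2 * real j+2)"
	have e: "e > 0" "(1 + real j) * e=1/2" using jr by (auto simp: e_def field_simps)
	define X where "X=(%s. if b then Y s else Y' s)"
	define T where "T=(%s. if b then-Y' s/j else j * Y s)"
	define X' where "X'=(%s. if b then Y' s else lame_potential \<nu> k h s * Y s)"
	define T' where "T'=(%s. if b then-(lame_potential \<nu> k h s * Y s)/j else j * Y' s)"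
	note sol=lame_re_solution[OF k,where \<nu>=\<nu> and h=h and b=b and S = "{0..?K}",folded Y_def Y'_def]
	have dY: "(Y has_real_derivative Y' s) (at s within {0..?K})"
		"(Y' has_real_derivative lame_potential \<nu> k h s * Y s) (at s within {0..?K})" if "s \<in> {0..?K}" for s
		using schroedinger_onD[OF sol that] by (simp_all add: has_real_derivative_iff_has_vector_derivative)
	have dX: "(X has_real_derivative X' s) (at s within {0..?K})" if "s \<in> {0..?K}" for s unfolding X_def X'_def using dY[OF that] by auto
	have dT: "(T has_real_derivative T' s) (at s within {0..?K})" if "s \<in> {0..?K}" for s
		unfolding T_def T'_def using DERIV_cdivide[OF DERIV_minus[OF dY(2)[OF that]],of "real j"]
			DERIV_cmult[OF dY(1)[OF that],of "real j"] by (cases b) auto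
	have P: "X s * cos (j * s) + T s * sin (j * s) > 0" if s: "s \<in> {0..?K}" for s :: real
	proof -
		have s2: "s \<in> {-2..2}" using s K by auto
		have XT: "\<bar>X s-cos (j * s)\<bar> <= e" "\<bar>T s-sin (j * s)\<bar> <= j * e"
		proof -
			show "\<bar>X s-cos (j * s)\<bar> <= e" using close[OF s2] by (cases b) (auto simp: X_def Y_def Y'_def trig_std_def trig_std'_def e_def)
			show "\<bar>T s-sin (j * s)\<bar> <= j * e"
			proof (cases b)
				case True
				have "T s-sin (j * s) = - (Y' s-trig_std' b j s)/j" using True jr by (simp add: T_def trig_std'_def field_simps)
				hence "\<bar>T s-sin (j * s)\<bar>=\<bar>Y' s-trig_std' b j s\<bar>/j" using jr by simp
				also have "... <= \<bar>Y' s-trig_std' b j s\<bar>/1" using jr by (intro divide_left_mono) auto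
				also have "... <= 1 * e" using close[OF s2] by (simp add: Y'_def e_def)
				also have "... <= j * e" using jr e by (intro mult_right_mono) auto
				finally show ?thesis .
			next
				case False
				have "T s-sin (j * s)=j*(Y s-trig_std b j s)" using False jr by (simp add: T_def trig_std_def field_simps)
				hence "\<bar>T s-sin (j * s)\<bar>=j*\<bar>Y s-trig_std b j s\<bar>" by (simp add: abs_mult)
				also have "... <= j * e" using close[OF s2] by (intro mult_left_mono) (auto simp: Y_def e_def)
				finally show ?thesis .
			qed
		qed
		have "\<bar>(X s-cos (j * s)) * cos (j * s)\<bar> <= e*1" "\<bar>(T s-sin (j * s)) * sin (j * s)\<bar> <= (j * e)*1"
			unfolding abs_mult using XT e by (intro mult_mono; simp)+
		moreover have "X s * cos (j * s) + T s * sin (j * s)=(X s-cos (j * s)) * cos (j * s)+(T s-sin (j * s)) * sin (j * s)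
			 + ((cos (j * s))^2+(sin (j * s))^2)" by (simp add: algebra_simps power2_eq_square)
		moreover have "(cos (j * s))^2+(sin (j * s))^2=1" by simp
		moreover have "e*1+(j * e)*1=1/2" using e by (simp add: algebra_simps)
		ultimately show ?thesis by linarith
	qed
	have rot: "X s * T' s-X' s * T s > 0" if s: "s \<in> {0..?K}" for s
	proof -
		have nz: "Y s ~= 0 \<or> Y' s ~= 0" using P[OF s] by (auto simp: X_def T_def split: if_splits)
		have q: "(Y' s)^2+(- lame_potential \<nu> k h s)*(Y s)^2 > 0"
		proof (cases "Y s=0")
			case False
			hence "(- lame_potential \<nu> k h s)*(Y s)^2 > 0" using V by (intro mult_pos_pos) auto
			thus ?thesis by (intro add_nonneg_pos zero_le_power2)
		qed (use nz in simp)
		have "X s * T' s-X' s * T s=((Y' s)^2+(- lame_potential \<nu> k h s)*(Y s)^2)*(if b then 1/j else j)"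
			by (simp add: X_def T_def X'_def T'_def field_simps power2_eq_square)
		thus ?thesis using q jr by simp
	qed
	have X0: "X 0=1" "T 0=0" using lame_re_init[OF k] by (auto simp: X_def T_def Y_def Y'_def)
	have XK: "if even j then T ?K=0 else X ?K=0" using bd by (auto simp: X_def T_def Y_def Y'_def split: if_splits)
	have jK: "\<bar>j * ?K-j*(pi/2)\<bar> < pi/2"
	proof -
		have "\<bar>j * ?K-j*(pi/2)\<bar>=j*\<bar>?K-pi/2\<bar>" unfolding right_diff_distrib[symmetric] abs_mult by simp
		also have "... < j*(pi/(2 * real j))" using K jr by (intro mult_strict_left_mono) auto
		finally show ?thesis using jr by simp
	qed
	obtain \<theta> where \<theta>: "bij_betw \<theta> {0<..<?K} {0<..<j*(pi/2)}"
		"!!s. s \<in> {0..?K} ==> X s=0 \<longleftrightarrow> cos (\<theta> s)=0" "!!s. s \<in> {0..?K} ==> T s=0 \<longleftrightarrow> sin (\<theta> s)=0"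
		using pruefer_angle[OF Kpos dX dT rot P X0 XK jK] by blast
	have "{s\<in>{0<..<?K}. Y s=0} = (if b then {s\<in>{0<..<?K}. cos (\<theta> s)=0} else {s\<in>{0<..<?K}. sin (\<theta> s)=0})"
	proof (cases b)
		case True
		thus ?thesis using \<theta>(2) by (auto simp: X_def)
	next
		case False
		thus ?thesis using \<theta>(3) jr by (auto simp: T_def)
	qed
	thus ?thesis using zeros_count_via_angle[OF \<theta>(1)] by (simp add: exact_zeros_def Y_def)
qed

lemma IVT_sign_change:
	fixes f :: "real => real"
	assumes "a <= b" "!!x. isCont f x" "f a * f b < 0"
	obtains x where "a <= x" "x <= b" "f x=0"
proof -
	have "(f a <= 0 & 0 <= f b) \<or> (f b <= 0 & 0 <= f a)" using assms(3) by (auto simp: mult_less_0_iff)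
	thus ?thesis using IVT[of f a 0 b] IVT2[of f b 0 a] assms that by blast
qed

text \<open>For small \<open>k\<close> the boundary value at \<open>K\<close> is close to that of a trigonometric function, which changes sign as \<open>h\<close> passes \<open>j^2\<close>.\<close>

lemma lame_eigen_exists_pos:
	assumes j: "j >= 1" and \<epsilon>: "\<epsilon> > 0"
	shows "\<forall>\<^sub>F k in at_right 0. \<exists>h E. lame_eigen \<nu> b j k h E & \<bar>h-(real j)\<^sup>2\<bar> < \<epsilon>"
proof -
	have jr: "real j >= 1" using j by simp
	have bj: "b \<or> j >= 1" using j by simp
	obtain \<delta> where \<delta>: "\<delta> > 0" "\<forall>\<^sub>F k in at_right 0. \<forall>h. \<bar>h-(real j)\<^sup>2\<bar> < \<delta> \<longrightarrow>
		(\<forall>s\<in>{-2..2}. \<bar>lame_re \<nu> b k h s-trig_std b j s\<bar> < 1/(2 * real j+2) & \<bar>lame_re' \<nu> b k h s-trig_std' b j s\<bar> < 1/(2 * real j+2))"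
		using lame_std_near_trig[OF bj,of "1/(2 * real j+2)"] jr by auto
	define d where "d=min (min \<delta> \<epsilon>) (1/2)"
	have d: "d > 0" "d <= \<delta>" "d <= \<epsilon>" "d <= 1/2" using \<delta> \<epsilon> by (auto simp: d_def)
	define \<eta> where "\<eta>=d/(2 * real j+2)"
	have \<eta>: "0 < \<eta>" "\<eta> < 1" using d jr by (auto simp: \<eta>_def field_simps)
	have \<eta>d: "(2 * real j+1)*\<eta> < d"
	proof -
		have "(2 * real j+2)*\<eta>=d" using jr by (simp add: \<eta>_def)
		thus ?thesis using \<eta>(1) by (simp add: algebra_simps)
	qed
	have near: "\<bar>h-(real j)\<^sup>2\<bar> < d" if "(j-\<eta>)^2 <= h" "h <= (j+\<eta>)^2" for h
	proof -
		have "\<eta>^2 <= \<eta>" using \<eta> by (simp add: power2_eq_square mult_left_le)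
		hence "(j+\<eta>)^2-(real j)\<^sup>2 <= (2 * real j+1)*\<eta>" "(real j)^2-(j-\<eta>)\<^sup>2 <= (2 * real j+1)*\<eta>"
			using \<eta> by (auto simp: power2_eq_square algebra_simps)
		thus ?thesis unfolding abs_less_iff using that \<eta>d by linarith
	qed
	define B where "B=(%k h. if b=even j then lame_re' \<nu> b k h (elliptic_K k) else lame_re \<nu> b k h (elliptic_K k))"
	define L where "L=(%\<omega>. if b=even j then trig_std' b \<omega> (pi/2) else trig_std b \<omega> (pi/2))"
	have BL: "((%k. B k (\<omega>^2)) \<longlongrightarrow> L \<omega>) (at_right 0)" if "\<omega> ~= 0" for \<omega>
		unfolding B_def L_def using boundary_tendsto[of b \<omega> \<nu>] that by auto
	have "((%k. B k ((j-\<eta>)^2) * B k ((j+\<eta>)^2)) \<longlongrightarrow> L (j-\<eta>) * L (j+\<eta>)) (at_right 0)"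
		using \<eta> jr by (intro tendsto_mult BL) auto
	moreover have "L (j-\<eta>) * L (j+\<eta>) < 0" unfolding L_def using trig_boundary_sign[OF \<eta> j,of b] by simp
	ultimately have e1: "\<forall>\<^sub>F k in at_right 0. B k ((j-\<eta>)^2) * B k ((j+\<eta>)^2) < 0" by (rule order_tendstoD)
	have "((%k::real. \<bar>\<nu>*(\<nu>+1)\<bar> * k^2) \<longlongrightarrow> \<bar>\<nu>*(\<nu>+1)\<bar>*0^2) (at_right 0)" by (intro tendsto_intros)
	hence e2: "\<forall>\<^sub>F k::real in at_right 0. \<bar>\<nu>*(\<nu>+1)\<bar> * k^2 < 1/2" by (rule order_tendstoD) simp
	have p2: "pi/2 < 2" using pi_less_4 by simp
	have e3: "\<forall>\<^sub>F k in at_right 0. \<bar>elliptic_K k-pi/2\<bar> < pi/(2 * real j)" by (rule eventually_elliptic_K_near) (use jr in simp)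
	have e4: "\<forall>\<^sub>F k in at_right 0. \<bar>elliptic_K k-pi/2\<bar> < 2-pi/2" by (rule eventually_elliptic_K_near) (use p2 in simp)
	show ?thesis using e1 e2 e3 e4 \<delta>(2) small_modulus
	proof eventually_elim
		case (elim k)
		hence k: "0 < k" "k < 1" by auto
		have "isCont (B k) h" for h unfolding B_def using lame_re_continuous_in_h[OF k] by (cases "b=even j") auto
		moreover have "(j-\<eta>)^2 <= (j+\<eta>)^2" using \<eta> jr by (intro power_mono) auto
		ultimately obtain h where h: "(j-\<eta>)^2 <= h" "h <= (j+\<eta>)^2" "B k h=0"
			using IVT_sign_change[of "(j-\<eta>)^2" "(j+\<eta>)^2" "B k"] elim(1) by metis
		have hd: "\<bar>h-(real j)\<^sup>2\<bar> < d" by (rule near[OF h(1,2)])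
		have bd: "if b=even j then lame_re' \<nu> b k h (elliptic_K k)=0 else lame_re \<nu> b k h (elliptic_K k)=0" using h(3) by (auto simp: B_def)
		have "exact_zeros k ((if b then j else j-1) div 2) (lame_re \<nu> b k h)"
		proof (rule lame_zero_count[OF k j elim(3) _ _ _ bd])
			show "elliptic_K k <= 2" using elim(4) by linarith
			have "(real j)^2 >= 1" using jr by simp
			thus "lame_potential \<nu> k h s < 0" for s using lame_potential_bounded[of \<nu> k h s] elim(2) hd d(4) by linarith
			show "\<bar>lame_re \<nu> b k h s-trig_std b j s\<bar> < 1/(2 * real j+2) & \<bar>lame_re' \<nu> b k h s-trig_std' b j s\<bar> < 1/(2 * real j+2)"
				if "s \<in> {-2..2}" for s using elim(5) hd d(2) that by force
		qed
		thus ?case using lame_eigen_of_std[OF k bd] hd d(3) by fastforce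
	qed
qed

text \<open>A bound quadratic in \<open>k\<close> is needed later: \<open>h\<close> has to be small even after multiplication by the square of \<open>K'\<close>.\<close>

lemma lame_eigen_exists_0:
	"\<forall>\<^sub>F k in at_right 0. \<exists>h E. lame_eigen \<nu> True 0 k h E & \<bar>h\<bar> <= \<bar>\<nu>*(\<nu>+1)\<bar> * k^2"
proof -
	obtain \<delta> where \<delta>: "\<delta> > 0" "\<forall>\<^sub>F k in at_right 0. \<forall>h. \<bar>h-(real 0)\<^sup>2\<bar> < \<delta> \<longrightarrow>
		(\<forall>s\<in>{-2..2}. \<bar>lame_re \<nu> True k h s-trig_std True (real 0) s\<bar> < 1/2 & \<bar>lame_re' \<nu> True k h s-trig_std' True (real 0) s\<bar> < 1/2)"
		using lame_std_near_trig[of True 0 "1/2" \<nu>] by auto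
	define c where "c=\<bar>\<nu>*(\<nu>+1)\<bar>"
	have "((%k::real. c * k^2) \<longlongrightarrow> c*0^2) (at_right 0)" by (intro tendsto_intros)
	hence e2: "\<forall>\<^sub>F k::real in at_right 0. c * k^2 < \<delta>/2" by (rule order_tendstoD) (use \<delta> in simp)
	have p2: "pi/2 < 2" using pi_less_4 by simp
	have e4: "\<forall>\<^sub>F k in at_right 0. \<bar>elliptic_K k-pi/2\<bar> < 2-pi/2" by (rule eventually_elliptic_K_near) (use p2 in simp)
	show ?thesis using e2 e4 \<delta>(2) small_modulus
	proof eventually_elim
		case (elim k)
		hence k: "0 < k" "k < 1" by auto
		let ?K = "elliptic_K k"
		have K: "0 < ?K" "?K <= 2" using elim(2) elliptic_K_gt_0[of k] k by (auto simp: abs_square_less_1)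
		have Y: "lame_re \<nu> True k h s > 0" if "\<bar>h\<bar> < \<delta>" "s \<in> {0..?K}" for h s
		proof -
			have "s \<in> {-2..2}" using that K by auto
			hence "\<bar>lame_re \<nu> True k h s-1\<bar> < 1/2" using elim(3) that by (force simp: trig_std_def)
			thus ?thesis by linarith
		qed
		have d: "(lame_re' \<nu> True k h has_real_derivative lame_potential \<nu> k h s * lame_re \<nu> True k h s) (at s)" for h s
			using schroedinger_onD(2)[OF lame_re_solution[OF k],of s UNIV] by (simp add: has_real_derivative_iff_has_vector_derivative)
		have up: "lame_re' \<nu> True k h ?K < 0" if "c * k^2 < h" "h < \<delta>" for h
		proof -
			have h: "\<bar>h\<bar> < \<delta>" using that by (smt (verit) c_def mult_nonneg_nonneg abs_ge_zero zero_le_power2)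
			have "lame_re' \<nu> True k h ?K < lame_re' \<nu> True k h 0"
			proof (rule DERIV_neg_imp_decreasing[OF K(1)])
				fix s assume s: "0 <= s" "s <= ?K"
				have "lame_potential \<nu> k h s < 0" using lame_potential_bounded[of \<nu> k h s] that by (simp add: c_def)
				hence "lame_potential \<nu> k h s * lame_re \<nu> True k h s < 0" using Y[OF h,of s] s by (simp add: mult_neg_pos)
				thus "\<exists>y. (lame_re' \<nu> True k h has_real_derivative y) (at s) & y < 0" using d by blast
			qed
			thus ?thesis using lame_re_init[OF k] by simp
		qed
		have down: "lame_re' \<nu> True k h ?K > 0" if "h < - (c * k^2)" "- \<delta> < h" for h
		proof -
			have h: "\<bar>h\<bar> < \<delta>" using that by (smt (verit) c_def mult_nonneg_nonneg abs_ge_zero zero_le_power2)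
			have "lame_re' \<nu> True k h ?K > lame_re' \<nu> True k h 0"
			proof (rule DERIV_pos_imp_increasing[OF K(1)])
				fix s assume s: "0 <= s" "s <= ?K"
				have "lame_potential \<nu> k h s > 0" using lame_potential_bounded[of \<nu> k h s] that by (simp add: c_def)
				hence "lame_potential \<nu> k h s * lame_re \<nu> True k h s > 0" using Y[OF h,of s] s by simp
				thus "\<exists>y. (lame_re' \<nu> True k h has_real_derivative y) (at s) & y > 0" using d by blast
			qed
			thus ?thesis using lame_re_init[OF k] by simp
		qed
		have "lame_re' \<nu> True k (- (\<delta>/2)) ?K * lame_re' \<nu> True k (\<delta>/2) ?K < 0"
			using up[of "\<delta>/2"] down[of "- (\<delta>/2)"] elim(1) \<delta>(1) by (intro mult_pos_neg) auto
		then obtain h where h: "- (\<delta>/2) <= h" "h <= \<delta>/2" "lame_re' \<nu> True k h ?K=0"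
			using IVT_sign_change[of "- (\<delta>/2)" "\<delta>/2" "%h. lame_re' \<nu> True k h ?K"] lame_re_continuous_in_h(2)[OF k] \<delta>(1) by auto
		have "\<not> c * k^2 < h" "\<not> h < - (c * k^2)" using up[of h] down[of h] h \<delta>(1) by auto
		hence "\<bar>h\<bar> <= c * k^2" by linarith
		moreover have "\<bar>h\<bar> < \<delta>" using h \<delta>(1) by linarith
		hence "lame_re \<nu> True k h s ~= 0" if "s \<in> {0<..<?K}" for s using Y[of h s] that by auto
		hence Z: "{s\<in>{0<..<?K}. lame_re \<nu> True k h s=0} = {}" by blast
		have "exact_zeros k ((if True then 0 else 0-1) div 2) (lame_re \<nu> True k h)" unfolding exact_zeros_def Z by simp
		hence "\<exists>E. lame_eigen \<nu> True 0 k h E" using lame_eigen_of_std[OF k,of True 0 \<nu> h] h(3) by simp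
		ultimately show ?case unfolding c_def by blast
	qed
qed

lemma lame_eigen_exists:
	assumes b: "b \<or> j >= 1" and \<epsilon>: "\<epsilon> > 0"
	shows "\<forall>\<^sub>F k in at_right 0. \<exists>h E. lame_eigen \<nu> b j k h E & \<bar>h-(real j)\<^sup>2\<bar> < \<epsilon> &
		(j=0 \<longrightarrow> \<bar>h\<bar> <= \<bar>\<nu>*(\<nu>+1)\<bar> * k^2)"
proof (cases "j >= 1")
	case True
	thus ?thesis using lame_eigen_exists_pos[OF True \<epsilon>,of \<nu> b] by (auto elim!: eventually_mono)
next
	case False
	hence j: "j=0" "b" using b by auto
	have "((%k::real. \<bar>\<nu>*(\<nu>+1)\<bar> * k^2) \<longlongrightarrow> \<bar>\<nu>*(\<nu>+1)\<bar>*0^2) (at_right 0)" by (intro tendsto_intros)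
	hence "\<forall>\<^sub>F k::real in at_right 0. \<bar>\<nu>*(\<nu>+1)\<bar> * k^2 < \<epsilon>" by (rule order_tendstoD) (use \<epsilon> in simp)
	thus ?thesis using lame_eigen_exists_0[of \<nu>]
	proof eventually_elim
		case (elim k)
		then obtain h E where "lame_eigen \<nu> True 0 k h E" "\<bar>h\<bar> <= \<bar>\<nu>*(\<nu>+1)\<bar> * k^2" by blast
		thus ?case using elim(1) j by (intro exI[of _ h] exI[of _ E]) auto
	qed
qed

section \<open>The hypergeometric function on the cut plane\<close>

definition olver_coeff :: "complex => complex => complex => nat => complex" where
	"olver_coeff a b c n=pochhammer a n * pochhammer b n * rGamma (c + of_nat n)/fact n"

lemma olver_coeff_Suc:
	"(of_nat n+1)*(c + of_nat n) * olver_coeff a b c (Suc n)=(a + of_nat n)*(b + of_nat n) * olver_coeff a b c n"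
proof -
	have r: "(c + of_nat n) * rGamma (c + of_nat (Suc n))=rGamma (c + of_nat n)" using rGamma_plus1[of "c + of_nat n"] by (simp add: add_ac)
	have f: "(of_nat n+1)/fact (Suc n)=(1/fact n :: complex)" by (simp add: field_simps del: of_nat_Suc) (simp add: algebra_simps)
	have "(of_nat n+1)*(c + of_nat n) * olver_coeff a b c (Suc n)
		= (a + of_nat n)*(b + of_nat n) * pochhammer a n * pochhammer b n*((c + of_nat n) * rGamma (c + of_nat (Suc n)))*((of_nat n+1)/fact (Suc n))"
		unfolding olver_coeff_def pochhammer_Suc by (simp only: mult_ac times_divide_eq_right times_divide_eq_left)
	also have "... = (a + of_nat n)*(b + of_nat n) * olver_coeff a b c n" unfolding r f olver_coeff_def by simp
	finally show ?thesis .
qed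

lemma tendsto_shift_ratio: "(%n. (a + of_nat n)/(b + of_nat n)) \<longlonglongrightarrow> (1::complex)"
proof -
	have inf: "filterlim (%n. b + of_nat n) at_infinity sequentially" by (intro tendsto_add_filterlim_at_infinity[OF tendsto_const] tendsto_of_nat)
	have "(%n. 1+(a-b)/(b + of_nat n)) \<longlonglongrightarrow> 1+0" by (intro tendsto_add tendsto_const tendsto_divide_0[OF tendsto_const inf])
	moreover have "\<forall>\<^sub>F n in sequentially. 1+(a-b)/(b + of_nat n)=(a + of_nat n)/(b + of_nat n)"
		using filterlim_at_infinity_imp_eventually_ne[OF inf,of 0] by eventually_elim (simp add: field_simps)
	ultimately show ?thesis by (simp add: filterlim_cong[OF refl refl])
qed

lemma olver_summable:
	assumes z: "norm z < 1" shows "summable (%n. olver_coeff a b c n * z^n)"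
proof -
	define q where "q=(%n. ((a + of_nat n)/(c + of_nat n))*((b + of_nat n)/(1 + of_nat n)) :: complex)"
	define r where "r=(1 + norm z)/2"
	have r: "norm z < r" "r < 1" using z by (auto simp: r_def)
	have "(%n. norm (q n * z)) \<longlonglongrightarrow> norm (1*1 * z)" unfolding q_def by (intro tendsto_intros tendsto_shift_ratio)
	hence "\<forall>\<^sub>F n in sequentially. norm (q n * z) < r" using r by (intro order_tendstoD) auto
	moreover have "\<forall>\<^sub>F n in sequentially. c + of_nat n ~= 0"
		by (intro filterlim_at_infinity_imp_eventually_ne tendsto_add_filterlim_at_infinity[OF tendsto_const] tendsto_of_nat)
	ultimately have "\<forall>\<^sub>F n in sequentially. norm (q n * z) < r & c + of_nat n ~= 0" by eventually_elim simp
	then obtain N where N: "!!n. n >= N ==> norm (q n * z) < r & c + of_nat n ~= 0" unfolding eventually_sequentially by blast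
	show ?thesis
	proof (rule summable_ratio_test[OF r(2)])
		fix n assume n: "n >= N"
		have n1: "(1::complex) + of_nat n ~= 0" by (metis of_nat_Suc of_nat_eq_0_iff nat.distinct(1))
		have "olver_coeff a b c (Suc n)=((a + of_nat n)*(b + of_nat n) * olver_coeff a b c n)/((c + of_nat n)*(1 + of_nat n))"
			using olver_coeff_Suc[of n c a b] N[OF n] n1 by (subst nonzero_eq_divide_eq) (auto simp: mult_ac add.commute)
		hence "olver_coeff a b c (Suc n)=q n * olver_coeff a b c n" by (simp add: q_def)
		hence "olver_coeff a b c (Suc n) * z^Suc n=(q n * z)*(olver_coeff a b c n * z^n)" by simp
		hence "norm (olver_coeff a b c (Suc n) * z^Suc n)=norm (q n * z) * norm (olver_coeff a b c n * z^n)" by (simp only: norm_mult)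
		also have "... <= r * norm (olver_coeff a b c n * z^n)" using N[OF n] by (intro mult_right_mono) auto
		finally show "norm (olver_coeff a b c (Suc n) * z^Suc n) <= r * norm (olver_coeff a b c n * z^n)" .
	qed
qed

lemma powser_euler_operator:
	fixes a :: "nat => complex"
	assumes s: "!!z. norm z < 1 ==> summable (%n. a n * z^n)" and z: "norm z < 1"
	shows "(%n. (of_nat n * a n) * z^n) sums (z * deriv (%z. \<Sum>n. a n * z^n) z)"
proof -
	have "deriv (%z. \<Sum>n. a n * z^n) z=(\<Sum>n. diffs a n * z^n)" using termdiffs_strong'[OF s z] by (rule DERIV_imp_deriv)
	moreover have "summable (%n. diffs a n * z^n)" by (rule termdiff_converges[OF z s])
	ultimately have "(%n. diffs a n * z^n) sums deriv (%z. \<Sum>n. a n * z^n) z" by (simp add: summable_sums)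
	from sums_mult[OF this,of z]
	have "(%n. (of_nat (Suc n) * a (Suc n)) * z^Suc n) sums (z * deriv (%z. \<Sum>n. a n * z^n) z)" by (simp add: diffs_def mult_ac)
	from sums_Suc[OF this] show ?thesis by simp
qed

definition olver_series :: "complex => complex => complex => complex => complex" where
	"olver_series a b c z=(\<Sum>n. olver_coeff a b c n * z^n)"

lemma olver_series_holomorphic: "olver_series a b c holomorphic_on ball 0 1" using termdiffs_strong'[of 1 "olver_coeff a b c",OF olver_summable]
	by (subst holomorphic_on_open) (auto simp: olver_series_def[abs_def] intro!: exI)

lemma olver_series_ode:
	assumes z: "norm z < 1" "z ~= 0"
	shows "z*(1-z) * deriv (deriv (olver_series a b c)) z+(c-(a + b+1) * z) * deriv (olver_series a b c) z
		 - a * b * olver_series a b c z=0"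
proof -
	let ?F = "olver_series a b c" and ?u = "olver_coeff a b c"
	have F: "?F=(%z. \<Sum>n. ?u n * z^n)" by (simp add: olver_series_def[abs_def])
	have s0: "(%n. ?u n * w^n) sums ?F w" if "norm w < 1" for w unfolding F using olver_summable[OF that] by (rule summable_sums)
	have s1: "(%n. (of_nat n * ?u n) * w^n) sums (w * deriv ?F w)" if "norm w < 1" for w
		unfolding F by (rule powser_euler_operator[OF olver_summable that])
	have sm1: "summable (%n. (of_nat n * ?u n) * w^n)" if "norm w < 1" for w using s1[OF that] by (simp add: sums_iff)
	have s2: "(%n. (of_nat n*(of_nat n * ?u n)) * z^n) sums (z * deriv (%z. \<Sum>n. (of_nat n * ?u n) * z^n) z)"
		by (rule powser_euler_operator[OF sm1 z(1)])
	have zb: "z \<in> ball 0 1" using z by simp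
	have hd: "?F field_differentiable at z" "deriv ?F field_differentiable at z"
		using olver_series_holomorphic zb holomorphic_on_imp_differentiable_at[of _ "ball 0 1"] holomorphic_deriv by blast+
	have "deriv (%z. \<Sum>n. (of_nat n * ?u n) * z^n) z=deriv (%z. z * deriv ?F z) z"
	proof (rule complex_derivative_transform_within_open[OF _ _ open_ball zb])
		have eq: "(\<Sum>n. (of_nat n * ?u n) * w^n)=w * deriv ?F w" if "w \<in> ball 0 1" for w using s1[of w] that by (simp add: sums_iff)
		show h: "(%z. z * deriv ?F z) holomorphic_on ball 0 1" by (intro holomorphic_intros holomorphic_deriv olver_series_holomorphic open_ball)
		show "(%z. \<Sum>n. (of_nat n * ?u n) * z^n) holomorphic_on ball 0 1" by (rule holomorphic_transform[OF h]) (use eq in simp)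
		show "(\<Sum>n. (of_nat n * ?u n) * w^n)=w * deriv ?F w" if "w \<in> ball 0 1" for w by (rule eq[OF that])
	qed
	also have "... = deriv ?F z + z * deriv (deriv ?F) z" using hd by simp
	finally have s2': "(%n. (of_nat n*(of_nat n * ?u n)) * z^n) sums (z*(deriv ?F z + z * deriv (deriv ?F) z))" using s2 by simp
	have "(%n. (of_nat n*(of_nat n * ?u n)) * z^n+(c-1)*((of_nat n * ?u n) * z^n))
		 sums (z*(deriv ?F z + z * deriv (deriv ?F) z)+(c-1)*(z * deriv ?F z))" by (intro sums_add sums_mult s2' s1 z)
	hence L: "(%n. (of_nat n*(of_nat n + c-1) * ?u n) * z^n)
		 sums (z*(deriv ?F z + z * deriv (deriv ?F) z)+(c-1)*(z * deriv ?F z))" by (simp add: algebra_simps)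
	have "(%n. (of_nat n*(of_nat n * ?u n)) * z^n+(a + b)*((of_nat n * ?u n) * z^n) + a * b*(?u n * z^n))
		 sums (z*(deriv ?F z + z * deriv (deriv ?F) z)+(a + b)*(z * deriv ?F z) + a * b * ?F z)" by (intro sums_add sums_mult s2' s1 s0 z)
	from sums_mult[OF this,of z]
	have "(%n. ((a + of_nat n)*(b + of_nat n) * ?u n) * z^Suc n)
		 sums (z*(z*(deriv ?F z + z * deriv (deriv ?F) z)+(a + b)*(z * deriv ?F z) + a * b * ?F z))" by (simp add: algebra_simps)
	hence "(%n. (of_nat (Suc n)*(of_nat (Suc n) + c-1) * ?u (Suc n)) * z^Suc n)
		 sums (z*(z*(deriv ?F z + z * deriv (deriv ?F) z)+(a + b)*(z * deriv ?F z) + a * b * ?F z))"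
		by (simp only: olver_coeff_Suc[symmetric]) (simp add: algebra_simps)
	from sums_Suc[OF this]
	have "(%n. (of_nat n*(of_nat n + c-1) * ?u n) * z^n)
		 sums (z*(z*(deriv ?F z + z * deriv (deriv ?F) z)+(a + b)*(z * deriv ?F z) + a * b * ?F z))" by simp
	from sums_unique2[OF L this]
	have "z*(deriv ?F z + z * deriv (deriv ?F) z+(c-1) * deriv ?F z
		 - (z*(deriv ?F z + z * deriv (deriv ?F) z)+(a + b)*(z * deriv ?F z) + a * b * ?F z))=0" by (simp add: algebra_simps)
	hence "deriv ?F z + z * deriv (deriv ?F) z+(c-1) * deriv ?F z
		 - (z*(deriv ?F z + z * deriv (deriv ?F) z)+(a + b)*(z * deriv ?F z) + a * b * ?F z)=0" using z(2) by simp
	thus ?thesis by (simp add: algebra_simps)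
qed

lemma closed_slit: "closed (of_real ` {x::real..} :: complex set)"
proof -
	have "of_real ` {x..} = {z::complex. x <= Re z} \<inter> {z. Im z=0}"
	proof (intro equalityI subsetI)
		fix z assume "z \<in> {z::complex. x <= Re z} \<inter> {z. Im z=0}"
		thus "z \<in> of_real ` {x..}" by (intro image_eqI[of _ _ "Re z"]) (auto simp: complex_eq_iff)
	qed auto
	moreover have "closed ({z::complex. x <= Re z} \<inter> {z. Im z=0})" by (intro closed_Int closed_halfspace_Re_ge closed_halfspace_Im_eq)
	ultimately show ?thesis by simp
qed

lemma slit_segment:
	assumes "z \<in>-(of_real ` {x::real..})" "p < x" "w \<in> closed_segment (of_real p) z"
	shows "w \<in>-(of_real ` {x::real..} :: complex set)"
proof
	assume "w \<in> of_real ` {x..}"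
	then obtain r where r: "w = of_real r" "x <= r" by auto
	obtain t where t: "0 <= t" "t <= 1" "w=(1-t) *\<^sub>R of_real p + t *\<^sub>R z" using assms(3) by (auto simp: closed_segment_def)
	have im: "t * Im z=0" and re: "r=(1-t) * p + t * Re z" using r t(3) by (auto simp: complex_eq_iff)
	have "t ~= 0" using re r(2) assms(2) by auto
	hence "Im z=0" using im by simp
	have "x <= Re z"
	proof (rule ccontr)
		assume "\<not> x <= Re z"
		hence "(1-t) * p + t * Re z < (1-t) * x + t * x"
			using t \<open>t ~= 0\<close> assms(2) by (intro add_le_less_mono mult_left_mono mult_strict_left_mono) auto
		thus False using re r(2) by (simp add: algebra_simps)
	qed
	hence "z = of_real (Re z)" "Re z \<in> {x..}" using \<open>Im z=0\<close> by (auto simp: complex_eq_iff)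
	thus False using assms(1) by (metis ComplD imageI)
qed

lemma connected_from_center:
	assumes "c \<in> S" "!!z. z \<in> S ==> closed_segment c z \<subseteq> S" shows "connected (S :: complex set)"
	by (rule starlike_imp_connected) (use assms in \<open>auto simp: starlike_def\<close>)

lemma connected_slit: "connected (- (of_real ` {x::real..}) :: complex set)"
proof (rule connected_from_center)
	show "of_real (x-1) \<in>-(of_real ` {x::real..} :: complex set)" by (simp del: of_real_diff add: image_iff)
	show "closed_segment (of_real (x-1)) z \<subseteq>-(of_real ` {x::real..})" if "z \<in>-(of_real ` {x::real..})" for z :: complex
		using slit_segment[OF that,of "x-1"] by auto
qed

text \<open>The series is continued along rays from \<open>-1/2\<close> in the plane without \<open>[0,\<infinity>)\<close>, where the
	hypergeometric equation is regular. That continuation agrees with the series on the slit disc, and the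
	two pieces cover the plane without \<open>[1,\<infinity>)\<close>.\<close>

lemma olver_F_continuation_exists:
	"\<exists>f. f holomorphic_on-(of_real ` {1::real..}) & (\<forall>w\<in>ball 0 1. f w = olver_series a b c w)"
proof -
	let ?F = "olver_series a b c"
	define S where "S=(- (of_real ` {0::real..}) :: complex set)"
	define z0 where "z0=(of_real (- 1/2) :: complex)"
	have S: "open S" "z0 \<in> S" unfolding S_def z0_def using closed_slit[of 0]
		by (auto simp: open_Compl image_iff simp del: of_real_divide of_real_minus)
	have seg: "closed_segment z0 z \<subseteq> S" if "z \<in> S" for z using slit_segment[of z 0 "-1/2"] that unfolding S_def z0_def by auto
	have ne: "z ~= 0" "1-z ~= 0" if "z \<in> S" for z
	proof -
		show "z ~= 0" using that unfolding S_def by (metis ComplD atLeast_iff imageI of_real_0 order_refl)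
		show "1-z ~= 0" using that unfolding S_def by (metis ComplD atLeast_iff imageI of_real_1 zero_le_one eq_iff_diff_eq_0)
	qed
	define p where "p=(%z. - (c-(a + b+1) * z)/(z*(1-z)))"
	define q where "q=(%z. a * b/(z*(1-z)))"
	have p: "p holomorphic_on S" and q: "q holomorphic_on S" unfolding p_def q_def using ne by (intro holomorphic_intros; simp)+
	obtain y where y: "y holomorphic_on S" "y z0 = ?F z0" "deriv y z0=deriv ?F z0"
		"!!z. z \<in> S ==> deriv (deriv y) z=p z * deriv y z + q z * y z" using linear_ode_exists[OF S seg p q] by metis
	have eq: "?F z=y z" if "z \<in> S \<inter> ball 0 1" for z
	proof (rule linear_ode_unique[where S = "S \<inter> ball 0 1" and p=p and q=q and ?z0.0=z0 and y = ?F and w=y])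
		show "open (S \<inter> ball 0 1)" using S by auto
		have z0b: "z0 \<in> ball 0 1" by (simp add: z0_def)
		thus z0: "z0 \<in> S \<inter> ball 0 1" using S by simp
		show "connected (S \<inter> ball 0 1)"
		proof (rule connected_from_center[OF z0])
			fix z assume "z \<in> S \<inter> ball 0 1"
			thus "closed_segment z0 z \<subseteq> S \<inter> ball 0 1" using seg closed_segment_subset[OF z0b _ convex_ball] by auto
		qed
		fix z assume z: "z \<in> S \<inter> ball 0 1"
		have "z*(1-z) * deriv (deriv ?F) z = - (c-(a + b+1) * z) * deriv ?F z + a * b * ?F z"
			using olver_series_ode[of z a b c] ne[of z] z by (simp add: algebra_simps)
		hence "deriv (deriv ?F) z=(- (c-(a + b+1) * z) * deriv ?F z + a * b * ?F z)/(z*(1-z))" using ne[of z] z by (simp add: field_simps)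
		thus "deriv (deriv ?F) z=p z * deriv ?F z + q z * ?F z" by (simp add: p_def q_def add_divide_distrib)
	next
		show "?F holomorphic_on S \<inter> ball 0 1" by (rule holomorphic_on_subset[OF olver_series_holomorphic]) auto
	qed (use that y p q in \<open>auto intro: holomorphic_on_subset\<close>)
	define f where "f=(%z. if z \<in> ball 0 1 then ?F z else y z)"
	have "f holomorphic_on ball 0 1" by (rule holomorphic_transform[OF olver_series_holomorphic]) (simp add: f_def)
	moreover have "f holomorphic_on S" by (rule holomorphic_transform[OF y(1)]) (use eq in \<open>auto simp: f_def\<close>)
	ultimately have "f holomorphic_on (ball 0 1 \<union> S)" using S by (intro holomorphic_on_Un) auto
	moreover have "- (of_real ` {1::real..}) \<subseteq> ball 0 1 \<union> S"
	proof
		fix z :: complex assume z: "z \<in>-(of_real ` {1::real..})"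
		show "z \<in> ball 0 1 \<union> S"
		proof (cases "z \<in> S")
			case False
			then obtain r where r: "z = of_real r" "0 <= r" by (auto simp: S_def)
			hence "r < 1" using z by (metis ComplD atLeast_iff imageI not_le)
			thus ?thesis using r by simp
		qed simp
	qed
	ultimately have "f holomorphic_on-(of_real ` {1::real..})" by (rule holomorphic_on_subset)
	thus ?thesis by (intro exI[of _ f]) (auto simp: f_def)
qed

lemma olver_F_properties:
	shows olver_F_holomorphic: "olver_F a b c holomorphic_on-(of_real ` {1::real..})"
		and olver_F_series: "!!w. norm w < 1 ==> olver_F a b c w = olver_series a b c w"
proof -
	let ?P = "%f. f holomorphic_on-(of_real ` {1::real..}) &
				(\<forall>w\<in>ball 0 1. (%n. pochhammer a n * pochhammer b n * rGamma (c + of_nat n)/fact n * w^n) sums f w)"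
	have "(%n. olver_coeff a b c n * w^n) sums olver_series a b c w" if "w \<in> ball 0 1" for w
		unfolding olver_series_def using that by (intro summable_sums olver_summable) simp
	hence "\<exists>f. ?P f" using olver_F_continuation_exists[of a b c] unfolding olver_coeff_def by auto
	hence P: "?P (SOME f. ?P f)" by (rule someI_ex)
	have eq: "olver_F a b c=(SOME f. ?P f)" by (simp add: olver_F_def fun_eq_iff)
	show "olver_F a b c holomorphic_on-(of_real ` {1::real..})" using P unfolding eq by blast
	fix w :: complex assume w: "norm w < 1"
	hence "(%n. olver_coeff a b c n * w^n) sums olver_F a b c w" using P unfolding eq olver_coeff_def by auto
	thus "olver_F a b c w = olver_series a b c w" by (simp add: olver_series_def sums_iff)
qed

lemma open_cut: "open (- (of_real ` {1::real..}) :: complex set)" using closed_slit by (simp add: open_Compl)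

lemma olver_F_deriv_eq:
	assumes "norm w < 1"
	shows "deriv (olver_F a b c) w=deriv (olver_series a b c) w"
		"deriv (deriv (olver_F a b c)) w=deriv (deriv (olver_series a b c)) w"
proof -
	have sub: "ball 0 1 \<subseteq>-(of_real ` {1::real..} :: complex set)" by auto
	have h: "olver_F a b c holomorphic_on ball 0 1" by (rule holomorphic_on_subset[OF olver_F_holomorphic sub])
	have d: "deriv (olver_F a b c) w=deriv (olver_series a b c) w" if "w \<in> ball 0 1" for w
		by (rule complex_derivative_transform_within_open[OF h olver_series_holomorphic open_ball that])
			 (simp add: olver_F_series)
	thus "deriv (olver_F a b c) w=deriv (olver_series a b c) w" using assms by simp
	show "deriv (deriv (olver_F a b c)) w=deriv (deriv (olver_series a b c)) w"
		by (rule complex_derivative_transform_within_open[OF holomorphic_deriv[OF h open_ball]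
					holomorphic_deriv[OF olver_series_holomorphic open_ball] open_ball]) (use d assms in auto)
qed

lemma olver_F_ode:
	assumes z: "z \<in>-(of_real ` {1::real..})"
	shows "z*(1-z) * deriv (deriv (olver_F a b c)) z+(c-(a + b+1) * z) * deriv (olver_F a b c) z
		 - a * b * olver_F a b c z=0"
proof (rule holomorphic_eq_on_connected_set[where S = "- (of_real ` {1::real..})" and U = "of_real ` {1/4..1/2}"
			and a = "1/4" and b = "1/2" and g = "%_. 0" and f = "%z. z*(1-z) * deriv (deriv (olver_F a b c)) z
				+ (c-(a + b+1) * z) * deriv (olver_F a b c) z-a * b * olver_F a b c z"])
	let ?f = "olver_F a b c"
	show "(%z. z*(1-z) * deriv (deriv ?f) z+(c-(a + b+1) * z) * deriv ?f z-a * b * ?f z) holomorphic_on-(of_real ` {1::real..})"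
		by (intro holomorphic_intros holomorphic_deriv olver_F_holomorphic open_cut)
	show "connected (complex_of_real ` {1/4..1/2})" by (intro connected_continuous_image continuous_intros) auto
	show "1/4 \<in> complex_of_real ` {1/4..1/2}" by (intro image_eqI[of _ _ "1/4"]) auto
	show "1/2 \<in> complex_of_real ` {1/4..1/2}" by (intro image_eqI[of _ _ "1/2"]) auto
	fix z assume "z \<in> complex_of_real ` {1/4..1/2}"
	hence z: "norm z < 1" "z ~= 0" by auto
	show "z*(1-z) * deriv (deriv ?f) z+(c-(a + b+1) * z) * deriv ?f z-a * b * ?f z=0"
		using olver_series_ode[OF z,of a b c] unfolding olver_F_deriv_eq[OF z(1)] olver_F_series[OF z(1)] .
qed (use z open_cut connected_slit in auto)

lemma olver_F_real_derivs:
	assumes "x < 1"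
	shows "(olver_F a b c has_field_derivative deriv (olver_F a b c) (of_real x)) (at (of_real x))"
		"(deriv (olver_F a b c) has_field_derivative deriv (deriv (olver_F a b c)) (of_real x)) (at (of_real x))"
proof -
	have "of_real x \<in>-(of_real ` {1::real..} :: complex set)" using assms by auto
	thus "(olver_F a b c has_field_derivative deriv (olver_F a b c) (of_real x)) (at (of_real x))"
		"(deriv (olver_F a b c) has_field_derivative deriv (deriv (olver_F a b c)) (of_real x)) (at (of_real x))"
		using olver_F_holomorphic holomorphic_deriv open_cut by (blast intro: holomorphic_derivI)+
qed

section \<open>An Abelian theorem\<close>

text \<open>The comparison coefficients \<open>v\<close> are those of \<open>(1 - x)\<close> to the power \<open>-(M + 1)\<close>.\<close>

lemma abel_polynomial_growth:
	fixes c :: "nat => complex" and M :: nat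
	defines "v \<equiv> %n. pochhammer (real M+1) n/fact n"
	assumes lim: "(%n. c n/of_real (v n)) \<longlonglongrightarrow> L"
		and s: "!!x. 0 <= x ==> x < 1 ==> summable (%n. c n * of_real x^n)"
	shows "((%x. of_real ((1-x)^(M+1))*(\<Sum>n. c n * of_real x^n)) \<longlongrightarrow> L) (at_left 1)"
proof -
	have vpos: "v n > 0" for n unfolding v_def by (simp add: pochhammer_pos)
	have vs: "(%n. v n * x^n) sums (1/(1-x)^(M+1))" if x: "0 <= x" "x < 1" for x :: real
	proof -
		have "(%n. ((- (real M+1)) gchoose n)*(- x)^n) sums (1+(- x)) powr (- (real M+1))" by (rule gen_binomial_real) (use x in auto)
		moreover have "((- (real M+1)) gchoose n)*(- x)^n=v n * x^n" for n
		proof -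
			have "((- (real M+1)) gchoose n)*(- x)^n=v n*(((- 1)^n)*(- x)^n)" unfolding gbinomial_pochhammer v_def minus_minus
				by (simp only: mult_ac times_divide_eq_right times_divide_eq_left)
			also have "((- 1)^n)*(- x)^n=x^n" by (simp flip: power_mult_distrib)
			finally show ?thesis .
		qed
		moreover have "(1+(- x)) powr (- (real M+1))=1/(1-x)^(M+1)"
		proof -
			have "(1-x) powr (- (real (M+1)))=1/(1-x)^(M+1)" using x by (simp only: powr_minus powr_realpow inverse_eq_divide diff_gt_0_iff_gt)
			thus ?thesis by (simp add: add.commute)
		qed
		ultimately show ?thesis by simp
	qed
	show ?thesis
	proof (rule tendstoI)
		fix e :: real assume e: "e > 0"
		hence "\<forall>\<^sub>F n in sequentially. dist (c n/of_real (v n)) L < e/2" by (intro tendstoD[OF lim]) simp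
		then obtain N where N: "!!n. n >= N ==> norm (c n/of_real (v n)-L) < e/2" unfolding eventually_sequentially dist_norm by blast
		have dn: "norm (c n-L * of_real (v n)) <= e/2 * v n" if "n >= N" for n
		proof -
			have "c n-L * of_real (v n)=(c n/of_real (v n)-L) * of_real (v n)" using vpos[of n] by (simp add: field_simps)
			hence "norm (c n-L * of_real (v n))=norm (c n/of_real (v n)-L) * v n" using vpos[of n] by (simp add: norm_mult)
			also have "... <= e/2 * v n" using N[OF that] vpos[of n] by (intro mult_right_mono) auto
			finally show ?thesis .
		qed
		define B where "B=(\<Sum>n<N. norm (c n-L * of_real (v n)))"
		have bound: "norm (of_real ((1-x)^(M+1))*(\<Sum>n. c n * of_real x^n)-L) <= (1-x)^(M+1) * B + e/2"
			if x: "0 <= x" "x < 1" for x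
		proof -
			have vsx: "(%n. of_real (v n * x^n)) sums (of_real (1/(1-x)^(M+1)) :: complex)" using vs[OF x] by (simp only: sums_of_real_iff)
			have d: "(%n. (c n-L * of_real (v n)) * of_real x^n) sums ((\<Sum>n. c n * of_real x^n)-L * of_real (1/(1-x)^(M+1)))"
				using sums_diff[OF summable_sums[OF s[OF x]] sums_mult[OF vsx,of L]] by (simp add: algebra_simps)
			define g where "g n=(if n < N then norm (c n-L * of_real (v n)) else 0) + e/2*(v n * x^n)" for n
			have gs: "g sums (B + e/2*(1/(1-x)^(M+1)))"
				unfolding g_def B_def using sums_add[OF sums_If_finite_set[of "{..<N}" "%n. norm (c n-L * of_real (v n))"] sums_mult[OF vs[OF x],of "e/2"]]
				by simp
			have le: "norm ((c n-L * of_real (v n)) * of_real x^n) <= g n" for n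
			proof (cases "n < N")
				case True
				have "norm ((c n-L * of_real (v n)) * of_real x^n) <= norm (c n-L * of_real (v n))*1"
					unfolding norm_mult using x by (intro mult_left_mono) (auto simp: norm_power power_le_one)
				also have "... <= g n" using True vpos[of n] x e by (simp add: g_def)
				finally show ?thesis .
			next
				case False
				have "norm ((c n-L * of_real (v n)) * of_real x^n)=norm (c n-L * of_real (v n)) * x^n" using x by (simp add: norm_mult norm_power)
				also have "... <= (e/2 * v n) * x^n" using dn[of n] False x by (intro mult_right_mono) auto
				finally show ?thesis using False by (simp add: g_def)
			qed
			have "norm ((\<Sum>n. c n * of_real x^n)-L * of_real (1/(1-x)^(M+1))) <= B + e/2*(1/(1-x)^(M+1))" unfolding sums_unique[OF d] sums_unique[OF gs]
				by (rule norm_suminf_le[OF le sums_summable[OF gs]])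
			hence n: "(1-x)^(M+1) * norm ((\<Sum>n. c n * of_real x^n)-L * of_real (1/(1-x)^(M+1)))
					<= (1-x)^(M+1)*(B + e/2*(1/(1-x)^(M+1)))" using x by (intro mult_left_mono) auto
			have p: "(1-x)^(M+1) > 0" using x by simp
			have "of_real ((1-x)^(M+1))*(\<Sum>n. c n * of_real x^n)-L
					= of_real ((1-x)^(M+1))*((\<Sum>n. c n * of_real x^n)-L * of_real (1/(1-x)^(M+1)))"
			proof -
				have "of_real ((1-x)^(M+1)) * of_real (1/(1-x)^(M+1))=(1::complex)"
				proof -
					have "of_real P * of_real (1/P)=(1::complex)" if "P > 0" for P :: real using that by (simp flip: of_real_mult)
					from this[OF p] show ?thesis .
				qed
				thus ?thesis by (simp only: right_diff_distrib mult.left_commute[of _ L] mult_1_right)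
			qed
			hence "norm (of_real ((1-x)^(M+1))*(\<Sum>n. c n * of_real x^n)-L)
					= (1-x)^(M+1) * norm ((\<Sum>n. c n * of_real x^n)-L * of_real (1/(1-x)^(M+1)))" using p by (simp only: norm_mult norm_of_real abs_of_pos)
			also note n
			also have "(1-x)^(M+1)*(B + e/2*(1/(1-x)^(M+1)))=(1-x)^(M+1) * B + e/2"
			proof -
				have "P*(B + e/2*(1/P))=P * B + e/2" if "P > 0" for P :: real using that by (simp add: distrib_left)
				from this[OF p] show ?thesis .
			qed
			finally show ?thesis .
		qed
		have "((%x. (1-x)^(M+1) * B + e/2) \<longlongrightarrow> (1-1)^(M+1) * B + e/2) (at_left 1)" by (intro tendsto_intros)
		hence "\<forall>\<^sub>F x in at_left 1. (1-x)^(M+1) * B + e/2 < e" by (rule order_tendstoD) (use e in simp)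
		moreover have "\<forall>\<^sub>F x in at_left (1::real). 0 <= x & x < 1" by (auto simp: eventually_at_left_field intro!: exI[of _ 0])
		ultimately show "\<forall>\<^sub>F x in at_left 1. dist (of_real ((1-x)^(M+1))*(\<Sum>n. c n * of_real x^n)) L < e"
			by eventually_elim (use bound in \<open>force simp: dist_norm\<close>)
	qed
qed

section \<open>Toroidal functions as solutions of the limiting equation\<close>

text \<open>The limit of the Lame potential seen from the pole, because \<open>\<nu>(\<nu>+1) = m^2 - 1/4\<close> for \<open>\<nu> = |m| - 1/2\<close>.\<close>

definition toroidal_potential :: "nat => int => real => real" where
	"toroidal_potential n m \<tau>=(real n)^2+((of_int m)^2-1/4)/(sinh \<tau>)^2"

lemma of_real_vector_derivative:
	"(f has_real_derivative d) (at t within S) ==> ((%t. of_real (f t) :: complex) has_vector_derivative of_real d) (at t within S)"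
	using bounded_linear.has_vector_derivative[OF bounded_linear_of_real] by (simp add: has_real_derivative_iff_has_vector_derivative)

lemma liouville_normal_form:
	fixes U U' :: "real => complex"
	assumes "!!t. t \<in> S ==> (\<phi> has_real_derivative p t*\<phi> t) (at t)"
		and "!!t. t \<in> S ==> (p has_real_derivative p' t) (at t)"
		and "!!t. t \<in> S ==> (U has_vector_derivative U' t) (at t)"
		and "!!t. t \<in> S ==> (U' has_vector_derivative of_real (g t) * U t-of_real (2 * p t) * U' t) (at t)"
		and "!!t. t \<in> S ==> V t=g t + p' t+(p t)^2"
	shows "schroedinger_on S V (%t. of_real (\<phi> t) * U t) (%t. of_real (\<phi> t)*(of_real (p t) * U t + U' t))" unfolding schroedinger_on_def
proof (intro ballI conjI)
	fix t assume t: "t \<in> S"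
	note d=assms(1-4)[OF t]
	note dw = of_real_vector_derivative[OF d(1)] of_real_vector_derivative[OF d(2)] d(3) d(4)
	have "((%t. of_real (\<phi> t) * U t) has_vector_derivative of_real (\<phi> t) * U' t + of_real (p t*\<phi> t) * U t) (at t)"
		by (intro has_vector_derivative_mult dw)
	thus "((%t. of_real (\<phi> t) * U t) has_vector_derivative of_real (\<phi> t)*(of_real (p t) * U t + U' t)) (at t within S)"
		by (rule has_vector_derivative_at_within[OF has_vector_derivative_eq_rhs]) (simp add: algebra_simps)
	have "((%t. of_real (\<phi> t)*(of_real (p t) * U t + U' t)) has_vector_derivative
			of_real (\<phi> t)*((of_real (p t) * U' t + of_real (p' t) * U t)+(of_real (g t) * U t-of_real (2 * p t) * U' t))
			+ of_real (p t*\<phi> t)*(of_real (p t) * U t + U' t)) (at t)" by (intro has_vector_derivative_mult has_vector_derivative_add dw)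
	thus "((%t. of_real (\<phi> t)*(of_real (p t) * U t + U' t)) has_vector_derivative V t *\<^sub>R (of_real (\<phi> t) * U t)) (at t within S)"
		by (rule has_vector_derivative_at_within[OF has_vector_derivative_eq_rhs])
			 (simp add: assms(5)[OF t] scaleR_conv_of_real algebra_simps power2_eq_square)
qed

lemma olver_F_compose_derivs:
	assumes "(x has_real_derivative x' t) (at t)" "(x' has_real_derivative x'') (at t)" "x t < 1"
	shows "((%t. olver_F a b c (of_real (x t))) has_vector_derivative of_real (x' t) * deriv (olver_F a b c) (of_real (x t))) (at t)"
		"((%t. of_real (x' t) * deriv (olver_F a b c) (of_real (x t))) has_vector_derivative
			of_real (x' t)*(of_real (x' t) * deriv (deriv (olver_F a b c)) (of_real (x t)))
			+ of_real x'' * deriv (olver_F a b c) (of_real (x t))) (at t)"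
proof -
	note d = olver_F_real_derivs[OF assms(3),of a b c]
	show "((%t. olver_F a b c (of_real (x t))) has_vector_derivative of_real (x' t) * deriv (olver_F a b c) (of_real (x t))) (at t)"
		using field_vector_diff_chain_at[OF of_real_vector_derivative[OF assms(1)] d(1)] by (simp add: o_def)
	have "((%t. deriv (olver_F a b c) (of_real (x t))) has_vector_derivative of_real (x' t) * deriv (deriv (olver_F a b c)) (of_real (x t))) (at t)"
		using field_vector_diff_chain_at[OF of_real_vector_derivative[OF assms(1)] d(2)] by (simp add: o_def)
	thus "((%t. of_real (x' t) * deriv (olver_F a b c) (of_real (x t))) has_vector_derivative
			of_real (x' t)*(of_real (x' t) * deriv (deriv (olver_F a b c)) (of_real (x t)))
			+ of_real x'' * deriv (olver_F a b c) (of_real (x t))) (at t)" by (intro has_vector_derivative_mult of_real_vector_derivative assms(2))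
qed

definition tor_P_amp :: "int => real => real" where
	"tor_P_amp m t=exp (ln (sinh t)/2-of_int m * ln (tanh (t/2)))"

definition tor_P_rate :: "int => real => real" where
	"tor_P_rate m t=(cosh t-2 * of_int m)/(2 * sinh t)"

definition tor_P_F :: "nat => int => complex => complex" where
	"tor_P_F n m = olver_F (1/2-of_nat n) (of_nat n+1/2) (1-of_int m)"

text \<open>The associated Legendre function at \<open>cosh t\<close> times \<open>sqrt (sinh t)\<close>; this factor removes the first-order term from Legendre's equation.\<close>

definition tor_P :: "nat => int => real => complex" where
	"tor_P n m t = of_real (tor_P_amp m t) * tor_P_F n m (of_real (- (sinh (t/2))\<^sup>2))"

definition tor_P' :: "nat => int => real => complex" where
	"tor_P' n m t = of_real (tor_P_amp m t)*(of_real (tor_P_rate m t) * tor_P_F n m (of_real (- (sinh (t/2))\<^sup>2))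
		 + of_real (- sinh t/2) * deriv (tor_P_F n m) (of_real (- (sinh (t/2))\<^sup>2)))"

lemma cosh_half: "cosh t=1+2*(sinh (t/2))^2" "sinh t=2 * sinh (t/2) * cosh (t/2)" for t :: real
	using cosh_double[of "t/2"] sinh_double[of "t/2"] by (simp_all add: cosh_square_eq)

lemma tor_P_solution: "schroedinger_on {0<..} (toroidal_potential n m) (tor_P n m) (tor_P' n m)"
proof -
	let ?p' = "%t. (2 * of_int m * cosh t-1)/(2*(sinh t)^2)"
	have "schroedinger_on {0<..} (toroidal_potential n m)
		(%t. of_real (tor_P_amp m t) * tor_P_F n m (of_real (- (sinh (t/2))\<^sup>2)))
		(%t. of_real (tor_P_amp m t)*(of_real (tor_P_rate m t) * tor_P_F n m (of_real (- (sinh (t/2))\<^sup>2))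
		 + of_real (- sinh t/2) * deriv (tor_P_F n m) (of_real (- (sinh (t/2))\<^sup>2))))"
	proof (rule liouville_normal_form[where g = "%t. (real n)\<^sup>2-1/4" and p' = ?p'])
		fix t :: real assume "t \<in> {0<..}"
		hence t: "t > 0" by simp
		have S: "sinh t > 0" "sinh (t/2) > 0" "cosh (t/2) > 0" "tanh (t/2) > 0" using t by auto
		have "((%t. ln (tanh (t/2))) has_real_derivative 1/sinh t) (at t)"
		proof -
			have "((%t. ln (tanh (t/2))) has_real_derivative inverse (tanh (t/2))*((1-(tanh (t/2))\<^sup>2)*(1/2))) (at t)"
				using S by (auto intro!: derivative_eq_intros simp: field_simps)
			moreover have "inverse (tanh (t/2))*((1-(tanh (t/2))\<^sup>2)*(1/2))=1/sinh t"
			proof -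
				have "1-(tanh (t/2))\<^sup>2=1/(cosh (t/2))^2" using S by (simp add: tanh_def power_divide divide_simps) (simp add: cosh_square_eq)
				thus ?thesis using S unfolding cosh_half(2)[of t] by (simp add: tanh_def power2_eq_square)
			qed
			ultimately show ?thesis by simp
		qed
		moreover have "((%t. ln (sinh t)) has_real_derivative cosh t/sinh t) (at t)" using S by (auto intro!: derivative_eq_intros)
		ultimately have "((%t. ln (sinh t)/2-of_int m * ln (tanh (t/2))) has_real_derivative cosh t/sinh t/2-of_int m*(1/sinh t)) (at t)"
			by (intro DERIV_diff DERIV_cdivide DERIV_cmult)
		from DERIV_fun_exp[OF this]
		show "(tor_P_amp m has_real_derivative tor_P_rate m t * tor_P_amp m t) (at t)" unfolding tor_P_amp_def[abs_def] tor_P_rate_def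
			by (rule DERIV_cong) (use S in \<open>simp add: field_simps\<close>)
		have "((%t. (cosh t-2 * of_int m)/(2 * sinh t)) has_real_derivative
			 (sinh t*(2 * sinh t)-(cosh t-2 * of_int m)*(2 * cosh t))/((2 * sinh t)*(2 * sinh t))) (at t)" using S by (auto intro!: derivative_eq_intros)
		thus "(tor_P_rate m has_real_derivative ?p' t) (at t)" unfolding tor_P_rate_def[abs_def]
		proof (rule DERIV_cong)
			have "sinh t*(2 * sinh t)-(cosh t-2 * of_int m)*(2 * cosh t)=2*((sinh t)^2-(cosh t)\<^sup>2)+4 * of_int m * cosh t"
				by (simp add: algebra_simps power2_eq_square)
			also have "... = 2*(2 * of_int m * cosh t-1)" by (simp add: cosh_square_eq algebra_simps)
			finally show "(sinh t*(2 * sinh t)-(cosh t-2 * of_int m)*(2 * cosh t))/((2 * sinh t)*(2 * sinh t))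
				= (2 * of_int m * cosh t-1)/(2*(sinh t)^2)" using S by (simp only: power2_eq_square)
		qed
		let ?x = "%t. - (sinh (t/2))\<^sup>2" and ?x' = "%t. - sinh t/2"
		have dx: "(?x has_real_derivative ?x' t) (at t)" unfolding cosh_half(2)[of t] by (auto intro!: derivative_eq_intros)
		have dx': "(?x' has_real_derivative-cosh t/2) (at t)" by (auto intro!: derivative_eq_intros)
		have lt: "?x t < 1" using S zero_less_power[of "sinh (t/2)" 2] by linarith
		note d = olver_F_compose_derivs[OF dx dx' lt,of "1/2-of_nat n" "of_nat n+1/2" "1-of_int m",folded tor_P_F_def]
		show "((%t. tor_P_F n m (of_real (?x t))) has_vector_derivative of_real (?x' t) * deriv (tor_P_F n m) (of_real (?x t))) (at t)" by (rule d(1))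
		let ?f = "tor_P_F n m (of_real (?x t))" and ?f1 = "deriv (tor_P_F n m) (of_real (?x t))" and ?f2 = "deriv (deriv (tor_P_F n m)) (of_real (?x t))"
		have cut: "complex_of_real (?x t) \<in>-(of_real ` {1::real..})" using lt by (auto simp del: of_real_minus of_real_power)
		define z :: complex where "z = of_real (?x t)"
		have "z*(1-z) * ?f2+((1-of_int m)-2 * z) * ?f1-(1/4-(of_nat n)\<^sup>2) * ?f=0"
			using olver_F_ode[OF cut,of "1/2-of_nat n" "of_nat n+1/2" "1-of_int m"]
			unfolding tor_P_F_def[symmetric] z_def[symmetric] by (simp add: algebra_simps power2_eq_square)
		moreover have "z*(1-z) = - (of_real (?x' t) * of_real (?x' t))"
		proof -
			have "?x t*(1 - ?x t) = - (?x' t * ?x' t)"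
				unfolding cosh_half(2)[of t] by (simp add: power2_eq_square) (simp add: algebra_simps cosh_square_eq[unfolded power2_eq_square])
			hence "complex_of_real (?x t*(1 - ?x t)) = of_real (- (?x' t * ?x' t))" by (rule arg_cong)
			thus ?thesis unfolding z_def by (simp del: of_real_power)
		qed
		moreover have "(1-of_int m)-2 * z = of_real (cosh t-of_int m)" unfolding z_def cosh_half(1)[of t] by simp
		ultimately have ode: "- (of_real (?x' t) * of_real (?x' t)) * ?f2 + of_real (cosh t-of_int m) * ?f1-(1/4-(of_nat n)\<^sup>2) * ?f=0" by (simp only:)
		have "- (x * x) * u + y-w=0 ==> x*(x * u)=y-w" for x u y w :: complex by (simp add: algebra_simps)
		from this[OF ode] have "of_real (?x' t)*(of_real (?x' t) * ?f2) = of_real (cosh t-of_int m) * ?f1-(1/4-(of_nat n)\<^sup>2) * ?f" .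
		hence e: "of_real (?x' t)*(of_real (?x' t) * ?f2) + of_real (- cosh t/2) * ?f1
			 = of_real ((real n)^2-1/4) * ?f + of_real (cosh t/2-of_int m) * ?f1" by (simp add: algebra_simps)
		have "- (2 * tor_P_rate m t) * ?x' t = cosh t/2-of_int m" using S by (simp add: tor_P_rate_def field_simps)
		moreover have "of_real (2 * tor_P_rate m t)*(of_real (?x' t) * ?f1) = - (of_real (- (2 * tor_P_rate m t) * ?x' t) * ?f1)"
			by (simp only: of_real_mult of_real_minus mult_minus_left minus_minus mult.assoc)
		ultimately have r: "of_real (2 * tor_P_rate m t)*(of_real (?x' t) * ?f1) = - (of_real (cosh t/2-of_int m) * ?f1)" by (simp only:)
		show "((%t. of_real (?x' t) * deriv (tor_P_F n m) (of_real (?x t))) has_vector_derivative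
			 of_real ((real n)^2-1/4) * ?f-of_real (2 * tor_P_rate m t)*(of_real (?x' t) * ?f1)) (at t)" unfolding r using d(2) unfolding e by simp
		have "((cosh t-2 * of_int m)/(2 * sinh t))^2 + ?p' t=((cosh t)^2-2+4*(of_int m)^2)/(4*(sinh t)^2)"
			using S by (simp add: power_divide divide_simps) (simp add: algebra_simps power2_eq_square)
		also have "... = 1/4+((of_int m)^2-1/4)/(sinh t)^2" using S by (simp add: cosh_square_eq divide_simps)
		finally show "toroidal_potential n m t=((real n)^2-1/4) + ?p' t+(tor_P_rate m t)^2" by (simp add: toroidal_potential_def tor_P_rate_def)
	qed
	thus ?thesis unfolding tor_P_def[abs_def] tor_P'_def[abs_def] .
qed

definition tor_Q_amp :: "nat => int => real => real" where
	"tor_Q_amp n m t=exp ((of_int m+1/2) * ln (tanh t)-real n * ln (cosh t))"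

definition tor_Q_rate :: "nat => int => real => real" where
	"tor_Q_rate n m t=(of_int m+1/2)/(sinh t * cosh t)-real n * tanh t"

definition tor_Q_par :: "nat => int => complex" where
	"tor_Q_par n m=(of_nat n + of_int m+1/2)/2"

definition tor_Q_F :: "nat => int => complex => complex" where
	"tor_Q_F n m = olver_F (tor_Q_par n m) (tor_Q_par n m+1/2) (of_nat n+1)"

text \<open>A constant multiple of \<open>sqrt (sinh t)\<close> times the Legendre function of the second kind at \<open>cosh t\<close>.\<close>

definition tor_Q :: "nat => int => real => complex" where
	"tor_Q n m t = of_real (tor_Q_amp n m t) * tor_Q_F n m (of_real (1/(cosh t)^2))"

definition tor_Q' :: "nat => int => real => complex" where
	"tor_Q' n m t = of_real (tor_Q_amp n m t)*(of_real (tor_Q_rate n m t) * tor_Q_F n m (of_real (1/(cosh t)^2))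
		 + of_real (- 2 * sinh t/cosh t^3) * deriv (tor_Q_F n m) (of_real (1/(cosh t)^2)))"

lemma tor_Q_solution: "schroedinger_on {0<..} (toroidal_potential n m) (tor_Q n m) (tor_Q' n m)"
proof -
	let ?X = "%t::real. 1/(cosh t)^2" and ?X' = "%t::real. - 2 * sinh t/cosh t^3"
	let ?g = "%t. (real n + of_int m+1/2)*(real n + of_int m+3/2) * ?X t"
	let ?p' = "%t. - (of_int m+1/2)*(1/(sinh t)^2 + ?X t)-real n * ?X t"
	have "schroedinger_on {0<..} (toroidal_potential n m)
		(%t. of_real (tor_Q_amp n m t) * tor_Q_F n m (of_real (?X t)))
		(%t. of_real (tor_Q_amp n m t)*(of_real (tor_Q_rate n m t) * tor_Q_F n m (of_real (?X t))
		 + of_real (?X' t) * deriv (tor_Q_F n m) (of_real (?X t))))"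
	proof (rule liouville_normal_form[where g = ?g and p' = ?p'])
		fix t :: real assume "t \<in> {0<..}"
		hence t: "t > 0" by simp
		define s c where "s=sinh t" and "c = cosh t"
		have S: "s > 0" "c > 0" "tanh t > 0" using t by (auto simp: s_def c_def)
		have c2: "c^2=s^2+1" by (simp add: s_def c_def cosh_square_eq)
		have th: "tanh t=s/c" by (simp add: tanh_def s_def c_def)
		have th2: "1-(tanh t)\<^sup>2=1/c^2" unfolding th using S c2[symmetric] by (simp add: power_divide divide_simps)
		have "((%t. (of_int m+1/2) * ln (tanh t)-real n * ln (cosh t)) has_real_derivative
			 (of_int m+1/2)*(inverse (tanh t)*(1-(tanh t)\<^sup>2))-real n*(inverse (cosh t) * sinh t)) (at t)"
			using S unfolding c_def by (auto intro!: derivative_eq_intros simp: field_simps)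
		from DERIV_fun_exp[OF this]
		show "(tor_Q_amp n m has_real_derivative tor_Q_rate n m t * tor_Q_amp n m t) (at t)"
			unfolding tor_Q_amp_def[abs_def] tor_Q_rate_def th2 unfolding th s_def[symmetric] c_def[symmetric]
			by (rule DERIV_cong) (use S in \<open>simp add: field_simps power2_eq_square\<close>)
		have d1: "((%t. (of_int m+1/2)/(sinh t * cosh t)) has_real_derivative-(of_int m+1/2)*(1/s^2+1/c^2)) (at t)"
		proof -
			have "((%t. sinh t * cosh t) has_real_derivative c * c + s * s) (at t)" unfolding s_def c_def by (auto intro!: derivative_eq_intros)
			from DERIV_divide[OF DERIV_const[of "of_int m+1/2"] this]
			have "((%t. (of_int m+1/2)/(sinh t * cosh t)) has_real_derivative
				 (0*(s * c)-(of_int m+1/2)*(c * c + s * s))/((s * c)*(s * c))) (at t)" using S unfolding s_def c_def by simp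
			thus ?thesis by (rule DERIV_cong) (use S in \<open>simp add: field_simps power2_eq_square\<close>)
		qed
		have d2: "((%t. real n * tanh t) has_real_derivative real n*(1/c^2)) (at t)"
			unfolding th2[symmetric] using S unfolding c_def by (auto intro!: derivative_eq_intros)
		show "(tor_Q_rate n m has_real_derivative ?p' t) (at t)" unfolding tor_Q_rate_def[abs_def] using DERIV_diff[OF d1 d2] unfolding s_def c_def by simp
		have dX: "(?X has_real_derivative ?X' t) (at t)"
		proof -
			have "((%t. 1/(cosh t)^2) has_real_derivative (0 * c^2-1*(2 * c * s))/(c^2 * c^2)) (at t)"
				unfolding s_def c_def by (auto intro!: derivative_eq_intros)
			thus ?thesis unfolding s_def[symmetric] c_def[symmetric]
				by (rule DERIV_cong) (use S in \<open>simp add: field_simps power2_eq_square power3_eq_cube\<close>)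
		qed
		have dX': "(?X' has_real_derivative 4 * ?X t-6*(?X t)^2) (at t)"
		proof -
			have "(?X' has_real_derivative ((- 2 * c) * c^3-(- 2 * s)*(3 * c^2 * s))/(c^3 * c^3)) (at t)"
			proof -
				have n: "((%t. - 2 * sinh t) has_real_derivative-2 * c) (at t)" unfolding c_def by (auto intro!: derivative_eq_intros)
				have d: "((%t. cosh t^3) has_real_derivative 3 * c^2 * s) (at t)" unfolding s_def c_def by (auto intro!: derivative_eq_intros)
				show ?thesis using DERIV_divide[OF n d] S unfolding s_def c_def by simp
			qed
			moreover have "((- 2 * c) * c^3-(- 2 * s)*(3 * c^2 * s))/(c^3 * c^3)=4*(1/c^2)-6*(1/c^2)^2"
			proof -
				have "(- 2 * c) * c^3-(- 2 * s)*(3 * c^2 * s) = c^2*(- 2 * c^2+6 * s^2)" by (simp add: algebra_simps power2_eq_square power3_eq_cube)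
				also have "s^2 = c^2-1" using c2 by simp
				finally have "(- 2 * c) * c^3-(- 2 * s)*(3 * c^2 * s) = c^2*(4 * c^2-6)" by simp
				moreover have "c^3 * c^3 = c^2*(c^2 * c^2)" by (simp add: power2_eq_square power3_eq_cube)
				ultimately show ?thesis using S by (simp add: power_divide diff_divide_distrib power2_eq_square)
			qed
			ultimately show ?thesis unfolding c_def by simp
		qed
		have Xc: "?X t=1/c^2" by (simp add: c_def)
		have "c^2 > 1" using S c2 by simp
		hence lt: "?X t < 1" unfolding Xc by (simp add: divide_less_eq_1)
		note d = olver_F_compose_derivs[OF dX dX' lt,of "tor_Q_par n m" "tor_Q_par n m+1/2" "of_nat n+1",folded tor_Q_F_def]
		show "((%t. tor_Q_F n m (of_real (?X t))) has_vector_derivative of_real (?X' t) * deriv (tor_Q_F n m) (of_real (?X t))) (at t)" by (rule d(1))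
		let ?f = "tor_Q_F n m (of_real (?X t))" and ?f1 = "deriv (tor_Q_F n m) (of_real (?X t))" and ?f2 = "deriv (deriv (tor_Q_F n m)) (of_real (?X t))"
		define x where "x = ?X t"
		have cut: "complex_of_real x \<in>-(of_real ` {1::real..})" using lt by (auto simp: x_def simp del: of_real_divide)
		have ode: "of_real x*(1-of_real x) * ?f2+((of_nat n+1)-(tor_Q_par n m+(tor_Q_par n m+1/2)+1) * of_real x) * ?f1
			 - tor_Q_par n m*(tor_Q_par n m+1/2) * ?f=0" using olver_F_ode[OF cut,of "tor_Q_par n m" "tor_Q_par n m+1/2" "of_nat n+1"]
			unfolding tor_Q_F_def[symmetric] x_def .
		have par: "tor_Q_par n m+(tor_Q_par n m+1/2)+1 = of_real (real n + of_int m+2)"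
			"tor_Q_par n m*(tor_Q_par n m+1/2) = of_real ((real n + of_int m+1/2)*(real n + of_int m+3/2)/4)" by (simp_all add: tor_Q_par_def field_simps)
		have X'2: "?X' t * ?X' t=4 * x*(x*(1-x))"
		proof -
			have "?X' t * ?X' t=4 * s^2/(c^2*(c^2 * c^2))" using S unfolding s_def[symmetric] c_def[symmetric] by (simp add: power2_eq_square power3_eq_cube)
			also have "... = 4*(1/c^2)*((1/c^2)*(1-1/c^2))" using S by (simp add: c2 divide_simps add_pos_nonneg)
			finally show ?thesis unfolding x_def Xc .
		qed
		have rX: "- (2 * tor_Q_rate n m t) * ?X' t=4*(of_int m+1/2) * x^2-4 * real n*(x-x\<^sup>2)"
		proof -
			have "- (2 * tor_Q_rate n m t) * ?X' t=4*(of_int m+1/2)*(1/(c^2 * c^2))-4 * real n*(s^2/(c^2 * c^2))"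
				unfolding tor_Q_rate_def th s_def[symmetric] c_def[symmetric] using S by (simp add: field_simps power2_eq_square power3_eq_cube)
			also have "s^2/(c^2 * c^2)=1/c^2-(1/c^2)\<^sup>2"
			proof -
				have s2: "s^2 = c^2-1" using c2 by simp
				show ?thesis unfolding s2 using S by (simp add: diff_divide_distrib power2_eq_square)
			qed
			finally show ?thesis unfolding x_def Xc by (simp add: power2_eq_square)
		qed
		have "of_real (?X' t)*(of_real (?X' t) * ?f2) = of_real (4 * x)*(of_real x*(1-of_real x) * ?f2)"
		proof -
			have "of_real (?X' t)*(of_real (?X' t) * ?f2) = of_real (?X' t * ?X' t) * ?f2" by (simp only: of_real_mult mult.assoc)
			also have "... = of_real (4 * x)*(of_real x*(1-of_real x) * ?f2)" unfolding X'2 by simp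
			finally show ?thesis .
		qed
		also have "of_real x*(1-of_real x) * ?f2 = of_real ((real n + of_int m+1/2)*(real n + of_int m+3/2)/4) * ?f
			 - ((of_nat n+1)-of_real (real n + of_int m+2) * of_real x) * ?f1"
		proof -
			have "x + y-w=0 ==> x=w-y" for x y w :: complex by (simp add: algebra_simps)
			from this[OF ode] show ?thesis unfolding par .
		qed
		finally have e1: "of_real (?X' t)*(of_real (?X' t) * ?f2) = of_real (4 * x) *
			 (of_real ((real n + of_int m+1/2)*(real n + of_int m+3/2)/4) * ?f
			 - ((of_nat n+1)-of_real (real n + of_int m+2) * of_real x) * ?f1)" .
		have e2: "of_real (?X' t)*(of_real (?X' t) * ?f2) + of_real (4 * x-6 * x^2) * ?f1
			= of_real (?g t) * ?f + of_real (4*(of_int m+1/2) * x^2-4 * real n*(x-x\<^sup>2)) * ?f1"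
			unfolding e1 unfolding x_def[symmetric] by (simp add: algebra_simps power2_eq_square)
		have r: "of_real (2 * tor_Q_rate n m t)*(of_real (?X' t) * ?f1) = - (of_real (4*(of_int m+1/2) * x^2-4 * real n*(x-x\<^sup>2)) * ?f1)"
		proof -
			have "of_real (2 * tor_Q_rate n m t)*(of_real (?X' t) * ?f1) = - (of_real (- (2 * tor_Q_rate n m t) * ?X' t) * ?f1)"
				by (simp only: of_real_mult of_real_minus mult_minus_left minus_minus mult.assoc)
			thus ?thesis unfolding rX .
		qed
		show "((%t. of_real (?X' t) * deriv (tor_Q_F n m) (of_real (?X t))) has_vector_derivative
			 of_real (?g t) * ?f-of_real (2 * tor_Q_rate n m t)*(of_real (?X' t) * ?f1)) (at t)"
			unfolding r diff_minus_eq_add e2[symmetric] using d(2) unfolding x_def .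
		have q1: "1/(s * c)*(1/(s * c))=1/s^2-1/c^2"
		proof -
			have "c * c-s * s=1" using c2 by (simp add: power2_eq_square)
			thus ?thesis using S by (simp add: divide_simps power2_eq_square)
		qed
		have q2: "1/(s * c)*(s/c)=1/c^2" using S by (simp add: power2_eq_square)
		have q3: "(s/c)*(s/c)=1-1/c^2" using th2 unfolding th by (simp add: power2_eq_square)
		have "(tor_Q_rate n m t)^2=((of_int m+1/2)*(1/(s * c))-real n*(s/c))^2" by (simp add: tor_Q_rate_def th s_def c_def)
		also have "... = (of_int m+1/2)^2*(1/(s * c)*(1/(s * c)))-2*(of_int m+1/2) * real n*(1/(s * c)*(s/c))
			 + (real n)^2*((s/c)*(s/c))"
		proof -
			have "(x * a-y * b)^2=x^2*(a * a)-2 * x * y*(a * b) + y^2*(b * b)" for x y a b :: real by (simp add: power2_eq_square algebra_simps)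
			thus ?thesis .
		qed
		finally have "(tor_Q_rate n m t)^2=(of_int m+1/2)^2*(1/s^2-1/c^2)-2*(of_int m+1/2) * real n*(1/c^2)
			 + (real n)^2*(1-1/c^2)" unfolding q1 q2 q3 .
		moreover have "(real n + of_int m+1/2)*(real n + of_int m+3/2) * X+(- (of_int m+1/2)*(Y + X)-real n * X)
			+ ((of_int m+1/2)^2*(Y-X)-2*(of_int m+1/2) * real n * X+(real n)^2*(1-X))=(real n)^2+((of_int m)^2-1/4) * Y" for X Y :: real
			by (simp add: field_simps power2_eq_square)
		ultimately have "?g t + ?p' t+(tor_Q_rate n m t)^2=(real n)^2+((of_int m)^2-1/4)*(1/s^2)"
			unfolding s_def[symmetric] c_def[symmetric] by (simp only:)
		thus "toroidal_potential n m t = ?g t + ?p' t+(tor_Q_rate n m t)^2" unfolding toroidal_potential_def s_def[symmetric] by simp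
	qed
	thus ?thesis unfolding tor_Q_def[abs_def] tor_Q'_def[abs_def] .
qed

lemma legendre_P_tor:
	assumes t: "t > 0"
	shows "of_real (sqrt (sinh t)) * legendre_P (of_nat n-1/2) (of_int m) (of_real (cosh t))=tor_P n m t"
proof -
	have S: "sinh t > 0" "sinh (t/2) > 0" "cosh (t/2) > 0" "tanh (t/2) > 0" using t by auto
	have arg: "(1-complex_of_real (cosh t))/2 = of_real (- (sinh (t/2))\<^sup>2)" unfolding cosh_half(1)[of t] by simp
	define r where "r=(1/tanh (t/2))^2"
	have rpos: "r > 0" using S by (simp add: r_def)
	have "cosh t+1=2*(cosh (t/2))^2" "cosh t-1=2*(sinh (t/2))^2" unfolding cosh_half(1)[of t] by (simp_all add: cosh_square_eq)
	hence "(cosh t+1)/(cosh t-1)=r" using S by (simp add: r_def tanh_def power_divide)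
	hence rat: "(complex_of_real (cosh t)+1)/(of_real (cosh t)-1) = of_real r" by (metis of_real_1 of_real_add of_real_diff of_real_divide)
	have ln_r: "ln r = - 2 * ln (tanh (t/2))" using S by (simp add: r_def ln_realpow ln_div)
	have "complex_of_real r powr (of_int m/2) = of_real r powr of_real (of_int m/2)" by simp
	also have "... = of_real (r powr (of_int m/2))" by (rule powr_of_real) (use rpos in simp)
	also have "r powr (of_int m/2)=exp (- of_int m * ln (tanh (t/2)))" using rpos by (simp add: powr_def ln_r)
	finally have pw: "complex_of_real r powr (of_int m/2) = of_real (exp (- of_int m * ln (tanh (t/2))))" .
	have sq: "sqrt (sinh t)=exp (ln (sinh t)/2)" using S by (simp add: ln_sqrt[symmetric])
	have "sqrt (sinh t) * exp (- of_int m * ln (tanh (t/2)))=tor_P_amp m t" unfolding sq tor_P_amp_def by (simp flip: exp_add)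
	hence amp: "complex_of_real (sqrt (sinh t)) * of_real (exp (- of_int m * ln (tanh (t/2)))) = of_real (tor_P_amp m t)" by (metis of_real_mult)
	have "of_real (sqrt (sinh t)) * legendre_P (of_nat n-1/2) (of_int m) (of_real (cosh t))
		 = (of_real (sqrt (sinh t)) * of_real (exp (- of_int m * ln (tanh (t/2))))) *
				olver_F (- (of_nat n-1/2)) ((of_nat n-1/2)+1) (1-of_int m) (of_real (- (sinh (t/2))\<^sup>2))"
		unfolding legendre_P_def arg rat pw by (simp only: mult.assoc)
	also have "(- (of_nat n-1/2) :: complex)=1/2-of_nat n" by simp
	also have "((of_nat n-1/2)+1 :: complex) = of_nat n+1/2" by simp
	finally show ?thesis unfolding amp tor_P_def tor_P_F_def .
qed

lemma exp_i_int_pi: "(- 1) powi m * exp (\<i> * of_int m * of_real pi)=(1::complex)"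
proof -
	have "exp (\<i> * of_int m * of_real pi) = cis (pi * of_int m)" by (simp add: cis_conv_exp mult_ac)
	also have "... = (if even m then 1 else -1)" by (simp add: complex_eq_iff)
	finally show ?thesis by (simp add: power_int_minus_left)
qed

lemma legendre_Q_tor:
	assumes t: "t > 0"
	shows "(- 1) powi m*(of_real (sqrt (sinh t)) * legendre_Q (of_nat n-1/2) (of_int m) (of_real (cosh t)))
		= of_real (sqrt pi/2 powr (real n+1/2)) * Gamma (of_nat n + of_int m+1/2) * tor_Q n m t"
proof -
	have S: "sinh t > 0" "cosh t > 0" "tanh t > 0" using t by auto
	have c1: "cosh t-1 > 0" using cosh_half(1)[of t] t by simp
	have w1: "complex_of_real (cosh t)-1 = of_real (cosh t-1)" "complex_of_real (cosh t)+1 = of_real (cosh t+1)" by simp_all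
	have pw: "complex_of_real x powr (of_int m/2) = of_real (exp (of_int m/2 * ln x))" if "x > 0" for x
	proof -
		have "complex_of_real x powr (of_int m/2) = of_real x powr of_real (of_int m/2)" by simp
		also have "... = of_real (x powr (of_int m/2))" by (rule powr_of_real) (use that in simp)
		finally show ?thesis using that by (simp add: powr_def)
	qed
	have lnprod: "ln (cosh t-1) + ln (cosh t+1)=2 * ln (sinh t)"
	proof -
		have "(cosh t-1)*(cosh t+1)=(sinh t)^2" unfolding sinh_square_eq by (simp add: algebra_simps power2_eq_square)
		hence "ln ((cosh t-1)*(cosh t+1))=ln ((sinh t)^2)" by simp
		thus ?thesis using c1 S by (simp add: ln_mult ln_realpow)
	qed
	have zm: "(complex_of_real (cosh t)-1) powr (of_int m/2)*(complex_of_real (cosh t)+1) powr (of_int m/2) = of_real (exp (of_int m * ln (sinh t)))"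
	proof -
		have "(complex_of_real (cosh t)-1) powr (of_int m/2)*(complex_of_real (cosh t)+1) powr (of_int m/2)
			= of_real (exp (of_int m/2 * ln (cosh t-1)) * exp (of_int m/2 * ln (cosh t+1)))" unfolding w1 using c1 S by (subst (1 2) pw) auto
		also have "exp (of_int m/2 * ln (cosh t-1)) * exp (of_int m/2 * ln (cosh t+1))=exp (of_int m/2*(ln (cosh t-1) + ln (cosh t+1)))"
			by (simp add: distrib_left exp_add)
		finally show ?thesis unfolding lnprod by simp
	qed
	have e1: "(of_nat n-1/2 :: complex) + of_int m+1 = of_real (real n + of_int m+1/2)" by simp
	have zc: "complex_of_real (cosh t) powr (of_nat n-1/2 + of_int m+1) = of_real (exp ((real n + of_int m+1/2) * ln (cosh t)))"
		unfolding e1 by (subst powr_of_real) (use S in \<open>auto simp: powr_def\<close>)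
	have two: "(2::complex) powr (of_nat n-1/2+1) = of_real (2 powr (real n+1/2))"
	proof -
		have "(of_nat n-1/2+1 :: complex) = of_real (real n+1/2)" by simp
		hence "(2::complex) powr (of_nat n-1/2+1) = of_real 2 powr of_real (real n+1/2)" by (simp only: of_real_numeral)
		also have "... = of_real (2 powr (real n+1/2))" by (rule powr_of_real) simp
		finally show ?thesis .
	qed
	have arg: "1/(complex_of_real (cosh t))^2 = of_real (1/(cosh t)^2)" by simp
	have par: "((of_nat n-1/2 :: complex) + of_int m+1)/2=tor_Q_par n m" "((of_nat n-1/2 :: complex) + of_int m+2)/2=tor_Q_par n m+1/2"
		"(of_nat n-1/2 :: complex)+3/2 = of_nat n+1" by (simp_all add: tor_Q_par_def field_simps)
	have sq: "sqrt (sinh t)=exp (ln (sinh t)/2)" using S by (simp add: ln_sqrt[symmetric])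
	have amp: "sqrt (sinh t) * exp (of_int m * ln (sinh t))/exp ((real n + of_int m+1/2) * ln (cosh t))=tor_Q_amp n m t"
	proof -
		have "ln (tanh t)=ln (sinh t)-ln (cosh t)" using S by (simp add: tanh_def ln_div)
		have "(of_int m+1/2) * ln (tanh t)-real n * ln (cosh t)=ln (sinh t)/2 + of_int m * ln (sinh t)-(real n + of_int m+1/2) * ln (cosh t)"
			unfolding \<open>ln (tanh t)=ln (sinh t)-ln (cosh t)\<close> by (simp add: algebra_simps)
		thus ?thesis unfolding sq tor_Q_amp_def by (simp add: exp_add exp_diff)
	qed
	have g: "(of_nat n-1/2 :: complex) + of_int m+1 = of_nat n + of_int m+1/2" by simp
	let ?F = "tor_Q_F n m (of_real (1/(cosh t)^2))"
	have Q: "legendre_Q (of_nat n-1/2) (of_int m) (of_real (cosh t)) =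
		exp (\<i> * of_int m * of_real pi) * of_real (sqrt pi) * Gamma (of_nat n + of_int m+1/2) * of_real (exp (of_int m * ln (sinh t)))
		/ (of_real (2 powr (real n+1/2)) * of_real (exp ((real n + of_int m+1/2) * ln (cosh t)))) * ?F"
		unfolding legendre_Q_def unfolding zm zc two arg par unfolding g tor_Q_F_def ..
	have "(- 1) powi m*(of_real (sqrt (sinh t)) * legendre_Q (of_nat n-1/2) (of_int m) (of_real (cosh t)))
		= ((- 1) powi m * exp (\<i> * of_int m * of_real pi)) * of_real (sqrt pi/2 powr (real n+1/2)) * Gamma (of_nat n + of_int m+1/2)
			* of_real (sqrt (sinh t) * exp (of_int m * ln (sinh t))/exp ((real n + of_int m+1/2) * ln (cosh t))) * ?F" unfolding Q by simp
	thus ?thesis unfolding exp_i_int_pi amp tor_Q_def by simp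
qed

section \<open>Behaviour of the toroidal functions at infinity\<close>

lemma tor_Q_F_at_0: "tor_Q_F n m 0 = of_real (1/fact n)"
proof -
	have "tor_Q_F n m 0 = olver_series (tor_Q_par n m) (tor_Q_par n m+1/2) (of_nat n+1) 0" unfolding tor_Q_F_def by (rule olver_F_series) simp
	also have "... = olver_coeff (tor_Q_par n m) (tor_Q_par n m+1/2) (of_nat n+1) 0" unfolding olver_series_def by (subst powser_zero) simp
	also have "... = inverse (Gamma (1 + of_nat n))" by (simp add: olver_coeff_def rGamma_inverse_Gamma add.commute)
	also have "... = of_real (1/fact n)" unfolding Gamma_fact by (simp add: inverse_eq_divide)
	finally show ?thesis .
qed

lemma tor_Q_F_limits:
	"((%t. tor_Q_F n m (of_real (1/(cosh t)^2))) \<longlongrightarrow> of_real (1/fact n)) at_top"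
	"((%t. of_real (- 2 * sinh t/cosh t^3) * deriv (tor_Q_F n m) (of_real (1/(cosh t)^2))) \<longlongrightarrow> 0) at_top"
proof -
	have X: "((%t::real. 1/(cosh t)^2) \<longlongrightarrow> 0) at_top" by real_asymp
	have X': "((%t::real. - 2 * sinh t/cosh t^3) \<longlongrightarrow> 0) at_top" by real_asymp
	have Xc: "((%t::real. complex_of_real (1/(cosh t)^2)) \<longlongrightarrow> of_real 0) at_top" by (rule tendsto_of_real[OF X])
	have "isCont (tor_Q_F n m) (of_real 0)" "isCont (deriv (tor_Q_F n m)) (of_real 0)" unfolding tor_Q_F_def
		using olver_F_real_derivs[OF zero_less_one,of "tor_Q_par n m" "tor_Q_par n m+1/2" "of_nat n+1"] by (auto dest: DERIV_isCont)
	from isCont_tendsto_compose[OF this(1) Xc] isCont_tendsto_compose[OF this(2) Xc]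
	have F: "((%t. tor_Q_F n m (of_real (1/(cosh t)^2))) \<longlongrightarrow> tor_Q_F n m (of_real 0)) at_top"
		and F': "((%t. deriv (tor_Q_F n m) (of_real (1/(cosh t)^2))) \<longlongrightarrow> deriv (tor_Q_F n m) (of_real 0)) at_top" .
	show "((%t. tor_Q_F n m (of_real (1/(cosh t)^2))) \<longlongrightarrow> of_real (1/fact n)) at_top" using F unfolding of_real_0 tor_Q_F_at_0 .
	show "((%t. of_real (- 2 * sinh t/cosh t^3) * deriv (tor_Q_F n m) (of_real (1/(cosh t)^2))) \<longlongrightarrow> 0) at_top"
		using tendsto_mult[OF tendsto_of_real[OF X'] F'] by simp
qed

lemma tor_Q_amp_asymp: "((%t. tor_Q_amp n m t * exp (real n * t)) \<longlongrightarrow> 2^n) at_top"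
proof -
	have l1: "((%t::real. ln (tanh t)) \<longlongrightarrow> 0) at_top" by real_asymp
	have l2: "((%t::real. ln (cosh t)-t) \<longlongrightarrow>-ln 2) at_top" by real_asymp (simp add: ln_div)
	have "((%t. exp ((of_int m+1/2) * ln (tanh t)-real n*(ln (cosh t)-t))) \<longlongrightarrow> exp ((of_int m+1/2)*0-real n*(- ln 2))) at_top"
		by (intro tendsto_intros l1 l2)
	moreover have "exp ((of_int m+1/2) * ln (tanh t)-real n*(ln (cosh t)-t))=tor_Q_amp n m t * exp (real n * t)" for t
		unfolding tor_Q_amp_def by (simp add: algebra_simps flip: exp_add)
	moreover have "exp ((of_int m+1/2)*0-real n*(- ln 2))=(2::real)^n" by (simp add: exp_of_nat_mult)
	ultimately show ?thesis by simp
qed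

lemma tor_Q_asymp: "((%t. tor_Q n m t * of_real (exp (real n * t))) \<longlongrightarrow> of_real (2^n/fact n)) at_top"
proof -
	have "((%t. of_real (tor_Q_amp n m t * exp (real n * t)) * tor_Q_F n m (of_real (1/(cosh t)^2))) \<longlongrightarrow> of_real (2^n) * of_real (1/fact n)) at_top"
		by (intro tendsto_mult tendsto_of_real tor_Q_amp_asymp tor_Q_F_limits)
	thus ?thesis by (simp add: tor_Q_def mult_ac)
qed

lemma tor_Q_bound: "\<exists>C>0. \<forall>\<^sub>F t in at_top. norm (tor_Q n m t) <= C * exp (- real n * t)"
proof -
	define C where "C=norm (complex_of_real (2^n/fact n))+1"
	have "((%t. norm (tor_Q n m t * of_real (exp (real n * t)))) \<longlongrightarrow> norm (complex_of_real (2^n/fact n))) at_top"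
		by (intro tendsto_norm tor_Q_asymp)
	hence "\<forall>\<^sub>F t in at_top. norm (tor_Q n m t * of_real (exp (real n * t))) < C" by (rule order_tendstoD) (simp add: C_def)
	hence "\<forall>\<^sub>F t in at_top. norm (tor_Q n m t) <= C * exp (- real n * t)"
	proof eventually_elim
		case (elim t)
		hence "norm (tor_Q n m t) * exp (real n * t) <= C" by (simp add: norm_mult)
		hence "norm (tor_Q n m t) * exp (real n * t) * exp (- real n * t) <= C * exp (- real n * t)" by (intro mult_right_mono) auto
		thus ?case by (simp add: mult.assoc flip: exp_add)
	qed
	moreover have "C > 0" unfolding C_def by (simp add: add_nonneg_pos)
	ultimately show ?thesis by blast
qed

lemma tor_Q_nonzero: "\<forall>\<^sub>F t in at_top. tor_Q n m t ~= 0"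
	using tendsto_imp_eventually_ne[OF tor_Q_asymp[of n m],of 0] by (auto elim!: eventually_mono)

lemma tor_Q'_tendsto_0: "((%t. tor_Q' n m t) \<longlongrightarrow> 0) at_top"
proof -
	have rate: "((%t. tor_Q_rate n m t) \<longlongrightarrow>-real n) at_top"
	proof -
		have "((%t::real. 1/(sinh t * cosh t)) \<longlongrightarrow> 0) at_top" "((%t::real. tanh t) \<longlongrightarrow> 1) at_top" by real_asymp+
		hence "((%t. (of_int m+1/2)*(1/(sinh t * cosh t))-real n * tanh t) \<longlongrightarrow> (of_int m+1/2)*0-real n*1) at_top"
			by (intro tendsto_intros)
		thus ?thesis by (simp add: tor_Q_rate_def)
	qed
	have amp: "((%t. tor_Q_amp n m t) \<longlongrightarrow> (if n=0 then 1 else 0)) at_top"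
	proof -
		have "((%t. exp (- real n * t)) \<longlongrightarrow> (if n=0 then 1 else 0)) at_top"
		proof (cases "n=0")
			case False
			hence "real n > 0" by simp
			thus ?thesis using False by (simp) real_asymp
		qed simp
		from tendsto_mult[OF tor_Q_amp_asymp[of n m] this]
		have "((%t. tor_Q_amp n m t * exp (real n * t) * exp (- real n * t)) \<longlongrightarrow> 2^n*(if n=0 then 1 else 0)) at_top" .
		moreover have "tor_Q_amp n m t * exp (real n * t) * exp (- real n * t)=tor_Q_amp n m t" for t by (simp add: mult.assoc flip: exp_add)
		moreover have "(2::real)^n*(if n=0 then 1 else 0)=(if n=0 then 1 else 0)" by simp
		ultimately show ?thesis by (simp only:)
	qed
	have "((%t. tor_Q' n m t) \<longlongrightarrow> of_real (if n=0 then 1 else 0)*(of_real (- real n) * of_real (1/fact n)+0)) at_top"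
		unfolding tor_Q'_def by (intro tendsto_mult tendsto_add tendsto_of_real amp rate tor_Q_F_limits)
	thus ?thesis by (cases "n=0") auto
qed

lemma tor_Q_bounded_limit: "\<exists>l. ((%t. tor_Q n m t) \<longlongrightarrow> l) at_top"
proof -
	have "((%t. exp (- real n * t)) \<longlongrightarrow> (if n=0 then 1 else 0)) at_top"
	proof (cases "n=0")
		case False
		hence "real n > 0" by simp
		thus ?thesis using False by (simp) real_asymp
	qed simp
	from tendsto_mult[OF tor_Q_asymp[of n m] tendsto_of_real[OF this]]
	have "((%t. tor_Q n m t * of_real (exp (real n * t)) * of_real (exp (- real n * t)))
			\<longlongrightarrow> of_real (2^n/fact n) * of_real (if n=0 then 1 else 0)) at_top" .
	moreover have "tor_Q n m t * of_real (exp (real n * t)) * of_real (exp (- real n * t))=tor_Q n m t" for t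
		by (simp add: mult.assoc flip: of_real_mult exp_add)
	ultimately show ?thesis by (simp only:) blast
qed

lemma toroidal_potential_continuous: "0 < a ==> continuous_on {a..b} (toroidal_potential n m)"
	unfolding toroidal_potential_def by (intro continuous_intros) auto

lemma toroidal_potential_bounded: "0 < a ==> bounded (toroidal_potential n m ` {a..b})"
	by (intro compact_imp_bounded compact_continuous_image toroidal_potential_continuous) auto

lemma schroedinger_wronskian_constant:
	fixes y z :: "real => complex"
	assumes y: "schroedinger_on S V y y'" and z: "schroedinger_on S V z z'" and S: "convex S"
	shows "\<exists>c. \<forall>t\<in>S. y t * z' t-y' t * z t = c"
proof -
	have "\<forall>t\<in>S. ((%t. y t * z' t-y' t * z t) has_vector_derivative 0) (at t within S)" using wronskian_derivative[OF y z] by simp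
	thus ?thesis using has_vector_derivative_zero_constant[OF S,of "%t. y t * z' t-y' t * z t"] by metis
qed

text \<open>Both functions are recessive at infinity, hence proportional; the leading coefficient does
	not depend on the sign of the order.\<close>

lemma tor_Q_abs_order:
	assumes t: "t > 0" shows "tor_Q n m t=tor_Q n \<bar>m\<bar> t" "tor_Q' n m t=tor_Q' n \<bar>m\<bar> t"
proof -
	let ?V = "toroidal_potential n m"
	have V: "toroidal_potential n \<bar>m\<bar> = ?V" by (simp add: toroidal_potential_def fun_eq_iff)
	have s: "schroedinger_on {0<..} ?V (tor_Q n m) (tor_Q' n m)" "schroedinger_on {0<..} ?V (tor_Q n \<bar>m\<bar>) (tor_Q' n \<bar>m\<bar>)"
		using tor_Q_solution[of n m] tor_Q_solution[of n "\<bar>m\<bar>"] unfolding V by auto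
	obtain c where c: "!!t. t > 0 ==> tor_Q n m t * tor_Q' n \<bar>m\<bar> t-tor_Q' n m t * tor_Q n \<bar>m\<bar> t = c"
		using schroedinger_wronskian_constant[OF s] by (auto simp: convex_real_interval)
	obtain l l' where l: "((%t. tor_Q n m t) \<longlongrightarrow> l) at_top" "((%t. tor_Q n \<bar>m\<bar> t) \<longlongrightarrow> l') at_top"
		using tor_Q_bounded_limit by blast
	have "((%t. tor_Q n m t * tor_Q' n \<bar>m\<bar> t-tor_Q' n m t * tor_Q n \<bar>m\<bar> t) \<longlongrightarrow> l*0-0 * l') at_top"
		by (intro tendsto_diff tendsto_mult l tor_Q'_tendsto_0)
	moreover have "\<forall>\<^sub>F t in at_top. tor_Q n m t * tor_Q' n \<bar>m\<bar> t-tor_Q' n m t * tor_Q n \<bar>m\<bar> t = c"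
		using eventually_gt_at_top[of 0] by eventually_elim (rule c)
	hence "((%t. tor_Q n m t * tor_Q' n \<bar>m\<bar> t-tor_Q' n m t * tor_Q n \<bar>m\<bar> t) \<longlongrightarrow> c) at_top"
		by (rule tendsto_eventually)
	ultimately have c0: "c=0" using tendsto_unique[OF trivial_limit_at_top_linorder] by fastforce
	obtain T where T: "T > 0" "tor_Q n \<bar>m\<bar> T ~= 0" using eventually_conj[OF tor_Q_nonzero[of n "\<bar>m\<bar>"] eventually_gt_at_top[of 0]]
		by (metis (mono_tags,lifting) eventually_at_top_linorder order_refl)
	define r where "r=tor_Q n m T/tor_Q n \<bar>m\<bar> T"
	have r': "tor_Q' n m T=r * tor_Q' n \<bar>m\<bar> T" using c[OF T(1)] c0 T(2) by (simp add: r_def field_simps)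
	have eq: "tor_Q n m t=r * tor_Q n \<bar>m\<bar> t & tor_Q' n m t=r * tor_Q' n \<bar>m\<bar> t" if t: "t > 0" for t
	proof -
		define a b where "a=min t T" and "b=max t T"
		have ab: "0 < a" "t \<in> {a..b}" "T \<in> {a..b}" using t T by (auto simp: a_def b_def)
		have sub: "{a..b} \<subseteq> {0<..}" using ab by auto
		have s1: "schroedinger_on {a..b} ?V (tor_Q n m) (tor_Q' n m)" by (rule schroedinger_on_subset[OF s(1) sub])
		have s2: "schroedinger_on {a..b} ?V (%t. r * tor_Q n \<bar>m\<bar> t) (%t. r * tor_Q' n \<bar>m\<bar> t)"
			by (rule schroedinger_on_linear[OF schroedinger_on_subset[OF s(2) sub] bounded_linear_mult_right])
		have "tor_Q n m T=r * tor_Q n \<bar>m\<bar> T" using T by (simp add: r_def)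
		from schroedinger_unique[OF s1 s2 toroidal_potential_bounded[OF ab(1)] ab(3) this r' ab(2)]
		show ?thesis by simp
	qed
	have "((%t. r*(tor_Q n \<bar>m\<bar> t * of_real (exp (real n * t)))) \<longlongrightarrow> r * of_real (2^n/fact n)) at_top"
		by (intro tendsto_mult tendsto_const tor_Q_asymp)
	moreover have "\<forall>\<^sub>F t in at_top. r*(tor_Q n \<bar>m\<bar> t * of_real (exp (real n * t)))=tor_Q n m t * of_real (exp (real n * t))"
		using eventually_gt_at_top[of 0] by eventually_elim (use eq in simp)
	ultimately have "((%t. tor_Q n m t * of_real (exp (real n * t))) \<longlongrightarrow> r * of_real (2^n/fact n)) at_top"
		by (rule Lim_transform_eventually)
	hence "r * of_real (2^n/fact n)=(of_real (2^n/fact n) :: complex)" using tendsto_unique[OF trivial_limit_at_top_linorder _ tor_Q_asymp] by blast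
	hence "r=1" by simp
	thus "tor_Q n m t=tor_Q n \<bar>m\<bar> t" "tor_Q' n m t=tor_Q' n \<bar>m\<bar> t" using eq[OF t] by auto
qed

section \<open>Behaviour of the toroidal functions at the origin\<close>

text \<open>Solutions with the larger exponent at 0. The condition on the derivative makes the Wronskian of two such solutions vanish at 0.\<close>

definition regular_branch :: "real => complex => (real => complex) => (real => complex) => bool" where
	"regular_branch \<sigma> b f f' \<longleftrightarrow> ((%t. f t/of_real (t powr \<sigma>)) \<longlongrightarrow> b) (at_right 0) &
		 ((%t. f' t/of_real (t powr (\<sigma>-1))) \<longlongrightarrow> of_real \<sigma> * b) (at_right 0)"

lemma positive_at_right_0: "\<forall>\<^sub>F t::real in at_right 0. t > 0" by (auto simp: eventually_at_right_field intro!: exI[of _ 1])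

definition tor_P_lead :: "nat => int => complex" where
	"tor_P_lead n m = olver_coeff (1/2-of_nat n) (of_nat n+1/2) (1-of_int m) (nat m)"

lemma tor_P_F_factor:
	obtains h where "h holomorphic_on ball 0 1" "h 0=tor_P_lead n m"
		"!!z. z \<in> ball 0 1 ==> tor_P_F n m z=z^nat m * h z"
proof -
	let ?u = "olver_coeff (1/2-of_nat n) (of_nat n+1/2) (1-of_int m)"
	define N where "N=nat m"
	define h where "h=(%z. \<Sum>j. ?u (j + N) * z^j)"
	have sm: "summable (%j. ?u (j + N) * z^j)" if z: "norm z < 1" for z
	proof (cases "z=0")
		case False
		have "summable (%j. ?u (j + N) * z^(j + N))" by (rule summable_ignore_initial_segment[OF olver_summable[OF z]])
		from summable_mult2[OF this,of "inverse (z^N)"] show ?thesis using False by (simp add: power_add field_simps)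
	qed (simp add: summable_0_powser)
	show ?thesis
	proof (rule that[of h])
		show "h holomorphic_on ball 0 1" using termdiffs_strong'[of 1 "%j. ?u (j + N)",OF sm] by (subst holomorphic_on_open) (auto simp: h_def intro!: exI)
		show "h 0=tor_P_lead n m" unfolding h_def tor_P_lead_def N_def by (subst powser_zero) simp
		fix z :: complex assume "z \<in> ball 0 1"
		hence z: "norm z < 1" by simp
		have u0: "?u j=0" if "j < N" for j
		proof -
			have "(1-of_int m + of_nat j :: complex) = of_int (1-m + int j)" by simp
			hence "rGamma (1-of_int m + of_nat j :: complex)=0" using that unfolding N_def by (simp only: rGamma_of_int) auto
			thus ?thesis by (simp add: olver_coeff_def)
		qed
		have "tor_P_F n m z=(\<Sum>j. ?u j * z^j)" unfolding tor_P_F_def olver_F_series[OF z] olver_series_def ..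
		also have "... = (\<Sum>j. ?u (j + N) * z^(j + N))+(\<Sum>j<N. ?u j * z^j)" by (rule suminf_split_initial_segment[OF olver_summable[OF z]])
		also have "(\<Sum>j<N. ?u j * z^j)=0" by (rule sum.neutral) (simp add: u0)
		also have "(\<Sum>j. ?u (j + N) * z^(j + N))=(\<Sum>j. z^N*(?u (j + N) * z^j))" by (simp add: power_add mult_ac)
		also have "... = z^N * h z" unfolding h_def by (rule suminf_mult[OF sm[OF z]])
		finally show "tor_P_F n m z=z^nat m * h z" by (simp add: N_def)
	qed
qed

text \<open>The amplitude \<open>\<omega>\<close> collects the factors with a branch point at the origin.\<close>

definition tor_P_omega :: "int => real => real" where
	"tor_P_omega m t=tor_P_amp m t*((sinh (t/2))^2)^nat m"

definition tor_P_pi :: "int => real => real" where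
	"tor_P_pi m t=tor_P_rate m t + real (nat m)*(sinh t/(2*(sinh (t/2))^2))"

lemma tor_P_near_0:
	obtains h where "h holomorphic_on ball 0 1" "h 0=tor_P_lead n m"
		"\<forall>\<^sub>F t in at_right 0. tor_P n m t=(- 1)^nat m * of_real (tor_P_omega m t) * h (of_real (- (sinh (t/2))\<^sup>2)) &
			 tor_P' n m t=(- 1)^nat m * of_real (tor_P_omega m t)*(of_real (tor_P_pi m t) * h (of_real (- (sinh (t/2))\<^sup>2))
					+ of_real (- sinh t/2) * deriv h (of_real (- (sinh (t/2))\<^sup>2)))"
proof -
	obtain h where h: "h holomorphic_on ball 0 1" "h 0=tor_P_lead n m"
		"!!z. z \<in> ball 0 1 ==> tor_P_F n m z=z^nat m * h z" using tor_P_F_factor[of n m] by blast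
	let ?N = "nat m"
	have lim: "((%t::real. (sinh (t/2))\<^sup>2) \<longlongrightarrow> 0) (at_right 0)" by real_asymp
	have small: "\<forall>\<^sub>F t::real in at_right 0. (sinh (t/2))\<^sup>2 < 1" by (rule order_tendstoD[OF lim]) simp
	have "\<forall>\<^sub>F t in at_right 0. tor_P n m t=(- 1) ^ ?N * of_real (tor_P_omega m t) * h (of_real (- (sinh (t/2))\<^sup>2)) &
			 tor_P' n m t=(- 1) ^ ?N * of_real (tor_P_omega m t)*(of_real (tor_P_pi m t) * h (of_real (- (sinh (t/2))\<^sup>2))
					+ of_real (- sinh t/2) * deriv h (of_real (- (sinh (t/2))\<^sup>2)))" using small positive_at_right_0
	proof eventually_elim
		case (elim t)
		define s where "s=(sinh (t/2))^2"
		have s: "0 < s" "s < 1" using elim by (auto simp: s_def)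
		define z :: complex where "z = of_real (- s)"
		have z: "z \<in> ball 0 1" "z ~= 0" using s by (auto simp: z_def simp del: of_real_minus)
		have hd: "(h has_field_derivative deriv h z) (at z)" using h(1) z(1) by (intro holomorphic_derivI[OF h(1) open_ball])
		have zN: "z ^ ?N=(- 1) ^ ?N * of_real (s ^ ?N)" unfolding z_def of_real_minus of_real_power by (rule power_minus)
		have f: "tor_P_F n m z=z ^ ?N * h z" by (rule h(3)[OF z(1)])
		have "deriv (tor_P_F n m) z=deriv (%z. z ^ ?N * h z) z"
		proof (rule complex_derivative_transform_within_open[OF _ _ open_ball z(1)])
			show hh: "(%z. z ^ ?N * h z) holomorphic_on ball 0 1" by (intro holomorphic_intros h)
			show "tor_P_F n m holomorphic_on ball 0 1" by (rule holomorphic_transform[OF hh]) (simp add: h(3))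
		qed (rule h(3))
		also have "... = of_nat ?N * z^(?N-1) * h z + z ^ ?N * deriv h z" by (rule DERIV_imp_deriv) (auto intro!: derivative_eq_intros hd simp: mult_ac)
		also have "of_nat ?N * z^(?N-1)=z ^ ?N*(of_nat ?N/z)" using z(2) by (cases ?N) auto
		finally have f': "deriv (tor_P_F n m) z=z ^ ?N*(of_nat ?N/z * h z + deriv h z)" by (simp add: algebra_simps)
		have "of_real (- sinh t/2)*(of_nat ?N/z)=(of_real (real ?N*(sinh t/(2 * s))) :: complex)" using s unfolding z_def by simp
		hence "of_real (tor_P_rate m t) * h z + of_real (- sinh t/2)*(of_nat ?N/z * h z + deriv h z)
			= (of_real (tor_P_rate m t) + of_real (real ?N*(sinh t/(2 * s)))) * h z + of_real (- sinh t/2) * deriv h z"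
			by (simp only: distrib_left distrib_right mult.assoc[symmetric] add.assoc)
		hence pi: "of_real (tor_P_rate m t) * h z + of_real (- sinh t/2)*(of_nat ?N/z * h z + deriv h z)
			= of_real (tor_P_pi m t) * h z + of_real (- sinh t/2) * deriv h z" unfolding tor_P_pi_def s_def[symmetric] of_real_add .
		have "tor_P n m t = of_real (tor_P_amp m t)*(z ^ ?N * h z)" unfolding tor_P_def s_def[symmetric] z_def[symmetric] f ..
		hence 1: "tor_P n m t=(- 1) ^ ?N * of_real (tor_P_omega m t) * h z" unfolding zN tor_P_omega_def s_def[symmetric] by simp
		have "tor_P' n m t = of_real (tor_P_amp m t)*(of_real (tor_P_rate m t)*(z ^ ?N * h z)
			 + of_real (- sinh t/2)*(z ^ ?N*(of_nat ?N/z * h z + deriv h z)))" unfolding tor_P'_def s_def[symmetric] z_def[symmetric] f f' ..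
		also have "... = of_real (tor_P_amp m t) * z ^ ?N*(of_real (tor_P_rate m t) * h z + of_real (- sinh t/2)*(of_nat ?N/z * h z + deriv h z))"
			by (simp only: distrib_left mult_ac)
		finally have 2: "tor_P' n m t=(- 1) ^ ?N * of_real (tor_P_omega m t)*(of_real (tor_P_pi m t) * h z + of_real (- sinh t/2) * deriv h z)"
			unfolding pi zN tor_P_omega_def s_def[symmetric] by simp
		show ?case using 1 2 unfolding z_def s_def by blast
	qed
	with h(1,2) show ?thesis by (rule that)
qed

lemma tor_P_omega_asymp: "((%t. tor_P_omega m t/t powr (\<bar>of_int m\<bar>+1/2)) \<longlongrightarrow> 2 powr (- \<bar>of_int m\<bar>)) (at_right 0)"
proof -
	have l: "((%t::real. ln (sinh t)-ln t) \<longlongrightarrow> 0) (at_right 0)" "((%t::real. ln (tanh (t/2))-ln t) \<longlongrightarrow>-ln 2) (at_right 0)"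
		"((%t::real. ln (sinh (t/2))-ln t) \<longlongrightarrow>-ln 2) (at_right 0)" by (real_asymp; simp add: ln_div)+
	have N: "2 * real (nat m)-of_int m=\<bar>of_int m\<bar>" by simp
	have "((%t. exp ((ln (sinh t)-ln t)/2-of_int m*(ln (tanh (t/2))-ln t)+2 * real (nat m)*(ln (sinh (t/2))-ln t)))
		 \<longlongrightarrow> exp (0/2-of_int m*(- ln 2)+2 * real (nat m)*(- ln 2))) (at_right 0)" by (intro tendsto_intros l) auto
	moreover have "exp (0/2-of_int m*(- ln 2)+2 * real (nat m)*(- ln 2))=(2::real) powr (- \<bar>of_int m\<bar>)"
		unfolding powr_def N[symmetric] by (simp add: algebra_simps)
	moreover have "\<forall>\<^sub>F t in at_right 0. exp ((ln (sinh t)-ln t)/2-of_int m*(ln (tanh (t/2))-ln t)+2 * real (nat m)*(ln (sinh (t/2))-ln t))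
		 = tor_P_omega m t/t powr (\<bar>of_int m\<bar>+1/2)" using positive_at_right_0
	proof eventually_elim
		case (elim t)
		have "((sinh (t/2))^2)^nat m=exp (2 * real (nat m) * ln (sinh (t/2)))"
		proof -
			have "exp (2 * real (nat m) * ln (sinh (t/2)))=exp (real (2 * nat m) * ln (sinh (t/2)))" by simp
			also have "... = exp (ln (sinh (t/2)))^(2 * nat m)" by (rule exp_of_nat_mult)
			finally show ?thesis using elim by (simp add: power_mult)
		qed
		moreover have "t powr (\<bar>of_int m\<bar>+1/2)=exp ((2 * real (nat m)-of_int m+1/2) * ln t)" using elim unfolding powr_def N by simp
		ultimately have "tor_P_omega m t/t powr (\<bar>of_int m\<bar>+1/2)
			= exp ((ln (sinh t)/2-of_int m * ln (tanh (t/2)))+2 * real (nat m) * ln (sinh (t/2))-(2 * real (nat m)-of_int m+1/2) * ln t)"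
			by (simp add: tor_P_omega_def tor_P_amp_def exp_add exp_diff)
		thus ?case by (simp add: algebra_simps diff_divide_distrib)
	qed
	ultimately show ?thesis using Lim_transform_eventually by fastforce
qed

lemma half_angle_limits:
	"((%t::real. - (sinh (t/2))\<^sup>2) \<longlongrightarrow> 0) (at_right 0)" "((%t::real. - sinh t/2) \<longlongrightarrow> 0) (at_right 0)"
	by real_asymp+

lemma ball_function_limit:
	assumes "h holomorphic_on ball 0 1"
	shows "((%t::real. h (of_real (- (sinh (t/2))\<^sup>2))) \<longlongrightarrow> h 0) (at_right 0)"
		"((%t::real. deriv h (of_real (- (sinh (t/2))\<^sup>2))) \<longlongrightarrow> deriv h 0) (at_right 0)"
proof -
	have c: "isCont h 0" "isCont (deriv h) 0" using assms holomorphic_deriv[OF assms open_ball]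
		by (auto intro!: continuous_on_interior[OF holomorphic_on_imp_continuous_on])
	have l: "((%t::real. complex_of_real (- (sinh (t/2))\<^sup>2)) \<longlongrightarrow> 0) (at_right 0)"
		using tendsto_of_real[OF half_angle_limits(1)] by simp
	show "((%t::real. h (of_real (- (sinh (t/2))\<^sup>2))) \<longlongrightarrow> h 0) (at_right 0)"
		"((%t::real. deriv h (of_real (- (sinh (t/2))\<^sup>2))) \<longlongrightarrow> deriv h 0) (at_right 0)"
		by (rule isCont_tendsto_compose[OF c(1) l] isCont_tendsto_compose[OF c(2) l])+
qed

lemma tor_P_regular:
	"regular_branch (\<bar>of_int m\<bar>+1/2) ((- 1)^nat m * of_real (2 powr (- \<bar>of_int m\<bar>)) * tor_P_lead n m) (tor_P n m) (tor_P' n m)"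
proof -
	obtain h where h: "h holomorphic_on ball 0 1" "h 0=tor_P_lead n m"
		"\<forall>\<^sub>F t in at_right 0. tor_P n m t=(- 1)^nat m * of_real (tor_P_omega m t) * h (of_real (- (sinh (t/2))\<^sup>2)) &
			 tor_P' n m t=(- 1)^nat m * of_real (tor_P_omega m t)*(of_real (tor_P_pi m t) * h (of_real (- (sinh (t/2))\<^sup>2))
					+ of_real (- sinh t/2) * deriv h (of_real (- (sinh (t/2))\<^sup>2)))" using tor_P_near_0[of n m] by blast
	define \<sigma> where "\<sigma>=\<bar>of_int m\<bar>+(1/2 :: real)"
	let ?w = "%t. tor_P_omega m t/t powr \<sigma>"
	note w=tor_P_omega_asymp[of m,folded \<sigma>_def]
	note hl=ball_function_limit[OF h(1)]
	have N: "2 * real (nat m)-of_int m=\<bar>of_int m\<bar>" by simp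
	have pi: "((%t. t * tor_P_pi m t) \<longlongrightarrow> \<sigma>) (at_right 0)"
	proof -
		have "((%t::real. t * cosh t/(2 * sinh t)) \<longlongrightarrow> 1/2) (at_right 0)" "((%t::real. t/sinh t) \<longlongrightarrow> 1) (at_right 0)"
			"((%t::real. t * sinh t/(2*(sinh (t/2))^2)) \<longlongrightarrow> 2) (at_right 0)" by (real_asymp; simp add: power2_eq_square)+
		hence "((%t. t * cosh t/(2 * sinh t)-of_int m*(t/sinh t) + real (nat m)*(t * sinh t/(2*(sinh (t/2))^2)))
			\<longlongrightarrow> 1/2-of_int m*1 + real (nat m)*2) (at_right 0)" by (intro tendsto_diff tendsto_add tendsto_mult tendsto_const)
		moreover have "1/2-of_int m*1 + real (nat m)*2=\<sigma>" unfolding \<sigma>_def N[symmetric] by simp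
		moreover have "t * cosh t/(2 * sinh t)-of_int m*(t/sinh t) + real (nat m)*(t * sinh t/(2*(sinh (t/2))^2))=t * tor_P_pi m t" for t
			unfolding tor_P_pi_def tor_P_rate_def by (cases "sinh t=0") (simp_all add: field_simps)
		ultimately show ?thesis by (simp only:)
	qed
	have "((%t. (- 1)^nat m * of_real (?w t) * h (of_real (- (sinh (t/2))\<^sup>2))) \<longlongrightarrow>
			(- 1)^nat m * of_real (2 powr (- \<bar>of_int m\<bar>)) * h 0) (at_right 0)" by (intro tendsto_mult tendsto_const tendsto_of_real w hl)
	moreover have "\<forall>\<^sub>F t in at_right 0. (- 1)^nat m * of_real (?w t) * h (of_real (- (sinh (t/2))\<^sup>2))=tor_P n m t/of_real (t powr \<sigma>)"
		using h(3) by eventually_elim simp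
	ultimately have 1: "((%t. tor_P n m t/of_real (t powr \<sigma>)) \<longlongrightarrow> (- 1)^nat m * of_real (2 powr (- \<bar>of_int m\<bar>)) * h 0) (at_right 0)"
		by (rule Lim_transform_eventually)
	have "((%t. (- 1)^nat m * of_real (?w t)*(of_real (t * tor_P_pi m t) * h (of_real (- (sinh (t/2))\<^sup>2))
			+ of_real t*(of_real (- sinh t/2) * deriv h (of_real (- (sinh (t/2))\<^sup>2))))) \<longlongrightarrow>
			(- 1)^nat m * of_real (2 powr (- \<bar>of_int m\<bar>))*(of_real \<sigma> * h 0 + of_real 0*(of_real 0 * deriv h 0))) (at_right 0)"
		by (intro tendsto_mult tendsto_add tendsto_const tendsto_of_real w hl pi half_angle_limits tendsto_ident_at)
	moreover have "\<forall>\<^sub>F t in at_right 0. (- 1)^nat m * of_real (?w t)*(of_real (t * tor_P_pi m t) * h (of_real (- (sinh (t/2))\<^sup>2))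
			+ of_real t*(of_real (- sinh t/2) * deriv h (of_real (- (sinh (t/2))\<^sup>2))))=tor_P' n m t/of_real (t powr (\<sigma>-1))"
		using h(3) positive_at_right_0
	proof eventually_elim
		case (elim t)
		hence "t powr (\<sigma>-1)=t powr \<sigma>/t" by (simp add: powr_diff)
		hence e: "of_real (tor_P_omega m t)/complex_of_real (t powr (\<sigma>-1)) = of_real (?w t) * of_real t" using elim by simp
		have "tor_P' n m t/of_real (t powr (\<sigma>-1))=(- 1)^nat m*(of_real (tor_P_omega m t)/complex_of_real (t powr (\<sigma>-1))) *
			 (of_real (tor_P_pi m t) * h (of_real (- (sinh (t/2))\<^sup>2)) + of_real (- sinh t/2) * deriv h (of_real (- (sinh (t/2))\<^sup>2)))"
			using elim by simp
		thus ?case unfolding e by (simp add: algebra_simps)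
	qed
	ultimately have "((%t. tor_P' n m t/of_real (t powr (\<sigma>-1))) \<longlongrightarrow>
		 (- 1)^nat m * of_real (2 powr (- \<bar>of_int m\<bar>))*(of_real \<sigma> * h 0 + of_real 0*(of_real 0 * deriv h 0))) (at_right 0)"
		by (rule Lim_transform_eventually)
	hence 2: "((%t. tor_P' n m t/of_real (t powr (\<sigma>-1))) \<longlongrightarrow> of_real \<sigma>*((- 1)^nat m * of_real (2 powr (- \<bar>of_int m\<bar>)) * h 0)) (at_right 0)"
		by (simp add: mult_ac)
	show ?thesis using 1 2 h(2) unfolding regular_branch_def \<sigma>_def by simp
qed

section \<open>The Wronskian of the toroidal functions\<close>

lemma diffs_tor_Q_ratio:
	fixes M n :: nat
	defines "u \<equiv> olver_coeff (tor_Q_par n (int M)) (tor_Q_par n (int M)+1/2) (of_nat n+1)"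
		and "v \<equiv> %j. pochhammer (real M+1) j/fact j"
	defines "L \<equiv> rGamma (tor_Q_par n (int M)) * rGamma (tor_Q_par n (int M)+1/2) * fact M"
	shows "(%j. diffs u j/of_real (v j)) \<longlonglongrightarrow> L" "(%j. u j/of_real (v j)) \<longlonglongrightarrow> 0"
proof -
	define a b c d :: complex where "a=tor_Q_par n (int M)" and "b=a+1/2" and "c = of_nat n+1" and "d = of_nat M+1"
	have vc: "complex_of_real (v j)=pochhammer d j/fact j" for j unfolding v_def d_def by (simp flip: pochhammer_of_real)
	have c_ne: "pochhammer c j ~= 0" and d_ne: "pochhammer d j ~= 0" for j
	proof -
		have "pochhammer (real n+1) j > 0" "pochhammer (real M+1) j > 0" by (intro pochhammer_pos; simp)+
		hence "complex_of_real (pochhammer (real n+1) j) ~= 0" "complex_of_real (pochhammer (real M+1) j) ~= 0" by (simp_all only: of_real_eq_0_iff)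
		thus "pochhammer c j ~= 0" "pochhammer d j ~= 0" unfolding c_def d_def by (simp_all flip: pochhammer_of_real)
	qed
	have rGc: "rGamma c ~= 0" "rGamma d=1/fact M" "rGamma d ~= 0"
	proof -
		have "rGamma c=inverse (Gamma (1 + of_nat n))" "rGamma d=inverse (Gamma (1 + of_nat M))"
			unfolding c_def d_def by (simp_all add: rGamma_inverse_Gamma add.commute)
		thus "rGamma c ~= 0" "rGamma d=1/fact M" "rGamma d ~= 0" unfolding Gamma_fact by (simp_all add: inverse_eq_divide)
	qed
	have diffs_u: "diffs u j=pochhammer a (Suc j) * pochhammer b (Suc j) * rGamma c/(pochhammer c (Suc j) * fact j)" for j
	proof -
		have "rGamma (c + of_nat (Suc j))=rGamma c/pochhammer c (Suc j)" using pochhammer_rGamma[of c "Suc j"] c_ne[of "Suc j"] by (simp add: field_simps)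
		moreover have "diffs u j = of_nat (Suc j)/fact (Suc j)*(pochhammer a (Suc j) * pochhammer b (Suc j) * rGamma (c + of_nat (Suc j)))"
			unfolding diffs_def u_def olver_coeff_def a_def b_def c_def by (simp only: times_divide_eq_left times_divide_eq_right mult_ac)
		moreover have "of_nat (Suc j)/fact (Suc j)=(1/fact j :: complex)" by (simp add: fact_Suc del: of_nat_Suc)
		ultimately show ?thesis by simp
	qed
	have ab: "a + b-c-d = - 1" unfolding a_def b_def c_def d_def tor_Q_par_def by (simp add: field_simps)
	define R where "R=(%j. rGamma_series a j * rGamma_series b j * rGamma c/(rGamma_series c j * rGamma_series d j)*((d + of_nat j)/(0 + of_nat j)))"
	have "R \<longlonglongrightarrow> rGamma a * rGamma b * rGamma c/(rGamma c * rGamma d)*1"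
		unfolding R_def using rGc by (intro tendsto_intros tendsto_shift_ratio) auto
	moreover have "rGamma a * rGamma b * rGamma c/(rGamma c * rGamma d)*1=L" using rGc by (simp add: L_def a_def b_def)
	moreover have "\<forall>\<^sub>F j in sequentially. R j=diffs u j/of_real (v j)" using eventually_gt_at_top[of 0]
	proof eventually_elim
		case (elim j)
		define E where "E z=exp (z * complex_of_real (ln (real j)))" for z
		have po: "pochhammer z (Suc j)=rGamma_series z j*(fact j * E z)" for z unfolding rGamma_series_def E_def by simp
		have Ene: "E z ~= 0" for z by (simp add: E_def)
		have "E a * E b/(E c * E d)=E (a + b-c-d)" unfolding E_def by (simp add: exp_add[symmetric] exp_diff[symmetric] algebra_simps)
		also have "... = 1/of_nat j" unfolding ab E_def using elim by (simp add: exp_minus exp_of_real inverse_eq_divide)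
		finally have EE: "E a * E b/(E c * E d)=1/of_nat j" .
		have dS: "pochhammer d (Suc j)=pochhammer d j*(d + of_nat j)" by (rule pochhammer_Suc)
		have dj: "d + of_nat j ~= 0" using d_ne[of "Suc j"] unfolding dS by auto
		have "diffs u j/of_real (v j)=pochhammer a (Suc j) * pochhammer b (Suc j) * rGamma c*(d + of_nat j)/(pochhammer c (Suc j) * pochhammer d (Suc j))"
		proof -
			have "A/(B * C)/(D/C)=A * X/(B*(D * X))" if "C ~= 0" "D ~= 0" "X ~= 0" "B ~= 0" for A B C D X :: complex using that by simp
			from this[OF _ d_ne[of j] dj c_ne[of "Suc j"],of "fact j"] show ?thesis unfolding diffs_u vc dS by simp
		qed
		also have "... = rGamma_series a j * rGamma_series b j * rGamma c/(rGamma_series c j * rGamma_series d j)*(d + of_nat j)*(E a * E b/(E c * E d))"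
		proof -
			have "(A*(f * Ea))*(B*(f * Eb)) * g * X/((C*(f * Ec))*(D*(f * Ed)))=A * B * g/(C * D) * X*(Ea * Eb/(Ec * Ed))"
				if "f ~= 0" for A B C D f g X Ea Eb Ec Ed :: complex using that by (simp add: mult_ac)
			from this[OF fact_nonzero] show ?thesis unfolding po .
		qed
		finally show ?case unfolding R_def EE by simp
	qed
	ultimately show lim: "(%j. diffs u j/of_real (v j)) \<longlonglongrightarrow> L" by (simp only: filterlim_cong[OF refl refl])
	have vpos: "v j > 0" for j unfolding v_def by (simp add: pochhammer_pos)
	have vmono: "v j <= v (Suc j)" for j
	proof -
		have "v (Suc j)=v j*((real M+1 + real j)/(real j+1))" unfolding v_def by (simp add: pochhammer_Suc field_simps)
		moreover have "v j*1 <= v j*((real M+1 + real j)/(real j+1))" using vpos[of j] by (intro mult_left_mono) auto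
		ultimately show ?thesis by simp
	qed
	have "(%j. norm (diffs u j/of_real (v j))*(1/real (Suc j))) \<longlonglongrightarrow> norm L*0" by (intro tendsto_mult tendsto_norm lim) real_asymp
	hence "(%j. u (Suc j)/of_real (v (Suc j))) \<longlonglongrightarrow> 0" unfolding mult_zero_right
	proof (rule Lim_null_comparison[rotated])
		show "\<forall>\<^sub>F j in sequentially. norm (u (Suc j)/of_real (v (Suc j))) <= norm (diffs u j/of_real (v j))*(1/real (Suc j))"
		proof (intro always_eventually allI)
			fix j
			have "norm (u (Suc j)/of_real (v (Suc j)))=norm (u (Suc j))/v (Suc j)" using vpos[of "Suc j"] by (simp add: norm_divide)
			also have "... <= norm (u (Suc j))/v j" using vpos[of j] vmono[of j] by (intro divide_left_mono) auto
			also have "... = norm (diffs u j/of_real (v j))*(1/real (Suc j))"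
				using vpos[of j] unfolding diffs_def by (simp add: norm_divide norm_mult del: of_nat_Suc)
			finally show "norm (u (Suc j)/of_real (v (Suc j))) <= norm (diffs u j/of_real (v j))*(1/real (Suc j))" .
		qed
	qed
	thus "(%j. u j/of_real (v j)) \<longlonglongrightarrow> 0" by (subst (asm) filterlim_sequentially_Suc)
qed

lemma tor_Q_F_near_1:
	fixes M :: nat
	shows "((%x. of_real ((1-x)^(M+1)) * deriv (tor_Q_F n (int M)) (of_real x)) \<longlongrightarrow>
		 rGamma (tor_Q_par n (int M)) * rGamma (tor_Q_par n (int M)+1/2) * fact M) (at_left 1)"
		"((%x. of_real ((1-x)^(M+1)) * tor_Q_F n (int M) (of_real x)) \<longlongrightarrow> 0) (at_left 1)"
proof -
	let ?u = "olver_coeff (tor_Q_par n (int M)) (tor_Q_par n (int M)+1/2) (of_nat n+1)"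
	have sm: "summable (%j. ?u j * z^j)" if "norm z < 1" for z by (rule olver_summable[OF that])
	have sm': "summable (%j. diffs ?u j * z^j)" if "norm z < 1" for z by (rule termdiff_converges[OF that sm])
	have eq: "(\<Sum>j. ?u j * of_real x^j)=tor_Q_F n (int M) (of_real x)" "(\<Sum>j. diffs ?u j * of_real x^j)=deriv (tor_Q_F n (int M)) (of_real x)"
		if "0 <= x" "x < 1" for x :: real
	proof -
		have x: "norm (complex_of_real x) < 1" using that by simp
		show "(\<Sum>j. ?u j * of_real x^j)=tor_Q_F n (int M) (of_real x)" unfolding tor_Q_F_def olver_F_series[OF x] olver_series_def ..
		show "(\<Sum>j. diffs ?u j * of_real x^j)=deriv (tor_Q_F n (int M)) (of_real x)"
			unfolding tor_Q_F_def olver_F_deriv_eq(1)[OF x] olver_series_def[abs_def] using termdiffs_strong'[OF sm x] by (rule DERIV_imp_deriv[symmetric])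
	qed
	have ev: "\<forall>\<^sub>F x::real in at_left 1. 0 <= x & x < 1" by (auto simp: eventually_at_left_field intro!: exI[of _ 0])
	have 1: "((%x. of_real ((1-x)^(M+1))*(\<Sum>j. diffs ?u j * of_real x^j)) \<longlongrightarrow>
		 rGamma (tor_Q_par n (int M)) * rGamma (tor_Q_par n (int M)+1/2) * fact M) (at_left 1)"
		by (rule abel_polynomial_growth[OF diffs_tor_Q_ratio(1)]) (rule sm',simp)
	have 2: "((%x. of_real ((1-x)^(M+1))*(\<Sum>j. ?u j * of_real x^j)) \<longlongrightarrow> 0) (at_left 1)"
		by (rule abel_polynomial_growth[OF diffs_tor_Q_ratio(2)]) (rule sm,simp)
	show "((%x. of_real ((1-x)^(M+1)) * deriv (tor_Q_F n (int M)) (of_real x)) \<longlongrightarrow>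
		 rGamma (tor_Q_par n (int M)) * rGamma (tor_Q_par n (int M)+1/2) * fact M) (at_left 1)"
		by (rule Lim_transform_eventually[OF 1]) (use ev in \<open>eventually_elim,simp add: eq\<close>)
	show "((%x. of_real ((1-x)^(M+1)) * tor_Q_F n (int M) (of_real x)) \<longlongrightarrow> 0) (at_left 1)"
		by (rule Lim_transform_eventually[OF 2]) (use ev in \<open>eventually_elim,simp add: eq\<close>)
qed

lemma tor_rate_difference:
	assumes t: "t > 0"
	shows "tor_Q_rate n \<bar>m\<bar> t-tor_P_pi m t = - (real n+(if m >= 0 then of_int m+1/2 else 1/2)) * tanh t
		 - (if m >= 0 then 0 else of_int (- m)*(tanh (t/2)/cosh t))"
proof -
	define s c where "s=sinh t" and "c = cosh t"
	have S: "s > 0" "c > 0" "sinh (t/2) > 0" "cosh (t/2) > 0" using t by (auto simp: s_def c_def)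
	have c2: "c * c=s * s+1" using cosh_square_eq[of t] by (simp add: s_def c_def power2_eq_square)
	have th: "tanh t=s/c" by (simp add: tanh_def s_def c_def)
	have h1: "s/(2*(sinh (t/2))^2)=(c+1)/s"
	proof -
		have a: "2*(sinh (t/2))^2 = c-1" unfolding c_def cosh_half(1)[of t] by simp
		have "c-1 > 0" unfolding a[symmetric] using S by simp
		moreover have "s * s=(c+1)*(c-1)" using c2 by (simp add: algebra_simps)
		ultimately show ?thesis unfolding a using S by (simp add: frac_eq_eq)
	qed
	have h2: "tanh (t/2)=(c-1)/s"
	proof -
		have a: "2*(sinh (t/2))^2 = c-1" unfolding c_def cosh_half(1)[of t] by simp
		show ?thesis unfolding a[symmetric] unfolding s_def cosh_half(2)[of t] using S by (simp add: tanh_def power2_eq_square)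
	qed
	have k1: "1/(s * c)-c/s = - (s/c)" using S c2 by (simp add: field_simps)
	show ?thesis
	proof (cases "m >= 0")
		case True
		have "tor_Q_rate n \<bar>m\<bar> t-tor_P_pi m t=(of_int m+1/2)*(1/(s * c))-real n * tanh t-(c-2 * of_int m)/(2 * s)-of_int m*((c+1)/s)"
			using True unfolding tor_Q_rate_def tor_P_pi_def tor_P_rate_def s_def[symmetric] c_def[symmetric] h1 by simp
		also have "... = (of_int m+1/2)*(1/(s * c)-c/s)-real n * tanh t" using S by (simp add: field_simps)
		finally show ?thesis unfolding k1 th using True by (simp add: algebra_simps)
	next
		case False
		have "tor_Q_rate n \<bar>m\<bar> t-tor_P_pi m t=(of_int (- m)+1/2)*(1/(s * c))-real n * tanh t-(c+2 * of_int (- m))/(2 * s)"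
			using False unfolding tor_Q_rate_def tor_P_pi_def tor_P_rate_def s_def[symmetric] c_def[symmetric] by simp
		also have "... = 1/2*(1/(s * c)-c/s) + of_int (- m)*(1/(s * c)-1/s)-real n * tanh t" using S by (simp add: field_simps)
		also have "1/(s * c)-1/s = - (((c-1)/s)/c)" using S by (simp add: field_simps)
		finally have "tor_Q_rate n \<bar>m\<bar> t-tor_P_pi m t=1/2*(- (s/c)) + of_int (- m)*(- (tanh (t/2)/c))-real n*(s/c)" unfolding k1 h2 th .
		moreover have "- (real n+1/2)*(s/c)-of_int (- m)*(tanh (t/2)/c)=1/2*(- (s/c)) + of_int (- m)*(- (tanh (t/2)/c))-real n*(s/c)"
			by (simp only: distrib_right minus_mult_minus minus_add_distrib mult_minus_left mult_minus_right diff_conv_add_uminus add_ac)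
		ultimately show ?thesis unfolding th c_def using False by simp
	qed
qed

lemma tor_wronskian_limit:
	"((%t. tor_P n m t * tor_Q' n \<bar>m\<bar> t-tor_P' n m t * tor_Q n \<bar>m\<bar> t) \<longlongrightarrow>
		 (- 1)^nat m * of_real (2 powr (- \<bar>of_int m\<bar>))*(- 2 * tor_P_lead n m *
			 (rGamma (tor_Q_par n \<bar>m\<bar>) * rGamma (tor_Q_par n \<bar>m\<bar>+1/2) * fact (nat \<bar>m\<bar>)))) (at_right 0)"
proof -
	define M where "M=nat \<bar>m\<bar>"
	have M: "\<bar>m\<bar>=int M" "\<bar>of_int m\<bar>=real M" by (auto simp: M_def)
	obtain h where h: "h holomorphic_on ball 0 1" "h 0=tor_P_lead n m"
		"\<forall>\<^sub>F t in at_right 0. tor_P n m t=(- 1)^nat m * of_real (tor_P_omega m t) * h (of_real (- (sinh (t/2))\<^sup>2)) &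
			 tor_P' n m t=(- 1)^nat m * of_real (tor_P_omega m t)*(of_real (tor_P_pi m t) * h (of_real (- (sinh (t/2))\<^sup>2))
					+ of_real (- sinh t/2) * deriv h (of_real (- (sinh (t/2))\<^sup>2)))" using tor_P_near_0[of n m] by blast
	note hl=ball_function_limit[OF h(1)]
	note w=tor_P_omega_asymp[of m,unfolded M(2)]
	define L where "L=rGamma (tor_Q_par n (int M)) * rGamma (tor_Q_par n (int M)+1/2) * fact M"
	let ?X = "%t::real. 1/(cosh t)^2"
	have X: "filterlim ?X (at_left 1) (at_right 0)" by real_asymp
	have F': "((%t. of_real ((1 - ?X t)^(M+1)) * deriv (tor_Q_F n (int M)) (of_real (?X t))) \<longlongrightarrow> L) (at_right 0)"
		unfolding L_def by (rule filterlim_compose[OF tor_Q_F_near_1(1) X])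
	have F: "((%t. of_real ((1 - ?X t)^(M+1)) * tor_Q_F n (int M) (of_real (?X t))) \<longlongrightarrow> 0) (at_right 0)"
		by (rule filterlim_compose[OF tor_Q_F_near_1(2) X])
	have r: "((%t::real. (t^2/(1 - ?X t))^(M+1)) \<longlongrightarrow> 1^(M+1)) (at_right 0)" by (intro tendsto_power) real_asymp
	have amp: "((%t. tor_Q_amp n (int M) t/t powr (real M+1/2)) \<longlongrightarrow> 1) (at_right 0)"
	proof -
		have l: "((%t::real. ln (tanh t)-ln t) \<longlongrightarrow> 0) (at_right 0)" "((%t::real. ln (cosh t)) \<longlongrightarrow> 0) (at_right 0)" by real_asymp+
		have "((%t. exp ((real M+1/2)*(ln (tanh t)-ln t)-real n * ln (cosh t))) \<longlongrightarrow> exp ((real M+1/2)*0-real n*0)) (at_right 0)"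
			by (intro tendsto_intros l)
		moreover have "\<forall>\<^sub>F t in at_right 0. exp ((real M+1/2)*(ln (tanh t)-ln t)-real n * ln (cosh t))=tor_Q_amp n (int M) t/t powr (real M+1/2)"
			using positive_at_right_0 by eventually_elim (simp add: tor_Q_amp_def powr_def algebra_simps flip: exp_diff)
		ultimately show ?thesis using Lim_transform_eventually by fastforce
	qed
	define D where "D=(%t. (tor_Q_rate n (int M) t-tor_P_pi m t)/t)"
	have D: "\<exists>l. (D \<longlongrightarrow> l) (at_right 0)"
	proof -
		have "((%t::real. tanh t/t) \<longlongrightarrow> 1) (at_right 0)" "((%t::real. tanh (t/2)/cosh t/t) \<longlongrightarrow> 1/2) (at_right 0)" by real_asymp+
		hence "((%t. - (real n+(if m >= 0 then of_int m+1/2 else 1/2))*(tanh t/t)-(if m >= 0 then 0 else of_int (- m))*(tanh (t/2)/cosh t/t))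
			 \<longlongrightarrow>-(real n+(if m >= 0 then of_int m+1/2 else 1/2))*1-(if m >= 0 then 0 else of_int (- m))*(1/2)) (at_right 0)"
			by (intro tendsto_diff tendsto_mult tendsto_const)
		moreover have "\<forall>\<^sub>F t in at_right 0. - (real n+(if m >= 0 then of_int m+1/2 else 1/2))*(tanh t/t)-(if m >= 0 then 0 else of_int (- m))*(tanh (t/2)/cosh t/t)=D t"
			using positive_at_right_0
		proof eventually_elim
			case (elim t)
			have "a*(tanh t/t)-d*(x/cosh t/t)=(a * tanh t-d*(x/cosh t))/t" for a d x :: real by (simp add: diff_divide_distrib)
			thus ?case unfolding D_def M(1)[symmetric] tor_rate_difference[OF elim] by (simp only:) simp
		qed
		ultimately show ?thesis using Lim_transform_eventually by blast
	qed
	then obtain l where l: "(D \<longlongrightarrow> l) (at_right 0)" by blast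
	let ?w = "%t. tor_P_omega m t/t powr (real M+1/2)" and ?a = "%t. tor_Q_amp n (int M) t/t powr (real M+1/2)"
	let ?F = "%t. of_real ((1 - ?X t)^(M+1)) * tor_Q_F n (int M) (of_real (?X t))"
	let ?F' = "%t. of_real ((1 - ?X t)^(M+1)) * deriv (tor_Q_F n (int M)) (of_real (?X t))"
	let ?h = "%t. h (of_real (- (sinh (t/2))\<^sup>2))" and ?h' = "%t. deriv h (of_real (- (sinh (t/2))\<^sup>2))"
	have X't: "((%t::real. - 2 * sinh t/cosh t^3/t) \<longlongrightarrow>-2) (at_right 0)" by real_asymp
	have x't: "((%t::real. - sinh t/2/t) \<longlongrightarrow>-(1/2)) (at_right 0)" by real_asymp
	have main: "((%t. (- 1)^nat m * of_real (?w t) * of_real (?a t) * of_real ((t^2/(1 - ?X t))^(M+1)) *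
		 (?h t*(of_real (D t) * ?F t + of_real (- 2 * sinh t/cosh t^3/t) * ?F' t)-of_real (- sinh t/2/t) * ?h' t * ?F t))
		 \<longlongrightarrow> (- 1)^nat m * of_real (2 powr (- real M)) * of_real 1 * of_real (1^(M+1)) *
		 (h 0*(of_real l*0 + of_real (- 2) * L)-of_real (- (1/2)) * deriv h 0*0)) (at_right 0)"
		by (intro tendsto_mult tendsto_add tendsto_diff tendsto_const tendsto_of_real w amp r hl l F F' X't x't)
	have ev: "\<forall>\<^sub>F t in at_right 0. (- 1)^nat m * of_real (?w t) * of_real (?a t) * of_real ((t^2/(1 - ?X t))^(M+1)) *
		 (?h t*(of_real (D t) * ?F t + of_real (- 2 * sinh t/cosh t^3/t) * ?F' t)-of_real (- sinh t/2/t) * ?h' t * ?F t)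
		 = tor_P n m t * tor_Q' n (int M) t-tor_P' n m t * tor_Q n (int M) t" using h(3) positive_at_right_0
	proof eventually_elim
		case (elim t)
		define G G' :: complex where "G=tor_Q_F n (int M) (of_real (?X t))" and "G'=deriv (tor_Q_F n (int M)) (of_real (?X t))"
		define H H' where "H = ?h t" and "H' = ?h' t"
		define e where "e=(1 - ?X t)^(M+1)"
		have "cosh t > 1" using cosh_half(1)[of t] elim by simp
		hence "(cosh t)^2 > 1" by simp
		hence "?X t < 1" by (simp add: divide_less_eq_1)
		hence epos: "e > 0" unfolding e_def by simp
		have tt: "t powr (real M+1/2) * t powr (real M+1/2) * t=(t^2)^(M+1)"
		proof -
			have "t powr (real M+1/2) * t powr (real M+1/2) * t=t powr (real M+1/2) * t powr (real M+1/2) * t powr 1" using elim by simp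
			also have "... = t powr real (2*(M+1))" by (simp only: powr_add[symmetric]) (simp add: algebra_simps)
			also have "... = t^(2*(M+1))" by (rule powr_realpow) (use elim in simp)
			finally show ?thesis by (simp only: power_mult)
		qed
		have coef: "?w t * ?a t*(t^2/(1 - ?X t))^(M+1) * e=tor_P_omega m t * tor_Q_amp n (int M) t * t"
		proof -
			have "(x/y)^N * y^N=x^N" if "y^N > 0" for x y :: real and N using that unfolding power_divide by (metis nonzero_eq_divide_eq less_irrefl)
			from this[OF epos[unfolded e_def]] have "(t^2/(1 - ?X t))^(M+1) * e=(t^2)^(M+1)" unfolding e_def .
			hence "?w t * ?a t*(t^2/(1 - ?X t))^(M+1) * e = ?w t * ?a t*(t powr (real M+1/2) * t powr (real M+1/2) * t)"
				unfolding tt by (simp only: mult.assoc)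
			thus ?thesis using elim by simp
		qed
		define q where "q=tor_Q_rate n (int M) t"
		define p where "p=tor_P_pi m t"
		have "tor_P n m t * tor_Q' n (int M) t-tor_P' n m t * tor_Q n (int M) t
			 = (- 1)^nat m * of_real (tor_P_omega m t * tor_Q_amp n (int M) t) *
				 (H*(of_real (q-p) * G + of_real (- 2 * sinh t/cosh t^3) * G')-of_real (- sinh t/2) * H' * G)"
			using elim(1) unfolding tor_Q_def tor_Q'_def G_def[symmetric] G'_def[symmetric] H_def[symmetric] H'_def[symmetric] q_def[symmetric] p_def[symmetric]
			by (simp only: of_real_mult of_real_diff) (simp only: algebra_simps)
		also have "q-p=D t * t" unfolding D_def q_def p_def using elim by simp
		also have "(- 1)^nat m * of_real (tor_P_omega m t * tor_Q_amp n (int M) t) *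
				 (H*(of_real (D t * t) * G + of_real (- 2 * sinh t/cosh t^3) * G')-of_real (- sinh t/2) * H' * G)
			 = (- 1)^nat m * of_real (tor_P_omega m t * tor_Q_amp n (int M) t * t) *
				 (H*(of_real (D t) * G + of_real (- 2 * sinh t/cosh t^3/t) * G')-of_real (- sinh t/2/t) * H' * G)"
		proof -
			have "of_real (- 2 * sinh t/cosh t^3) = of_real t * complex_of_real (- 2 * sinh t/cosh t^3/t)"
				"of_real (- sinh t/2) = of_real t * complex_of_real (- sinh t/2/t)" using elim by simp_all
			thus ?thesis by (simp only: of_real_mult) (simp only: algebra_simps)
		qed
		finally have fin: "tor_P n m t * tor_Q' n (int M) t-tor_P' n m t * tor_Q n (int M) t=(- 1)^nat m * of_real (tor_P_omega m t * tor_Q_amp n (int M) t * t) *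
				 (H*(of_real (D t) * G + of_real (- 2 * sinh t/cosh t^3/t) * G')-of_real (- sinh t/2/t) * H' * G)" .
		show ?case unfolding fin coef[symmetric] G_def[symmetric] G'_def[symmetric] H_def[symmetric] H'_def[symmetric] e_def[symmetric]
			by (simp only: of_real_mult) (simp only: algebra_simps)
	qed
	show ?thesis using Lim_transform_eventually[OF main ev] h(2) unfolding M(1) M(2) L_def by (simp add: mult_ac)
qed

lemma half_integer_not_nonpos: "(of_int k+1/2 :: complex) \<notin> \<int>\<^sub>\<le>\<^sub>0"
proof
	assume "(of_int k+1/2 :: complex) \<in> \<int>\<^sub>\<le>\<^sub>0"
	then obtain j where "(of_int k+1/2 :: complex) = of_int j" by (auto elim!: nonpos_Ints_cases)
	hence "(of_int (2 * k+1) :: complex) = of_int (2 * j)" by (simp add: field_simps)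
	hence "2 * k+1=2 * j" by (simp only: of_int_eq_iff)
	thus False by presburger
qed

lemma pochhammer_reflect_half:
	"(- 1)^M * pochhammer (1/2-of_nat n) M * Gamma (of_nat n-of_nat M+1/2)=(Gamma (of_nat n+1/2) :: complex)"
proof (induction M)
	case (Suc M)
	have e: "of_nat n-of_nat M+1/2=(of_int (int n-int M-1)+1/2 :: complex)+1" by simp
	have "Gamma (of_nat n-of_nat M+1/2)=(of_int (int n-int M-1)+1/2) * Gamma (of_int (int n-int M-1)+1/2 :: complex)"
		unfolding e by (rule Gamma_plus1[OF half_integer_not_nonpos])
	moreover have "(of_int (int n-int M-1)+1/2 :: complex) = of_nat n-of_nat (Suc M)+1/2"
		"(of_int (int n-int M-1)+1/2 :: complex) = - (1/2-of_nat n + of_nat M)" by simp_all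
	ultimately have g: "Gamma (of_nat n-of_nat M+1/2) = - (1/2-of_nat n + of_nat M) * Gamma (of_nat n-of_nat (Suc M)+1/2 :: complex)" by metis
	have "(- 1)^Suc M*(p * x) * G=(- 1)^M * p*(- x * G)" for p x G :: complex by simp
	thus ?case unfolding pochhammer_Suc by (simp only: g[symmetric] Suc.IH)
qed simp

lemma tor_P_lead_Gamma:
	"(- 1)^nat m * tor_P_lead n m * fact (nat \<bar>m\<bar>) * Gamma (of_nat n-of_int m+1/2)=Gamma (of_nat n + of_int \<bar>m\<bar>+1/2)"
proof (cases "m >= 0")
	case True
	then obtain M where M: "m=int M" by (metis zero_le_imp_eq_int)
	have "rGamma (1-of_int m + of_nat M :: complex)=1" unfolding M by simp
	hence lead: "tor_P_lead n m=pochhammer (1/2-of_nat n) M * pochhammer (of_nat n+1/2) M/fact M"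
		unfolding tor_P_lead_def olver_coeff_def using M by simp
	have hn: "(of_nat n+1/2 :: complex) \<notin> \<int>\<^sub>\<le>\<^sub>0" using half_integer_not_nonpos[of "int n"] by simp
	have "pochhammer (of_nat n+1/2) M * Gamma (of_nat n+1/2)=(Gamma (of_nat n+1/2 + of_nat M) :: complex)"
		using pochhammer_Gamma[OF hn,of M] hn by (simp add: Gamma_eq_zero_iff)
	hence "((- 1)^M * pochhammer (1/2-of_nat n) M * Gamma (of_nat n-of_nat M+1/2)) * pochhammer (of_nat n+1/2) M=(Gamma (of_nat n+1/2 + of_nat M) :: complex)"
		unfolding pochhammer_reflect_half by (simp add: mult.commute)
	thus ?thesis unfolding lead using M by (simp add: mult_ac add_ac)
next
	case False
	define M where "M=nat (- m)"
	have M: "m = - int M" "nat m=0" "nat \<bar>m\<bar>=M" using False by (auto simp: M_def)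
	have "rGamma (1 + of_nat M :: complex)=1/fact M" by (simp add: rGamma_inverse_Gamma Gamma_fact inverse_eq_divide)
	hence "tor_P_lead n m=1/fact M" unfolding tor_P_lead_def olver_coeff_def M(2) unfolding M(1) by simp
	thus ?thesis unfolding M(2,3) unfolding M(1) by simp
qed

text \<open>The Wronskian is constant and is read off at the origin from the leading terms of both functions. That of the second comes from an Abelian theorem for the hypergeometric series; the duplication formula simplifies the constant.\<close>

lemma tor_wronskian:
	assumes t: "t > 0"
	shows "tor_P n m t * tor_Q' n m t-tor_P' n m t * tor_Q n m t
		 = - of_real (2 powr (real n+1/2)/sqrt pi)/Gamma (of_nat n-of_int m+1/2)"
proof -
	define M where "M=nat \<bar>m\<bar>"
	have M: "\<bar>m\<bar>=int M" "\<bar>of_int m\<bar>=real M" "nat \<bar>m\<bar>=M" by (auto simp: M_def)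
	let ?V = "toroidal_potential n m"
	have V: "toroidal_potential n \<bar>m\<bar> = ?V" by (simp add: toroidal_potential_def fun_eq_iff)
	have s: "schroedinger_on {0<..} ?V (tor_Q n \<bar>m\<bar>) (tor_Q' n \<bar>m\<bar>)" using tor_Q_solution[of n "\<bar>m\<bar>"] unfolding V .
	obtain c where c: "!!t. t > 0 ==> tor_P n m t * tor_Q' n \<bar>m\<bar> t-tor_P' n m t * tor_Q n \<bar>m\<bar> t = c"
		using schroedinger_wronskian_constant[OF tor_P_solution s] by (auto simp: convex_real_interval)
	have "\<forall>\<^sub>F t in at_right 0. tor_P n m t * tor_Q' n \<bar>m\<bar> t-tor_P' n m t * tor_Q n \<bar>m\<bar> t = c"
		using positive_at_right_0 by eventually_elim (rule c)
	hence "((%t. tor_P n m t * tor_Q' n \<bar>m\<bar> t-tor_P' n m t * tor_Q n \<bar>m\<bar> t) \<longlongrightarrow> c) (at_right 0)"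
		by (rule tendsto_eventually)
	hence c1: "c=(- 1)^nat m * of_real (2 powr (- \<bar>of_int m\<bar>))*(- 2 * tor_P_lead n m *
			 (rGamma (tor_Q_par n \<bar>m\<bar>) * rGamma (tor_Q_par n \<bar>m\<bar>+1/2) * fact (nat \<bar>m\<bar>)))"
		using tendsto_unique[OF _ _ tor_wronskian_limit] by force
	define a where "a=tor_Q_par n \<bar>m\<bar>"
	have a2: "2 * a = of_nat n + of_int \<bar>m\<bar>+1/2" by (simp add: a_def tor_Q_par_def)
	have apos: "a = of_real ((real n + real M+1/2)/2)" "a+1/2 = of_real ((real n + real M+1/2)/2+1/2)" unfolding a_def tor_Q_par_def M(1) by simp_all
	have an: "a \<notin> \<int>\<^sub>\<le>\<^sub>0" "a+1/2 \<notin> \<int>\<^sub>\<le>\<^sub>0"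
	proof -
		have neg: "complex_of_real x \<notin> \<int>\<^sub>\<le>\<^sub>0" if "x > 0" for x using that by (auto dest!: nonpos_Ints_nonpos simp: of_real_in_nonpos_Ints_iff)
		show "a \<notin> \<int>\<^sub>\<le>\<^sub>0" unfolding apos(1) by (rule neg) simp
		show "a+1/2 \<notin> \<int>\<^sub>\<le>\<^sub>0" unfolding apos(2) by (rule neg) (simp add: add_pos_nonneg add_nonneg_pos)
	qed
	have g2: "(of_nat n + of_int \<bar>m\<bar>+1/2 :: complex) \<notin> \<int>\<^sub>\<le>\<^sub>0" "(of_nat n-of_int m+1/2 :: complex) \<notin> \<int>\<^sub>\<le>\<^sub>0"
		using half_integer_not_nonpos[of "int n+\<bar>m\<bar>"] half_integer_not_nonpos[of "int n-m"] by simp_all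
	have gne: "Gamma (of_nat n + of_int \<bar>m\<bar>+1/2 :: complex) ~= 0" "Gamma (of_nat n-of_int m+1/2 :: complex) ~= 0"
		using g2 by (simp_all add: Gamma_eq_zero_iff)
	have dup: "Gamma a * Gamma (a+1/2)=exp ((1-2 * a) * of_real (ln 2)) * of_real (sqrt pi) * Gamma (of_nat n + of_int \<bar>m\<bar>+1/2)"
		using Gamma_legendre_duplication[OF an] unfolding a2 .
	have ex: "exp ((1-2 * a) * of_real (ln 2)) = of_real (2 powr (1/2-real n-real M))"
	proof -
		have "(1-2 * a) * of_real (ln 2) = of_real ((1/2-real n-real M) * ln 2)" unfolding a2 M(1) by simp
		thus ?thesis by (simp only: exp_of_real powr_def) simp
	qed
	have rr: "rGamma a * rGamma (a+1/2)=1/(of_real (2 powr (1/2-real n-real M)) * of_real (sqrt pi) * Gamma (of_nat n + of_int \<bar>m\<bar>+1/2))"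
		unfolding rGamma_inverse_Gamma inverse_eq_divide using dup unfolding ex by simp
	have lead: "(- 1)^nat m * tor_P_lead n m * fact M=Gamma (of_nat n + of_int \<bar>m\<bar>+1/2)/Gamma (of_nat n-of_int m+1/2)"
		using tor_P_lead_Gamma[of m n] gne unfolding M(3) by (simp add: field_simps)
	have "c = - 2 * of_real (2 powr (- real M))*((- 1)^nat m * tor_P_lead n m * fact M)*(rGamma a * rGamma (a+1/2))"
		unfolding c1 M(2,3) a_def by (simp only: mult_ac)
	also have "... = - (2 * of_real (2 powr (- real M))/of_real (2 powr (1/2-real n-real M) * sqrt pi))/Gamma (of_nat n-of_int m+1/2)"
		unfolding lead rr using gne by simp
	also have "2 * of_real (2 powr (- real M))/of_real (2 powr (1/2-real n-real M) * sqrt pi) = complex_of_real (2*2 powr (- real M)/(2 powr (1/2-real n-real M) * sqrt pi))" by simp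
	also have "2*2 powr (- real M)/(2 powr (1/2-real n-real M) * sqrt pi)=2 powr (real n+1/2)/sqrt pi"
	proof -
		have "2*2 powr (- real M)/2 powr (1/2-real n-real M)=(2::real) powr (1 + - real M-(1/2-real n-real M))" by (simp only: powr_diff powr_add) simp
		also have "1 + - real M-(1/2-real n-real M)=real n+1/2" by simp
		finally show ?thesis by (simp add: field_simps)
	qed
	finally show ?thesis using c[OF t] unfolding tor_Q_abs_order[OF t,of n m] by simp
qed

section \<open>The Frobenius solution at the pole\<close>

lemma second_derivative_from_derivatives:
	fixes y :: "complex => complex"
	assumes S: "open S" and d: "!!s. s \<in> S ==> (y has_field_derivative y1 s) (at s)" "!!s. s \<in> S ==> (y1 has_field_derivative y2 s) (at s)"
	shows "y holomorphic_on S" "s \<in> S ==> deriv (deriv y) s=y2 s"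
proof -
	show h: "y holomorphic_on S" using d(1) S by (meson holomorphic_on_open)
	assume s: "s \<in> S"
	have "deriv (deriv y) s=deriv y1 s"
	proof (rule complex_derivative_transform_within_open[OF _ _ S s])
		show "deriv y holomorphic_on S" by (rule holomorphic_deriv[OF h S])
		show "y1 holomorphic_on S" using d(2) S by (meson holomorphic_on_open)
		show "!!w. w \<in> S ==> deriv y w=y1 w" using d(1) DERIV_imp_deriv by blast
	qed
	thus "deriv (deriv y) s=y2 s" using DERIV_imp_deriv[OF d(2)[OF s]] by simp
qed

text \<open>The regular part is even because the function is odd; this is why only every second Frobenius coefficient occurs.\<close>

lemma odd_reciprocal_square:
	fixes f :: "complex => complex"
	assumes S: "open S" "0 \<in> S" and f: "f holomorphic_on S" "f 0=0" "deriv f 0=1" "!!z. f (- z) = - f z"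
	obtains r g where "r > 0" "g holomorphic_on ball 0 r" "!!u. g (- u)=g u"
		"!!u. u \<in> ball 0 r ==> u ~= 0 ==> inverse ((f u)^2)=inverse (u^2) + g u"
proof -
	define f1 where "f1 z=(if z=0 then deriv f 0 else (f z-f 0)/(z-0))" for z
	have f1h: "f1 holomorphic_on S" unfolding f1_def[abs_def] by (rule pole_lemma_open[OF f(1) S(1)])
	have f1: "f u=u * f1 u" for u using f by (simp add: f1_def)
	have f1e: "f1 (- u)=f1 u" for u by (simp add: f1_def f)
	have "open (S \<inter> f1 -` (- {0}))" by (intro continuous_open_preimage holomorphic_on_imp_continuous_on f1h S) auto
	moreover have "0 \<in> S \<inter> f1 -` (- {0})" using S f by (simp add: f1_def)
	ultimately obtain r where r: "r > 0" "ball 0 r \<subseteq> S \<inter> f1 -` (- {0})" by (meson openE)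
	define G where "G z=inverse ((f1 z)^2)" for z
	have Gh: "G holomorphic_on ball 0 r" unfolding G_def[abs_def] using r(2) by (intro holomorphic_intros holomorphic_on_subset[OF f1h]) auto
	have Ge: "G (- u)=G u" for u by (simp add: G_def f1e)
	have G0: "G 0=1" by (simp add: G_def f1_def f)
	have z: "(0::complex) \<in> ball 0 r" using r by simp
	have D: "(G has_field_derivative deriv G 0) (at 0)" by (rule holomorphic_derivI[OF Gh open_ball z])
	have "((%u. G (- u)) has_field_derivative deriv G 0 * - 1) (at 0)"
		by (rule DERIV_chain2[of G]) (use D in \<open>auto intro!: derivative_eq_intros\<close>)
	hence "deriv G 0=deriv G 0 * - 1" unfolding Ge using D by (metis DERIV_unique)
	hence G'0: "deriv G 0=0" by simp
	define g1 where "g1 z=(if z=0 then deriv G 0 else (G z-G 0)/(z-0))" for z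
	define g where "g z=(if z=0 then deriv g1 0 else (g1 z-g1 0)/(z-0))" for z
	have g1h: "g1 holomorphic_on ball 0 r" unfolding g1_def[abs_def] by (rule pole_lemma_open[OF Gh open_ball])
	have gh: "g holomorphic_on ball 0 r" unfolding g_def[abs_def] by (rule pole_lemma_open[OF g1h open_ball])
	have ge: "g (- u)=g u" for u by (simp add: g_def g1_def Ge G'0)
	have "inverse ((f u)^2)=inverse (u^2) + g u" if "u ~= 0" for u
	proof -
		have "inverse ((f u)^2)=inverse (u^2) * G u" by (simp add: f1 G_def power_mult_distrib)
		also have "G u=1 + u^2 * g u" using that by (simp add: g_def g1_def G'0 G0 power2_eq_square)
		finally show ?thesis using that by (simp add: distrib_left)
	qed
	with r(1) gh ge show ?thesis by (rule that)
qed

lemma even_power_series: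
	fixes W :: "complex => complex"
	assumes r: "r > 0" and W: "W holomorphic_on ball 0 r" "!!u. W (- u)=W u"
	obtains w M where "!!j. norm (w j) <= M*(2/r)^j" "!!j. odd j ==> w j=0"
		"!!u. norm u < r ==> (%j. w j * u^j) sums W u"
proof -
	define w where "w j=(deriv ^^ j) W 0/fact j" for j
	have sums: "(%j. w j * u^j) sums W u" if "norm u < r" for u using holomorphic_power_series[OF W(1),of u] that by (simp add: w_def)
	have odd: "w j=0" if "odd j" for j
	proof -
		have "(deriv ^^ j) W 0=(deriv ^^ j) (%u. W (- 1 * u+0)) 0" by (simp add: W(2))
		also have "... = (- 1)^j*(deriv ^^ j) W (- 1*0+0)"
			by (rule higher_deriv_compose_linear'[where S = "ball 0 r" and T = "ball 0 r",OF W(1) open_ball open_ball]) (use r in auto)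
		finally have "(deriv ^^ j) W 0 = - (deriv ^^ j) W 0" using that by simp
		thus ?thesis by (simp add: w_def)
	qed
	have "(%j. w j * of_real (r/2)^j) \<longlonglongrightarrow> 0" using sums[of "of_real (r/2)"] r by (intro summable_LIMSEQ_zero) (auto simp: sums_iff)
	hence "Bseq (%j. w j * of_real (r/2)^j)" using convergent_imp_Bseq convergent_def by blast
	then obtain M where M: "!!j. norm (w j * of_real (r/2)^j) <= M" by (auto simp: Bseq_def)
	have "norm (w j) <= M*(2/r)^j" for j
	proof -
		have "norm (w j)*(r/2)^j <= M" using M[of j] r by (simp add: norm_mult norm_power)
		hence "norm (w j)*(r/2)^j*(2/r)^j <= M*(2/r)^j" using r by (intro mult_right_mono) auto
		thus ?thesis using r by (simp add: power_divide)
	qed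
	thus ?thesis using odd sums by (rule that)
qed

text \<open>The power series \<open>B\<close> with \<open>B(0) = 1\<close> and \<open>u B'' + 2 \<sigma> B' = u W B\<close>, where \<open>W\<close> has the coefficients \<open>w\<close>.\<close>

fun frobenius_coeff :: "(nat => complex) => real => nat => complex" where
	"frobenius_coeff w \<sigma> 0=1"
| "frobenius_coeff w \<sigma> (Suc 0)=0"
| "frobenius_coeff w \<sigma> (Suc (Suc j)) =
		 (\<Sum>i\<le>j. w i * frobenius_coeff w \<sigma> (j-i))/of_real ((real j+2)*(real j+1+2*\<sigma>))"

lemma frobenius_coeff_odd:
	assumes w: "!!j. odd j ==> w j=0"
	shows "odd j ==> frobenius_coeff w \<sigma> j=0"
proof (induction j rule: less_induct)
	case (less j)
	then consider "j=1" | i where "j=Suc (Suc i)" by (metis One_nat_def not0_implies_Suc even_zero)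
	thus ?case
	proof cases
		case 2
		have "w l * frobenius_coeff w \<sigma> (i-l)=0" if "l <= i" for l using w[of l] less.IH[of "i-l"] less.prems that 2 by (cases "odd l") auto
		thus ?thesis unfolding 2 by (simp add: sum.neutral)
	qed simp
qed

lemma frobenius_coeff_bound:
	assumes w: "!!j. norm (w j) <= M * R^j" and R: "1 <= R" "M <= R^2" and \<sigma>: "\<sigma> >= 1/2"
	shows "norm (frobenius_coeff w \<sigma> j) <= R^j"
proof (induction j rule: less_induct)
	case (less j)
	have M: "M >= 0" using w[of 0] norm_ge_zero[of "w 0"] by (simp del: norm_ge_zero)
	consider "j=0" | "j=1" | i where "j=Suc (Suc i)" by (metis One_nat_def not0_implies_Suc)
	thus ?case
	proof cases
		case (3 i)
		let ?D = "(real i+2)*(real i+1+2*\<sigma>)"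
		have D: "?D > 0" using \<sigma> by (intro mult_pos_pos) auto
		have "norm (\<Sum>l\<le>i. w l * frobenius_coeff w \<sigma> (i-l)) <= (\<Sum>l\<le>i. M * R^i)"
		proof (rule sum_norm_le)
			fix l assume l: "l \<in> {..i}"
			have "norm (w l * frobenius_coeff w \<sigma> (i-l)) <= (M * R ^ l) * R^(i-l)" unfolding norm_mult by (intro mult_mono w less) (use 3 M R in auto)
			also have "... = M * R^i" using l by (simp add: mult.assoc flip: power_add)
			finally show "norm (w l * frobenius_coeff w \<sigma> (i-l)) <= M * R^i" .
		qed
		also have "... = (real i+1)*(M * R^i)" by simp
		also have "... <= ?D*(R^2 * R^i)"
		proof (intro mult_mono)
			have "1*(real i+1) <= ?D" using \<sigma> by (intro mult_mono) auto
			thus "real i+1 <= ?D" by simp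
		qed (use R M \<sigma> D in auto)
		finally have "norm (\<Sum>l\<le>i. w l * frobenius_coeff w \<sigma> (i-l)) <= R^j * ?D" by (simp add: 3 power2_eq_square mult_ac)
		hence "norm (\<Sum>l\<le>i. w l * frobenius_coeff w \<sigma> (i-l)) / ?D <= R^j" using D by (simp only: pos_divide_le_eq)
		moreover have "norm (complex_of_real ?D) = ?D" using D by (simp only: norm_of_real abs_of_pos)
		ultimately show ?thesis unfolding 3 frobenius_coeff.simps norm_divide by simp
	qed (use R in auto)
qed

lemma frobenius_series:
	fixes u :: complex
	assumes w: "!!j. norm (w j) <= M * R^j" and R: "1 <= R" "M <= R^2" and \<sigma>: "\<sigma> >= 1/2"
		and u: "norm u < 1/R" and W: "(%j. w j * u^j) sums W"
	defines "b \<equiv> frobenius_coeff w \<sigma>"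
	shows "(%j. b j * u^j) sums (\<Sum>j. b j * u^j)"
		"((%u. \<Sum>j. b j * u^j) has_field_derivative (\<Sum>j. diffs b j * u^j)) (at u)"
		"((%u. \<Sum>j. diffs b j * u^j) has_field_derivative (\<Sum>j. diffs (diffs b) j * u^j)) (at u)"
		"u*(\<Sum>j. diffs (diffs b) j * u^j)+2 * of_real \<sigma>*(\<Sum>j. diffs b j * u^j)=u*(W*(\<Sum>j. b j * u^j))"
proof -
	have M: "M >= 0" using w[of 0] norm_ge_zero[of "w 0"] by (simp del: norm_ge_zero)
	have geo: "summable (%j. c*(R * norm v)^j)" if "norm v < 1/R" for v :: complex and c :: real
		using that R by (intro summable_mult summable_geometric) (simp add: field_simps)
	have smn: "summable (%j. norm (b j * v^j))" if "norm v < 1/R" for v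
	proof (rule summable_comparison_test'[OF geo[OF that,of 1]])
		fix j show "norm (norm (b j * v^j)) <= 1*(R * norm v)^j"
			using frobenius_coeff_bound[of w M R \<sigma> j,OF w R \<sigma>] by (simp add: b_def norm_mult norm_power power_mult_distrib mult_right_mono)
	qed
	have smw: "summable (%j. norm (w j * u^j))"
	proof (rule summable_comparison_test'[OF geo[OF u,of M]])
		fix j show "norm (norm (w j * u^j)) <= M*(R * norm u)^j"
			using mult_right_mono[OF w[of j],of "norm u^j"] by (simp add: norm_mult norm_power power_mult_distrib mult.assoc)
	qed
	have sm: "summable (%j. b j * v^j)" if "norm v < 1/R" for v by (rule summable_norm_cancel[OF smn[OF that]])
	have sm1: "summable (%j. diffs b j * v^j)" if "norm v < 1/R" for v by (rule termdiff_converges[OF that sm])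
	have sm2: "summable (%j. diffs (diffs b) j * v^j)" if "norm v < 1/R" for v by (rule termdiff_converges[OF that sm1])
	show S0: "(%j. b j * u^j) sums (\<Sum>j. b j * u^j)" by (rule summable_sums[OF sm[OF u]])
	show "((%u. \<Sum>j. b j * u^j) has_field_derivative (\<Sum>j. diffs b j * u^j)) (at u)" by (rule termdiffs_strong'[OF sm u])
	show "((%u. \<Sum>j. diffs b j * u^j) has_field_derivative (\<Sum>j. diffs (diffs b) j * u^j)) (at u)" by (rule termdiffs_strong'[OF sm1 u])
	let ?B = "\<Sum>j. b j * u^j" and ?B1 = "\<Sum>j. diffs b j * u^j" and ?B2 = "\<Sum>j. diffs (diffs b) j * u^j"
	let ?c = "%j. \<Sum>i\<le>j. w i * b (j-i)"
	have d0: "diffs b 0=0" by (simp add: diffs_def b_def)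
	have S1: "(%j. diffs b (Suc j) * u^Suc j) sums ?B1" using sums_Suc_iff[of "%j. diffs b j * u^j" ?B1] summable_sums[OF sm1[OF u]] d0 by simp
	have L: "(%j. u*(diffs (diffs b) j * u^j)+2 * of_real \<sigma>*(diffs b (Suc j) * u^Suc j)) sums (u * ?B2+2 * of_real \<sigma> * ?B1)"
		by (intro sums_add sums_mult S1 summable_sums[OF sm2[OF u]])
	have rec: "of_nat (Suc j)*(of_nat (Suc (Suc j)) * b (Suc (Suc j)))+2 * of_real \<sigma>*(of_nat (Suc (Suc j)) * b (Suc (Suc j))) = ?c j" for j
	proof -
		let ?D = "(real j+2)*(real j+1+2*\<sigma>)"
		have D: "complex_of_real ?D ~= 0" using \<sigma> by (simp only: of_real_eq_0_iff) (simp add: mult_eq_0_iff)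
		have "of_nat (Suc j)*(of_nat (Suc (Suc j)) * x)+2 * of_real \<sigma>*(of_nat (Suc (Suc j)) * x)=x * of_real ?D" for x :: complex
			by (simp add: algebra_simps)
		note eq=this
		have c: "x/d * d=x" if "d ~= 0" for x d :: complex using that by simp
		show ?thesis unfolding b_def frobenius_coeff.simps eq c[OF D] ..
	qed
	have "u*(diffs (diffs b) j * u^j)+2 * of_real \<sigma>*(diffs b (Suc j) * u^Suc j)=u*(?c j * u^j)" for j
	proof -
		have "u*(diffs (diffs b) j * u^j)+2 * of_real \<sigma>*(diffs b (Suc j) * u^Suc j)
			= (of_nat (Suc j)*(of_nat (Suc (Suc j)) * b (Suc (Suc j)))+2 * of_real \<sigma>*(of_nat (Suc (Suc j)) * b (Suc (Suc j))))*(u * u^j)"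
			unfolding diffs_def by (simp only: power_Suc distrib_right distrib_left mult_ac)
		thus ?thesis unfolding rec by (simp only: mult_ac)
	qed
	with L have L': "(%j. u*(?c j * u^j)) sums (u * ?B2+2 * of_real \<sigma> * ?B1)" by simp
	have "(%j. \<Sum>i\<le>j. (w i * u^i)*(b (j-i) * u^(j-i))) sums ((\<Sum>j. w j * u^j) * ?B)" by (rule Cauchy_product_sums[OF smw smn[OF u]])
	moreover have "(\<Sum>i\<le>j. (w i * u^i)*(b (j-i) * u^(j-i))) = ?c j * u^j" for j unfolding sum_distrib_right
	proof (rule sum.cong[OF refl])
		fix i assume "i \<in> {..j}"
		hence "u^j=u^i * u^(j-i)" by (simp flip: power_add)
		thus "(w i * u^i)*(b (j-i) * u^(j-i))=w i * b (j-i) * u^j" by (simp only: mult_ac)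
	qed
	ultimately have "(%j. u*(?c j * u^j)) sums (u*(W * ?B))" using W by (intro sums_mult) (simp add: sums_iff)
	with L' show "u * ?B2+2 * of_real \<sigma> * ?B1=u*(W * ?B)" by (rule sums_unique2)
qed

lemma shift_derivative:
	assumes "(f has_field_derivative (D::complex)) (at (s-c))"
	shows "((%s. f (s-c)) has_field_derivative D) (at s)"
proof -
	have "((%s. s-c) has_field_derivative 1) (at s)" by (auto intro!: derivative_eq_intros)
	from DERIV_chain2[of f D "%s. s-c" s 1 UNIV,OF assms this] show ?thesis by simp
qed

text \<open>At \<open>iK' + u\<close> the shift turns the potential into \<open>\<nu>(\<nu>+1)/sn(u)^2 - h\<close>, whose Frobenius solution is a convergent series. It then continues to the strip as a solution of a linear equation.\<close>

lemma lame_frobenius_exists: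
	assumes k: "0 < k" "k < 1" and \<nu>: "\<nu> >= - 1/2"
	obtains F where "lame_ode \<nu> k h F" "frobenius_at_iK' \<nu> k F"
proof -
	let ?K = "elliptic_K' k" and ?i = "\<i> * complex_of_real (elliptic_K' k)"
	define \<sigma> where "\<sigma>=\<nu>+1"
	have \<sigma>: "\<sigma> >= 1/2" using \<nu> by (simp add: \<sigma>_def)
	have Kpos: "?K > 0" by (rule elliptic_K'_pos[OF k])
	obtain r g where g: "r > 0" "g holomorphic_on ball 0 r" "!!u. g (- u)=g u"
		"!!u. u \<in> ball 0 r ==> u ~= 0 ==> inverse ((sn_cont k u)^2)=inverse (u^2) + g u"
		using odd_reciprocal_square[OF open_strip zero_in_strip[OF k] sn_cont_holomorphic[OF k] sn_cont_0[OF k] sn_cont_deriv_0[OF k] sn_cont_minus[OF k]]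
		by blast
	define W where "W u = of_real (\<nu>*(\<nu>+1)) * g u-of_real h" for u
	have Wh: "W holomorphic_on ball 0 r" unfolding W_def[abs_def] by (intro holomorphic_intros g)
	have We: "W (- u)=W u" for u by (simp add: W_def g(3))
	obtain w M where w: "!!j. norm (w j) <= M*(2/r)^j" "!!j. odd j ==> w j=0" "!!u. norm u < r ==> (%j. w j * u^j) sums W u"
		using even_power_series[OF g(1) Wh We] by blast
	have M: "M >= 0" using w(1)[of 0] norm_ge_zero[of "w 0"] by (simp del: norm_ge_zero)
	define R where "R=1+2/r + M"
	have R: "1 <= R" "2/r <= R" "M <= R" using g(1) M by (auto simp: R_def)
	have "R*1 <= R * R" by (rule mult_left_mono) (use R in auto)
	hence R2: "M <= R^2" using R(3) unfolding power2_eq_square by linarith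
	have wR: "norm (w j) <= M * R^j" for j using w(1)[of j] mult_left_mono[OF power_mono[OF R(2),of j] M] g(1) by simp
	define b where "b=frobenius_coeff w \<sigma>"
	define \<rho> where "\<rho>=min (1/R) (min r ?K)"
	have \<rho>: "\<rho> > 0" "\<rho> <= 1/R" "\<rho> <= r" "\<rho> <= ?K" using R g(1) Kpos by (auto simp: \<rho>_def)
	note fs=frobenius_series[OF wR R(1) R2 \<sigma>,folded b_def]
	define S where "S=strip k \<inter> ball ?i \<rho>"
	have S: "open S" "connected S" "S \<subseteq> strip k" unfolding S_def by (auto intro!: convex_connected convex_Int convex_strip open_strip)
	let ?B = "%u. \<Sum>j. b j * u^j" and ?B1 = "%u. \<Sum>j. diffs b j * u^j" and ?B2 = "%u. \<Sum>j. diffs (diffs b) j * u^j"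
	let ?\<sigma> = "complex_of_real \<sigma>"
	define y where "y s=(s - ?i) powr ?\<sigma> * ?B (s - ?i)" for s
	define y1 where "y1 s = ?\<sigma>*(s - ?i) powr (?\<sigma>-1) * ?B (s - ?i)+(s - ?i) powr ?\<sigma> * ?B1 (s - ?i)" for s
	have uS: "norm (s - ?i) < 1/R & norm (s - ?i) < r & Im (s - ?i) < 0 & - ?K < Im (s - ?i) & s - ?i \<notin> \<real>\<^sub>\<le>\<^sub>0 & s - ?i ~= 0" if "s \<in> S" for s
	proof -
		have n: "norm (s - ?i) < \<rho>" using that by (simp add: S_def dist_norm norm_minus_commute)
		have i: "Im (s - ?i) < 0" using that by (auto simp: S_def strip_def)
		have c: "s - ?i \<notin> \<real>\<^sub>\<le>\<^sub>0" using i unfolding complex_nonpos_Reals_iff by linarith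
		hence "s - ?i ~= 0" by auto
		moreover have "\<bar>Im (s - ?i)\<bar> <= norm (s - ?i)" by (rule abs_Im_le_cmod)
		hence "- ?K < Im (s - ?i)" "norm (s - ?i) < 1/R" "norm (s - ?i) < r" using n i \<rho> by linarith+
		ultimately show ?thesis using i c by blast
	qed
	have powr_shift: "u powr (z-1)=u powr z/u" if "u ~= 0" for u z :: complex using that by (simp add: powr_def exp_diff left_diff_distrib)
	have dy: "(y has_field_derivative y1 s) (at s)" "(y1 has_field_derivative (of_real (\<nu>*(\<nu>+1) * k^2)*(sn_cont k s)^2-of_real h) * y s) (at s)"
		if s: "s \<in> S" for s
	proof -
		define u where "u=s - ?i"
		note us=uS[OF s,folded u_def]
		have Wu: "(%j. w j * u^j) sums W u" using us by (intro w) auto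
		note f=fs[OF _ Wu]
		have P: "((%s. (s - ?i) powr z) has_field_derivative z * u powr (z-1)) (at s)" for z
			by (rule shift_derivative) (simp only: u_def[symmetric] has_field_derivative_powr us not_False_eq_True)
		have B: "((%s. ?B (s - ?i)) has_field_derivative ?B1 u) (at s)" "((%s. ?B1 (s - ?i)) has_field_derivative ?B2 u) (at s)"
			using f(2,3) us by (auto intro!: shift_derivative simp: u_def)
		show "(y has_field_derivative y1 s) (at s)"
			unfolding y_def[abs_def] y1_def using DERIV_mult[OF P[of ?\<sigma>] B(1)] by (simp only: u_def mult.commute[of "?B1 _"])
		have d: "(y1 has_field_derivative ?\<sigma>*((?\<sigma>-1) * u powr (?\<sigma>-1-1)) * ?B u + ?\<sigma> * u powr (?\<sigma>-1) * ?B1 u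
				+ (?\<sigma> * u powr (?\<sigma>-1) * ?B1 u + u powr ?\<sigma> * ?B2 u)) (at s)"
			unfolding y1_def[abs_def] using DERIV_add[OF DERIV_mult[OF DERIV_cmult[OF P[of "?\<sigma>-1"],of ?\<sigma>] B(1)] DERIV_mult[OF P[of ?\<sigma>] B(2)]]
			by (simp only: u_def mult.commute[of "?B1 _"] mult.commute[of "?B2 _"])
		define p where "p=u powr ?\<sigma>"
		have u0: "u ~= 0" using us by blast
		have "of_real k * sn_cont k (?i + u) * sn_cont k u=1" by (rule sn_cont_shift[OF k]) (use us in auto)
		hence ks: "of_real k * sn_cont k s * sn_cont k u=1" by (simp add: u_def)
		hence sn0: "sn_cont k u ~= 0" by auto
		have "(of_real k * sn_cont k s)^2*(sn_cont k u)^2=1" using ks by (simp flip: power_mult_distrib)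
		hence "(of_real k * sn_cont k s)^2=inverse ((sn_cont k u)^2)" using sn0 by (simp add: field_simps)
		also have "... = inverse (u^2) + g u" by (rule g(4)) (use us in auto)
		finally have "of_real (\<nu>*(\<nu>+1) * k^2)*(sn_cont k s)^2 = of_real (\<nu>*(\<nu>+1))*(inverse (u^2) + g u)"
			by (simp add: power_mult_distrib mult_ac)
		hence V: "of_real (\<nu>*(\<nu>+1) * k^2)*(sn_cont k s)^2-of_real h = of_real (\<nu>*(\<nu>+1)) * inverse (u^2) + W u"
			by (simp add: W_def algebra_simps)
		have ss: "?\<sigma>*(?\<sigma>-1) = of_real (\<nu>*(\<nu>+1))" by (simp add: \<sigma>_def mult.commute)
		have e: "?\<sigma>*((?\<sigma>-1)*(p/u/u)) * ?B u + ?\<sigma>*(p/u) * ?B1 u+(?\<sigma>*(p/u) * ?B1 u + p * ?B2 u)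
			= (?\<sigma>*(?\<sigma>-1)) * inverse (u^2)*(p * ?B u) + p/u*(u * ?B2 u+2 * ?\<sigma> * ?B1 u)"
			using u0 by (simp add: field_simps power2_eq_square)
		have "?\<sigma>*((?\<sigma>-1)*(p/u/u)) * ?B u + ?\<sigma>*(p/u) * ?B1 u+(?\<sigma>*(p/u) * ?B1 u + p * ?B2 u)
			= (of_real (\<nu>*(\<nu>+1)) * inverse (u^2) + W u)*(p * ?B u)" unfolding e ss using f(4) us u0 by (simp add: distrib_right)
		thus "(y1 has_field_derivative (of_real (\<nu>*(\<nu>+1) * k^2)*(sn_cont k s)^2-of_real h) * y s) (at s)"
			using d unfolding V y_def u_def[symmetric] powr_shift[OF u0] p_def[symmetric] by simp
	qed
	note sd=second_derivative_from_derivatives[OF S(1) dy]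
	define s0 where "s0 = ?i-\<i> * of_real (\<rho>/2)"
	have s0: "s0 \<in> S" unfolding S_def s0_def using \<rho> by (auto simp: strip_def dist_norm norm_mult)
	obtain F where F: "lame_ode \<nu> k h F" "F s0=y s0" "deriv F s0=deriv y s0"
		using lame_ode_exists[OF k,of s0 \<nu> h "y s0" "deriv y s0"] s0 S(3) by blast
	have Fy: "F s=y s" if "s \<in> S" for s by (rule lame_ode_unique[OF k S s0 sd(1) sd(2) F(1) _ _ that,symmetric]) (use F in auto)
	have "frobenius_at_iK' \<nu> k F" unfolding frobenius_at_iK'_def
	proof (intro exI conjI ballI)
		show "\<rho> > 0" by (rule \<rho>)
		show "b (2*0) ~= 0" by (simp add: b_def)
		fix s assume "s \<in> strip k \<inter> ball ?i \<rho>"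
		hence s: "s \<in> S" by (simp add: S_def)
		define u where "u=s - ?i"
		note us=uS[OF s,folded u_def]
		have Wu: "(%j. w j * u^j) sums W u" using us by (intro w) auto
		have "(%j. b j * u^j) sums ?B u" using fs(1)[OF _ Wu] us by blast
		moreover have "strict_mono (%p::nat. 2 * p)" by (simp add: strict_mono_def)
		moreover have "b j * u^j=0" if "j \<notin> range (%p::nat. 2 * p)" for j
			using that frobenius_coeff_odd[where w=w and j=j and \<sigma>=\<sigma>,OF w(2)] by (auto simp: b_def elim: evenE)
		ultimately have "(%p. b (2 * p) * u^(2 * p)) sums ?B u" using sums_mono_reindex[of "%p::nat. 2 * p" "%j. b j * u^j"] by blast
		from sums_mult[OF this,of "u powr ?\<sigma>"]
		have "(%p. u powr ?\<sigma>*(b (2 * p) * u^(2 * p))) sums F s" unfolding Fy[OF s] y_def u_def .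
		moreover have "u powr ?\<sigma>*(b (2 * p) * u^(2 * p))=b (2 * p) * u powr of_real (2 * real p+\<nu>+1)" for p
		proof -
			have "u^(2 * p)=exp (of_nat (2 * p) * Ln u)" using us by (simp only: exp_of_nat_mult) simp
			hence "u powr ?\<sigma> * u^(2 * p)=u powr of_real (2 * real p+\<nu>+1)" using us by (simp add: powr_def \<sigma>_def algebra_simps flip: exp_add)
			thus ?thesis by (simp add: mult_ac)
		qed
		ultimately show "(%p. b (2 * p)*(s - ?i) powr of_real (2 * real p+\<nu>+1)) sums F s" by (simp only: u_def)
	qed
	with F(1) show ?thesis by (rule that)
qed

text \<open>With \<open>u = -i\<tau>\<close> the principal power only contributes a constant phase.\<close>

lemma frobenius_regular_branch:
	assumes k: "0 < k" "k < 1" and F: "lame_ode \<nu> k h F" "frobenius_at_iK' \<nu> k F"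
	obtains b where "b ~= 0" "regular_branch (\<nu>+1) b (%\<tau>. F (\<i> * of_real (elliptic_K' k-\<tau>))) (%\<tau>. - \<i> * deriv F (\<i> * of_real (elliptic_K' k-\<tau>)))"
proof -
	let ?K = "elliptic_K' k" and ?i = "\<i> * complex_of_real (elliptic_K' k)"
	define f f' where "f=(%\<tau>. F (\<i> * of_real (?K-\<tau>)))" and "f'=(%\<tau>. - \<i> * deriv F (\<i> * of_real (?K-\<tau>)))"
	define \<sigma> where "\<sigma>=\<nu>+1"
	obtain d r where d: "d 0 ~= 0" "r > 0"
		"!!s. s \<in> strip k \<inter> ball ?i r ==> (%p. d p*(s - ?i) powr of_real (2 * real p+\<nu>+1)) sums F s"
		using F(2) unfolding frobenius_at_iK'_def by blast
	define e where "e=exp (- \<i> * of_real (\<sigma> * pi/2))"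
	define c where "c p=d p*(e*(- 1)^p)" for p
	define q where "q=min r ?K/2"
	have q: "q > 0" "q < r" "q < ?K" using d(2) elliptic_K'_pos[OF k] by (auto simp: q_def min_def)
	have ser: "(%p. c p*(of_real (\<tau>^2))^p) sums (f \<tau>/of_real (\<tau> powr \<sigma>))" if \<tau>: "0 < \<tau>" "\<tau> <= q" for \<tau>
	proof -
		let ?s = "\<i> * complex_of_real (?K-\<tau>)"
		have m: "?s - ?i = of_real \<tau>*(- \<i>)" by (simp add: algebra_simps)
		have "norm (?s - ?i) < r" unfolding m using \<tau> q by (simp add: norm_mult)
		hence "?s \<in> strip k \<inter> ball ?i r" using \<tau> q by (auto simp: strip_def dist_norm norm_minus_commute)
		from d(3)[OF this] have "(%p. d p*(of_real \<tau>*(- \<i>)) powr of_real (2 * real p+\<nu>+1)) sums f \<tau>" unfolding m f_def .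
		moreover have "d p*(of_real \<tau>*(- \<i>)) powr of_real (2 * real p+\<nu>+1) = of_real (\<tau> powr \<sigma>)*(c p*(of_real (\<tau>^2))^p)" for p
		proof -
			have L: "Ln (of_real \<tau>*(- \<i>)) = of_real (ln \<tau>)-\<i> * of_real (pi/2)" using Ln_times_of_real[OF \<tau>(1),of "- \<i>"] Ln_of_real[OF \<tau>(1)] by simp
			have "(of_real \<tau>*(- \<i>)) powr of_real (2 * real p+\<nu>+1)=exp (of_real (2 * real p+\<sigma>)*(of_real (ln \<tau>)-\<i> * of_real (pi/2)))"
				using \<tau> unfolding powr_def L by (simp add: \<sigma>_def add_ac)
			also have "of_real (2 * real p+\<sigma>)*(of_real (ln \<tau>)-\<i> * of_real (pi/2))
				 = of_real (\<sigma> * ln \<tau>)+(of_nat p * of_real (2 * ln \<tau>)+(- \<i> * of_real (\<sigma> * pi/2) + of_nat p*(- (\<i> * of_real pi))))"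
				by (simp add: algebra_simps)
			also have "exp ... = of_real (exp (\<sigma> * ln \<tau>))*(of_real (exp (2 * ln \<tau>))^p*(e * exp (- (\<i> * of_real pi))^p))"
				unfolding exp_add exp_of_nat_mult e_def exp_of_real ..
			also have "exp (2 * ln \<tau>)=\<tau>^2" using \<tau> by (simp add: exp_double)
			also have "exp (\<sigma> * ln \<tau>)=\<tau> powr \<sigma>" using \<tau> by (simp add: powr_def)
			also have "exp (- (\<i> * complex_of_real pi)) = - 1" by (simp add: exp_minus)
			finally show ?thesis by (simp add: c_def mult_ac)
		qed
		ultimately have "(%p. of_real (\<tau> powr \<sigma>)*(c p*(of_real (\<tau>^2))^p)) sums f \<tau>" by simp
		from sums_divide[OF this,of "of_real (\<tau> powr \<sigma>)"] \<tau> show ?thesis by simp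
	qed
	define \<Phi> where "\<Phi> x=(\<Sum>p. c p * x^p)" for x
	have sm: "summable (%p. c p * of_real (q^2)^p)" using ser[of q] q by (auto simp: sums_iff)
	have \<Phi>d: "(\<Phi> has_field_derivative (\<Sum>p. diffs c p * x^p)) (at x)" if "norm x < q^2" for x
		unfolding \<Phi>_def[abs_def] by (rule termdiffs_strong[OF sm]) (use that q in \<open>simp add: norm_power\<close>)
	have \<Phi>h: "\<Phi> holomorphic_on ball 0 (q^2)" using \<Phi>d by (subst holomorphic_on_open) (auto intro!: exI)
	have z: "(0::complex) \<in> ball 0 (q^2)" using q by simp
	have \<Phi>0: "\<Phi> 0 = c 0" unfolding \<Phi>_def by (rule powser_zero)
	have cont: "isCont \<Phi> 0" "isCont (deriv \<Phi>) 0"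
		using \<Phi>h holomorphic_deriv[OF \<Phi>h open_ball] z by (auto intro!: continuous_on_interior[OF holomorphic_on_imp_continuous_on])
	have "((%\<tau>. complex_of_real (\<tau>^2)) \<longlongrightarrow> of_real (0^2)) (at_right 0)" by (intro tendsto_intros)
	hence sq: "((%\<tau>. complex_of_real (\<tau>^2)) \<longlongrightarrow> 0) (at_right 0)" by simp
	note L\<Phi>=isCont_tendsto_compose[OF cont(1) sq] and L\<Phi>'=isCont_tendsto_compose[OF cont(2) sq]
	have ev: "\<forall>\<^sub>F \<tau>::real in at_right 0. 0 < \<tau> & \<tau> < q" using q(1) by (auto simp: eventually_at_right_field intro!: exI[of _ q])
	have fF: "f \<tau> = of_real (\<tau> powr \<sigma>)*\<Phi> (of_real (\<tau>^2))" if "0 < \<tau>" "\<tau> < q" for \<tau>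
		using ser[of \<tau>] that by (simp add: sums_iff \<Phi>_def)
	have f'F: "f' \<tau>/of_real (\<tau> powr (\<sigma>-1)) = of_real \<sigma>*\<Phi> (of_real (\<tau>^2))+2 * of_real (\<tau>^2) * deriv \<Phi> (of_real (\<tau>^2))"
		if \<tau>: "0 < \<tau>" "\<tau> < q" for \<tau>
	proof -
		have "\<tau>^2 < q^2" using \<tau> by (intro power_strict_mono) auto
		hence "(of_real \<tau>)^2 \<in> ball (0::complex) (q^2)" using \<tau> by (simp add: norm_power)
		hence "((%z. \<Phi> (z^2)) has_field_derivative deriv \<Phi> ((of_real \<tau>)^2)*(2 * of_real \<tau>)) (at (of_real \<tau>))"
			by (intro DERIV_chain2[OF holomorphic_derivI[OF \<Phi>h open_ball]]) (auto intro!: derivative_eq_intros)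
		from has_vector_derivative_real_field[OF this]
		have D1: "((%\<tau>. \<Phi> (of_real (\<tau>^2))) has_vector_derivative deriv \<Phi> (of_real (\<tau>^2))*(2 * of_real \<tau>)) (at \<tau>)" by simp
		have "((%\<tau>. \<tau> powr \<sigma>) has_real_derivative \<sigma>*\<tau> powr (\<sigma>-1)) (at \<tau>)" using \<tau> by (intro has_real_derivative_powr)
		hence D2: "((%\<tau>. complex_of_real (\<tau> powr \<sigma>)) has_vector_derivative of_real (\<sigma>*\<tau> powr (\<sigma>-1))) (at \<tau>)"
			by (rule of_real_vector_derivative)
		have "((%\<tau>. of_real (\<tau> powr \<sigma>)*\<Phi> (of_real (\<tau>^2))) has_vector_derivative
			 of_real (\<tau> powr \<sigma>)*(deriv \<Phi> (of_real (\<tau>^2))*(2 * of_real \<tau>)) + of_real (\<sigma>*\<tau> powr (\<sigma>-1))*\<Phi> (of_real (\<tau>^2))) (at \<tau>)"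
			by (rule has_vector_derivative_mult[OF D2 D1])
		hence "(f has_vector_derivative
			 of_real (\<tau> powr \<sigma>)*(deriv \<Phi> (of_real (\<tau>^2))*(2 * of_real \<tau>)) + of_real (\<sigma>*\<tau> powr (\<sigma>-1))*\<Phi> (of_real (\<tau>^2))) (at \<tau>)"
			by (rule has_vector_derivative_transform_within_open[of _ _ _ "{0<..<q}"]) (use \<tau> fF in auto)
		moreover have "(f has_vector_derivative f' \<tau>) (at \<tau>)"
			unfolding f_def f'_def using lame_ode_imaginary_derivs(1)[OF F(1),of \<tau> UNIV] \<tau> q by simp
		ultimately have "f' \<tau> = of_real (\<tau> powr \<sigma>)*(deriv \<Phi> (of_real (\<tau>^2))*(2 * of_real \<tau>)) + of_real (\<sigma>*\<tau> powr (\<sigma>-1))*\<Phi> (of_real (\<tau>^2))"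
			by (rule vector_derivative_unique_at[rotated])
		moreover have "\<tau> powr \<sigma>=\<tau> powr (\<sigma>-1)*\<tau>" using \<tau> by (simp add: powr_diff)
		ultimately have "f' \<tau> = of_real (\<tau> powr (\<sigma>-1))*(of_real \<sigma>*\<Phi> (of_real (\<tau>^2))+2 * of_real (\<tau>^2) * deriv \<Phi> (of_real (\<tau>^2)))"
			by (simp add: algebra_simps power2_eq_square)
		thus ?thesis using \<tau> by simp
	qed
	have 1: "((%\<tau>. f \<tau>/of_real (\<tau> powr \<sigma>)) \<longlongrightarrow> c 0) (at_right 0)"
		by (rule Lim_transform_eventually[OF L\<Phi>[unfolded \<Phi>0]]) (use ev in eventually_elim,simp add: fF)
	have "((%\<tau>. of_real \<sigma>*\<Phi> (of_real (\<tau>^2))+2 * of_real (\<tau>^2) * deriv \<Phi> (of_real (\<tau>^2))) \<longlongrightarrow> of_real \<sigma>*\<Phi> 0+2*0 * deriv \<Phi> 0) (at_right 0)"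
		by (intro tendsto_intros L\<Phi> L\<Phi>' sq)
	hence "((%\<tau>. f' \<tau>/of_real (\<tau> powr (\<sigma>-1))) \<longlongrightarrow> of_real \<sigma>*\<Phi> 0+2*0 * deriv \<Phi> 0) (at_right 0)"
		by (rule Lim_transform_eventually) (use ev in eventually_elim,simp only: f'F)
	with 1 have "regular_branch (\<nu>+1) (c 0) f f'" unfolding regular_branch_def \<sigma>_def[symmetric] by (simp add: \<Phi>0)
	moreover have "c 0 ~= 0" using d(1) by (simp add: c_def e_def)
	ultimately show ?thesis unfolding f_def f'_def by (intro that[of "c 0"])
qed

section \<open>Functions of the second kind\<close>

lemma lame_second_kind_iff:
	assumes k: "0 < k" "k < 1" and E: "lame_ode \<nu> k h E"
	shows "lame_second_kind \<nu> k h E F \<longleftrightarrow> lame_ode \<nu> k h F & frobenius_at_iK' \<nu> k F &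
		(\<forall>t. \<bar>t\<bar> < elliptic_K' k \<longrightarrow> \<i>*(F (\<i> * of_real t) * deriv E (\<i> * of_real t)-E (\<i> * of_real t) * deriv F (\<i> * of_real t))=1)" (is "_ \<longleftrightarrow> ?rhs")
proof -
	have ode: "F holomorphic_on strip k & (\<forall>s\<in>strip k. deriv (deriv F) s+(of_real h-of_real (\<nu>*(\<nu>+1) * k^2)*(jacobi_sn_strip s k)^2) * F s=0)
		 \<longleftrightarrow> lame_ode \<nu> k h F" unfolding lame_ode_def using jacobi_sn_strip_eq[OF k]
		by (intro conj_cong refl ball_cong) (simp add: algebra_simps add_eq_0_iff2 eq_diff_eq)
	have vd: "vector_derivative (%t. G (\<i> * of_real t)) (at t)=\<i> * deriv G (\<i> * of_real t)"
		if G: "lame_ode \<nu> k h G" and t: "\<bar>t\<bar> < elliptic_K' k" for G and t :: real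
	proof -
		have s: "\<i> * of_real t \<in> strip k" using t by (simp add: strip_def)
		have "((%z. G (\<i> * z)) has_field_derivative deriv G (\<i> * of_real t)*\<i>) (at (of_real t))"
			by (rule DERIV_chain2[where f=G and g = "%z. \<i> * z" and x = "of_real t",OF lame_ode_derivs(1)[OF G s]]) (auto intro!: derivative_eq_intros)
		from has_vector_derivative_real_field[OF this] show ?thesis by (intro vector_derivative_at) (simp add: mult.commute)
	qed
	have "F (\<i> * of_real t) * vector_derivative (%t. E (\<i> * of_real t)) (at t)-E (\<i> * of_real t) * vector_derivative (%t. F (\<i> * of_real t)) (at t)
		= \<i>*(F (\<i> * of_real t) * deriv E (\<i> * of_real t)-E (\<i> * of_real t) * deriv F (\<i> * of_real t))"
		if "lame_ode \<nu> k h F" "\<bar>t\<bar> < elliptic_K' k" for t unfolding vd[OF E that(2)] vd[OF that] by (simp only: right_diff_distrib mult_ac)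
	note eq=this
	have "lame_second_kind \<nu> k h E F \<longleftrightarrow> lame_ode \<nu> k h F & frobenius_at_iK' \<nu> k F & (\<forall>t. \<bar>t\<bar> < elliptic_K' k \<longrightarrow>
		 F (\<i> * of_real t) * vector_derivative (%t. E (\<i> * of_real t)) (at t)-E (\<i> * of_real t) * vector_derivative (%t. F (\<i> * of_real t)) (at t)=1)"
		unfolding lame_second_kind_def ode[symmetric] by (simp only: conj_assoc)
	also have "... \<longleftrightarrow> ?rhs" by (intro conj_cong refl all_cong1 imp_cong) (simp only: eq)
	finally show ?thesis .
qed

lemma lame_wronskian_constant:
	assumes y: "lame_ode \<nu> k h y" and z: "lame_ode \<nu> k h z"
	shows "\<exists>c. \<forall>s\<in>strip k. y s * deriv z s-deriv y s * z s = c"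
proof (rule has_field_derivative_zero_constant[OF convex_strip])
	fix s assume s: "s \<in> strip k"
	show "((%s. y s * deriv z s-deriv y s * z s) has_field_derivative 0) (at s within strip k)"
	proof -
		let ?Q = "of_real (\<nu>*(\<nu>+1) * k^2)*(sn_cont k s)^2-of_real h"
		have "((%s. y s * deriv z s-deriv y s * z s) has_field_derivative
			 (deriv y s * deriv z s+(?Q * z s) * y s)-((?Q * y s) * z s + deriv z s * deriv y s)) (at s)"
			by (intro DERIV_diff DERIV_mult lame_ode_derivs[OF y s] lame_ode_derivs[OF z s])
		moreover have "(deriv y s * deriv z s+(?Q * z s) * y s)-((?Q * y s) * z s + deriv z s * deriv y s)=0" by (simp only: mult_ac) simp
		ultimately show ?thesis by (simp only: has_field_derivative_at_within)
	qed
qed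

text \<open>Once the Wronskian with \<open>E\<close> is nonzero, the normalisation is a matter of scaling.\<close>

lemma lame_second_kind_exists:
	assumes k: "0 < k" "k < 1" and E: "lame_ode \<nu> k h E" and F: "lame_ode \<nu> k h F" "frobenius_at_iK' \<nu> k F"
		and s0: "s0 \<in> strip k" "F s0 * deriv E s0-E s0 * deriv F s0 ~= 0"
	shows "\<exists>G. lame_second_kind \<nu> k h E G"
proof -
	obtain c where c: "!!s. s \<in> strip k ==> F s * deriv E s-deriv F s * E s = c" using lame_wronskian_constant[OF F(1) E] by blast
	have c0: "c ~= 0" using c[OF s0(1)] s0(2) by (simp add: mult.commute)
	define a where "a=1/(\<i> * c)"
	define G where "G s=a * F s" for s
	have a: "a ~= 0" using c0 by (simp add: a_def)
	have Gd: "deriv G s=a * deriv F s" if "s \<in> strip k" for s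
		unfolding G_def[abs_def] by (rule DERIV_imp_deriv) (intro DERIV_cmult lame_ode_derivs(1)[OF F(1) that])
	have Gh: "(G has_field_derivative a * deriv F s) (at s)" "((%s. a * deriv F s) has_field_derivative a*((of_real (\<nu>*(\<nu>+1) * k^2)*(sn_cont k s)^2-of_real h) * F s)) (at s)"
		if "s \<in> strip k" for s unfolding G_def[abs_def] by (intro DERIV_cmult lame_ode_derivs[OF F(1) that])+
	have "lame_ode \<nu> k h G" unfolding lame_ode_def using second_derivative_from_derivatives[OF open_strip Gh] by (simp add: G_def)
	moreover have "frobenius_at_iK' \<nu> k G"
	proof -
		obtain d r where d: "d 0 ~= 0" "r > 0"
			"!!s. s \<in> strip k \<inter> ball (\<i> * of_real (elliptic_K' k)) r ==> (%p. d p*(s-\<i> * of_real (elliptic_K' k)) powr of_real (2 * real p+\<nu>+1)) sums F s"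
			using F(2) unfolding frobenius_at_iK'_def by blast
		show ?thesis unfolding frobenius_at_iK'_def
			using d a sums_mult[OF d(3),of _ a] by (intro exI[of _ "%p. a * d p"] exI[of _ r]) (auto simp: G_def mult.assoc)
	qed
	moreover have "\<i>*(G (\<i> * of_real t) * deriv E (\<i> * of_real t)-E (\<i> * of_real t) * deriv G (\<i> * of_real t))=1"
		if "\<bar>t\<bar> < elliptic_K' k" for t
	proof -
		have s: "\<i> * of_real t \<in> strip k" using that by (simp add: strip_def)
		have "\<i>*(G (\<i> * of_real t) * deriv E (\<i> * of_real t)-E (\<i> * of_real t) * deriv G (\<i> * of_real t))
			 = \<i> * a*(F (\<i> * of_real t) * deriv E (\<i> * of_real t)-deriv F (\<i> * of_real t) * E (\<i> * of_real t))"
			unfolding Gd[OF s] by (simp add: G_def algebra_simps)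
		thus ?thesis unfolding c[OF s] using c0 by (simp add: a_def)
	qed
	ultimately show ?thesis using lame_second_kind_iff[OF k E] by blast
qed

section \<open>Comparison of regular branches\<close>

lemma dominated_difference:
	fixes f :: "real => complex"
	assumes st: "s <= t" and f: "!!x. x \<in> {s..t} ==> (f has_vector_derivative f' x) (at x within {s..t})"
		and \<phi>: "!!x. x \<in> {s..t} ==> (\<phi> has_real_derivative \<phi>' x) (at x)" and b: "!!x. x \<in> {s..t} ==> norm (f' x) <= \<phi>' x"
	shows "norm (f t-f s) <= \<phi> t-\<phi> s"
proof (cases "s < t")
	case True
	show ?thesis
	proof (rule differentiable_bound_general[OF True])
		show "continuous_on {s..t} f" using f by (rule continuous_on_vector_derivative)
		show "continuous_on {s..t} \<phi>" using \<phi> by (intro continuous_at_imp_continuous_on ballI DERIV_isCont) auto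
		fix x assume x: "s < x" "x < t"
		show "(f has_vector_derivative f' x) (at x)" using f[of x] x at_within_Icc_at[OF x] by simp
		show "(\<phi> has_vector_derivative \<phi>' x) (at x)" using \<phi>[of x] x by (simp add: has_real_derivative_iff_has_vector_derivative)
		show "norm (f' x) <= \<phi>' x" using b x by simp
	qed
qed (use st in simp)

lemma complex_quotient_derivative:
	fixes f w :: "real => complex"
	assumes "(f has_vector_derivative f') (at x within S)" "(w has_vector_derivative w') (at x within S)" "w x ~= 0"
	shows "((%x. f x/w x) has_vector_derivative (w x * f'-w' * f x)/(w x)^2) (at x within S)"
proof -
	have "((%x. f x/w x) has_derivative (%h. - f x*(inverse (w x)*(h *\<^sub>R w') * inverse (w x))+(h *\<^sub>R f')/w x)) (at x within S)"
		by (rule has_derivative_divide[OF assms(1,2)[unfolded has_vector_derivative_def] assms(3)])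
	moreover have "- f x*(inverse (w x)*(h *\<^sub>R w') * inverse (w x))+(h *\<^sub>R f')/w x=h *\<^sub>R ((w x * f'-w' * f x)/(w x)^2)" for h
		using assms(3) by (simp add: field_simps power2_eq_square scaleR_conv_of_real)
	ultimately show ?thesis unfolding has_vector_derivative_def by simp
qed

text \<open>The quotient \<open>f/w\<close> tends to 1 at 0, and its derivative is the Wronskian over the square of \<open>w\<close>. The Wronskian is the integral of \<open>(V - U) w f\<close>, so both are controlled by the supremum of the quotient itself, and the estimate closes for small \<open>V - U\<close>.\<close>

lemma regular_branch_compare:
	fixes w f :: "real => complex"
	assumes \<sigma>: "\<sigma> >= 1/2" and a: "0 < a" and b: "b ~= 0"
		and w: "schroedinger_on {0<..a} U w w'" "regular_branch \<sigma> b w w'"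
		and bnd: "!!t. 0 < t ==> t <= a ==> norm b/2 * t powr \<sigma> <= norm (w t)" "!!t. 0 < t ==> t <= a ==> norm (w t) <= 2 * norm b * t powr \<sigma>"
		and f: "schroedinger_on {0<..a} V f f'" "regular_branch \<sigma> b f f'"
		and \<epsilon>: "!!t. 0 < t ==> t <= a ==> \<bar>V t-U t\<bar> <= \<epsilon>" "16*\<epsilon> * a^2 <= 1/2"
	shows "norm (f a/w a-1) <= 32*\<epsilon> * a^2" "norm (w a * f' a-w' a * f a) <= 8*\<epsilon>*(norm b)^2*(a powr \<sigma>)^2 * a"
proof -
	define \<rho> where "\<rho> t=f t/w t" for t
	define X where "X t=w t * f' t-w' t * f t" for t
	have nb: "norm b > 0" using b by simp
	have e0: "\<epsilon> >= 0" using \<epsilon>(1)[OF a] by linarith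
	have wne: "w t ~= 0" if "0 < t" "t <= a" for t
	proof -
		have "0 < norm b/2 * t powr \<sigma>" using nb that by simp
		with bnd(1)[OF that] show ?thesis by auto
	qed
	note lim=w(2)[unfolded regular_branch_def] f(2)[unfolded regular_branch_def]
	have ev: "\<forall>\<^sub>F t in at_right 0. 0 < t & t <= c" if "c > 0" for c :: real
		using that by (auto simp: eventually_at_right_field intro!: exI[of _ c])
	have \<rho>0: "(\<rho> \<longlongrightarrow> 1) (at_right 0)"
	proof -
		have "((%t. (f t/of_real (t powr \<sigma>))/(w t/of_real (t powr \<sigma>))) \<longlongrightarrow> b/b) (at_right 0)"
			using lim b by (intro tendsto_divide) auto
		moreover have "\<forall>\<^sub>F t in at_right 0. (f t/of_real (t powr \<sigma>))/(w t/of_real (t powr \<sigma>))=\<rho> t"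
			using positive_at_right_0 by eventually_elim (simp add: \<rho>_def)
		ultimately show ?thesis using b Lim_transform_eventually by fastforce
	qed
	have X0: "(X \<longlongrightarrow> 0) (at_right 0)"
	proof -
		let ?Y = "%t. (w t/of_real (t powr \<sigma>))*(f' t/of_real (t powr (\<sigma>-1)))-(w' t/of_real (t powr (\<sigma>-1)))*(f t/of_real (t powr \<sigma>))"
		have "(?Y \<longlongrightarrow> b*(of_real \<sigma> * b)-(of_real \<sigma> * b) * b) (at_right 0)"
			using lim by (intro tendsto_diff tendsto_mult) auto
		hence Y: "(?Y \<longlongrightarrow> 0) (at_right 0)" by (simp add: mult_ac)
		show ?thesis
		proof (rule Lim_null_comparison[OF _ tendsto_norm_zero[OF Y]])
			show "\<forall>\<^sub>F t in at_right 0. norm (X t) <= norm (?Y t)" using ev[OF zero_less_one]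
			proof eventually_elim
				case (elim t)
				define p p1 where "p = complex_of_real (t powr \<sigma>)" and "p1 = complex_of_real (t powr (\<sigma>-1))"
				have p: "p ~= 0" "p1 ~= 0" using elim by (auto simp: p_def p1_def)
				have "X t = ?Y t*(p * p1)" unfolding X_def p_def[symmetric] p1_def[symmetric] using p by (simp add: field_simps)
				moreover have "norm (p * p1)=t powr (2*\<sigma>-1)" using elim by (simp add: p_def p1_def norm_mult flip: powr_add)
				moreover have "t powr (2*\<sigma>-1) <= 1" using elim \<sigma> by (intro powr_le1) auto
				ultimately show ?case using mult_left_le[of "t powr (2*\<sigma>-1)" "norm (?Y t)"] by (simp add: norm_mult)
			qed
		qed
	qed
	have wc: "continuous_on {0<..a} w" "continuous_on {0<..a} f" using schroedinger_on_continuous w(1) f(1) by blast+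
	have \<rho>c: "continuous_on {0<..a} \<rho>" unfolding \<rho>_def[abs_def] using wne by (intro continuous_intros wc) auto
	have bdd: "bdd_above ((%t. norm (\<rho> t)) ` {0<..a})"
	proof -
		have "\<forall>\<^sub>F t in at_right 0. norm (\<rho> t) < 2" using tendsto_norm[OF \<rho>0] by (rule order_tendstoD) simp
		then obtain d where d: "d > 0" "!!t. 0 < t ==> t < d ==> norm (\<rho> t) < 2" by (auto simp: eventually_at_right_field)
		have "bounded (\<rho> ` {min d a..a})" by (intro compact_imp_bounded compact_continuous_image continuous_on_subset[OF \<rho>c]) (use d a in auto)
		then obtain B where B: "!!t. t \<in> {min d a..a} ==> norm (\<rho> t) <= B" unfolding bounded_iff by blast
		have "norm (\<rho> t) <= max 2 B" if "0 < t" "t <= a" for t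
			using d(2)[of t] B[of t] that by (cases "t < d") (auto simp: min_def max_def split: if_splits)
		thus ?thesis by (intro bdd_aboveI2[of _ _ "max 2 B"]) auto
	qed
	define M where "M=(SUP t\<in>{0<..a}. norm (\<rho> t))"
	have M: "norm (\<rho> t) <= M" if "0 < t" "t <= a" for t unfolding M_def using that by (intro cSUP_upper bdd) auto
	have M0: "M >= 0" using M[OF a] norm_ge_zero order_trans by blast
	have Xb: "norm (X t) <= 4*\<epsilon>*(norm b)^2 * M*(t powr \<sigma>)^2 * t" if t: "0 < t" "t <= a" for t
	proof (rule tendsto_upperbound)
		let ?C = "4*\<epsilon>*(norm b)^2 * M*(t powr \<sigma>)^2"
		show "((%s. norm (X t-X s)) \<longlongrightarrow> norm (X t)) (at_right 0)"
			using tendsto_norm[OF tendsto_diff[OF tendsto_const X0],of "X t"] by simp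
		show "\<forall>\<^sub>F s in at_right 0. norm (X t-X s) <= ?C * t" using ev[OF t(1)]
		proof eventually_elim
			case (elim s)
			have sub: "{s..t} \<subseteq> {0<..a}" using elim t by auto
			have "norm (X t-X s) <= ?C * t - ?C * s"
			proof (rule dominated_difference)
				fix x assume x: "x \<in> {s..t}"
				show "(X has_vector_derivative of_real (V x-U x)*(w x * f x)) (at x within {s..t})" unfolding X_def[abs_def]
					by (rule wronskian_derivative[OF schroedinger_on_subset[OF w(1) sub] schroedinger_on_subset[OF f(1) sub] x])
				have x': "0 < x" "x <= a" "x <= t" using x sub by auto
				have fx: "f x=\<rho> x * w x" using wne[OF x'(1,2)] by (simp add: \<rho>_def)
				have "x powr \<sigma> <= t powr \<sigma>" using x' \<sigma> by (intro powr_mono2) auto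
				hence wx: "norm (w x) <= 2 * norm b * t powr \<sigma>" using bnd(2)[OF x'(1,2)] nb by (smt (verit) mult_left_mono)
				have "norm (of_real (V x-U x)*(w x * f x))=\<bar>V x-U x\<bar>*(norm (\<rho> x)*(norm (w x))^2)"
					unfolding fx by (simp only: norm_mult norm_of_real power2_eq_square mult_ac)
				also have "... <= \<epsilon>*(M*(2 * norm b * t powr \<sigma>)^2)" by (intro mult_mono power_mono \<epsilon> M x' wx) (use e0 M0 in auto)
				finally show "norm (of_real (V x-U x)*(w x * f x)) <= ?C" by (simp add: power_mult_distrib mult_ac)
				show "((%x. ?C * x) has_real_derivative ?C) (at x)" by (auto intro!: derivative_eq_intros)
			qed (use elim in auto)
			also have "... <= ?C * t" using elim e0 M0 by simp
			finally show ?case .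
		qed
	qed simp
	have \<rho>b: "norm (\<rho> t-1) <= 16*\<epsilon> * M * a^2" if t: "0 < t" "t <= a" for t
	proof (rule tendsto_upperbound)
		let ?C = "16*\<epsilon> * M * a"
		show "((%s. norm (\<rho> t-\<rho> s)) \<longlongrightarrow> norm (\<rho> t-1)) (at_right 0)" by (intro tendsto_intros \<rho>0)
		show "\<forall>\<^sub>F s in at_right 0. norm (\<rho> t-\<rho> s) <= 16*\<epsilon> * M * a^2" using ev[OF t(1)]
		proof eventually_elim
			case (elim s)
			have sub: "{s..t} \<subseteq> {0<..a}" using elim t by auto
			have "norm (\<rho> t-\<rho> s) <= ?C * t - ?C * s"
			proof (rule dominated_difference)
				fix x assume x: "x \<in> {s..t}"
				have x': "0 < x" "x <= a" "x <= t" using x sub by auto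
				show "(\<rho> has_vector_derivative X x/(w x)^2) (at x within {s..t})" unfolding X_def \<rho>_def[abs_def]
					by (rule complex_quotient_derivative[OF schroedinger_onD(1)[OF schroedinger_on_subset[OF f(1) sub] x]
								schroedinger_onD(1)[OF schroedinger_on_subset[OF w(1) sub] x] wne[OF x'(1,2)]])
				have p: "x powr \<sigma> > 0" using x' by simp
				have "norm (X x/(w x)^2)=norm (X x)/(norm (w x))^2" by (simp add: norm_divide norm_power)
				also have "... <= (4*\<epsilon>*(norm b)^2 * M*(x powr \<sigma>)^2 * x)/(norm b/2 * x powr \<sigma>)^2"
					by (intro frac_le power_mono Xb bnd x') (use p nb x' e0 M0 in auto)
				also have "... = 16*\<epsilon> * M * x" using p nb by (simp add: power_mult_distrib power_divide)
				also have "... <= ?C" using x' e0 M0 by (intro mult_left_mono) auto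
				finally show "norm (X x/(w x)^2) <= ?C" .
				show "((%x. ?C * x) has_real_derivative ?C) (at x)" by (auto intro!: derivative_eq_intros)
			qed (use elim in auto)
			also have "... <= ?C * a"
			proof -
				have "?C * t <= ?C * a" "0 <= ?C * s" using elim t e0 M0 a by (auto intro!: mult_left_mono)
				thus ?thesis by linarith
			qed
			also have "... = 16*\<epsilon> * M * a^2" by (simp add: power2_eq_square)
			finally show ?case .
		qed
	qed simp
	have half: "16*\<epsilon> * M * a^2 <= M/2" using mult_right_mono[OF \<epsilon>(2) M0] by (simp add: mult_ac)
	have "M <= 1 + M/2" unfolding M_def[of]
	proof (rule cSUP_least)
		fix t assume "t \<in> {0<..a}"
		hence "norm (\<rho> t-1) <= M/2" using \<rho>b[of t] half by auto
		thus "norm (\<rho> t) <= 1+(SUP t\<in>{0<..a}. norm (\<rho> t))/2" using norm_triangle_ineq[of "\<rho> t-1" 1] unfolding M_def by simp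
	qed (use a in auto)
	hence M2: "M <= 2" by simp
	have "\<epsilon> * a^2 * M <= \<epsilon> * a^2*2" using e0 by (intro mult_left_mono M2) auto
	hence "16*\<epsilon> * M * a^2 <= 32*\<epsilon> * a^2" by (simp add: mult_ac)
	with \<rho>b[OF a order_refl] show "norm (f a/w a-1) <= 32*\<epsilon> * a^2" unfolding \<rho>_def by (rule order_trans)
	have "(4*\<epsilon>*(norm b)^2*(a powr \<sigma>)^2 * a) * M <= (4*\<epsilon>*(norm b)^2*(a powr \<sigma>)^2 * a)*2"
		using e0 a by (intro mult_left_mono M2) auto
	with Xb[OF a order_refl] show "norm (w a * f' a-w' a * f a) <= 8*\<epsilon>*(norm b)^2*(a powr \<sigma>)^2 * a" by (simp add: X_def mult_ac)
qed

section \<open>The limit near the pole\<close>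

lemma lame_nu_product: "lame_nu m*(lame_nu m+1)=(of_int m)^2-1/4"
proof -
	have "(of_int m)^2=(real_of_int \<bar>m\<bar>)^2" by simp
	thus ?thesis by (simp add: lame_nu_def power2_eq_square field_simps)
qed

lemma pole_potential_difference:
	"lame_pole_potential (lame_nu m) k h \<tau>-toroidal_potential n m \<tau>
		= (h-(real n)\<^sup>2)+((of_int m)^2-1/4)*(jacobi_cs_square k \<tau>-1/(sinh \<tau>)^2)"
	unfolding lame_pole_potential_def toroidal_potential_def lame_nu_product by (simp add: right_diff_distrib)

lemma pole_potential_close:
	assumes H: "(H \<longlongrightarrow> (real n)\<^sup>2) (at_right 0)" and T: "T > 0"
	obtains \<epsilon> where "(\<epsilon> \<longlongrightarrow> 0) (at_right 0)"
		"\<forall>\<^sub>F k in at_right 0. \<forall>\<tau>. 0 < \<tau> & \<tau> <= T \<longrightarrow> \<bar>lame_pole_potential (lame_nu m) k (H k) \<tau>-toroidal_potential n m \<tau>\<bar> <= \<epsilon> k"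
proof -
	obtain C where C: "C > 0" "\<forall>\<^sub>F k in at_right 0. \<forall>\<tau>. 0 < \<tau> & \<tau> <= T \<longrightarrow> \<bar>jacobi_cs_square k \<tau>-1/(sinh \<tau>)^2\<bar> <= C * k^2"
		using jacobi_cs_square_uniform[OF T] by blast
	let ?N = "\<bar>(of_int m)\<^sup>2-1/4\<bar> :: real"
	define \<epsilon> where "\<epsilon> k=\<bar>H k-(real n)\<^sup>2\<bar> + ?N*(C * k^2)" for k
	have "(\<epsilon> \<longlongrightarrow> \<bar>(real n)\<^sup>2-(real n)\<^sup>2\<bar> + ?N*(C*0^2)) (at_right 0)"
		unfolding \<epsilon>_def[abs_def] by (intro tendsto_intros H)
	moreover have "\<forall>\<^sub>F k in at_right 0. \<forall>\<tau>. 0 < \<tau> & \<tau> <= T \<longrightarrow> \<bar>lame_pole_potential (lame_nu m) k (H k) \<tau>-toroidal_potential n m \<tau>\<bar> <= \<epsilon> k"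
		using C(2)
	proof eventually_elim
		case (elim k)
		show ?case
		proof (intro allI impI)
			fix \<tau> assume "0 < \<tau> & \<tau> <= T"
			with elim have "?N*\<bar>jacobi_cs_square k \<tau>-1/(sinh \<tau>)^2\<bar> <= ?N*(C * k^2)" by (intro mult_left_mono) auto
			thus "\<bar>lame_pole_potential (lame_nu m) k (H k) \<tau>-toroidal_potential n m \<tau>\<bar> <= \<epsilon> k"
				unfolding pole_potential_difference \<epsilon>_def abs_mult[symmetric] by (intro order_trans[OF abs_triangle_ineq]) simp
		qed
	qed
	ultimately show ?thesis by (intro that[of \<epsilon>]) simp_all
qed

abbreviation (input) pole_value :: "(complex => complex) => real => real => complex" where
	"pole_value y k \<tau> \<equiv> y (\<i> * of_real (elliptic_K' k-\<tau>))"

abbreviation (input) pole_slope :: "(complex => complex) => real => real => complex" where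
	"pole_slope y k \<tau> \<equiv>-\<i> * deriv y (\<i> * of_real (elliptic_K' k-\<tau>))"

lemma pole_line_scaled:
	assumes "0 < k" "k < 1" "lame_ode \<nu> k h y" "S \<subseteq> {0<..elliptic_K' k}"
	shows "schroedinger_on S (lame_pole_potential \<nu> k h) (%\<tau>. pole_value y k \<tau>/c) (%\<tau>. pole_slope y k \<tau>/c)"
	using schroedinger_on_linear[OF lame_ode_imaginary_line[OF assms] bounded_linear_divide[of c]] .

text \<open>The potentials converge uniformly on compact intervals, so convergence at one point spreads to all of them.\<close>

lemma toroidal_continuation:
	assumes H: "(H \<longlongrightarrow> (real n)\<^sup>2) (at_right 0)" and Y: "\<forall>\<^sub>F k in at_right 0. lame_ode (lame_nu m) k (H k) (Y k)"
		and z: "schroedinger_on {0<..} (toroidal_potential n m) z z'" and a: "a > 0"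
		and lim: "((%k. pole_value (Y k) k a/c k) \<longlongrightarrow> z a) (at_right 0)" "((%k. pole_slope (Y k) k a/c k) \<longlongrightarrow> z' a) (at_right 0)"
		and t: "t > 0"
	shows "((%k. pole_value (Y k) k t/c k) \<longlongrightarrow> z t) (at_right 0)" "((%k. pole_slope (Y k) k t/c k) \<longlongrightarrow> z' t) (at_right 0)"
proof -
	define A B where "A=min a t" and "B=max a t"
	have AB: "0 < A" "A <= B" "0 < B" "a \<in> {A..B}" "t \<in> {A..B}" using a t by (auto simp: A_def B_def)
	obtain \<epsilon> where \<epsilon>: "(\<epsilon> \<longlongrightarrow> 0) (at_right 0)"
		"\<forall>\<^sub>F k in at_right 0. \<forall>\<tau>. 0 < \<tau> & \<tau> <= B \<longrightarrow> \<bar>lame_pole_potential (lame_nu m) k (H k) \<tau>-toroidal_potential n m \<tau>\<bar> <= \<epsilon> k"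
		using pole_potential_close[OF H AB(3)] by blast
	have V: "uniform_limit {A..B} (%k. lame_pole_potential (lame_nu m) k (H k)) (toroidal_potential n m) (at_right 0)" unfolding uniform_limit_iff
	proof (intro allI impI)
		fix e :: real assume "e > 0"
		with \<epsilon>(1) have "\<forall>\<^sub>F k in at_right 0. \<epsilon> k < e" by (rule order_tendstoD)
		with \<epsilon>(2) show "\<forall>\<^sub>F k in at_right 0. \<forall>x\<in>{A..B}. dist (lame_pole_potential (lame_nu m) k (H k) x) (toroidal_potential n m x) < e"
		proof eventually_elim
			case (elim k)
			show ?case
			proof
				fix x assume "x \<in> {A..B}"
				hence "\<bar>lame_pole_potential (lame_nu m) k (H k) x-toroidal_potential n m x\<bar> <= \<epsilon> k" using elim(1) AB(1) by simp
				thus "dist (lame_pole_potential (lame_nu m) k (H k) x) (toroidal_potential n m x) < e" using elim(2) by (simp add: dist_real_def)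
			qed
		qed
	qed
	have "\<forall>\<^sub>F k in at_right 0. B <= elliptic_K' k" using elliptic_K'_at_top by (auto simp: filterlim_at_top)
	hence y: "\<forall>\<^sub>F k in at_right 0. schroedinger_on {A..B} (lame_pole_potential (lame_nu m) k (H k))
			(%\<tau>. pole_value (Y k) k \<tau>/c k) (%\<tau>. pole_slope (Y k) k \<tau>/c k)"
		using Y small_modulus by eventually_elim (rule pole_line_scaled,use AB in auto)
	have z': "schroedinger_on {A..B} (toroidal_potential n m) z z'" by (rule schroedinger_on_subset[OF z]) (use AB in auto)
	note u=schroedinger_uniform_limit[OF y z' V toroidal_potential_bounded[OF AB(1)] AB(4) lim]
	show "((%k. pole_value (Y k) k t/c k) \<longlongrightarrow> z t) (at_right 0)" "((%k. pole_slope (Y k) k t/c k) \<longlongrightarrow> z' t) (at_right 0)"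
		using tendsto_uniform_limitI[OF u(1) AB(5)] tendsto_uniform_limitI[OF u(2) AB(5)] by auto
qed

lemma tor_P_lead_nonzero: "tor_P_lead n m ~= 0"
proof
	assume "tor_P_lead n m=0"
	hence "Gamma (of_nat n + of_int \<bar>m\<bar>+1/2 :: complex)=0" using tor_P_lead_Gamma[of m n] by simp
	moreover have "(of_nat n + of_int \<bar>m\<bar>+1/2 :: complex) \<notin> \<int>\<^sub>\<le>\<^sub>0" using half_integer_not_nonpos[of "int n+\<bar>m\<bar>"] by simp
	ultimately show False by (simp add: Gamma_eq_zero_iff)
qed

text \<open>Divide by the leading coefficient at the pole; the comparison of regular branches then gives the limit at one point.\<close>

lemma frobenius_solution_limit:
	assumes H: "(H \<longlongrightarrow> (real n)\<^sup>2) (at_right 0)"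
		and F: "\<forall>\<^sub>F k in at_right 0. lame_ode (lame_nu m) k (H k) (F k) & frobenius_at_iK' (lame_nu m) k (F k)"
	shows "\<exists>\<beta>. (\<forall>\<^sub>F k in at_right 0. \<beta> k ~= 0) &
		(\<forall>t>0. ((%k. pole_value (F k) k t/\<beta> k) \<longlongrightarrow> tor_P n m t) (at_right 0) &
					 ((%k. pole_slope (F k) k t/\<beta> k) \<longlongrightarrow> tor_P' n m t) (at_right 0))"
proof -
	define \<sigma> where "\<sigma>=\<bar>of_int m\<bar>+(1/2 :: real)"
	have \<sigma>: "\<sigma> >= 1/2" "lame_nu m+1=\<sigma>" by (simp_all add: \<sigma>_def lame_nu_def)
	define b where "b=(- 1)^nat m * of_real (2 powr (- \<bar>of_int m\<bar>)) * tor_P_lead n m"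
	have b: "b ~= 0" using tor_P_lead_nonzero by (simp add: b_def)
	have w: "regular_branch \<sigma> b (tor_P n m) (tor_P' n m)" unfolding \<sigma>_def b_def by (rule tor_P_regular)
	have "((%t. norm (tor_P n m t/of_real (t powr \<sigma>))) \<longlongrightarrow> norm b) (at_right 0)"
		using w unfolding regular_branch_def by (intro tendsto_norm) auto
	note ord = order_tendstoD[OF this]
	have "\<forall>\<^sub>F t in at_right 0. norm (tor_P n m t/of_real (t powr \<sigma>)) > norm b/2"
		"\<forall>\<^sub>F t in at_right 0. norm (tor_P n m t/of_real (t powr \<sigma>)) < 2 * norm b" by (rule ord(1),use b in simp,rule ord(2),use b in simp)
	hence "\<forall>\<^sub>F t in at_right 0. norm b/2 * t powr \<sigma> <= norm (tor_P n m t) & norm (tor_P n m t) <= 2 * norm b * t powr \<sigma>"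
		using positive_at_right_0 by eventually_elim (simp add: norm_divide field_simps)
	then obtain a0 where a0: "a0 > 0" "!!t. 0 < t ==> t < a0 ==> norm b/2 * t powr \<sigma> <= norm (tor_P n m t) & norm (tor_P n m t) <= 2 * norm b * t powr \<sigma>"
		by (auto simp: eventually_at_right_field)
	define a where "a=a0/2"
	have a: "a > 0" using a0 by (simp add: a_def)
	have bnd: "norm b/2 * t powr \<sigma> <= norm (tor_P n m t)" "norm (tor_P n m t) <= 2 * norm b * t powr \<sigma>" if "0 < t" "t <= a" for t
		using a0(2)[of t] that a0(1) by (auto simp: a_def)
	have wa: "tor_P n m a ~= 0"
	proof -
		have "0 < norm b/2 * a powr \<sigma>" using b a by simp
		with bnd(1)[OF a] show ?thesis by auto
	qed
	define \<beta> where "\<beta> k=(SOME d. d ~= 0 & regular_branch \<sigma> d (pole_value (F k) k) (pole_slope (F k) k))/b" for k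
	have \<beta>: "\<forall>\<^sub>F k in at_right 0. \<beta> k ~= 0 & regular_branch \<sigma> (b*\<beta> k) (pole_value (F k) k) (pole_slope (F k) k)"
		using F small_modulus
	proof eventually_elim
		case (elim k)
		have "\<exists>d. d ~= 0 & regular_branch \<sigma> d (pole_value (F k) k) (pole_slope (F k) k)"
			using frobenius_regular_branch[of k "lame_nu m" "H k" "F k"] elim unfolding \<sigma>(2) by blast
		from someI_ex[OF this] show ?case using b by (simp add: \<beta>_def)
	qed
	obtain \<epsilon> where \<epsilon>: "(\<epsilon> \<longlongrightarrow> 0) (at_right 0)"
		"\<forall>\<^sub>F k in at_right 0. \<forall>\<tau>. 0 < \<tau> & \<tau> <= a \<longrightarrow> \<bar>lame_pole_potential (lame_nu m) k (H k) \<tau>-toroidal_potential n m \<tau>\<bar> <= \<epsilon> k"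
		using pole_potential_close[OF H a] by blast
	let ?f = "%k. pole_value (F k) k a/\<beta> k" and ?f' = "%k. pole_slope (F k) k a/\<beta> k"
	have "((%k. 16*\<epsilon> k * a^2) \<longlongrightarrow> 16*0 * a^2) (at_right 0)" by (intro tendsto_intros \<epsilon>)
	hence small: "\<forall>\<^sub>F k in at_right 0. 16*\<epsilon> k * a^2 < 1/2" by (rule order_tendstoD) simp
	have "\<forall>\<^sub>F k in at_right 0. a <= elliptic_K' k" using elliptic_K'_at_top by (auto simp: filterlim_at_top)
	with small \<epsilon>(2) \<beta> F small_modulus
	have cmp: "\<forall>\<^sub>F k in at_right 0. norm (?f k/tor_P n m a-1) <= 32*\<epsilon> k * a^2 &
			norm (tor_P n m a * ?f' k-tor_P' n m a * ?f k) <= 8*\<epsilon> k*(norm b)^2*(a powr \<sigma>)^2 * a"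
	proof eventually_elim
		case (elim k)
		have s: "schroedinger_on {0<..a} (lame_pole_potential (lame_nu m) k (H k)) (%\<tau>. pole_value (F k) k \<tau>/\<beta> k) (%\<tau>. pole_slope (F k) k \<tau>/\<beta> k)"
			by (rule pole_line_scaled) (use elim in auto)
		have g: "regular_branch \<sigma> (b*\<beta> k) (pole_value (F k) k) (pole_slope (F k) k)" and \<beta>k: "\<beta> k ~= 0" using elim by auto
		have r: "regular_branch \<sigma> b (%\<tau>. pole_value (F k) k \<tau>/\<beta> k) (%\<tau>. pole_slope (F k) k \<tau>/\<beta> k)"
			unfolding regular_branch_def using tendsto_divide[OF conjunct1[OF g[unfolded regular_branch_def]] tendsto_const[of "\<beta> k"] \<beta>k]
				tendsto_divide[OF conjunct2[OF g[unfolded regular_branch_def]] tendsto_const[of "\<beta> k"] \<beta>k] \<beta>k by (simp add: mult_ac)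
		have wS: "schroedinger_on {0<..a} (toroidal_potential n m) (tor_P n m) (tor_P' n m)" by (rule schroedinger_on_subset[OF tor_P_solution]) auto
		have e1: "\<bar>lame_pole_potential (lame_nu m) k (H k) t-toroidal_potential n m t\<bar> <= \<epsilon> k" if "0 < t" "t <= a" for t using elim that by auto
		have e2: "16*\<epsilon> k * a^2 <= 1/2" using elim by auto
		show ?case using regular_branch_compare[OF \<sigma>(1) a b wS w bnd s r e1 e2] by blast
	qed
	have l1: "((%k. ?f k/tor_P n m a-1) \<longlongrightarrow> 0) (at_right 0)"
	proof (rule Lim_null_comparison)
		show "\<forall>\<^sub>F k in at_right 0. norm (?f k/tor_P n m a-1) <= 32*\<epsilon> k * a^2" using cmp by eventually_elim blast
		have "((%k. 32*\<epsilon> k * a^2) \<longlongrightarrow> 32*0 * a^2) (at_right 0)" by (intro tendsto_intros \<epsilon>)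
		thus "((%k. 32*\<epsilon> k * a^2) \<longlongrightarrow> 0) (at_right 0)" by simp
	qed
	have l2: "((%k. tor_P n m a * ?f' k-tor_P' n m a * ?f k) \<longlongrightarrow> 0) (at_right 0)"
	proof (rule Lim_null_comparison)
		show "\<forall>\<^sub>F k in at_right 0. norm (tor_P n m a * ?f' k-tor_P' n m a * ?f k) <= 8*\<epsilon> k*(norm b)^2*(a powr \<sigma>)^2 * a"
			using cmp by eventually_elim blast
		have "((%k. 8*\<epsilon> k*(norm b)^2*(a powr \<sigma>)^2 * a) \<longlongrightarrow> 8*0*(norm b)^2*(a powr \<sigma>)^2 * a) (at_right 0)" by (intro tendsto_mult tendsto_const \<epsilon>)
		thus "((%k. 8*\<epsilon> k*(norm b)^2*(a powr \<sigma>)^2 * a) \<longlongrightarrow> 0) (at_right 0)" by simp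
	qed
	have "((%k. (?f k/tor_P n m a-1+1) * tor_P n m a) \<longlongrightarrow> (0+1) * tor_P n m a) (at_right 0)" by (intro tendsto_intros l1)
	hence f: "(?f \<longlongrightarrow> tor_P n m a) (at_right 0)" using wa by simp
	have "((%k. (tor_P n m a * ?f' k-tor_P' n m a * ?f k + tor_P' n m a * ?f k)/tor_P n m a) \<longlongrightarrow> (0 + tor_P' n m a * tor_P n m a)/tor_P n m a) (at_right 0)"
		by (intro tendsto_intros l2 f wa)
	moreover have "(tor_P n m a * x-y + y)/tor_P n m a=x" for x y using wa by simp
	moreover have "(0 + tor_P' n m a * tor_P n m a)/tor_P n m a=tor_P' n m a" using wa by simp
	ultimately have f': "(?f' \<longlongrightarrow> tor_P' n m a) (at_right 0)" by (simp only:)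
	have Y: "\<forall>\<^sub>F k in at_right 0. lame_ode (lame_nu m) k (H k) (F k)" using F by eventually_elim blast
	have \<beta>0: "\<forall>\<^sub>F k in at_right 0. \<beta> k ~= 0" using \<beta> by eventually_elim blast
	show ?thesis by (intro exI[of _ \<beta>] conjI allI impI \<beta>0) (rule toroidal_continuation[OF H Y tor_P_solution a f f'],assumption)+
qed

section \<open>The solution regular at the origin, seen from the pole\<close>

lemma decreasing_from_derivative:
	fixes g :: "real => real"
	assumes st: "s <= t" and g: "!!x. x \<in> {s..t} ==> (g has_real_derivative g' x) (at x within {s..t})"
		and neg: "!!x. x \<in> {s..t} ==> g' x <= 0"
	shows "g t <= g s"
proof (rule DERIV_nonpos_imp_decreasing_open[OF st])
	show "\<exists>y. (g has_real_derivative y) (at x) & y <= 0" if "s < x" "x < t" for x using g[of x] neg[of x] that at_within_Icc_at[OF that] by auto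
	show "continuous_on {s..t} g" by (rule DERIV_continuous_on[OF g])
qed

text \<open>The inner product of \<open>y\<close> and \<open>y'\<close> increases where \<open>V\<close> is nonnegative and vanishes at \<open>L\<close>, so \<open>|y|\<close> decreases towards \<open>L\<close>. If \<open>y(L) = 0\<close>, then \<open>|y'|\<close> is at least 1 throughout, which makes \<open>y(a)\<close> large.\<close>

lemma confined_solution_bound:
	fixes y y' :: "real => complex"
	assumes y: "schroedinger_on {a..L} V y y'" and L: "a+1 <= L" and V: "!!t. t \<in> {a..L} ==> V t >= 0"
		and end_point: "y L=0 & norm (y' L)=1 \<or> norm (y L)=1 & y' L=0"
	shows "norm (y a) >= 1" "!!t. t \<in> {a..L} ==> norm (y t) <= norm (y a)"
proof -
	define p where "p t=inner (y t) (y' t)" for t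
	have real: "(g has_vector_derivative d) F ==> (g has_real_derivative d) F" for g d F by (simp add: has_real_derivative_iff_has_vector_derivative)
	have d: "(p has_real_derivative (norm (y' t))\<^sup>2 + V t*(norm (y t))^2) (at t within T)"
		"((%t. (norm (y t))\<^sup>2) has_real_derivative 2 * p t) (at t within T)"
		"((%t. (norm (y' t))\<^sup>2) has_real_derivative 2 * V t * p t) (at t within T)" if t: "t \<in> T" "T \<subseteq> {a..L}" for t T
	proof -
		note D=schroedinger_onD[OF schroedinger_on_subset[OF y t(2)] t(1)]
		note B=bounded_bilinear.has_vector_derivative[OF bounded_bilinear_inner]
		show "(p has_real_derivative (norm (y' t))\<^sup>2 + V t*(norm (y t))^2) (at t within T)"
			using B[OF D] unfolding p_def[abs_def] by (intro real) (simp add: power2_norm_eq_inner add.commute)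
		show "((%t. (norm (y t))\<^sup>2) has_real_derivative 2 * p t) (at t within T)"
			using B[OF D(1,1)] unfolding p_def power2_norm_eq_inner by (intro real) (simp add: inner_commute)
		show "((%t. (norm (y' t))\<^sup>2) has_real_derivative 2 * V t * p t) (at t within T)"
			using B[OF D(2,2)] unfolding p_def power2_norm_eq_inner by (intro real) (simp add: inner_commute mult.assoc)
	qed
	have pL: "p L=0" using end_point by (auto simp: p_def)
	have sub: "{s..t} \<subseteq> {a..L}" if "s \<in> {a..L}" "t \<in> {a..L}" for s t using that by auto
	have La: "a \<in> {a..L}" "L \<in> {a..L}" using L by auto
	have pneg: "p t <= 0" if t: "t \<in> {a..L}" for t
	proof -
		have "- p L <= - p t"
		proof (rule decreasing_from_derivative[where s=t and t=L and g = "%t. - p t" and g' = "%t. - ((norm (y' t))^2 + V t*(norm (y t))^2)"])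
			fix x assume x: "x \<in> {t..L}"
			hence "V x >= 0" using t V by auto
			hence "(norm (y' x))^2 + V x*(norm (y x))^2 >= 0" by (intro add_nonneg_nonneg mult_nonneg_nonneg) auto
			thus "- ((norm (y' x))^2 + V x*(norm (y x))^2) <= 0" by linarith
			show "((%t. - p t) has_real_derivative-((norm (y' x))^2 + V x*(norm (y x))^2)) (at x within {t..L})"
				using x sub[OF t La(2)] by (intro DERIV_minus d)
		qed (use t in auto)
		thus ?thesis by (simp add: pL)
	qed
	have mono: "(norm (y t))^2 <= (norm (y s))^2" if "s \<in> {a..L}" "t \<in> {a..L}" "s <= t" for s t
	proof (rule decreasing_from_derivative[where s=s and t=t and g = "%t. (norm (y t))\<^sup>2" and g' = "%t. 2 * p t"])
		fix x assume x: "x \<in> {s..t}"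
		thus "2 * p x <= 0" using pneg[of x] that by auto
		show "((%t. (norm (y t))\<^sup>2) has_real_derivative 2 * p x) (at x within {s..t})" using x sub[OF that(1,2)] by (intro d)
	qed (use that in auto)
	show "norm (y t) <= norm (y a)" if "t \<in> {a..L}" for t using mono[OF La(1) that] that power2_le_imp_le[OF _ norm_ge_zero] by auto
	show "norm (y a) >= 1"
	proof (cases "norm (y L)=1")
		case True
		thus ?thesis using mono[OF La] L power2_le_imp_le[of "norm (y L)" "norm (y a)"] by simp
	next
		case False
		hence n: "norm (y' L)=1" using end_point by auto
		have n': "(norm (y' t))^2 >= 1" if t: "t \<in> {a..L}" for t
		proof -
			have "(norm (y' L))^2 <= (norm (y' t))^2"
			proof (rule decreasing_from_derivative[where s=t and t=L and g = "%t. (norm (y' t))\<^sup>2" and g' = "%t. 2 * V t * p t"])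
				fix x assume x: "x \<in> {t..L}"
				hence "x \<in> {a..L}" using t by auto
				thus "2 * V x * p x <= 0" using V pneg by (intro mult_nonneg_nonpos) auto
				show "((%t. (norm (y' t))\<^sup>2) has_real_derivative 2 * V x * p x) (at x within {t..L})" using x sub[OF t La(2)] by (intro d)
			qed (use t in auto)
			thus ?thesis by (simp add: n)
		qed
		have p: "p t <= - (L-t)" if t: "t \<in> {a..L}" for t
		proof -
			have "- (p L+(L-L)) <= - (p t+(L-t))"
			proof (rule decreasing_from_derivative[where s=t and t=L and g = "%t. - (p t+(L-t))" and g' = "%t. - ((norm (y' t))^2 + V t*(norm (y t))^2+(0-1))"])
				fix x assume x: "x \<in> {t..L}"
				hence x': "x \<in> {a..L}" using t by auto
				hence "V x*(norm (y x))^2 >= 0" using V by simp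
				thus "- ((norm (y' x))^2 + V x*(norm (y x))^2+(0-1)) <= 0" using n'[OF x'] by simp
				show "((%t. - (p t+(L-t))) has_real_derivative-((norm (y' x))^2 + V x*(norm (y x))^2+(0-1))) (at x within {t..L})"
					using x sub[OF t La(2)] by (intro DERIV_minus DERIV_add DERIV_diff DERIV_const DERIV_ident d)
			qed (use t in auto)
			thus ?thesis by (simp add: pL)
		qed
		have "(norm (y L))^2-(L-L)\<^sup>2 <= (norm (y a))^2-(L-a)\<^sup>2"
		proof (rule decreasing_from_derivative[where s=a and t=L and g = "%t. (norm (y t))\<^sup>2-(L-t)\<^sup>2" and g' = "%t. 2 * p t-(2*(L-t)*(0-1))"])
			fix x assume x: "x \<in> {a..L}"
			show "2 * p x-(2*(L-x)*(0-1)) <= 0" using p[OF x] by simp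
			have "((%t. (L-t)\<^sup>2) has_real_derivative 2*(L-x)*(0-1)) (at x within {a..L})" by (auto intro!: derivative_eq_intros)
			thus "((%t. (norm (y t))\<^sup>2-(L-t)\<^sup>2) has_real_derivative 2 * p x-(2*(L-x)*(0-1))) (at x within {a..L})"
				using x by (intro DERIV_diff d) auto
		qed (use L in auto)
		moreover have "1^2 <= (L-a)^2" using L by (intro power_mono) auto
		ultimately have "1^2 <= (norm (y a))^2" using zero_le_power2[of "norm (y L)"] unfolding diff_self power2_eq_square[of 0] by linarith
		thus ?thesis by (rule power2_le_imp_le) simp
	qed
qed

lemma exponentially_dominated_difference:
	fixes f :: "real => complex"
	assumes st: "s <= t" and f: "!!x. x \<in> {s..t} ==> (f has_vector_derivative f' x) (at x within {s..t})"
		and b: "!!x. x \<in> {s..t} ==> norm (f' x) <= \<alpha>+\<beta> * exp (- x)" and \<beta>: "\<beta> >= 0"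
	shows "norm (f t-f s) <= \<alpha>*(t-s)+\<beta> * exp (- s)"
proof -
	have "norm (f t-f s) <= (\<alpha> * t-\<beta> * exp (- t))-(\<alpha> * s-\<beta> * exp (- s))"
		by (rule dominated_difference[OF st f _ b]) (auto intro!: derivative_eq_intros)
	moreover have "\<beta> * exp (- t) >= 0" using \<beta> by simp
	ultimately show ?thesis by (simp add: right_diff_distrib)
qed

text \<open>For \<open>n = 0\<close> the potential is almost zero. Integrating the equation twice from the far end keeps the solution near its end value.\<close>

lemma free_solution_bound:
	fixes y y' :: "real => complex"
	assumes y: "schroedinger_on {a..L} V y y'" and L: "a >= 0" "a+1 <= L"
		and V: "!!t. t \<in> {a..L} ==> \<bar>V t-h\<bar> <= exp (- t)/8" and h: "\<bar>h\<bar> * L^2 <= 1/8"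
		and end_point: "y L=1" "y' L=0" and t: "t \<in> {a..L}"
	shows "norm (y t-1) <= 1/3"
proof -
	have "continuous_on {a..L} (%t. norm (y t))" using schroedinger_on_continuous(1)[OF y] by (rule continuous_on_norm)
	moreover have "compact {a..L}" "{a..L} ~= {}" using L by auto
	ultimately obtain t0 where t0: "t0 \<in> {a..L}" "!!t. t \<in> {a..L} ==> norm (y t) <= norm (y t0)"
		using continuous_attains_sup[of "{a..L}" "%t. norm (y t)"] by blast
	define M where "M=norm (y t0)"
	have M: "M >= 0" by (simp add: M_def)
	have hL: "\<bar>h\<bar>*(L * L) <= 1/8" using h by (simp add: power2_eq_square)
	have sub: "{t..L} \<subseteq> {a..L}" if "t \<in> {a..L}" for t using that by auto
	have y'b: "norm (y' t) <= \<bar>h\<bar> * M * L + M/8 * exp (- t)" if t: "t \<in> {a..L}" for t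
	proof -
		have "norm (y' L-y' t) <= \<bar>h\<bar> * M*(L-t) + M/8 * exp (- t)"
		proof (rule exponentially_dominated_difference)
			fix x assume x: "x \<in> {t..L}"
			show "(y' has_vector_derivative V x *\<^sub>R y x) (at x within {t..L})" by (rule schroedinger_onD(2)[OF schroedinger_on_subset[OF y sub[OF t]] x])
			have x': "x \<in> {a..L}" using x t by auto
			have "\<bar>V x\<bar> <= \<bar>h\<bar> + exp (- x)/8" using V[OF x'] by linarith
			hence "norm (V x *\<^sub>R y x) <= (\<bar>h\<bar> + exp (- x)/8) * M" unfolding norm_scaleR M_def by (intro mult_mono t0 x') auto
			thus "norm (V x *\<^sub>R y x) <= \<bar>h\<bar> * M + M/8 * exp (- x)" by (simp add: algebra_simps)
		qed (use t M in auto)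
		also have "\<bar>h\<bar> * M*(L-t) <= \<bar>h\<bar> * M * L" using t L M by (intro mult_left_mono) auto
		finally show ?thesis by (simp add: end_point)
	qed
	have yb: "norm (1-y t) <= M/4" if t: "t \<in> {a..L}" for t
	proof -
		have "norm (y L-y t) <= \<bar>h\<bar> * M * L*(L-t) + M/8 * exp (- t)"
			by (rule exponentially_dominated_difference[OF _ schroedinger_onD(1)[OF schroedinger_on_subset[OF y sub[OF t]]] y'b])
				(use t M in auto)
		moreover have "\<bar>h\<bar> * M * L*(L-t) <= \<bar>h\<bar> * M * L * L" using t L M by (intro mult_left_mono) auto
		moreover have "\<bar>h\<bar> * M * L * L <= 1/8 * M" using mult_right_mono[OF hL M] by (simp add: mult_ac)
		moreover have "M/8 * exp (- t) <= M/8*1" using t L M by (intro mult_left_mono) auto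
		ultimately show ?thesis by (simp add: end_point)
	qed
	have "M <= 1 + M/4" using yb[OF t0(1)] norm_triangle_ineq2[of "y t0" 1] unfolding M_def by (simp add: norm_minus_commute)
	thus ?thesis using yb[OF t] by (simp add: norm_minus_commute)
qed

text \<open>The Wronskian at \<open>a\<close> is its value at \<open>L\<close> plus the integral of \<open>(V - U) q y\<close>. Decay of \<open>q\<close> makes this integral small; for \<open>n = 0\<close> the constant part of \<open>V - U\<close> costs a factor \<open>L\<close>.\<close>

lemma wronskian_at_left_end:
	fixes q q' y y' :: "real => complex"
	assumes q: "schroedinger_on {a..L} U q q'" and y: "schroedinger_on {a..L} V y y'" and L: "a >= 0" "a <= L"
		and qb: "!!t. t \<in> {a..L} ==> norm (q t) <= C * exp (- real n * t)" and C: "C >= 0"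
		and V: "!!t. t \<in> {a..L} ==> \<bar>V t-U t\<bar> <= \<delta>+\<eta> * exp (- t)" and \<delta>: "\<delta> >= 0" "\<eta> >= 0"
		and yb: "!!t. t \<in> {a..L} ==> norm (y t) <= 2 * norm (y a)" "norm (y a) >= 1/2"
	shows "norm (q a * y' a-q' a * y a)/norm (y a)
		 <= 2*(norm (q L) * norm (y' L) + norm (q' L) * norm (y L))+2 * C*((if n=0 then \<delta> * L else \<delta>)+\<eta>)"
proof -
	define Y where "Y=norm (y a)"
	have Y: "Y >= 1/2" using yb by (simp add: Y_def)
	let ?W = "%t. q t * y' t-q' t * y t"
	define \<alpha> \<beta> where "\<alpha>=2 * C * Y*(if n=0 then \<delta> else 0)" and "\<beta>=2 * C * Y*(if n=0 then \<eta> else \<delta>+\<eta>)"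
	have ab: "\<alpha> >= 0" "\<beta> >= 0" using C Y \<delta> by (auto simp: \<alpha>_def \<beta>_def)
	have "norm (?W L - ?W a) <= \<alpha>*(L-a)+\<beta> * exp (- a)"
	proof (rule exponentially_dominated_difference[OF L(2)])
		fix t assume t: "t \<in> {a..L}"
		show "(?W has_vector_derivative of_real (V t-U t)*(q t * y t)) (at t within {a..L})" by (rule wronskian_derivative[OF q y t])
		have t0: "t >= 0" using t L by auto
		have "norm (of_real (V t-U t)*(q t * y t))=\<bar>V t-U t\<bar>*(norm (q t) * norm (y t))" by (simp only: norm_mult norm_of_real)
		also have "... <= (\<delta>+\<eta> * exp (- t))*((C * exp (- real n * t))*(2 * Y))"
			using V[OF t] qb[OF t] yb(1)[OF t] C \<delta> unfolding Y_def by (intro mult_mono) (auto intro!: add_nonneg_nonneg)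
		also have "... = 2 * C * Y*((\<delta>+\<eta> * exp (- t)) * exp (- real n * t))" by (simp only: mult_ac)
		also have "... <= 2 * C * Y*((if n=0 then \<delta> else 0)+(if n=0 then \<eta> else \<delta>+\<eta>) * exp (- t))"
		proof (intro mult_left_mono)
			show "(\<delta>+\<eta> * exp (- t)) * exp (- real n * t) <= (if n=0 then \<delta> else 0)+(if n=0 then \<eta> else \<delta>+\<eta>) * exp (- t)"
			proof (cases "n=0")
				case False
				have "exp (- t) <= 1" "t <= real n * t" using t0 False by (auto simp: mult_le_cancel_right1)
				hence "(\<delta>+\<eta> * exp (- t)) * exp (- real n * t) <= (\<delta>+\<eta>*1) * exp (- t)"
					using \<delta> by (intro mult_mono add_mono mult_left_mono) auto
				thus ?thesis using False by simp
			qed simp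
		qed (use C Y in auto)
		finally show "norm (of_real (V t-U t)*(q t * y t)) <= \<alpha>+\<beta> * exp (- t)" by (simp add: \<alpha>_def \<beta>_def distrib_left mult.assoc)
	qed (rule ab)
	moreover have "\<alpha>*(L-a) <= \<alpha> * L" using ab L by (intro mult_left_mono) auto
	moreover have "\<beta> * exp (- a) <= \<beta>*1" using ab L by (intro mult_left_mono) auto
	moreover have "norm (?W L) <= norm (q L) * norm (y' L) + norm (q' L) * norm (y L)"
		using norm_triangle_ineq4[of "q L * y' L" "q' L * y L"] by (simp add: norm_mult)
	moreover have "norm (?W a) <= norm (?W L) + norm (?W L - ?W a)" using norm_triangle_ineq4[of "?W L" "?W L - ?W a"] by simp
	ultimately have "norm (?W a) <= (norm (q L) * norm (y' L) + norm (q' L) * norm (y L))+(\<alpha> * L+\<beta>)" by linarith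
	also have "... <= (norm (q L) * norm (y' L) + norm (q' L) * norm (y L))*(2 * Y)+(\<alpha> * L+\<beta>)"
		using mult_left_mono[of 1 "2 * Y" "norm (q L) * norm (y' L) + norm (q' L) * norm (y L)"] Y by simp
	also have "\<alpha> * L+\<beta>=2 * C*((if n=0 then \<delta> * L else \<delta>)+\<eta>) * Y" by (simp add: \<alpha>_def \<beta>_def algebra_simps)
	finally have "norm (?W a) <= (2*(norm (q L) * norm (y' L) + norm (q' L) * norm (y L))+2 * C*((if n=0 then \<delta> * L else \<delta>)+\<eta>)) * Y"
		by (simp add: algebra_simps)
	thus ?thesis using Y unfolding Y_def[symmetric] by (simp add: pos_divide_le_eq)
qed

lemma lame_std_pole_end:
	assumes k: "0 < k" "k < 1"
	shows "pole_value (lame_std \<nu> b k h) k (elliptic_K' k)=(if b then 1 else 0)"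
		"pole_slope (lame_std \<nu> b k h) k (elliptic_K' k)=(if b then 0 else-\<i>)" using lame_std(2,3)[OF k,of \<nu> b h] by auto

lemma small_cs_square:
	assumes a: "a >= 1" and k: "0 < k" "k < 1" and \<tau>: "a <= \<tau>" "\<tau> <= elliptic_K' k"
	shows "\<bar>jacobi_cs_square k \<tau>\<bar> <= 32 * exp (- a) * exp (- \<tau>)"
proof -
	have e: "exp (- 2 * a) <= 1/2"
	proof -
		have "2 <= exp (2 * a)" using exp_ge_add_one_self[of "2 * a"] a by linarith
		hence "1/exp (2 * a) <= 1/2" by (intro divide_left_mono) auto
		thus ?thesis by (simp add: exp_minus inverse_eq_divide)
	qed
	have "(1/2)^2 <= (1-exp (- 2 * a))^2" using e by (intro power_mono) auto
	hence "4/(1-exp (- 2 * a))^2 <= 4/(1/2)^2" by (intro divide_left_mono) (auto simp: power2_eq_square intro!: mult_pos_pos)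
	hence "4/(1-exp (- 2 * a))^2 <= 16" by (simp add: power2_eq_square)
	hence "1/(sinh \<tau>)^2 <= 16 * exp (- 2*\<tau>)" using a by (intro order_trans[OF inverse_sinh_square_le[of a \<tau>] mult_right_mono] \<tau>) auto
	moreover have "\<bar>jacobi_cs_square k \<tau>-1/(sinh \<tau>)^2\<bar> <= 1/(sinh \<tau>)^2" using a \<tau> by (intro jacobi_cs_square_le k) auto
	ultimately have "\<bar>jacobi_cs_square k \<tau>\<bar> <= 32 * exp (- 2*\<tau>)" by linarith
	also have "32 * exp (- 2*\<tau>)=32 * exp (- \<tau>) * exp (- \<tau>)" by (simp flip: exp_add)
	also have "... <= 32 * exp (- a) * exp (- \<tau>)" using \<tau> by (intro mult_right_mono mult_left_mono) auto
	finally show ?thesis .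
qed

lemma lame_std_bound:
	fixes n :: nat
	assumes a: "a >= 1" "32*\<bar>(of_int m)\<^sup>2-1/4\<bar> * exp (- a) <= 1/8" and L: "a+1 <= elliptic_K' k"
		and k: "0 < k" "k < 1" and h: "if n=0 then \<bar>h\<bar>*(elliptic_K' k)^2 <= 1/8 else h >= 1/2" and b: "b \<or> n >= 1"
	defines "y \<equiv> %\<tau>. pole_value (lame_std (lame_nu m) b k h) k \<tau>"
	shows "norm (y a) >= 1/2" "t \<in> {a..elliptic_K' k} ==> norm (y t) <= 2 * norm (y a)"
proof -
	let ?K = "elliptic_K' k" and ?V = "lame_pole_potential (lame_nu m) k h"
	define y' where "y'=(%\<tau>. pole_slope (lame_std (lame_nu m) b k h) k \<tau>)"
	have y: "schroedinger_on {a..?K} ?V y y'" unfolding y_def y'_def by (rule lame_ode_imaginary_line[OF k lame_std(1)[OF k]]) (use a in auto)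
	have V: "\<bar>?V t-h\<bar> <= exp (- t)/8" if "t \<in> {a..?K}" for t
	proof -
		have "\<bar>?V t-h\<bar>=\<bar>(of_int m)\<^sup>2-1/4\<bar>*\<bar>jacobi_cs_square k t\<bar>" unfolding lame_pole_potential_def lame_nu_product by (simp add: abs_mult)
		also have "... <= \<bar>(of_int m)\<^sup>2-1/4\<bar>*(32 * exp (- a) * exp (- t))" using that by (intro mult_left_mono small_cs_square a k) auto
		also have "... = (32*\<bar>(of_int m)\<^sup>2-1/4\<bar> * exp (- a)) * exp (- t)" by (simp only: mult_ac)
		also have "... <= 1/8 * exp (- t)" by (intro mult_right_mono a) auto
		finally show ?thesis by simp
	qed
	note fin=lame_std_pole_end[OF k,of "lame_nu m" b h]
	have "norm (y a) >= 1/2 & (\<forall>t\<in>{a..?K}. norm (y t) <= 2 * norm (y a))"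
	proof (cases "n=0")
		case True
		hence b: "b=True" using b by auto
		have f: "y ?K=1" "y' ?K=0" using fin unfolding b y_def y'_def by simp_all
		have near: "norm (y t-1) <= 1/3" if "t \<in> {a..?K}" for t by (rule free_solution_bound[OF y _ L V _ f that]) (use a h True in auto)
		have "norm (y a) >= 2/3" using near[of a] norm_triangle_ineq2[of 1 "1-y a"] L by (simp add: norm_minus_commute)
		moreover have "norm (y t) <= 4/3" if "t \<in> {a..?K}" for t using near[OF that] norm_triangle_ineq2[of "y t" 1] by simp
		ultimately show ?thesis by force
	next
		case False
		have V0: "?V t >= 0" if t: "t \<in> {a..?K}" for t
		proof -
			have "exp (- t) <= 1" using t a by auto
			moreover have "h >= 1/2" using h False by simp
			ultimately show ?thesis using V[OF t] by linarith
		qed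
		have e: "y ?K=0 & norm (y' ?K)=1 \<or> norm (y ?K)=1 & y' ?K=0" using fin by (cases b) (simp_all add: y_def y'_def)
		have "norm (y a) >= 1" by (rule confined_solution_bound(1)[OF y L _ e]) (rule V0)
		moreover have "norm (y t) <= norm (y a)" if "t \<in> {a..?K}" for t by (rule confined_solution_bound(2)[OF y L _ e that]) (rule V0)
		ultimately show ?thesis by force
	qed
	thus "norm (y a) >= 1/2" "t \<in> {a..elliptic_K' k} ==> norm (y t) <= 2 * norm (y a)" by auto
qed

text \<open>Seen from the pole, the solution is prescribed at the distant point \<open>K'\<close>. Such a solution becomes proportional to the one that is recessive at infinity, since their Wronskian is small compared with its size.\<close>

lemma lame_std_limit:
	assumes H: "(H \<longlongrightarrow> (real n)\<^sup>2) (at_right 0)" and H0: "n=0 \<longrightarrow> (\<forall>\<^sub>F k in at_right 0. \<bar>H k\<bar> <= c * k^2)" and b: "b \<or> n >= 1"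
	shows "\<exists>\<gamma>. (\<forall>\<^sub>F k in at_right 0. \<gamma> k ~= 0) &
		(\<forall>t>0. ((%k. pole_value (lame_std (lame_nu m) b k (H k)) k t/\<gamma> k) \<longlongrightarrow> tor_Q n m t) (at_right 0) &
					 ((%k. pole_slope (lame_std (lame_nu m) b k (H k)) k t/\<gamma> k) \<longlongrightarrow> tor_Q' n m t) (at_right 0))"
proof -
	define N where "N=\<bar>(of_int m)\<^sup>2-1/4 :: real\<bar>"
	have N: "N >= 0" by (simp add: N_def)
	obtain C where C: "C > 0" "\<forall>\<^sub>F t in at_top. norm (tor_Q n m t) <= C * exp (- real n * t)" using tor_Q_bound by blast
	obtain T where T: "!!t. t >= T ==> norm (tor_Q n m t) <= C * exp (- real n * t)" "!!t. t >= T ==> tor_Q n m t ~= 0"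
		using eventually_conj[OF C(2) tor_Q_nonzero[of n m]] unfolding eventually_at_top_linorder by blast
	have "((%a::real. 32 * N * exp (- a)) \<longlongrightarrow> 32 * N*0) at_top"
		by (intro tendsto_intros filterlim_compose[OF exp_at_bot] filterlim_uminus_at_bot_at_top)
	hence "\<forall>\<^sub>F a in at_top. 32 * N * exp (- a) < 1/8" by (rule order_tendstoD) simp
	then obtain T' where T': "!!a. a >= T' ==> 32 * N * exp (- a) < 1/8" unfolding eventually_at_top_linorder by blast
	define a where "a=max 1 (max T T')"
	have a: "a >= 1" "a >= T" "32 * N * exp (- a) <= 1/8" by (simp_all only: a_def max.cobounded1 max.coboundedI2 less_imp_le[OF T'])
	have qa: "tor_Q n m a ~= 0" using T(2) a by simp
	define y y' where "y k=(%\<tau>. pole_value (lame_std (lame_nu m) b k (H k)) k \<tau>)" and "y' k=(%\<tau>. pole_slope (lame_std (lame_nu m) b k (H k)) k \<tau>)" for k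
	let ?q = "tor_Q n m" and ?q' = "tor_Q' n m" and ?K = "elliptic_K'"
	have K: "\<forall>\<^sub>F k in at_right 0. a+1 <= ?K k" using elliptic_K'_at_top by (auto simp: filterlim_at_top)
	define \<Delta> where "\<Delta> k=(if n=0 then \<bar>H k\<bar>*(?K k)^2 else \<bar>H k-(real n)\<^sup>2\<bar>)" for k
	have \<Delta>: "(\<Delta> \<longlongrightarrow> 0) (at_right 0)"
	proof (cases "n=0")
		case True
		have "((%k. \<bar>c\<bar>*16 * k) \<longlongrightarrow> \<bar>c\<bar>*16*0) (at_right 0)" by (intro tendsto_intros)
		hence l: "((%k. \<bar>c\<bar>*16 * k) \<longlongrightarrow> 0) (at_right 0)" by simp
		have "((%k::real. k\<^sup>2) \<longlongrightarrow> 0\<^sup>2) (at_right 0)" by (intro tendsto_intros)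
		hence k2: "\<forall>\<^sub>F k::real in at_right 0. k\<^sup>2 < 1/2" by (rule order_tendstoD) simp
		show ?thesis
		proof (rule Lim_null_comparison[OF _ l])
			show "\<forall>\<^sub>F k in at_right 0. norm (\<Delta> k) <= \<bar>c\<bar>*16 * k" using H0[rule_format,OF True] small_modulus k2 K
			proof eventually_elim
				case (elim k)
				have "?K k <= 4/sqrt k" using elim by (intro elliptic_K'_le) auto
				hence "(?K k)^2 <= (4/sqrt k)^2" using elim a by (intro power_mono) auto
				also have "... = 16/k" using elim by (simp add: power_divide)
				finally have K2: "(?K k)^2 <= 16/k" .
				have "c * k^2 <= \<bar>c\<bar> * k^2" by (intro mult_right_mono) auto
				hence "\<bar>H k\<bar> <= \<bar>c\<bar> * k^2" using elim by linarith
				hence "\<bar>H k\<bar>*(?K k)^2 <= (\<bar>c\<bar> * k^2)*(16/k)" using K2 by (intro mult_mono) auto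
				also have "... = \<bar>c\<bar>*16 * k" using elim by (simp add: power2_eq_square)
				finally show ?case using True by (simp add: \<Delta>_def)
			qed
		qed
	next
		case False
		have "((%k. \<bar>H k-(real n)\<^sup>2\<bar>) \<longlongrightarrow> \<bar>(real n)\<^sup>2-(real n)\<^sup>2\<bar>) (at_right 0)" by (intro tendsto_intros H)
		thus ?thesis using False by (simp add: \<Delta>_def[abs_def])
	qed
	have hyp: "\<forall>\<^sub>F k in at_right 0. if n=0 then \<bar>H k\<bar>*(?K k)^2 <= 1/8 else H k >= 1/2"
	proof -
		have "\<forall>\<^sub>F k in at_right 0. \<Delta> k < 1/8" using \<Delta> by (rule order_tendstoD) simp
		thus ?thesis
		proof eventually_elim
			case (elim k)
			show ?case
			proof (cases "n=0")
				case False
				hence "1 <= (real n)^2" by simp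
				moreover have "\<bar>H k-(real n)\<^sup>2\<bar> < 1/8" using elim False by (simp add: \<Delta>_def)
				ultimately have "H k >= 1/2" by linarith
				thus ?thesis using False by simp
			qed (use elim in \<open>simp add: \<Delta>_def\<close>)
		qed
	qed
	define bd where "bd k=norm (?q (?K k)) * norm (y' k (?K k)) + norm (?q' (?K k)) * norm (y k (?K k))" for k
	have bd: "(bd \<longlongrightarrow> 0) (at_right 0)"
	proof -
		have q': "((%k. norm (?q' (?K k))) \<longlongrightarrow> 0) (at_right 0)"
			by (rule tendsto_norm_zero) (rule filterlim_compose[OF tor_Q'_tendsto_0 elliptic_K'_at_top])
		have q: "((%k. if n=0 then 0 else norm (?q (?K k))) \<longlongrightarrow> 0) (at_right 0)"
		proof (cases "n=0")
			case False
			have "(?q \<longlongrightarrow> 0) at_top"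
			proof (rule Lim_null_comparison[OF C(2)])
				have "((%t. exp (- (real n * t))) \<longlongrightarrow> 0) at_top"
					using False by (intro filterlim_compose[OF exp_at_bot] filterlim_compose[OF filterlim_uminus_at_bot_at_top] filterlim_tendsto_pos_mult_at_top[OF tendsto_const _ filterlim_ident]) auto
				thus "((%t. C * exp (- real n * t)) \<longlongrightarrow> 0) at_top" using tendsto_mult_right_zero[of _ _ C] by simp
			qed
			thus ?thesis using False tendsto_norm_zero[OF filterlim_compose[OF _ elliptic_K'_at_top]] by auto
		qed simp
		show ?thesis
		proof (rule Lim_null_comparison)
			show "((%k. (if n=0 then 0 else norm (?q (?K k))) + norm (?q' (?K k))) \<longlongrightarrow> 0) (at_right 0)" using tendsto_add[OF q q'] by simp
			show "\<forall>\<^sub>F k in at_right 0. norm (bd k) <= (if n=0 then 0 else norm (?q (?K k))) + norm (?q' (?K k))" using small_modulus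
			proof eventually_elim
				case (elim k)
				thus ?case using lame_std_pole_end[of k "lame_nu m" b "H k"] b by (cases b) (auto simp: bd_def y_def y'_def)
			qed
		qed
	qed
	define W where "W k=(?q a * y' k a - ?q' a * y k a)/y k a" for k
	have ya: "\<forall>\<^sub>F k in at_right 0. norm (y k a) >= 1/2 & (\<forall>t\<in>{a..?K k}. norm (y k t) <= 2 * norm (y k a))"
		using hyp small_modulus K by eventually_elim (use lame_std_bound[OF a(1) a(3)[unfolded N_def] _ _ _ _ b] in \<open>auto simp: y_def\<close>)
	have W: "(W \<longlongrightarrow> 0) (at_right 0)"
	proof (rule tendstoI)
		fix e :: real assume e: "e > 0"
		define \<eta> where "\<eta>=e/(8 * C*(N+1))"
		have \<eta>: "\<eta> > 0" using e C N by (simp add: \<eta>_def)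
		have "C*(N*\<eta>) <= C*((N+1)*\<eta>)" using C \<eta> N by (intro mult_left_mono mult_right_mono) auto
		also have "C*((N+1)*\<eta>)=e/8"
		proof -
			have "x*(z*(e/(8 * x * z)))=e/8" if "x ~= 0" "z ~= 0" for x z :: real using that by simp
			from this[of C "N+1"] show ?thesis using C N by (simp add: \<eta>_def)
		qed
		finally have \<eta>2: "C*(N*\<eta>) <= e/8" .
		have w: "\<forall>\<^sub>F k in at_right 0. \<forall>\<tau>. a <= \<tau> & \<tau> <= ?K k \<longrightarrow> \<bar>jacobi_cs_square k \<tau>-1/(sinh \<tau>)^2\<bar> <= \<eta> * exp (- \<tau>)"
			using jacobi_cs_square_weighted[OF _ \<eta>,of a] a by simp
		have "((%k. 2 * bd k+2 * C*\<Delta> k) \<longlongrightarrow> 2*0+2 * C*0) (at_right 0)" by (intro tendsto_intros bd \<Delta>)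
		hence "\<forall>\<^sub>F k in at_right 0. 2 * bd k+2 * C*\<Delta> k < e/2" by (rule order_tendstoD) (use e in simp)
		with w ya K small_modulus show "\<forall>\<^sub>F k in at_right 0. dist (W k) 0 < e"
		proof eventually_elim
			case (elim k)
			have k: "0 < k" "k < 1" and KK: "a+1 <= ?K k" using elim by auto
			let ?V = "lame_pole_potential (lame_nu m) k (H k)"
			have yS: "schroedinger_on {a..?K k} ?V (y k) (y' k)" unfolding y_def y'_def
				by (rule lame_ode_imaginary_line[OF k lame_std(1)[OF k]]) (use a in auto)
			have qS: "schroedinger_on {a..?K k} (toroidal_potential n m) ?q ?q'" by (rule schroedinger_on_subset[OF tor_Q_solution]) (use a in auto)
			have V: "\<bar>?V t-toroidal_potential n m t\<bar> <= \<bar>H k-(real n)\<^sup>2\<bar> + N*\<eta> * exp (- t)" if "t \<in> {a..?K k}" for t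
			proof -
				have "N*\<bar>jacobi_cs_square k t-1/(sinh t)^2\<bar> <= N*(\<eta> * exp (- t))" using elim that N by (intro mult_left_mono) auto
				thus ?thesis unfolding pole_potential_difference N_def abs_mult[symmetric] by (intro order_trans[OF abs_triangle_ineq]) (simp add: mult.assoc)
			qed
			have "norm (W k)=norm (?q a * y' k a - ?q' a * y k a)/norm (y k a)" by (simp add: W_def norm_divide)
			also have "... <= 2 * bd k+2 * C*((if n=0 then \<bar>H k-(real n)\<^sup>2\<bar> * ?K k else \<bar>H k-(real n)\<^sup>2\<bar>) + N*\<eta>)"
				unfolding bd_def by (rule wronskian_at_left_end[OF qS yS _ _ T(1) _ V]) (use a C N \<eta> elim KK in auto)
			also have "... <= 2 * bd k+2 * C*(\<Delta> k + N*\<eta>)"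
			proof -
				have "?K k*1 <= ?K k * ?K k" using KK a by (intro mult_left_mono) auto
				hence "\<bar>H k\<bar> * ?K k <= \<bar>H k\<bar>*(?K k)^2" by (intro mult_left_mono) (simp_all add: power2_eq_square)
				thus ?thesis using C by (simp add: \<Delta>_def)
			qed
			also have "... = (2 * bd k+2 * C*\<Delta> k)+2*(C*(N*\<eta>))" by (simp add: algebra_simps)
			also have "... < e" using elim \<eta>2 e by linarith
			finally show ?case by simp
		qed
	qed
	define \<gamma> where "\<gamma> k=y k a / ?q a" for k
	have \<gamma>0: "\<forall>\<^sub>F k in at_right 0. \<gamma> k ~= 0" using ya by eventually_elim (use qa in \<open>auto simp: \<gamma>_def\<close>)
	have 1: "((%k. pole_value (lame_std (lame_nu m) b k (H k)) k a/\<gamma> k) \<longlongrightarrow> ?q a) (at_right 0)"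
	proof (rule tendsto_eventually)
		show "\<forall>\<^sub>F k in at_right 0. pole_value (lame_std (lame_nu m) b k (H k)) k a/\<gamma> k = ?q a"
			using ya by eventually_elim (auto simp: \<gamma>_def y_def)
	qed
	have "((%k. W k + ?q' a) \<longlongrightarrow> 0 + ?q' a) (at_right 0)" by (intro tendsto_intros W)
	hence "((%k. W k + ?q' a) \<longlongrightarrow> ?q' a) (at_right 0)" by simp
	hence 2: "((%k. pole_slope (lame_std (lame_nu m) b k (H k)) k a/\<gamma> k) \<longlongrightarrow> ?q' a) (at_right 0)"
	proof (rule Lim_transform_eventually)
		show "\<forall>\<^sub>F k in at_right 0. W k + ?q' a=pole_slope (lame_std (lame_nu m) b k (H k)) k a/\<gamma> k" using ya
		proof eventually_elim
			case (elim k)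
			hence "y k a ~= 0" by auto
			hence "W k + ?q' a=y' k a/\<gamma> k" using qa by (simp add: W_def \<gamma>_def field_simps)
			thus ?case by (simp only: y'_def)
		qed
	qed
	have Y: "\<forall>\<^sub>F k in at_right 0. lame_ode (lame_nu m) k (H k) (lame_std (lame_nu m) b k (H k))"
		using small_modulus by eventually_elim (rule lame_std(1),auto)
	have a0: "a > 0" using a by simp
	show ?thesis by (intro exI[of _ \<gamma>] conjI allI impI \<gamma>0) (rule toroidal_continuation[OF H Y tor_Q_solution a0 1 2],assumption)+
qed

section \<open>Normalised eigenfunctions and their limits\<close>

lemma lame_eigen_multiple:
	assumes k: "0 < k" "k < 1" and E: "lame_eigen \<nu> b j k h E"
	obtains c where "c ~= 0" "!!s. s \<in> {0..elliptic_K k} ==> E s = c * lame_re \<nu> b k h s"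
		"((%s. (lame_re \<nu> b k h s)\<^sup>2) has_integral 1/c^2) {0..elliptic_K k}"
proof -
	let ?K = "elliptic_K k" and ?y = "lame_re \<nu> b k h"
	have K: "?K > 0" using k by (intro elliptic_K_gt_0) (simp add: abs_square_less_1)
	obtain E' where E': "schroedinger_on {0..?K} (lame_potential \<nu> k h) E E'" "if b then E' 0=0 else E 0=0"
		and norm: "lame_normalized k E" using E unfolding lame_eigen_def by blast
	define c where "c=(if b then E 0 else E' 0)"
	have y: "schroedinger_on {0..?K} (lame_potential \<nu> k h) (%s. c * ?y s) (%s. c * lame_re' \<nu> b k h s)"
		by (rule schroedinger_on_linear[OF lame_re_solution[OF k] bounded_linear_mult_right])
	have Ey: "E s = c * ?y s" if "s \<in> {0..?K}" for s by (rule schroedinger_unique(1)[OF E'(1) y lame_potential_bounded_image,of 0])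
			(use that K E'(2) lame_re_init[OF k,of \<nu> b h] in \<open>auto simp: c_def split: if_splits\<close>)
	have int: "((%s. (c * ?y s)\<^sup>2) has_integral 1) {0..?K}" by (rule has_integral_eq[OF _ norm[unfolded lame_normalized_def]]) (simp add: Ey)
	have c: "c ~= 0"
	proof
		assume "c=0"
		hence "((%s. 0 :: real) has_integral 1) {0..?K}" using int by simp
		hence "(1 :: real)=0" by (rule has_integral_unique) (rule has_integral_0)
		thus False by simp
	qed
	have "((%s. (1/c^2)*(c * ?y s)^2) has_integral (1/c^2)*1) {0..?K}" by (rule has_integral_mult_right[OF int])
	hence "((%s. (?y s)\<^sup>2) has_integral 1/c^2) {0..?K}" using c by (simp add: power_mult_distrib)
	with c Ey show ?thesis by (rule that)
qed

lemma lame_eigenfunction_continuation: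
	assumes k: "0 < k" "k < 1" and E: "lame_eigen \<nu> b j k h E"
	shows "\<exists>f. f holomorphic_on strip k & (\<exists>e. lame_eigen \<nu> b j k h e & (\<forall>s\<in>{0..elliptic_K k}. f (of_real s) = of_real (e s)))"
proof -
	obtain c where c: "c ~= 0" "!!s. s \<in> {0..elliptic_K k} ==> E s = c * lame_re \<nu> b k h s" using lame_eigen_multiple[OF k E] by metis
	have "lame_std \<nu> b k h holomorphic_on strip k" using lame_std(1)[OF k] unfolding lame_ode_def by blast
	hence "(%z. of_real c * lame_std \<nu> b k h z) holomorphic_on strip k" by (intro holomorphic_intros)
	thus ?thesis using E c(2) by (intro exI[of _ "%z. of_real c * lame_std \<nu> b k h z"] exI[of _ E] conjI) (auto simp: lame_std_real[OF k])
qed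

lemma lame_eigenfunction_std:
	assumes k: "0 < k" "k < 1" and f: "f holomorphic_on strip k"
		and E: "lame_eigen \<nu> b j k h E" "!!s. s \<in> {0..elliptic_K k} ==> f (of_real s) = of_real (E s)"
	obtains c where "c ~= 0" "!!z. z \<in> strip k ==> f z = of_real c * lame_std \<nu> b k h z"
		"((%s. (lame_re \<nu> b k h s)\<^sup>2) has_integral 1/c^2) {0..elliptic_K k}"
proof -
	obtain c where c: "c ~= 0" "!!s. s \<in> {0..elliptic_K k} ==> E s = c * lame_re \<nu> b k h s"
		"((%s. (lame_re \<nu> b k h s)\<^sup>2) has_integral 1/c^2) {0..elliptic_K k}" using lame_eigen_multiple[OF k E(1)] by blast
	have K: "elliptic_K k > 0" using k by (intro elliptic_K_gt_0) (simp add: abs_square_less_1)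
	have std: "lame_std \<nu> b k h holomorphic_on strip k" using lame_std(1)[OF k] unfolding lame_ode_def by blast
	have eq: "f z = of_real c * lame_std \<nu> b k h z" if z: "z \<in> strip k" for z
	proof (rule holomorphic_eq_on_connected_set[where f=f and g = "%z. of_real c * lame_std \<nu> b k h z" and S = "strip k"
				and U = "of_real ` {0..elliptic_K k}" and a = "of_real 0" and b = "of_real (elliptic_K k)"])
		show "(%z. of_real c * lame_std \<nu> b k h z) holomorphic_on strip k" by (intro holomorphic_intros std)
		show "connected (complex_of_real ` {0..elliptic_K k})" by (intro connected_continuous_image continuous_intros) simp
		show "complex_of_real ` {0..elliptic_K k} \<subseteq> strip k" using of_real_in_strip[OF k] by auto
		show "of_real 0 \<in> complex_of_real ` {0..elliptic_K k}" "of_real (elliptic_K k) \<in> complex_of_real ` {0..elliptic_K k}"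
			using K by (intro imageI; simp)+
		show "complex_of_real 0 ~= of_real (elliptic_K k)" using K by simp
		show "f w = of_real c * lame_std \<nu> b k h w" if "w \<in> complex_of_real ` {0..elliptic_K k}" for w
			using that E(2) c(2) by (auto simp: lame_std_real[OF k])
	qed (auto intro!: f open_strip convex_connected convex_strip z)
	show ?thesis by (rule that[OF c(1) eq c(3)])
qed

text \<open>The integral of the square of the trigonometric limit over \<open>[0, \<pi>/2]\<close>.\<close>

definition trig_norm :: "bool => nat => real" where
	"trig_norm b n=(if n=0 then pi/2 else if b then pi/4 else pi/(4*(real n)^2))"

lemma lame_norm_limit:
	assumes H: "(H \<longlongrightarrow> (real n)\<^sup>2) (at_right 0)" and b: "b \<or> n >= 1"
		and N: "\<forall>\<^sub>F k in at_right 0. ((%s. (lame_re \<nu> b k (H k) s)\<^sup>2) has_integral N k) {0..elliptic_K k}"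
	shows "(N \<longlongrightarrow> trig_norm b n) (at_right 0)"
proof -
	let ?g = "trig_std b (real n)" and ?y = "%k. lame_re \<nu> b k (H k)"
	have b': "b \<or> real n ~= 0" using b by auto
	have u: "uniform_limit {-2..2} ?y ?g (at_right 0)" by (rule lame_re_uniform_limit(1)[OF small_modulus tendsto_ident_at H b']) simp
	have gc: "continuous_on S ?g" for S using schroedinger_on_continuous(1)[OF trig_std_solution[OF b']] .
	have gb: "bounded (?g ` {-2..2})" by (intro compact_imp_bounded compact_continuous_image gc) simp
	have u2: "uniform_limit {-2..2} (%k s. (?y k s)\<^sup>2) (%s. (?g s)\<^sup>2) (at_right 0)"
		unfolding power2_eq_square by (rule uniform_lim_mult[OF u u gb gb])
	define A where "A x=(if n=0 then x else if b then x/2 + sin (2 * real n * x)/(4 * real n)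
		 else (x/2-sin (2 * real n * x)/(4 * real n))/(real n)^2)" for x
	have dA: "(A has_real_derivative (?g x)\<^sup>2) (at x within S)" for x S
	proof -
		have c: "cos (2 * real n * x)=2*(cos (real n * x))^2-1" "cos (2 * real n * x)=1-2*(sin (real n * x))^2"
			using cos_double_cos[of "real n * x"] cos_double_sin[of "real n * x"] by (simp_all add: mult.assoc)
		consider "n=0" | "n ~= 0" b | "n ~= 0" "\<not> b" by blast
		thus ?thesis
		proof cases
			case 1
			hence "A=(%x. x)" by (intro ext) (simp add: A_def)
			thus ?thesis using 1 b by (auto simp: trig_std_def)
		next
			case 2
			hence "A=(%x. x/2 + sin (2 * real n * x)/(4 * real n))" by (intro ext) (simp add: A_def)
			moreover have "((%x. x/2 + sin (2 * real n * x)/(4 * real n)) has_real_derivative 1/2 + cos (2 * real n * x)*(2 * real n)/(4 * real n)) (at x within S)"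
				by (auto intro!: derivative_eq_intros)
			moreover have "1/2 + cos (2 * real n * x)*(2 * real n)/(4 * real n)=(?g x)^2" using 2 unfolding c(1) by (simp add: trig_std_def field_simps)
			ultimately show ?thesis by (simp only:)
		next
			case 3
			hence "A=(%x. (x/2-sin (2 * real n * x)/(4 * real n))/(real n)^2)" by (intro ext) (simp add: A_def)
			moreover have "((%x. (x/2-sin (2 * real n * x)/(4 * real n))/(real n)^2) has_real_derivative (1/2-cos (2 * real n * x)*(2 * real n)/(4 * real n))/(real n)^2) (at x within S)"
				by (intro DERIV_cdivide DERIV_diff) (auto intro!: derivative_eq_intros)
			moreover have "(1/2-cos (2 * real n * x)*(2 * real n)/(4 * real n))/(real n)^2=(?g x)^2" using 3 unfolding c(2) by (simp add: trig_std_def field_simps)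
			ultimately show ?thesis by (simp only:)
		qed
	qed
	have gi: "((%s. (?g s)\<^sup>2) has_integral (A x-A 0)) {0..x}" if "x >= 0" for x
		using fundamental_theorem_of_calculus[OF that,of A "%s. (?g s)\<^sup>2"] dA by (simp add: has_real_derivative_iff_has_vector_derivative)
	have K2: "\<forall>\<^sub>F k in at_right 0. elliptic_K k < 2" using elliptic_K_tendsto by (rule order_tendstoD) (use pi_less_4 in simp)
	have diff: "((%k. N k-(A (elliptic_K k)-A 0)) \<longlongrightarrow> 0) (at_right 0)"
	proof (rule tendstoI)
		fix e :: real assume e: "e > 0"
		have "\<forall>\<^sub>F k in at_right 0. \<forall>s\<in>{-2..2}. dist ((?y k s)^2) ((?g s)^2) < e/4" using u2[unfolded uniform_limit_iff,rule_format,of "e/4"] e by simp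
		with N K2 small_modulus show "\<forall>\<^sub>F k in at_right 0. dist (N k-(A (elliptic_K k)-A 0)) 0 < e"
		proof eventually_elim
			case (elim k)
			have K: "elliptic_K k > 0" using elim by (intro elliptic_K_gt_0) (simp add: abs_square_less_1)
			have i: "((%s. (?y k s)\<^sup>2-(?g s)\<^sup>2) has_integral (N k-(A (elliptic_K k)-A 0))) {0..elliptic_K k}"
				using elim gi[of "elliptic_K k"] K by (intro has_integral_diff) auto
			have "norm ((?y k s)^2-(?g s)\<^sup>2) <= e/4" if "s \<in> {0..elliptic_K k}" for s using elim that by (force simp: dist_norm less_imp_le)
			hence "norm (N k-(A (elliptic_K k)-A 0)) <= e/4 * Henstock_Kurzweil_Integration.content {0..elliptic_K k}"
				using e by (intro has_integral_bound_real[OF _ finite.emptyI i]) auto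
			hence "norm (N k-(A (elliptic_K k)-A 0)) <= e/4 * elliptic_K k" using K by simp
			also have "... <= e/4*2" using e elim by (intro mult_left_mono) auto
			also have "... < e" using e by simp
			finally show ?case by simp
		qed
	qed
	have "isCont A (pi/2)" using dA[of "pi/2" UNIV] by (rule DERIV_isCont)
	hence "((%k. A (elliptic_K k)) \<longlongrightarrow> A (pi/2)) (at_right 0)" using elliptic_K_tendsto by (rule isCont_tendsto_compose)
	from tendsto_add[OF diff tendsto_diff[OF this tendsto_const[of "A 0"]]]
	have "(N \<longlongrightarrow> A (pi/2)-A 0) (at_right 0)" by simp
	moreover have "A (pi/2)-A 0=trig_norm b n"
	proof -
		have "sin (2 * real n*(pi/2))=0" using sin_npi[of n] by simp
		thus ?thesis unfolding A_def trig_norm_def by simp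
	qed
	ultimately show ?thesis by simp
qed

lemma lame_real_axis_limit:
	assumes H: "(H \<longlongrightarrow> (real n)\<^sup>2) (at_right 0)" and b: "b \<or> n >= 1"
	shows "((%k. lame_re \<nu> b k (H k) (2 * elliptic_K k-\<psi>)) \<longlongrightarrow> trig_std b (real n) (pi-\<psi>)) (at_right 0)"
proof -
	define R where "R=\<bar>pi-\<psi>\<bar>+1"
	have b': "b \<or> real n ~= 0" using b by auto
	have u: "uniform_limit {-R..R} (%k. lame_re \<nu> b k (H k)) (trig_std b (real n)) (at_right 0)"
		by (rule lame_re_uniform_limit(1)[OF small_modulus tendsto_ident_at H b']) (simp add: R_def)
	have "((%k. 2 * elliptic_K k-\<psi>) \<longlongrightarrow> 2*(pi/2)-\<psi>) (at_right 0)" by (intro tendsto_intros elliptic_K_tendsto)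
	hence x: "((%k. 2 * elliptic_K k-\<psi>) \<longlongrightarrow> pi-\<psi>) (at_right 0)" by simp
	have "\<forall>\<^sub>F k in at_right 0. dist (2 * elliptic_K k-\<psi>) (pi-\<psi>) < 1" by (rule tendstoD[OF x]) simp
	hence in_R: "\<forall>\<^sub>F k in at_right 0. 2 * elliptic_K k-\<psi> \<in> {-R..R}" by eventually_elim (auto simp: R_def dist_real_def)
	show ?thesis by (rule uniform_limit_moving_point[OF u _ x in_R]) (auto simp: R_def intro: schroedinger_on_continuous(1)[OF trig_std_solution[OF b']])
qed

section \<open>The limit of a single term\<close>

lemma tor_wronskian_nonzero: "t > 0 ==> tor_P n m t * tor_Q' n m t-tor_P' n m t * tor_Q n m t ~= 0"
	using half_integer_not_nonpos[of "int n-m"] by (simp add: tor_wronskian Gamma_eq_zero_iff)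

lemma second_kind_eventually_exists:
	assumes H: "(H \<longlongrightarrow> (real n)\<^sup>2) (at_right 0)" and H0: "n=0 \<longrightarrow> (\<forall>\<^sub>F k in at_right 0. \<bar>H k\<bar> <= c * k^2)" and b: "b \<or> n >= 1"
		and E: "\<forall>\<^sub>F k in at_right 0. \<exists>d. d ~= 0 & (\<forall>z\<in>strip k. E k z = of_real d * lame_std (lame_nu m) b k (H k) z)"
	shows "\<forall>\<^sub>F k in at_right 0. lame_ode (lame_nu m) k (H k) (E k) & (\<exists>F. lame_second_kind (lame_nu m) k (H k) (E k) F)"
proof -
	let ?\<nu> = "lame_nu m"
	define \<Phi> where "\<Phi> k=(SOME F. lame_ode ?\<nu> k (H k) F & frobenius_at_iK' ?\<nu> k F)" for k
	have \<Phi>: "\<forall>\<^sub>F k in at_right 0. lame_ode ?\<nu> k (H k) (\<Phi> k) & frobenius_at_iK' ?\<nu> k (\<Phi> k)" using small_modulus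
	proof eventually_elim
		case (elim k)
		have "\<exists>F. lame_ode ?\<nu> k (H k) F & frobenius_at_iK' ?\<nu> k F"
			using lame_frobenius_exists[of k ?\<nu> "H k"] elim by (auto simp: lame_nu_def)
		thus ?case unfolding \<Phi>_def by (rule someI_ex)
	qed
	obtain \<beta> where \<beta>': "(\<forall>\<^sub>F k in at_right 0. \<beta> k ~= 0) & (\<forall>t>0. ((%k. pole_value (\<Phi> k) k t/\<beta> k) \<longlongrightarrow> tor_P n m t) (at_right 0) &
			((%k. pole_slope (\<Phi> k) k t/\<beta> k) \<longlongrightarrow> tor_P' n m t) (at_right 0))" using frobenius_solution_limit[OF H \<Phi>] ..
	note \<beta>=\<beta>'[THEN conjunct2,rule_format,THEN conjunct1] \<beta>'[THEN conjunct2,rule_format,THEN conjunct2]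
	let ?s = "%k. lame_std ?\<nu> b k (H k)"
	obtain \<gamma> where \<gamma>': "(\<forall>\<^sub>F k in at_right 0. \<gamma> k ~= 0) & (\<forall>t>0. ((%k. pole_value (?s k) k t/\<gamma> k) \<longlongrightarrow> tor_Q n m t) (at_right 0) &
			((%k. pole_slope (?s k) k t/\<gamma> k) \<longlongrightarrow> tor_Q' n m t) (at_right 0))" using lame_std_limit[where m=m,OF H H0 b] ..
	note \<gamma>=\<gamma>'[THEN conjunct2,rule_format,THEN conjunct1] \<gamma>'[THEN conjunct2,rule_format,THEN conjunct2]
	have "((%k. pole_value (\<Phi> k) k 1/\<beta> k*(pole_slope (?s k) k 1/\<gamma> k)-pole_slope (\<Phi> k) k 1/\<beta> k*(pole_value (?s k) k 1/\<gamma> k))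
		 \<longlongrightarrow> tor_P n m 1 * tor_Q' n m 1-tor_P' n m 1 * tor_Q n m 1) (at_right 0)"
		by (rule tendsto_diff[OF tendsto_mult[OF \<beta>(1)[OF zero_less_one] \<gamma>(2)[OF zero_less_one]] tendsto_mult[OF \<beta>(2)[OF zero_less_one] \<gamma>(1)[OF zero_less_one]]])
	from tendsto_imp_eventually_ne[OF this tor_wronskian_nonzero[OF zero_less_one]]
	have ne: "\<forall>\<^sub>F k in at_right 0. pole_value (\<Phi> k) k 1/\<beta> k*(pole_slope (?s k) k 1/\<gamma> k)-pole_slope (\<Phi> k) k 1/\<beta> k*(pole_value (?s k) k 1/\<gamma> k) ~= 0" .
	have "\<forall>\<^sub>F k in at_right 0. 1 <= elliptic_K' k" using elliptic_K'_at_top by (auto simp: filterlim_at_top)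
	with ne E \<Phi> small_modulus show ?thesis
	proof eventually_elim
		case (elim k)
		have k: "0 < k" "k < 1" using elim by auto
		obtain d where d: "d ~= 0" "!!z. z \<in> strip k ==> E k z = of_real d * ?s k z" using elim by blast
		note s=lame_std(1)[OF k,of ?\<nu> "H k" b]
		have "(E k has_field_derivative of_real d * deriv (?s k) z) (at z)" if "z \<in> strip k" for z
			by (rule has_field_derivative_transform_within_open[OF DERIV_cmult[OF lame_ode_derivs(1)[OF s that]] open_strip that]) (simp add: d(2))
		note E1=this
		have E2: "((%z. of_real d * deriv (?s k) z) has_field_derivative
				of_real d*((of_real (?\<nu>*(?\<nu>+1) * k^2)*(sn_cont k z)^2-of_real (H k)) * ?s k z)) (at z)" if "z \<in> strip k" for z
			by (intro DERIV_cmult lame_ode_derivs[OF s that])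
		have ode: "lame_ode ?\<nu> k (H k) (E k)" unfolding lame_ode_def using second_derivative_from_derivatives[OF open_strip E1 E2] by (simp add: d(2))
		let ?z = "\<i> * complex_of_real (elliptic_K' k-1)"
		have z: "?z \<in> strip k" using elim by (intro imaginary_in_strip) auto
		have "\<Phi> k ?z * deriv (E k) ?z-E k ?z * deriv (\<Phi> k) ?z = of_real d*(\<Phi> k ?z * deriv (?s k) ?z-deriv (\<Phi> k) ?z * ?s k ?z)"
			using DERIV_imp_deriv[OF E1[OF z]] d(2)[OF z] by (simp add: algebra_simps)
		moreover have "\<Phi> k ?z * deriv (?s k) ?z-deriv (\<Phi> k) ?z * ?s k ?z ~= 0"
		proof
			assume 0: "\<Phi> k ?z * deriv (?s k) ?z-deriv (\<Phi> k) ?z * ?s k ?z=0"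
			have "p/B*(- \<i> * s'/G) - - \<i> * p'/B*(s/G) = - \<i>/(B * G)*(p * s'-p' * s)" for p p' s s' B G :: complex
				by (simp add: algebra_simps diff_divide_distrib)
			note eq=this[of "\<Phi> k ?z" "\<beta> k" "deriv (?s k) ?z" "\<gamma> k" "deriv (\<Phi> k) ?z" "?s k ?z"]
			show False by (rule notE[OF elim(1)]) (unfold eq 0,simp)
		qed
		ultimately have "\<Phi> k ?z * deriv (E k) ?z-E k ?z * deriv (\<Phi> k) ?z ~= 0" using d(1) by simp
		with lame_second_kind_exists[OF k ode _ _ z] elim ode show ?case by blast
	qed
qed

text \<open>The product of \<open>E\<close> and \<open>F\<close> at two points is divided by their Wronskian, which the normalisation fixes. All unknown scale factors cancel, and the norm of \<open>E\<close> enters only through the square of \<open>d\<close>.\<close>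

lemma lame_product_limit:
	assumes t: "\<tau> > 0" "\<tau>' > 0" and b: "b \<or> n >= 1"
		and H: "(H \<longlongrightarrow> (real n)\<^sup>2) (at_right 0)" and H0: "n=0 \<longrightarrow> (\<forall>\<^sub>F k in at_right 0. \<bar>H k\<bar> <= c * k^2)"
		and E: "\<forall>\<^sub>F k in at_right 0. d k ~= 0 & (\<forall>z\<in>strip k. E k z = of_real (d k) * lame_std (lame_nu m) b k (H k) z) &
			((%s. (lame_re (lame_nu m) b k (H k) s)\<^sup>2) has_integral 1/(d k)^2) {0..elliptic_K k}"
		and F: "\<forall>\<^sub>F k in at_right 0. lame_ode (lame_nu m) k (H k) (E k) & lame_second_kind (lame_nu m) k (H k) (E k) (F k)"
	shows "((%k. E k (of_real (2 * elliptic_K k-\<psi>)) * E k (of_real (2 * elliptic_K k-\<psi>')) * pole_value (E k) k \<tau> * pole_value (F k) k \<tau>') \<longlongrightarrow>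
		 of_real (trig_std b (real n) (pi-\<psi>) * trig_std b (real n) (pi-\<psi>')/trig_norm b n) *
		 (- (tor_Q n m \<tau> * tor_P n m \<tau>')/(tor_P n m 1 * tor_Q' n m 1-tor_P' n m 1 * tor_Q n m 1))) (at_right 0)"
proof -
	let ?\<nu> = "lame_nu m" and ?W = "tor_P n m 1 * tor_Q' n m 1-tor_P' n m 1 * tor_Q n m 1"
	let ?s = "%k. lame_std ?\<nu> b k (H k)"
	have F': "\<forall>\<^sub>F k in at_right 0. lame_ode ?\<nu> k (H k) (F k) & frobenius_at_iK' ?\<nu> k (F k)"
		using F small_modulus by eventually_elim (auto simp: lame_second_kind_iff)
	obtain \<beta> where \<beta>': "(\<forall>\<^sub>F k in at_right 0. \<beta> k ~= 0) & (\<forall>t>0. ((%k. pole_value (F k) k t/\<beta> k) \<longlongrightarrow> tor_P n m t) (at_right 0) &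
			((%k. pole_slope (F k) k t/\<beta> k) \<longlongrightarrow> tor_P' n m t) (at_right 0))" using frobenius_solution_limit[OF H F'] ..
	note \<beta>=\<beta>'[THEN conjunct1] \<beta>'[THEN conjunct2,rule_format,THEN conjunct1] \<beta>'[THEN conjunct2,rule_format,THEN conjunct2]
	obtain \<gamma> where \<gamma>': "(\<forall>\<^sub>F k in at_right 0. \<gamma> k ~= 0) & (\<forall>t>0. ((%k. pole_value (?s k) k t/\<gamma> k) \<longlongrightarrow> tor_Q n m t) (at_right 0) &
			((%k. pole_slope (?s k) k t/\<gamma> k) \<longlongrightarrow> tor_Q' n m t) (at_right 0))" using lame_std_limit[where m=m,OF H H0 b] ..
	note \<gamma>=\<gamma>'[THEN conjunct1] \<gamma>'[THEN conjunct2,rule_format,THEN conjunct1] \<gamma>'[THEN conjunct2,rule_format,THEN conjunct2]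
	define w where "w k=pole_value (F k) k 1/\<beta> k*(pole_slope (?s k) k 1/\<gamma> k)-pole_slope (F k) k 1/\<beta> k*(pole_value (?s k) k 1/\<gamma> k)" for k
	have wl: "(w \<longlongrightarrow> ?W) (at_right 0)" unfolding w_def[abs_def]
		by (rule tendsto_diff[OF tendsto_mult[OF \<beta>(2)[OF zero_less_one] \<gamma>(3)[OF zero_less_one]] tendsto_mult[OF \<beta>(3)[OF zero_less_one] \<gamma>(2)[OF zero_less_one]]])
	have W0: "?W ~= 0" by (rule tor_wronskian_nonzero) simp
	have "\<forall>\<^sub>F k in at_right 0. ((%s. (lame_re ?\<nu> b k (H k) s)\<^sup>2) has_integral 1/(d k)^2) {0..elliptic_K k}" using E by eventually_elim blast
	from lame_norm_limit[OF H b this] have "((%k. 1/(d k)^2) \<longlongrightarrow> trig_norm b n) (at_right 0)" .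
	moreover have "trig_norm b n ~= 0" by (simp add: trig_norm_def)
	ultimately have "((%k. 1/(1/(d k)^2)) \<longlongrightarrow> 1/trig_norm b n) (at_right 0)" by (intro tendsto_intros)
	hence dl: "((%k. (d k)\<^sup>2) \<longlongrightarrow> 1/trig_norm b n) (at_right 0)" by simp
	let ?r = "%k x. lame_re ?\<nu> b k (H k) (2 * elliptic_K k-x)"
	have "((%k. of_real ((d k)^2*(?r k \<psi> * ?r k \<psi>'))*(- (pole_value (?s k) k \<tau>/\<gamma> k*(pole_value (F k) k \<tau>'/\<beta> k))/w k)) \<longlongrightarrow>
		 of_real (1/trig_norm b n*(trig_std b (real n) (pi-\<psi>) * trig_std b (real n) (pi-\<psi>')))*(- (tor_Q n m \<tau> * tor_P n m \<tau>') / ?W)) (at_right 0)"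
		by (rule tendsto_mult[OF tendsto_of_real[OF tendsto_mult[OF dl tendsto_mult[OF lame_real_axis_limit[OF H b] lame_real_axis_limit[OF H b]]]]
					tendsto_divide[OF tendsto_minus[OF tendsto_mult[OF \<gamma>(2)[OF t(1)] \<beta>(2)[OF t(2)]]] wl W0]])
	hence L: "((%k. of_real ((d k)^2*(?r k \<psi> * ?r k \<psi>'))*(- (pole_value (?s k) k \<tau>/\<gamma> k*(pole_value (F k) k \<tau>'/\<beta> k))/w k)) \<longlongrightarrow>
		 of_real (trig_std b (real n) (pi-\<psi>) * trig_std b (real n) (pi-\<psi>')/trig_norm b n)*(- (tor_Q n m \<tau> * tor_P n m \<tau>') / ?W)) (at_right 0)"
		by simp
	have "\<forall>\<^sub>F k in at_right 0. max 1 \<tau> <= elliptic_K' k" using elliptic_K'_at_top unfolding filterlim_at_top by blast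
	with E F \<beta>(1) \<gamma>(1) small_modulus
	have "\<forall>\<^sub>F k in at_right 0. of_real ((d k)^2*(?r k \<psi> * ?r k \<psi>'))*(- (pole_value (?s k) k \<tau>/\<gamma> k*(pole_value (F k) k \<tau>'/\<beta> k))/w k)
		 = E k (of_real (2 * elliptic_K k-\<psi>)) * E k (of_real (2 * elliptic_K k-\<psi>')) * pole_value (E k) k \<tau> * pole_value (F k) k \<tau>'"
	proof eventually_elim
		case (elim k)
		have k: "0 < k" "k < 1" using elim by auto
		have Ez: "E k z = of_real (d k) * ?s k z" if "z \<in> strip k" for z using elim that by blast
		have E1: "(E k has_field_derivative of_real (d k) * deriv (?s k) z) (at z)" if "z \<in> strip k" for z
			by (rule has_field_derivative_transform_within_open[OF DERIV_cmult[OF lame_ode_derivs(1)[OF lame_std(1)[OF k] that]] open_strip that]) (simp add: Ez)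
		have Er: "E k (of_real x) = of_real (d k * lame_re ?\<nu> b k (H k) x)" for x using Ez[OF of_real_in_strip[OF k]] by (simp add: lame_std_real[OF k])
		have st: "\<i> * of_real (elliptic_K' k-\<tau>) \<in> strip k" "\<i> * of_real (elliptic_K' k-1) \<in> strip k" using elim t by (intro imaginary_in_strip; simp)+
		let ?z = "\<i> * complex_of_real (elliptic_K' k-1)"
		have "\<bar>elliptic_K' k-1\<bar> < elliptic_K' k" using elim by auto
		hence "\<i>*(F k ?z * deriv (E k) ?z-E k ?z * deriv (F k) ?z)=1" using elim lame_second_kind_iff[OF k,of ?\<nu> "H k" "E k" "F k"] by blast
		hence wr: "\<i> * of_real (d k)*(F k ?z * deriv (?s k) ?z - ?s k ?z * deriv (F k) ?z)=1"
			unfolding DERIV_imp_deriv[OF E1[OF st(2)]] Ez[OF st(2)] by (simp add: algebra_simps)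
		have "p/B*(- \<i> * s'/G) - - \<i> * p'/B*(s/G) = - \<i>/(B * G)*(p * s'-s * p')" for p p' s s' B G :: complex
			by (simp add: algebra_simps diff_divide_distrib)
		hence "w k = - \<i>/(\<beta> k*\<gamma> k)*(F k ?z * deriv (?s k) ?z - ?s k ?z * deriv (F k) ?z)" unfolding w_def .
		hence "w k*(of_real (d k)*\<beta> k*\<gamma> k) = - (\<i> * of_real (d k)*(F k ?z * deriv (?s k) ?z - ?s k ?z * deriv (F k) ?z))" using elim by simp
		hence "w k*(of_real (d k)*\<beta> k*\<gamma> k) = - 1" unfolding wr .
		hence "1/w k = - (w k*(of_real (d k)*\<beta> k*\<gamma> k))/w k" "w k ~= 0" by auto
		hence w: "1/w k = - (of_real (d k)*\<beta> k*\<gamma> k)" by simp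
		have "- (S/\<gamma> k*(P/\<beta> k))/w k = - (S/\<gamma> k*(P/\<beta> k))*(1/w k)" for S P by simp
		hence "- (S/\<gamma> k*(P/\<beta> k))/w k = of_real (d k) * S * P" for S P unfolding w using elim by simp
		note w'=this
		show ?case unfolding w' Er Ez[OF st(1)] by (simp add: power2_eq_square mult_ac)
	qed
	thus ?thesis by (rule Lim_transform_eventually[OF L])
qed

lemma expansion_term_limit:
	assumes t: "\<tau> > 0" "\<tau>' > 0" and b: "b \<or> n >= 1"
		and h: "!!k. h k=(SOME h. \<exists>e. lame_eigen (lame_nu m) b n k h e)"
		and E: "!!k. E k=(SOME f. f holomorphic_on strip k & (\<exists>e. lame_eigen (lame_nu m) b n k (h k) e & (\<forall>s\<in>{0..elliptic_K k}. f (of_real s) = of_real (e s))))"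
		and F: "!!k. F k=(SOME F. lame_second_kind (lame_nu m) k (h k) (E k) F)"
	shows "((%k. E k (of_real (2 * elliptic_K k-\<psi>)) * E k (of_real (2 * elliptic_K k-\<psi>')) * pole_value (E k) k \<tau> * pole_value (F k) k \<tau>') \<longlongrightarrow>
		 of_real (trig_std b (real n) (pi-\<psi>) * trig_std b (real n) (pi-\<psi>')/trig_norm b n) *
		 (- (tor_Q n m \<tau> * tor_P n m \<tau>')/(tor_P n m 1 * tor_Q' n m 1-tor_P' n m 1 * tor_Q n m 1))) (at_right 0)"
proof -
	let ?\<nu> = "lame_nu m"
	have near: "\<forall>\<^sub>F k in at_right 0. (\<exists>e. lame_eigen ?\<nu> b n k (h k) e) & \<bar>h k-(real n)\<^sup>2\<bar> < \<epsilon> & (n=0 \<longrightarrow> \<bar>h k\<bar> <= \<bar>?\<nu>*(?\<nu>+1)\<bar> * k^2)"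
		if "\<epsilon> > 0" for \<epsilon> using lame_eigen_exists[OF b that,of ?\<nu>] small_modulus
	proof eventually_elim
		case (elim k)
		then obtain g e where g: "lame_eigen ?\<nu> b n k g e" "\<bar>g-(real n)\<^sup>2\<bar> < \<epsilon>" "n=0 \<longrightarrow> \<bar>g\<bar> <= \<bar>?\<nu>*(?\<nu>+1)\<bar> * k^2" by blast
		have "\<exists>e. lame_eigen ?\<nu> b n k (h k) e" unfolding h by (rule someI_ex) (use g(1) in blast)
		moreover from this obtain e' where e': "lame_eigen ?\<nu> b n k (h k) e'" by blast
		have k: "0 < k" "k < 1" using elim by auto
		have "h k=g" by (rule lame_eigen_unique[OF k e' g(1)])
		ultimately show ?case using g by simp
	qed
	have H: "(h \<longlongrightarrow> (real n)\<^sup>2) (at_right 0)"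
	proof (rule tendstoI)
		fix \<epsilon> :: real assume "\<epsilon> > 0"
		from near[OF this] show "\<forall>\<^sub>F k in at_right 0. dist (h k) ((real n)^2) < \<epsilon>" by eventually_elim (simp add: dist_real_def)
	qed
	have H0: "n=0 \<longrightarrow> (\<forall>\<^sub>F k in at_right 0. \<bar>h k\<bar> <= \<bar>?\<nu>*(?\<nu>+1)\<bar> * k^2)"
	proof
		assume n0: "n=0"
		from near[OF zero_less_one] show "\<forall>\<^sub>F k in at_right 0. \<bar>h k\<bar> <= \<bar>?\<nu>*(?\<nu>+1)\<bar> * k^2"
			by eventually_elim (use n0 in simp)
	qed
	define P where "P k c \<longleftrightarrow> c ~= 0 & (\<forall>z\<in>strip k. E k z = of_real c * lame_std ?\<nu> b k (h k) z) &
			((%s. (lame_re ?\<nu> b k (h k) s)\<^sup>2) has_integral 1/c^2) {0..elliptic_K k}" for k c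
	define d where "d k=(SOME c. P k c)" for k
	have Ed: "\<forall>\<^sub>F k in at_right 0. P k (d k)" using near[OF zero_less_one] small_modulus
	proof eventually_elim
		case (elim k)
		then obtain e where e: "lame_eigen ?\<nu> b n k (h k) e" and k: "0 < k" "k < 1" by blast
		from someI_ex[OF lame_eigenfunction_continuation[OF k e],folded E]
		obtain e' where e': "E k holomorphic_on strip k" "lame_eigen ?\<nu> b n k (h k) e'" "!!s. s \<in> {0..elliptic_K k} ==> E k (of_real s) = of_real (e' s)" by blast
		obtain c where "P k c" unfolding P_def using lame_eigenfunction_std[OF k e'] by metis
		thus ?case unfolding d_def by (rule someI)
	qed
	have Ex: "\<forall>\<^sub>F k in at_right 0. \<exists>d. d ~= 0 & (\<forall>z\<in>strip k. E k z = of_real d * lame_std ?\<nu> b k (h k) z)"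
		using Ed by eventually_elim (auto simp: P_def)
	have FF: "\<forall>\<^sub>F k in at_right 0. lame_ode ?\<nu> k (h k) (E k) & lame_second_kind ?\<nu> k (h k) (E k) (F k)"
	proof -
		have "\<forall>\<^sub>F k in at_right 0. lame_ode ?\<nu> k (h k) (E k) & (\<exists>F. lame_second_kind ?\<nu> k (h k) (E k) F)"
			by (rule second_kind_eventually_exists[OF H H0 b Ex])
		thus ?thesis
		proof eventually_elim
			case (elim k)
			thus ?case using someI_ex[of "lame_second_kind ?\<nu> k (h k) (E k)"] unfolding F by blast
		qed
	qed
	show ?thesis by (rule lame_product_limit[OF t b H H0 Ed[unfolded P_def] FF])
qed

section \<open>The limit theorem\<close>

text \<open>Whatever the parity of \<open>n\<close>, one of the two families tends to cosines and the other to sines; the addition theorem combines them.\<close>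

lemma trig_product_sum:
	fixes n :: nat and \<psi> \<psi>' :: real
	defines "L \<equiv> %b. trig_std b (real n) (pi-\<psi>) * trig_std b (real n) (pi-\<psi>')/trig_norm b n"
	shows "L (even n)+(if n=0 then 0 else L (odd n))=2/pi * neumann_factor n * cos (real n*(\<psi>-\<psi>'))"
proof (cases "n=0")
	case True
	thus ?thesis by (simp add: L_def trig_std_def trig_norm_def neumann_factor_def)
next
	case False
	have "L True=4/pi*(cos (real n*(pi-\<psi>)) * cos (real n*(pi-\<psi>')))" using False by (simp add: L_def trig_std_def trig_norm_def)
	moreover have "L False=4/pi*(sin (real n*(pi-\<psi>)) * sin (real n*(pi-\<psi>')))"
		using False by (simp add: L_def trig_std_def trig_norm_def power2_eq_square)
	ultimately have "L True + L False=4/pi * cos (real n*(pi-\<psi>)-real n*(pi-\<psi>'))" unfolding cos_diff by (simp only: distrib_left)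
	also have "real n*(pi-\<psi>)-real n*(pi-\<psi>') = - (real n*(\<psi>-\<psi>'))" by (simp add: right_diff_distrib)
	finally have "L True + L False=4/pi * cos (real n*(\<psi>-\<psi>'))" by simp
	moreover have "L (even n) + L (odd n)=L True + L False" by (cases "even n") simp_all
	ultimately show ?thesis using False by (simp add: neumann_factor_def)
qed

theorem theorem7p4:
	fixes m :: int and n :: nat and \<tau> \<tau>' \<psi> \<psi>' :: real
	assumes "\<tau> > 0" and "\<tau>' > 0"
	shows "((\<lambda>k. coeff_A m n \<tau> \<tau>' \<psi> \<psi>' k) \<longlongrightarrow> coeff_B m n \<tau> \<tau>' \<psi> \<psi>') (at_right 0)"
proof -
	define L where "L b=trig_std b (real n) (pi-\<psi>) * trig_std b (real n) (pi-\<psi>')/trig_norm b n" for b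
	define G where "G = - (tor_Q n m \<tau> * tor_P n m \<tau>')/(tor_P n m 1 * tor_Q' n m 1-tor_P' n m 1 * tor_Q n m 1)"
	have C: "((%k. coeff_C m n \<tau> \<tau>' \<psi> \<psi>' k) \<longlongrightarrow> of_real (L (even n)) * G) (at_right 0)"
		unfolding coeff_C_def L_def G_def
	proof (rule expansion_term_limit[OF assms,where b = "even n" and h = "lame_a (lame_nu m) n"])
		show "even n \<or> 1 <= n" by (cases n) auto
	qed (simp_all only: lame_a_def lame_Ec_def lame_Fc_def lame_c_eigen_iff)
	have S: "((%k. coeff_S m n \<tau> \<tau>' \<psi> \<psi>' k) \<longlongrightarrow> of_real (if n=0 then 0 else L (odd n)) * G) (at_right 0)"
	proof (cases "n=0")
		case False
		have "((%k. lame_Es (lame_nu m) n k (of_real (2 * elliptic_K k-\<psi>)) * lame_Es (lame_nu m) n k (of_real (2 * elliptic_K k-\<psi>'))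
			 * lame_Es (lame_nu m) n k (\<i> * of_real (elliptic_K' k-\<tau>)) * lame_Fs (lame_nu m) n k (\<i> * of_real (elliptic_K' k-\<tau>'))) \<longlongrightarrow> of_real (L (odd n)) * G) (at_right 0)"
			unfolding L_def G_def
		proof (rule expansion_term_limit[OF assms,where b = "odd n" and h = "lame_b (lame_nu m) n"])
			show "odd n \<or> 1 <= n" using False by auto
		qed (simp_all only: lame_b_def lame_Es_def lame_Fs_def lame_s_eigen_iff)
		thus ?thesis using False by (simp add: coeff_S_def)
	qed (simp add: coeff_S_def)
	note rho=tendsto_real_sqrt[OF flat_ring_rho_tendsto]
	define x x' where "x = cosh \<tau>-cos \<psi>" and "x' = cosh \<tau>'-cos \<psi>'"
	let ?sg = "(- 1) powi m :: complex"
	let ?Q = "legendre_Q (of_nat n-1/2) (of_int m) (of_real (cosh \<tau>))" and ?P = "legendre_P (of_nat n-1/2) (of_int m) (of_real (cosh \<tau>'))"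
	let ?gm = "Gamma (of_nat n-of_int m+1/2 :: complex)" and ?gp = "Gamma (of_nat n + of_int m+1/2 :: complex)"
	let ?c = "complex_of_real (sqrt pi/2 powr (real n+1/2))"
	define T where "T=2/pi * neumann_factor n * cos (real n*(\<psi>-\<psi>'))"
	have "((%k. coeff_A m n \<tau> \<tau>' \<psi> \<psi>' k) \<longlongrightarrow> 1/2 * of_real (sqrt (x/sinh \<tau>)) * of_real (sqrt (x'/sinh \<tau>'))
			* (of_real (L (even n)) * G + of_real (if n=0 then 0 else L (odd n)) * G)) (at_right 0)" unfolding coeff_A_def x_def x'_def
		by (intro tendsto_mult tendsto_add tendsto_const tendsto_of_real rho assms C S)
	also have "of_real (L (even n)) * G + of_real (if n=0 then 0 else L (odd n)) * G = of_real T * G"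
		unfolding T_def trig_product_sum[symmetric] L_def by (simp only: of_real_add distrib_right)
	also have "G = ?c * tor_Q n m \<tau> * ?gm * tor_P n m \<tau>'" unfolding G_def tor_wronskian[OF zero_less_one] by (simp add: field_simps)
	also have "?c * tor_Q n m \<tau> = ?sg*(of_real (sqrt (sinh \<tau>)) * ?Q) / ?gp"
		using half_integer_not_nonpos[of "int n + m"] unfolding legendre_Q_tor[OF assms(1)] by (simp add: Gamma_eq_zero_iff)
	also have "tor_P n m \<tau>' = of_real (sqrt (sinh \<tau>')) * ?P" by (rule legendre_P_tor[OF assms(2),symmetric])
	also have "1/2 * of_real (sqrt (x/sinh \<tau>)) * of_real (sqrt (x'/sinh \<tau>'))
			* (of_real T*(?sg*(of_real (sqrt (sinh \<tau>)) * ?Q) / ?gp * ?gm*(of_real (sqrt (sinh \<tau>')) * ?P)))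
		 = of_real (sqrt (x/sinh \<tau>) * sqrt (sinh \<tau>)) * of_real (sqrt (x'/sinh \<tau>') * sqrt (sinh \<tau>')) * of_real (T/2) * ?sg*(?gm / ?gp) * ?Q * ?P"
		by simp
	also have "sqrt (x/sinh \<tau>) * sqrt (sinh \<tau>)=sqrt x" using assms by (simp add: real_sqrt_divide)
	also have "sqrt (x'/sinh \<tau>') * sqrt (sinh \<tau>')=sqrt x'" using assms by (simp add: real_sqrt_divide)
	also have "?sg = of_real ((- 1) powi m)" by (simp add: of_real_power_int)
	also have "?gm = of_real (Gamma (real n-of_int m+1/2))" by (simp flip: Gamma_complex_of_real)
	also have "?gp = of_real (Gamma (real n + of_int m+1/2))" by (simp flip: Gamma_complex_of_real)
	also have "of_real (sqrt x) * of_real (sqrt x') * of_real (T/2) * of_real ((- 1) powi m)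
			 * (of_real (Gamma (real n-of_int m+1/2))/of_real (Gamma (real n + of_int m+1/2))) * ?Q * ?P = coeff_B m n \<tau> \<tau>' \<psi> \<psi>'"
		unfolding coeff_B_def x_def[symmetric] x'_def[symmetric] T_def by (simp add: mult_ac)
	finally show ?thesis .
qed

end
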